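(* Assume the following three hypotheses on Borel measurable functions $f:\mathbb{R}^d\times\mathbb{R}^d\to\mathbb{R}^d$ and $g:\mathbb{R}^d\times\mathbb{R}^d\to\mathbb{R}^{d\times m}$. (i) For every $R>0$ there is $\ell_R>0$ such that $|f(x,y)-f(\bar x,\bar y)|\vee|g(x,y)-g(\bar x,\bar y)|\le \ell_R(|x-\bar x|+|y-\bar y|)$ for all $x,\bar x,y,\bar y\in\mathbb{R}^d$ with $|x|\vee|\bar x|\vee|y|\vee|\bar y|\le R$. (ii) There exist constants $\alpha\ge 2$ and $a_1,a_2,a_3\ge 0$ with $a_2>a_3$ such that $2\langle x,f(x,y)\rangle+|g(x,y)|^2\le a_1-a_2|x|^\alpha+a_3|y|^\alpha$ for all $x,y\in\mathbb{R}^d$. (iii) There exist constants $b_1,b_2,b_3,b_4\ge0$ with $b_1>b_2$, $b_3>b_4$, and a continuous function $V:\mathbb{R}^d\times\mathbb{R}^d\to\mathbb{R}_+$ with $V(x,x)=0$ for all $x$, such that for all $x,\bar x,y,\bar y\in\mathbb{R}^d$ $$2\langle x-\bar x,f(x,y)-f(\bar x,\bar y)\rangle+|g(x,y)-g(\bar x,\bar y)|^2\le -b_1|x-\bar x|^2+b_2|y-\bar y|^2-b_3V(x,\bar x)+b_4V(y,\bar y).$$ Let $\pi\in\mathcal{P}(C)$ be the unique invariant measure of the segment process of the SDDE $\mathrm{d}x(t)=f(x(t),x(t-\tau))\mathrm{d}t+g(x(t),x(t-\tau))\mathrm{d}W(t)$, and, for step sizes $\Delta\in(0,\hat\Delta_1\wedge\hat\Delta_2]$,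 let $\pi^\Delta\in\mathcal{P}(C)$ be the unique invariant measure of the truncated EM segment process with step size $\Delta$. Then $$\lim_{\Delta\to0}d_{\Xi}\big(\pi,\pi^{\Delta}\big)=0.$$
   Context: Notation. $|\cdot|$ is the Euclidean norm on $\mathbb{R}^d$ and the trace (Frobenius) norm on $\mathbb{R}^{d\times m}$; $a\vee b=\max\{a,b\}$, $a\wedge b=\min\{a,b\}$; $\mathbb{R}_+=[0,\infty)$. $\tau>0$ is fixed; $C=C([-\tau,0];\mathbb{R}^d)$ with supremum norm $\|\cdot\|$. $W$ is an $m$-dimensional Brownian motion on a probability space $(\Omega,\mathcal{F},\mathbb{P})$ with a right-continuous complete filtration $\{\mathcal{F}_t\}_{t\ge0}$. $\mathcal{P}(C)$ is the set of Borel probability measures on $C$, with the Fortet-Mourier distance $d_\Xi(P_1,P_2)=\sup_{\Psi\in\Xi}\big|\int_C\Psi\,\mathrm{d}P_1-\int_C\Psi\,\mathrm{d}P_2\big|$, where $\Xi$ is the set of $\Psi:C\to\mathbb{R}$ with $|\Psi(X_1)-\Psi(X_2)|\le\|X_1-X_2\|$ for all $X_1,X_2\in C$ and $\sup_{X\in C}|\Psi(X)|\le1$. SDDE. Under hypotheses (i), (ii) the SDDE with initial data $x=\xi$ on $[-\tau,0]$, $\xi\in C$, has a unique global solution $x^\xi(t)$, $t\ge-\tau$; its segment process is $x^\xi_t(\theta)=x^\xi(t+\theta)$, $\theta\in[-\tau,0]$, and $\mu^\xi_t$ is the law of $x^\xi_t$ on $C$. A measure $\pi$ is invariant if $\int_C\mu^X_t(A)\,\pi(\mathrm{d}X)=\pi(A)$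 for all $t\ge0$ and Borel $A\subset C$. Known fact (Wang, Wu, Mao 2019): under (i)–(iii) the segment process has a unique invariant measure $\pi$, and $\lim_{t\to\infty}d_\Xi(\mu^\xi_t,\pi)=0$ for every $\xi\in C$. Truncation. Fix a strictly increasing continuous function $\Phi:[1,\infty)\to\mathbb{R}_+$ with $\Phi(R)\to\infty$ as $R\to\infty$ such that for all $R\ge1$ $$\sup_{|x|\vee|\bar x|\vee|y|\vee|\bar y|\le R}\Big[\frac{|f(x,y)-f(\bar x,\bar y)|}{|x-\bar x|+1\wedge|y-\bar y|}+\frac{|g(x,y)-g(\bar x,\bar y)|^2}{(|x-\bar x|+1\wedge|y-\bar y|)^2}\Big]\le\Phi(R)$$ (supremum over points with nonzero denominators; such $\Phi$ exists by the local Lipschitz hypothesis (i)). Fix $\nu\in(0,1/3]$, and let $K=1\vee\Phi(1)\vee|f(\mathbf{0},\mathbf{0})|\vee|g(\mathbf{0},\mathbf{0})|^2$. Define $\Gamma^{\Delta}(x)=\big(|x|\wedge\Phi^{-1}(K\Delta^{-\nu})\big)\frac{x}{|x|}$, with $x/|x|=\mathbf{0}$ if $x=\mathbf{0}$. Scheme. Step sizes $\Delta$ are always of the form $\Delta=\tau/N\in(0,1)$ with an integer $N>\tau$; $t_k=k\Delta$ for $k\ge-N$. For $\xi\in C$ let $\breve u^{\xi,\Delta}(t_k)=\xi(t_k)$ for $k=-N,\dots,0$; $u^{\xi,\Delta}(t_k)=\Gamma^{\Delta}(\breve u^{\xi,\Delta}(t_k))$ for $k\ge-N$; and for $k\ge0$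 $$\breve u^{\xi,\Delta}(t_{k+1})=u^{\xi,\Delta}(t_k)+f(u^{\xi,\Delta}(t_k),u^{\xi,\Delta}(t_{k-N}))\Delta+g(u^{\xi,\Delta}(t_k),u^{\xi,\Delta}(t_{k-N}))(W(t_{k+1})-W(t_k)).$$ Let $y^{\xi,\Delta}(t)=\Gamma^\Delta(\xi(t))$ for $t\in[-\tau,0]$ and $y^{\xi,\Delta}(t)=\frac{t_{k+1}-t}{\Delta}u^{\xi,\Delta}(t_k)+\frac{t-t_k}{\Delta}u^{\xi,\Delta}(t_{k+1})$ for $t\in[t_k,t_{k+1}]$, $k\ge0$. The truncated EM segment process is $Y^{\xi,\Delta}_{t_k}(\theta)=y^{\xi,\Delta}(t_k+\theta)$, $\theta\in[-\tau,0]$, $k\ge0$; $\mu^{\xi,\Delta}_{t_k}$ denotes its law on $C$. A measure $\pi^\Delta\in\mathcal{P}(C)$ is invariant for it if $\int_C\mathbb{P}(Y^{X,\Delta}_{t_k}\in A)\,\pi^\Delta(\mathrm{d}X)=\pi^\Delta(A)$ for all $k\ge0$ and Borel $A\subset C$. Constants. $\hat\Delta_1\in(0,1)$ is a fixed number with $a_2-6K^2\hat\Delta_1^{1-2\nu}>a_3$, and $\hat\Delta_2\in(0,1)$ is a fixed number with $b_1-4K^2\hat\Delta_2^{1-2\nu}>b_2$. Under (i)–(iii), for every step size $\Delta\in(0,\hat\Delta_1\wedge\hat\Delta_2]$ there is a unique invariant measure $\pi^\Delta$ of the truncated EM segment process, and $\lim_{k\Delta\to\infty}d_\Xi(\mu^{\xi,\Delta}_{t_k},\pi^\Delta)=0$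 for each $\xi\in C$, uniformly in such $\Delta$. *)

theory Defs
  imports "HOL-Probability.Probability"
begin

section \<open>The path space and its probability measures\<close>

text \<open>
  \<open>C([-\<tau>,0]; \<real>\<^sup>d)\<close> with the supremum metric, as an abstract metric space. A path is a function on
  the reals that is \<^const>\<open>undefined\<close> outside \<open>[-\<tau>,0]\<close>; the two lemmas unfold the carrier and
  the distance.
\<close>

definition C_metric :: "real \<Rightarrow> (real \<Rightarrow> real^'d) metric" where
  "C_metric \<tau> = cfunspace (subtopology euclidean {-\<tau>..0}) euclidean_metric"

lemma mspace_C_metric:
  "mspace (C_metric \<tau>) = {\<phi>. \<phi> \<in> extensional {-\<tau>..0} \<and> continuous_on {-\<tau>..0} \<phi>}"
proof -
  have "bounded (\<phi> ` {-\<tau>..0})" if "continuous_on {-\<tau>..0} \<phi>" for \<phi> :: "real \<Rightarrow> real^'d"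
    using that by (intro compact_imp_bounded compact_continuous_image) auto
  then show ?thesis
    by (auto simp: C_metric_def)
qed

lemma mdist_C_metric:
  assumes "\<tau> > 0" "\<phi> \<in> mspace (C_metric \<tau>)" "\<psi> \<in> mspace (C_metric \<tau>)"
  shows "mdist (C_metric \<tau>) \<phi> \<psi> = (SUP \<theta>\<in>{-\<tau>..0}. norm (\<phi> \<theta> - \<psi> \<theta>))"
  using assms
  by (auto simp: C_metric_def mdist_cfunspace_eq_mdist_funspace Met_TC.fdist_def Met_TC.fspace_def dist_norm)

definition C_borel :: "real \<Rightarrow> (real \<Rightarrow> real^'d) measure" where
  "C_borel \<tau> = sigma (mspace (C_metric \<tau>)) {U. openin (mtopology_of (C_metric \<tau>)) U}"

definition FM_test :: "real \<Rightarrow> ((real \<Rightarrow> real^'d) \<Rightarrow> real) set" where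
  "FM_test \<tau> = {\<Psi>.
     (\<forall>X\<^sub>1\<in>mspace (C_metric \<tau>). \<forall>X\<^sub>2\<in>mspace (C_metric \<tau>).
        \<bar>\<Psi> X\<^sub>1 - \<Psi> X\<^sub>2\<bar> \<le> mdist (C_metric \<tau>) X\<^sub>1 X\<^sub>2) \<and>
     (\<forall>X\<in>mspace (C_metric \<tau>). \<bar>\<Psi> X\<bar> \<le> 1)}"

definition FM_dist :: "real \<Rightarrow> (real \<Rightarrow> real^'d) measure \<Rightarrow> (real \<Rightarrow> real^'d) measure \<Rightarrow> real" where
  "FM_dist \<tau> P\<^sub>1 P\<^sub>2 = (SUP \<Psi>\<in>FM_test \<tau>. \<bar>(\<integral>X. \<Psi> X \<partial>P\<^sub>1) - (\<integral>X. \<Psi> X \<partial>P\<^sub>2)\<bar>)"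

text \<open>Here \<open>\<kappa> t X\<close> is the law at time \<open>t \<in> T\<close> of the process started from \<open>X\<close>.\<close>

definition invariant_prob ::
  "'a measure \<Rightarrow> 't set \<Rightarrow> ('t \<Rightarrow> 'a \<Rightarrow> 'a measure) \<Rightarrow> 'a measure \<Rightarrow> bool" where
  "invariant_prob S T \<kappa> \<pi> \<longleftrightarrow>
     \<pi> \<in> space (prob_algebra S) \<and>
     (\<forall>t\<in>T. \<forall>A\<in>sets S. (\<integral>\<^sup>+ X. emeasure (\<kappa> t X) A \<partial>\<pi>) = emeasure \<pi> A)"

definition segment :: "real \<Rightarrow> (real \<Rightarrow> 'w \<Rightarrow> real^'d) \<Rightarrow> real \<Rightarrow> 'w \<Rightarrow> (real \<Rightarrow> real^'d)" where
  "segment \<tau> x t \<omega> = (\<lambda>\<theta>\<in>{-\<tau>..0}. x (t + \<theta>) \<omega>)"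

definition segment_law ::
  "'w measure \<Rightarrow> real \<Rightarrow> (real \<Rightarrow> 'w \<Rightarrow> real^'d) \<Rightarrow> real \<Rightarrow> (real \<Rightarrow> real^'d) measure" where
  "segment_law M \<tau> x t = distr M (C_borel \<tau>) (segment \<tau> x t)"


section \<open>Brownian motion\<close>

text \<open>Filtrations and processes are indexed by the reals; only times \<open>t \<ge> 0\<close> are constrained.\<close>

definition usual_filtration :: "'w measure \<Rightarrow> (real \<Rightarrow> 'w measure) \<Rightarrow> bool" where
  "usual_filtration M F \<longleftrightarrow>
     (\<forall>t\<ge>0. subalgebra M (F t)) \<and>
     (\<forall>s\<ge>0. \<forall>t\<ge>s. sets (F s) \<subseteq> sets (F t)) \<and>
     (\<forall>t\<ge>0. sets (F t) = (\<Inter>s\<in>{t<..}. sets (F s))) \<and>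
     (\<forall>A\<in>null_sets M. \<forall>B\<subseteq>A. B \<in> sets (F 0))"

definition brownian_motion ::
  "'w measure \<Rightarrow> (real \<Rightarrow> 'w measure) \<Rightarrow> (real \<Rightarrow> 'w \<Rightarrow> real^'m) \<Rightarrow> bool" where
  "brownian_motion M F W \<longleftrightarrow>
     (AE \<omega> in M. W 0 \<omega> = 0) \<and>
     (AE \<omega> in M. continuous_on {0..} (\<lambda>t. W t \<omega>)) \<and>
     (\<forall>t\<ge>0. W t \<in> borel_measurable (F t)) \<and>
     (\<forall>s\<ge>0. \<forall>t>s.
        distributed M lborel (\<lambda>\<omega>. W t \<omega> - W s \<omega>)
          (\<lambda>z. ennreal (\<Prod>i\<in>UNIV. normal_density 0 (sqrt (t - s)) (z $ i))) \<and>
        prob_space.indep_set M (sets (F s))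
          {(\<lambda>\<omega>. W t \<omega> - W s \<omega>) -` B \<inter> space M | B. B \<in> sets borel})"


section \<open>The Ito integral\<close>

text \<open>
  A simple integrand is given by \<open>n\<close>, times \<open>s 0 < \<dots> < s n\<close> and bounded matrices \<open>H j\<close> known at
  time \<open>s j\<close>. The integral of a progressively measurable, locally square integrable integrand is
  the limit, uniformly on compact time intervals in probability, of integrals of simple integrands
  that approximate it in \<open>L\<^sup>2[0,T]\<close> in probability. It is a relation, since the limit is
  determined only up to indistinguishability. The norm of \<open>real^'m^'d\<close> is the Frobenius norm.
\<close>

definition simple_integrand ::
  "'w measure \<Rightarrow> (real \<Rightarrow> 'w measure) \<Rightarrow> nat \<Rightarrow> (nat \<Rightarrow> real) \<Rightarrow> (nat \<Rightarrow> 'w \<Rightarrow> real^'m^'d) \<Rightarrow> bool"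
  where
  "simple_integrand M F n s H \<longleftrightarrow>
     0 \<le> s 0 \<and> (\<forall>j<n. s j < s (Suc j)) \<and>
     (\<forall>j<n. H j \<in> borel_measurable (F (s j)) \<and> bounded (H j ` space M))"

definition simple_process ::
  "nat \<Rightarrow> (nat \<Rightarrow> real) \<Rightarrow> (nat \<Rightarrow> 'w \<Rightarrow> real^'m^'d) \<Rightarrow> real \<Rightarrow> 'w \<Rightarrow> real^'m^'d" where
  "simple_process n s H t \<omega> = (\<Sum>j<n. indicator {s j<..s (Suc j)} t *\<^sub>R H j \<omega>)"

definition simple_integral ::
  "(real \<Rightarrow> 'w \<Rightarrow> real^'m) \<Rightarrow> nat \<Rightarrow> (nat \<Rightarrow> real) \<Rightarrow> (nat \<Rightarrow> 'w \<Rightarrow> real^'m^'d) \<Rightarrow>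
     real \<Rightarrow> 'w \<Rightarrow> real^'d" where
  "simple_integral W n s H t \<omega> =
     (\<Sum>j<n. H j \<omega> *v (W (min (s (Suc j)) t) \<omega> - W (min (s j) t) \<omega>))"

definition ito_integral ::
  "'w measure \<Rightarrow> (real \<Rightarrow> 'w measure) \<Rightarrow> (real \<Rightarrow> 'w \<Rightarrow> real^'m) \<Rightarrow>
     (real \<Rightarrow> 'w \<Rightarrow> real^'m^'d) \<Rightarrow> (real \<Rightarrow> 'w \<Rightarrow> real^'d) \<Rightarrow> bool" where
  "ito_integral M F W \<phi> I \<longleftrightarrow>
     (\<forall>t\<ge>0. (\<lambda>(s, \<omega>). \<phi> s \<omega>) \<in> borel_measurable (restrict_space borel {0..t} \<Otimes>\<^sub>M F t)) \<and>
     (\<forall>T\<ge>0. AE \<omega> in M. (\<integral>\<^sup>+ s\<in>{0..T}. ennreal ((norm (\<phi> s \<omega>))\<^sup>2) \<partial>lborel) < \<infinity>) \<and>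
     (\<forall>t\<ge>0. I t \<in> borel_measurable (F t)) \<and>
     (AE \<omega> in M. continuous_on {0..} (\<lambda>t. I t \<omega>)) \<and>
     (\<forall>T\<ge>0. \<exists>n s H.
        (\<forall>k. simple_integrand M F (n k) (s k) (H k)) \<and>
        (\<forall>\<epsilon>>0. (\<lambda>k. measure M {\<omega>\<in>space M.
           (\<integral>\<^sup>+ r\<in>{0..T}. ennreal ((norm (simple_process (n k) (s k) (H k) r \<omega> - \<phi> r \<omega>))\<^sup>2) \<partial>lborel)
             > ennreal \<epsilon>}) \<longlonglongrightarrow> 0) \<and>
        (\<forall>\<epsilon>>0. (\<lambda>k. measure M {\<omega>\<in>space M.
           \<exists>t\<in>{0..T}. norm (simple_integral W (n k) (s k) (H k) t \<omega> - I t \<omega>) > \<epsilon>}) \<longlonglongrightarrow> 0))"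


section \<open>The stochastic delay differential equation\<close>

definition sdde_solution ::
  "'w measure \<Rightarrow> (real \<Rightarrow> 'w measure) \<Rightarrow> (real \<Rightarrow> 'w \<Rightarrow> real^'m) \<Rightarrow>
     (real^'d \<Rightarrow> real^'d \<Rightarrow> real^'d) \<Rightarrow> (real^'d \<Rightarrow> real^'d \<Rightarrow> real^'m^'d) \<Rightarrow>
     real \<Rightarrow> (real \<Rightarrow> real^'d) \<Rightarrow> (real \<Rightarrow> 'w \<Rightarrow> real^'d) \<Rightarrow> bool" where
  "sdde_solution M F W f g \<tau> \<xi> x \<longleftrightarrow>
     (\<forall>\<omega>\<in>space M. continuous_on {-\<tau>..} (\<lambda>t. x t \<omega>)) \<and>
     (\<forall>t\<ge>0. x t \<in> borel_measurable (F t)) \<and>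
     (\<forall>\<omega>\<in>space M. \<forall>\<theta>\<in>{-\<tau>..0}. x \<theta> \<omega> = \<xi> \<theta>) \<and>
     (\<exists>I. ito_integral M F W (\<lambda>s \<omega>. g (x s \<omega>) (x (s - \<tau>) \<omega>)) I \<and>
        (AE \<omega> in M. \<forall>t\<ge>0.
           set_integrable lborel {0..t} (\<lambda>s. f (x s \<omega>) (x (s - \<tau>) \<omega>)) \<and>
           x t \<omega> = \<xi> 0 + (LINT s:{0..t}|lborel. f (x s \<omega>) (x (s - \<tau>) \<omega>)) + I t \<omega>))"


section \<open>The truncated Euler--Maruyama scheme\<close>

text \<open>
  The denominator is read as \<open>|x - x'| + (1 \<and> |y - y'|)\<close>. The supremum over the points with nonzero
  denominator is written as a bound at each of them.
\<close>

definition truncation_function ::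
  "(real^'d \<Rightarrow> real^'d \<Rightarrow> real^'d) \<Rightarrow> (real^'d \<Rightarrow> real^'d \<Rightarrow> real^'m^'d) \<Rightarrow> (real \<Rightarrow> real) \<Rightarrow> bool" where
  "truncation_function f g \<Phi> \<longleftrightarrow>
     (\<forall>R\<ge>1. 0 \<le> \<Phi> R) \<and> strict_mono_on {1..} \<Phi> \<and> continuous_on {1..} \<Phi> \<and>
     filterlim \<Phi> at_top at_top \<and>
     (\<forall>R\<ge>1. \<forall>x x' y y'.
        max (max (norm x) (norm x')) (max (norm y) (norm y')) \<le> R \<and>
        norm (x - x') + min 1 (norm (y - y')) \<noteq> 0 \<longrightarrow>
        norm (f x y - f x' y') / (norm (x - x') + min 1 (norm (y - y'))) +
        (norm (g x y - g x' y'))\<^sup>2 / (norm (x - x') + min 1 (norm (y - y')))\<^sup>2 \<le> \<Phi> R)"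

definition truncation_const ::
  "(real^'d \<Rightarrow> real^'d \<Rightarrow> real^'d) \<Rightarrow> (real^'d \<Rightarrow> real^'d \<Rightarrow> real^'m^'d) \<Rightarrow> (real \<Rightarrow> real) \<Rightarrow> real" where
  "truncation_const f g \<Phi> = max (max 1 (\<Phi> 1)) (max (norm (f 0 0)) ((norm (g 0 0))\<^sup>2))"

text \<open>
  \<^const>\<open>sgn\<close> is \<open>x / |x|\<close>, and zero at the origin. For \<open>\<Delta> \<in> (0,1)\<close> and \<open>K \<ge> \<Phi>(1)\<close> the argument
  of the inverse lies in the range of \<open>\<Phi>\<close>.
\<close>

definition truncate :: "(real \<Rightarrow> real) \<Rightarrow> real \<Rightarrow> real \<Rightarrow> real \<Rightarrow> real^'d \<Rightarrow> real^'d" where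
  "truncate \<Phi> K \<nu> \<Delta> x = min (norm x) (the_inv_into {1..} \<Phi> (K * \<Delta> powr (-\<nu>))) *\<^sub>R sgn x"

text \<open>
  In the scheme \<open>G\<close> is the truncation map, the step size is \<open>\<tau> / N\<close>, and \<open>em_pre \<dots> k\<close>
  (before truncation) and \<open>em \<dots> k\<close> (after it) are the values at time \<open>k \<tau> / N\<close>,
  meaningful for \<open>k \<ge> -N\<close>.
\<close>

function em_pre ::
  "(real^'d \<Rightarrow> real^'d \<Rightarrow> real^'d) \<Rightarrow> (real^'d \<Rightarrow> real^'d \<Rightarrow> real^'m^'d) \<Rightarrow>
     (real \<Rightarrow> 'w \<Rightarrow> real^'m) \<Rightarrow> (real^'d \<Rightarrow> real^'d) \<Rightarrow> real \<Rightarrow> nat \<Rightarrow>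
     (real \<Rightarrow> real^'d) \<Rightarrow> int \<Rightarrow> 'w \<Rightarrow> real^'d" where
  "em_pre f g W G \<tau> N \<xi> k \<omega> =
     (if k \<le> 0 then \<xi> (of_int k * (\<tau> / real N))
      else
        let \<Delta> = \<tau> / real N;
            u = G (em_pre f g W G \<tau> N \<xi> (k - 1) \<omega>);
            v = G (em_pre f g W G \<tau> N \<xi> (k - 1 - int N) \<omega>)
        in u + \<Delta> *\<^sub>R f u v + g u v *v (W (of_int k * \<Delta>) \<omega> - W (of_int (k - 1) * \<Delta>) \<omega>))"
  by pat_completeness auto
termination
  by (relation "Wellfounded.measure (\<lambda>(f, g, W, G, \<tau>, N, \<xi>, k, \<omega>). nat k)") auto

declare em_pre.simps [simp del]

definition em ::
  "(real^'d \<Rightarrow> real^'d \<Rightarrow> real^'d) \<Rightarrow> (real^'d \<Rightarrow> real^'d \<Rightarrow> real^'m^'d) \<Rightarrow>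
     (real \<Rightarrow> 'w \<Rightarrow> real^'m) \<Rightarrow> (real^'d \<Rightarrow> real^'d) \<Rightarrow> real \<Rightarrow> nat \<Rightarrow>
     (real \<Rightarrow> real^'d) \<Rightarrow> int \<Rightarrow> 'w \<Rightarrow> real^'d" where
  "em f g W G \<tau> N \<xi> k \<omega> = G (em_pre f g W G \<tau> N \<xi> k \<omega>)"

definition em_interp ::
  "(real^'d \<Rightarrow> real^'d \<Rightarrow> real^'d) \<Rightarrow> (real^'d \<Rightarrow> real^'d \<Rightarrow> real^'m^'d) \<Rightarrow>
     (real \<Rightarrow> 'w \<Rightarrow> real^'m) \<Rightarrow> (real^'d \<Rightarrow> real^'d) \<Rightarrow> real \<Rightarrow> nat \<Rightarrow>
     (real \<Rightarrow> real^'d) \<Rightarrow> real \<Rightarrow> 'w \<Rightarrow> real^'d" where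
  "em_interp f g W G \<tau> N \<xi> t \<omega> =
     (if t \<le> 0 then G (\<xi> t)
      else
        let \<Delta> = \<tau> / real N; k = \<lfloor>t / \<Delta>\<rfloor>
        in ((of_int (k + 1) * \<Delta> - t) / \<Delta>) *\<^sub>R em f g W G \<tau> N \<xi> k \<omega> +
           ((t - of_int k * \<Delta>) / \<Delta>) *\<^sub>R em f g W G \<tau> N \<xi> (k + 1) \<omega>)"

definition em_segment_law ::
  "'w measure \<Rightarrow> (real^'d \<Rightarrow> real^'d \<Rightarrow> real^'d) \<Rightarrow> (real^'d \<Rightarrow> real^'d \<Rightarrow> real^'m^'d) \<Rightarrow>
     (real \<Rightarrow> 'w \<Rightarrow> real^'m) \<Rightarrow> (real^'d \<Rightarrow> real^'d) \<Rightarrow> real \<Rightarrow> nat \<Rightarrow>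
     nat \<Rightarrow> (real \<Rightarrow> real^'d) \<Rightarrow> (real \<Rightarrow> real^'d) measure" where
  "em_segment_law M f g W G \<tau> N k \<xi> =
     segment_law M \<tau> (em_interp f g W G \<tau> N \<xi>) (real k * (\<tau> / real N))"

end

theory Submission
  imports Defs
begin

text \<open>
  Both \<open>\<pi>\<close> and \<open>\<pi>\<^sub>\<Delta>\<close> are compared, by invariance and contraction, with the law at one large time
  \<open>m * \<tau>\<close> of the segment process started from the zero path; at that time the truncated
  Euler--Maruyama segment converges in probability to the segment of the solution.
  Contraction and moment bounds are proved only for the truncated scheme, uniformly in the step size,
  from a discrete delay inequality and a maximal inequality, and pass to the solution in the limit.
  No Ito formula is used: the Ito integral enters only through the convergence of its Riemann sums,
  which follows from a tail estimate for simple integrands that are frozen once their energy is large.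
\<close>


section \<open>Gaussian increments\<close>

text \<open>The coefficients are only locally Lipschitz, so solution and scheme are never compared
  globally. With probability close to 1 the path stays in some ball; there the coefficients may be
  composed with the projection onto the ball, which makes them bounded and globally Lipschitz, and
  for small steps the truncation of the scheme does not act. The resulting convergence has no rate,
  which is enough because the comparison time is fixed before the step size tends to 0. The
  contraction time depends on the size of the initial paths, so the invariant measures of all
  schemes need one common ball. Each of them is tight by itself, but not with a common radius; that
  radius comes from the moment bound for the scheme started from the zero path, to whose law at late
  times each of these measures is close. The solutions form an arbitrary family indexed by the
  initial path, so their laws need not depend measurably on it. Invariance is therefore used for one
  event at a time, and integrals of test functions are recovered from level sets.\<close>

lemma lborel_integral_prod_vec:
  fixes \<phi> :: "'m::finite \<Rightarrow> real \<Rightarrow> real"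
  assumes "\<And>i. integrable lborel (\<phi> i)"
  shows "integrable lborel (\<lambda>z::real^'m. \<Prod>i\<in>UNIV. \<phi> i (z $ i))"
    and "(\<integral>z. (\<Prod>i\<in>UNIV. \<phi> i (z $ i)) \<partial>(lborel :: (real^'m) measure)) = (\<Prod>i\<in>UNIV. (\<integral>r. \<phi> i r \<partial>lborel))"
proof -
  interpret product_sigma_finite "\<lambda>b::real^'m. lborel :: real measure" ..
  let ?e = "\<lambda>i. axis i 1 :: real^'m"
  \<comment> \<open>\<open>lborel_eq\<close> presents Lebesgue measure as the image of a product
    over \<open>Basis\<close>, so the factors are carried from indices to the basis vectors
    \<open>axis i 1\<close>.\<close>
  define \<psi> where "\<psi> b = \<phi> (inv_into UNIV ?e b)" for b
  have inj: "inj ?e"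
    by (auto simp: inj_on_def axis_eq_axis)
  have B: "(Basis :: (real^'m) set) = range ?e"
    by (auto simp: Basis_vec_def)
  have \<psi>: "\<psi> (?e i) = \<phi> i" for i
    by (simp only: \<psi>_def inv_f_f[OF inj])
  have eq: "(\<Prod>i\<in>UNIV. \<phi> i (z $ i)) = (\<Prod>b\<in>Basis. \<psi> b (z \<bullet> b))" for z :: "real^'m"
    unfolding B by (subst prod.reindex[OF inj]) (simp add: \<psi> inner_axis)
  have meas [measurable]: "\<phi> i \<in> borel_measurable borel" for i
    using borel_measurable_integrable[OF assms[of i]] by simp
  have int: "integrable lborel (\<psi> b)" for b
    unfolding \<psi>_def by (rule assms)
  have coord: "(\<Sum>b\<in>Basis. f b *\<^sub>R b) \<bullet> b' = f b'" if "b' \<in> Basis" for f :: "real^'m \<Rightarrow> real" and b'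
    using that by (simp add: inner_sum_left inner_Basis if_distrib sum.delta cong: if_cong)
  have m: "(\<lambda>f. \<Sum>b\<in>Basis. f b *\<^sub>R b) \<in> measurable (\<Pi>\<^sub>M b\<in>(Basis::(real^'m) set). lborel) borel"
    by measurable
  have eq2: "(\<Prod>b\<in>Basis. \<psi> b ((\<Sum>b\<in>Basis. f b *\<^sub>R b) \<bullet> b)) = (\<Prod>b\<in>Basis. \<psi> b (f b))" for f
    by (intro prod.cong refl) (simp add: coord)
  have pm: "(\<lambda>z::real^'m. \<Prod>i\<in>UNIV. \<phi> i (z $ i)) \<in> borel_measurable borel"
    by measurable
  show "integrable lborel (\<lambda>z::real^'m. \<Prod>i\<in>UNIV. \<phi> i (z $ i))"
    by (subst lborel_eq, subst integrable_distr_eq[OF m pm], subst eq, subst eq2)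
      (intro product_integrable_prod int, simp)
  have "(\<integral>z. (\<Prod>i\<in>UNIV. \<phi> i (z $ i)) \<partial>(lborel :: (real^'m) measure)) = (\<Prod>b\<in>Basis. (\<integral>r. \<psi> b r \<partial>lborel))"
    by (subst lborel_eq, subst integral_distr[OF m pm], subst eq, subst eq2)
      (intro product_integral_prod int, simp)
  also have "\<dots> = (\<Prod>i\<in>UNIV. (\<integral>r. \<phi> i r \<partial>lborel))"
    unfolding B by (subst prod.reindex[OF inj]) (simp add: \<psi>)
  finally show "(\<integral>z. (\<Prod>i\<in>UNIV. \<phi> i (z $ i)) \<partial>(lborel :: (real^'m) measure)) = (\<Prod>i\<in>UNIV. (\<integral>r. \<phi> i r \<partial>lborel))" .
qed

text \<open>The monomial is distributed over the coordinates of the product density, as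
  \<open>\<phi>1\<close> and \<open>\<phi>2\<close> do, so that each moment is a product of
  one-dimensional moments. A coordinate that occurs once contributes a vanishing first moment; for
  \<open>j = k\<close> that coordinate contributes the variance.\<close>

lemma gaussian_vec_moments:
  fixes j k :: "'m::finite"
  assumes "\<sigma> > 0"
  defines "\<rho> \<equiv> \<lambda>z::real^'m. \<Prod>i\<in>UNIV. normal_density 0 \<sigma> (z $ i)"
  shows "integrable lborel (\<lambda>z. \<rho> z * z $ j)"
    and "(\<integral>z. \<rho> z * z $ j \<partial>lborel) = 0"
    and "integrable lborel (\<lambda>z. \<rho> z * (z $ j * z $ k))"
    and "(\<integral>z. \<rho> z * (z $ j * z $ k) \<partial>lborel) = (if j = k then \<sigma>\<^sup>2 else 0)"
proof -
  have m0: "integrable lborel (normal_density 0 \<sigma>)" "(\<integral>r. normal_density 0 \<sigma> r \<partial>lborel) = 1"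
    using assms(1) by simp_all
  have m1: "integrable lborel (\<lambda>r. normal_density 0 \<sigma> r * r)" "(\<integral>r. normal_density 0 \<sigma> r * r \<partial>lborel) = 0"
    using integrable_normal_moment_nz_1[OF assms(1), of 0] integral_normal_moment_nz_1[OF assms(1), of 0] by simp_all
  have m2: "integrable lborel (\<lambda>r. normal_density 0 \<sigma> r * (r * r))"
    "(\<integral>r. normal_density 0 \<sigma> r * (r * r) \<partial>lborel) = \<sigma>\<^sup>2"
    using integrable_normal_moment[OF assms(1), of 0 2] integral_normal_moment_even[OF assms(1), of 0 1]
    by (simp_all add: power2_eq_square)
  define \<phi>1 where "\<phi>1 i r = normal_density 0 \<sigma> r * (if i = j then r else 1)" for i r
  define \<phi>2 where "\<phi>2 i r = normal_density 0 \<sigma> r * ((if i = j then r else 1) * (if i = k then r else 1))" for i r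
  have 1: "(\<Prod>i\<in>UNIV. \<phi>1 i (z $ i)) = \<rho> z * z $ j" for z :: "real^'m"
    by (simp add: \<phi>1_def \<rho>_def prod.distrib prod.delta)
  have 2: "(\<Prod>i\<in>UNIV. \<phi>2 i (z $ i)) = \<rho> z * (z $ j * z $ k)" for z :: "real^'m"
    by (simp add: \<phi>2_def \<rho>_def prod.distrib prod.delta)
  have i1: "integrable lborel (\<phi>1 i)" for i
    using m0 m1 by (cases "i = j") (simp_all add: \<phi>1_def[abs_def])
  have i2: "integrable lborel (\<phi>2 i)" for i
    using m0 m1 m2 by (cases "i = j"; cases "i = k") (simp_all add: \<phi>2_def[abs_def])
  have v1: "(\<integral>r. \<phi>1 i r \<partial>lborel) = (if i = j then 0 else 1)" for i
    using m0 m1 by (simp add: \<phi>1_def)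
  have v2: "(\<integral>r. \<phi>2 i r \<partial>lborel) = (if i = j \<and> i = k then \<sigma>\<^sup>2 else if i = j \<or> i = k then 0 else 1)" for i
    using m0 m1 m2 by (cases "i = j"; cases "i = k") (simp_all add: \<phi>2_def)
  show "integrable lborel (\<lambda>z. \<rho> z * z $ j)" "integrable lborel (\<lambda>z. \<rho> z * (z $ j * z $ k))"
    using lborel_integral_prod_vec(1)[of \<phi>1, OF i1] lborel_integral_prod_vec(1)[of \<phi>2, OF i2]
    by (simp_all add: 1 2)
  show "(\<integral>z. \<rho> z * z $ j \<partial>lborel) = 0"
    using lborel_integral_prod_vec(2)[of \<phi>1, OF i1] by (simp add: 1 v1 prod.delta)
  have "(\<Prod>i\<in>UNIV. (\<integral>r. \<phi>2 i r \<partial>lborel)) = (if j = k then \<sigma>\<^sup>2 else 0)"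
  proof (cases "j = k")
    case True
    then have "(\<Prod>i\<in>UNIV. (\<integral>r. \<phi>2 i r \<partial>lborel)) = (\<Prod>i\<in>UNIV. if i = j then \<sigma>\<^sup>2 else 1)"
      by (intro prod.cong refl) (simp add: v2)
    then show ?thesis
      using True by simp
  next
    case False
    then show ?thesis
      by (intro trans[OF prod_zero]) (auto intro!: exI[of _ j] simp: v2)
  qed
  then show "(\<integral>z. \<rho> z * (z $ j * z $ k) \<partial>lborel) = (if j = k then \<sigma>\<^sup>2 else 0)"
    using lborel_integral_prod_vec(2)[of \<phi>2, OF i2] by (simp add: 2)
qed

lemma borel_measurable_vec_nth [measurable (raw)]:
  "X \<in> borel_measurable M \<Longrightarrow> (\<lambda>\<omega>. X \<omega> $ i) \<in> borel_measurable M"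
  by (erule measurable_compose) (intro borel_measurable_continuous_onI continuous_intros)

lemma norm_vec_sq: "(norm (v :: real^'n))\<^sup>2 = (\<Sum>i\<in>UNIV. (v $ i)\<^sup>2)"
  by (simp add: norm_vec_def L2_set_def sum_nonneg)

lemma norm_mat_sq: "(norm (A :: real^'m^'n))\<^sup>2 = (\<Sum>i\<in>UNIV. \<Sum>j\<in>UNIV. (A $ i $ j)\<^sup>2)"
  by (simp add: norm_vec_def L2_set_def sum_nonneg)

lemma integrable_mult_of_sq:
  fixes X Y :: "'a \<Rightarrow> real"
  assumes "integrable M (\<lambda>\<omega>. (X \<omega>)\<^sup>2)" "integrable M (\<lambda>\<omega>. (Y \<omega>)\<^sup>2)"
    and [measurable]: "X \<in> borel_measurable M" "Y \<in> borel_measurable M"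
  shows "integrable M (\<lambda>\<omega>. X \<omega> * Y \<omega>)"
proof (rule Bochner_Integration.integrable_bound)
  show "integrable M (\<lambda>\<omega>. (X \<omega>)\<^sup>2 + (Y \<omega>)\<^sup>2)"
    using assms by simp
  show "AE \<omega> in M. norm (X \<omega> * Y \<omega>) \<le> norm ((X \<omega>)\<^sup>2 + (Y \<omega>)\<^sup>2)"
  proof (intro AE_I2)
    fix \<omega>
    have "2 * (\<bar>X \<omega>\<bar> * \<bar>Y \<omega>\<bar>) \<le> (X \<omega>)\<^sup>2 + (Y \<omega>)\<^sup>2"
      using sum_squares_bound[of "\<bar>X \<omega>\<bar>" "\<bar>Y \<omega>\<bar>"] by simp
    moreover have "0 \<le> \<bar>X \<omega>\<bar> * \<bar>Y \<omega>\<bar>" by simp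
    ultimately show "norm (X \<omega> * Y \<omega>) \<le> norm ((X \<omega>)\<^sup>2 + (Y \<omega>)\<^sup>2)"
      unfolding real_norm_def abs_mult by linarith
  qed
qed simp

section \<open>Brownian increments: independence from the past and the one-step isometry\<close>

locale brownian_space = prob_space M
  for M :: "'w measure" +
  fixes F :: "real \<Rightarrow> 'w measure" and W :: "real \<Rightarrow> 'w \<Rightarrow> real^'m"
  assumes usual_filtration: "usual_filtration M F"
    and brownian_motion: "brownian_motion M F W"
begin

lemma subalgebra_F: "0 \<le> t \<Longrightarrow> subalgebra M (F t)"
  using usual_filtration by (auto simp: usual_filtration_def)

lemma space_F: "0 \<le> t \<Longrightarrow> space (F t) = space M"
  using subalgebra_F by (auto simp: subalgebra_def)

lemma sets_F_mono: "0 \<le> s \<Longrightarrow> s \<le> t \<Longrightarrow> sets (F s) \<subseteq> sets (F t)"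
  using usual_filtration unfolding usual_filtration_def by blast

lemma sets_F_events: "0 \<le> t \<Longrightarrow> B \<in> sets (F t) \<Longrightarrow> B \<in> events"
  using subalgebra_F by (auto simp: subalgebra_def)

lemma measurable_F_mono:
  assumes "X \<in> measurable (F s) N" "0 \<le> s" "s \<le> t"
  shows "X \<in> measurable (F t) N"
  by (rule measurable_mono[THEN subsetD, OF _ _ _ _ assms(1)])
    (use assms sets_F_mono space_F in auto)

lemma measurable_F_M: "X \<in> measurable (F s) N \<Longrightarrow> 0 \<le> s \<Longrightarrow> X \<in> measurable M N"
  using measurable_from_subalg subalgebra_F by blast

lemma null_subset: "A \<in> null_sets M \<Longrightarrow> B \<subseteq> A \<Longrightarrow> B \<in> events"
  using usual_filtration sets_F_events[of 0 B] unfolding usual_filtration_def by blast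

text \<open>The usual conditions put every subset of a null set into \<open>F 0\<close>, hence into
  \<open>M\<close>. This makes suprema over uncountably many times measurable when the paths are
  continuous only almost surely.\<close>

lemma events_AE_cong:
  assumes "A \<in> events" "AE \<omega> in M. \<omega> \<in> A \<longleftrightarrow> \<omega> \<in> B" "B \<subseteq> space M"
  shows "B \<in> events"
proof -
  from assms(2) obtain N where N: "N \<in> null_sets M" "{\<omega>\<in>space M. \<not> (\<omega> \<in> A \<longleftrightarrow> \<omega> \<in> B)} \<subseteq> N"
    by (auto simp: eventually_ae_filter)
  have "A - B \<in> events" "B - A \<in> events"
    using N(2) assms(3) sets.sets_into_space[OF assms(1)] by (auto intro!: null_subset[OF N(1)])
  moreover have "B = (A - (A - B)) \<union> (B - A)" by auto
  ultimately show ?thesis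
    using assms(1) by (metis sets.Diff sets.Un)
qed

lemma W_F: "0 \<le> t \<Longrightarrow> W t \<in> borel_measurable (F t)"
  using brownian_motion by (auto simp: brownian_motion_def)

lemma W_M [measurable]: "0 \<le> t \<Longrightarrow> W t \<in> borel_measurable M"
  using W_F measurable_F_M by blast

lemma W_continuous: "AE \<omega> in M. continuous_on {0..} (\<lambda>t. W t \<omega>)"
  using brownian_motion by (auto simp: brownian_motion_def)

lemma indep_set_mono: "indep_set A B \<Longrightarrow> A' \<subseteq> A \<Longrightarrow> B' \<subseteq> B \<Longrightarrow> indep_set A' B'"
  unfolding indep_sets2_eq by (meson subset_iff subset_trans)

text \<open>Brownian motion is defined by independence of two set systems, while factoring an
  expectation needs a pair of real random variables. \<open>Z\<close> will be a monomial in
  quantities known at time \<open>s\<close>, and \<open>h\<close> a coordinate of the increment or a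
  product of two coordinates.\<close>

lemma increment_indep:
  fixes h :: "real^'m \<Rightarrow> real" and Z :: "'w \<Rightarrow> real"
  assumes st: "0 \<le> s" "s < t" and Z: "Z \<in> borel_measurable (F s)"
    and h [measurable]: "h \<in> borel_measurable borel"
  shows "indep_var borel Z borel (\<lambda>\<omega>. h (W t \<omega> - W s \<omega>))"
proof -
  let ?D = "\<lambda>\<omega>. W t \<omega> - W s \<omega>"
  let ?A = "{?D -` B \<inter> space M | B. B \<in> sets borel}"
  have ind: "indep_set (sets (F s)) ?A"
    using brownian_motion st unfolding brownian_motion_def by blast
  have [measurable]: "W t \<in> borel_measurable M" "W s \<in> borel_measurable M"
    using st by auto
  have "sigma_sets (space M) {Z -` A \<inter> space M | A. A \<in> sets borel} \<subseteq> sigma_sets (space M) (sets (F s))"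
    using measurable_sets[OF Z] space_F[OF st(1)] by (intro sigma_sets_mono') auto
  moreover have "sigma_sets (space M) {(\<lambda>\<omega>. h (?D \<omega>)) -` A \<inter> space M | A. A \<in> sets borel} \<subseteq> ?A"
  proof -
    have "{(\<lambda>\<omega>. h (?D \<omega>)) -` A \<inter> space M | A. A \<in> sets borel} \<subseteq> ?A"
    proof safe
      fix A :: "real set" assume "A \<in> sets borel"
      then have "h -` A \<in> sets borel"
        using measurable_sets[OF h, of A] by simp
      then show "\<exists>B. (\<lambda>\<omega>. h (?D \<omega>)) -` A \<inter> space M = ?D -` B \<inter> space M \<and> B \<in> sets borel"
        by (intro exI[of _ "h -` A"]) auto
    qed
    then have "sigma_sets (space M) {(\<lambda>\<omega>. h (?D \<omega>)) -` A \<inter> space M | A. A \<in> sets borel} \<subseteq> sigma_sets (space M) ?A"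
      by (rule sigma_sets_mono')
    also have "sigma_sets (space M) ?A = {?D -` B \<inter> space M | B. B \<in> sigma_sets UNIV (sets borel)}"
      by (rule sigma_sets_vimage_commute[symmetric]) simp
    also have "sigma_sets UNIV (sets (borel :: (real^'m) measure)) = sets borel"
      using sets.sigma_sets_eq[of "borel :: (real^'m) measure"] by simp
    finally show ?thesis .
  qed
  moreover have "sigma_sets (space M) (sets (F s)) = sets (F s)"
    using sets.sigma_sets_eq[of "F s"] space_F[OF st(1)] by simp
  ultimately have sub: "sigma_sets (space M) {Z -` A \<inter> space M | A. A \<in> sets borel} \<subseteq> sets (F s)"
    "sigma_sets (space M) {(\<lambda>\<omega>. h (?D \<omega>)) -` A \<inter> space M | A. A \<in> sets borel} \<subseteq> ?A" by simp_all
  have "indep_set (sigma_sets (space M) {Z -` A \<inter> space M | A. A \<in> sets borel})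
     (sigma_sets (space M) {(\<lambda>\<omega>. h (?D \<omega>)) -` A \<inter> space M | A. A \<in> sets borel})"
    by (rule indep_set_mono[OF ind sub])
  then show ?thesis
    unfolding indep_var_eq using measurable_F_M[OF Z st(1)] by simp
qed

lemma increment_moments:
  assumes st: "0 \<le> s" "s < t"
  shows "integrable M (\<lambda>\<omega>. (W t \<omega> - W s \<omega>) $ j)" "expectation (\<lambda>\<omega>. (W t \<omega> - W s \<omega>) $ j) = 0"
    "integrable M (\<lambda>\<omega>. (W t \<omega> - W s \<omega>) $ j * (W t \<omega> - W s \<omega>) $ k)"
    "expectation (\<lambda>\<omega>. (W t \<omega> - W s \<omega>) $ j * (W t \<omega> - W s \<omega>) $ k) = (if j = k then t - s else 0)"
proof -
  let ?\<rho> = "\<lambda>z::real^'m. \<Prod>i\<in>UNIV. normal_density 0 (sqrt (t - s)) (z $ i)"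
  have D: "distributed M lborel (\<lambda>\<omega>. W t \<omega> - W s \<omega>) (\<lambda>z. ennreal (?\<rho> z))"
    using brownian_motion st unfolding brownian_motion_def by blast
  have nn: "0 \<le> ?\<rho> z" for z by (intro prod_nonneg) simp
  have \<sigma>: "sqrt (t - s) > 0" using st by simp
  note g = gaussian_vec_moments[OF \<sigma>, where 'm = 'm]
  show "integrable M (\<lambda>\<omega>. (W t \<omega> - W s \<omega>) $ j)"
    using distributed_integrable[OF D, of "\<lambda>z. z $ j"] nn g(1)[of j] by simp
  show "expectation (\<lambda>\<omega>. (W t \<omega> - W s \<omega>) $ j) = 0"
    using distributed_integral[OF D, of "\<lambda>z. z $ j"] nn g(2)[of j] by simp
  show "integrable M (\<lambda>\<omega>. (W t \<omega> - W s \<omega>) $ j * (W t \<omega> - W s \<omega>) $ k)"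
    using distributed_integrable[OF D, of "\<lambda>z. z $ j * z $ k"] nn g(3)[of j k] by simp
  show "expectation (\<lambda>\<omega>. (W t \<omega> - W s \<omega>) $ j * (W t \<omega> - W s \<omega>) $ k) = (if j = k then t - s else 0)"
    using g(4)[of j k] st by (subst distributed_integral[OF D, symmetric]) (simp_all add: nn)
qed

text \<open>Ito isometry for a single step, by expanding the square in coordinates. The mixed terms
  vanish because the increment is centred and independent of \<open>a\<close> and \<open>H\<close>;
  in the quadratic terms only the diagonal of its covariance survives, and this produces the
  Frobenius norm of \<open>H\<close>.\<close>

lemma increment_L2:
  fixes a :: "'w \<Rightarrow> real^'n" and H :: "'w \<Rightarrow> real^'m^'n"
  assumes st: "0 \<le> s" "s < t"
    and a: "a \<in> borel_measurable (F s)" "integrable M (\<lambda>\<omega>. (norm (a \<omega>))\<^sup>2)"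
    and H: "H \<in> borel_measurable (F s)" "integrable M (\<lambda>\<omega>. (norm (H \<omega>))\<^sup>2)"
  shows "integrable M (\<lambda>\<omega>. (norm (a \<omega> + H \<omega> *v (W t \<omega> - W s \<omega>)))\<^sup>2)"
    and "expectation (\<lambda>\<omega>. (norm (a \<omega> + H \<omega> *v (W t \<omega> - W s \<omega>)))\<^sup>2) =
      expectation (\<lambda>\<omega>. (norm (a \<omega>))\<^sup>2) + (t - s) * expectation (\<lambda>\<omega>. (norm (H \<omega>))\<^sup>2)"
proof -
  define D where "D \<omega> = W t \<omega> - W s \<omega>" for \<omega>
  note mom = increment_moments[OF st, folded D_def]
  have aF [measurable]: "(\<lambda>\<omega>. a \<omega> $ i) \<in> borel_measurable (F s)" for i
    using a(1) by (rule borel_measurable_vec_nth)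
  have HF [measurable]: "(\<lambda>\<omega>. H \<omega> $ i $ j) \<in> borel_measurable (F s)" for i j
    using H(1) by (intro borel_measurable_vec_nth)
  have aM [measurable]: "a \<in> borel_measurable M" and HM [measurable]: "H \<in> borel_measurable M"
    using a(1) H(1) measurable_F_M st(1) by blast+
  have le1: "(v $ i)\<^sup>2 \<le> (norm v)\<^sup>2" for v :: "real^'n" and i
    unfolding norm_vec_sq by (rule member_le_sum) auto
  have le2: "(A $ i $ j)\<^sup>2 \<le> (norm A)\<^sup>2" for A :: "real^'m^'n" and i j
  proof -
    have "(A $ i $ j)\<^sup>2 \<le> (\<Sum>j\<in>UNIV. (A $ i $ j)\<^sup>2)" by (rule member_le_sum) auto
    also have "\<dots> \<le> (norm A)\<^sup>2" unfolding norm_mat_sq by (rule member_le_sum) (auto intro: sum_nonneg)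
    finally show ?thesis .
  qed
  have a2: "integrable M (\<lambda>\<omega>. (a \<omega> $ i)\<^sup>2)" for i
    by (rule Bochner_Integration.integrable_bound[OF a(2)]) (auto simp: le1)
  have H2: "integrable M (\<lambda>\<omega>. (H \<omega> $ i $ j)\<^sup>2)" for i j
    by (rule Bochner_Integration.integrable_bound[OF H(2)]) (auto simp: le2)
  have aH: "integrable M (\<lambda>\<omega>. a \<omega> $ i * H \<omega> $ i $ j)" for i j
    by (rule integrable_mult_of_sq[OF a2 H2]) auto
  have HH: "integrable M (\<lambda>\<omega>. H \<omega> $ i $ j * H \<omega> $ i $ k)" for i j k
    by (rule integrable_mult_of_sq[OF H2 H2]) auto
  have ind1: "indep_var borel (\<lambda>\<omega>. a \<omega> $ i * H \<omega> $ i $ j) borel (\<lambda>\<omega>. D \<omega> $ j)" for i j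
    unfolding D_def by (rule increment_indep[OF st, where h = "\<lambda>z. z $ j"]) auto
  have ind2: "indep_var borel (\<lambda>\<omega>. H \<omega> $ i $ j * H \<omega> $ i $ k) borel (\<lambda>\<omega>. D \<omega> $ j * D \<omega> $ k)" for i j k
    unfolding D_def by (rule increment_indep[OF st, where h = "\<lambda>z. z $ j * z $ k"]) auto
  note I1 = indep_var_integrable[OF ind1 aH mom(1)]
  note E1 = indep_var_lebesgue_integral[OF ind1 aH mom(1)]
  note I2 = indep_var_integrable[OF ind2 HH mom(3)]
  note E2 = indep_var_lebesgue_integral[OF ind2 HH mom(3)]
  have expand: "(norm (a \<omega> + H \<omega> *v D \<omega>))\<^sup>2 = (norm (a \<omega>))\<^sup>2
      + (\<Sum>i\<in>UNIV. \<Sum>j\<in>UNIV. 2 * (a \<omega> $ i * H \<omega> $ i $ j * D \<omega> $ j))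
      + (\<Sum>i\<in>UNIV. \<Sum>j\<in>UNIV. \<Sum>k\<in>UNIV. H \<omega> $ i $ j * H \<omega> $ i $ k * (D \<omega> $ j * D \<omega> $ k))" for \<omega>
  proof -
    have "(norm (a \<omega> + H \<omega> *v D \<omega>))\<^sup>2 = (norm (a \<omega>))\<^sup>2 + 2 * (a \<omega> \<bullet> (H \<omega> *v D \<omega>)) + (norm (H \<omega> *v D \<omega>))\<^sup>2"
      by (simp add: power2_norm_eq_inner inner_add_left inner_add_right inner_commute)
    also have "2 * (a \<omega> \<bullet> (H \<omega> *v D \<omega>)) = (\<Sum>i\<in>UNIV. \<Sum>j\<in>UNIV. 2 * (a \<omega> $ i * H \<omega> $ i $ j * D \<omega> $ j))"
      by (simp add: inner_vec_def matrix_vector_mult_def sum_distrib_left mult.assoc)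
    also have "(norm (H \<omega> *v D \<omega>))\<^sup>2 =
        (\<Sum>i\<in>UNIV. \<Sum>j\<in>UNIV. \<Sum>k\<in>UNIV. H \<omega> $ i $ j * H \<omega> $ i $ k * (D \<omega> $ j * D \<omega> $ k))"
      unfolding norm_vec_sq by (simp add: matrix_vector_mult_def power2_eq_square sum_product mult_ac)
    finally show ?thesis by simp
  qed
  have "(\<Sum>i\<in>UNIV. \<Sum>j\<in>UNIV. \<Sum>k\<in>UNIV. expectation (\<lambda>\<omega>. H \<omega> $ i $ j * H \<omega> $ i $ k) * (if j = k then t - s else 0))
      = (t - s) * expectation (\<lambda>\<omega>. (norm (H \<omega>))\<^sup>2)"
    by (simp add: norm_mat_sq H2 power2_eq_square[symmetric] if_distrib sum_distrib_left mult.commute cong: if_cong)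
  then show "expectation (\<lambda>\<omega>. (norm (a \<omega> + H \<omega> *v (W t \<omega> - W s \<omega>)))\<^sup>2) =
      expectation (\<lambda>\<omega>. (norm (a \<omega>))\<^sup>2) + (t - s) * expectation (\<lambda>\<omega>. (norm (H \<omega>))\<^sup>2)"
    unfolding D_def[symmetric] expand
    by (simp add: a(2) I1 I2 E1 E2 mom)
  show "integrable M (\<lambda>\<omega>. (norm (a \<omega> + H \<omega> *v (W t \<omega> - W s \<omega>)))\<^sup>2)"
    unfolding D_def[symmetric] expand by (simp add: a(2) I1 I2)
qed

text \<open>Testing against all \<open>B\<close> in \<open>F s\<close> takes the place of
  conditional expectations. Nothing new has to be computed: multiplying \<open>a\<close> and
  \<open>H\<close> by the indicator of \<open>B\<close> keeps them measurable at time
  \<open>s\<close>.\<close>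

lemma increment_L2_set:
  fixes a :: "'w \<Rightarrow> real^'n" and H :: "'w \<Rightarrow> real^'m^'n"
  assumes st: "0 \<le> s" "s < t"
    and a: "a \<in> borel_measurable (F s)" "integrable M (\<lambda>\<omega>. (norm (a \<omega>))\<^sup>2)"
    and H: "H \<in> borel_measurable (F s)" "integrable M (\<lambda>\<omega>. (norm (H \<omega>))\<^sup>2)"
    and B: "B \<in> sets (F s)"
  shows "expectation (\<lambda>\<omega>. (norm (a \<omega> + H \<omega> *v (W t \<omega> - W s \<omega>)))\<^sup>2 * indicator B \<omega>) =
      expectation (\<lambda>\<omega>. ((norm (a \<omega>))\<^sup>2 + (t - s) * (norm (H \<omega>))\<^sup>2) * indicator B \<omega>)"
proof -
  have BM: "B \<in> events"
    using B st(1) sets_F_events by blast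
  have ind: "((indicator B \<omega> :: real))\<^sup>2 = indicator B \<omega>" for \<omega>
    by (simp add: indicator_def)
  have n: "(norm (indicator B \<omega> *\<^sub>R v))\<^sup>2 = (norm v)\<^sup>2 * indicator B \<omega>" for v :: "'b::real_normed_vector" and \<omega>
    by (simp add: indicator_def)
  have i1: "integrable M (\<lambda>\<omega>. (norm (a \<omega>))\<^sup>2 * indicator B \<omega>)" "integrable M (\<lambda>\<omega>. (norm (H \<omega>))\<^sup>2 * indicator B \<omega>)"
    using BM a(2) H(2) by (auto intro!: integrable_real_mult_indicator)
  have "expectation (\<lambda>\<omega>. (norm (indicator B \<omega> *\<^sub>R a \<omega> + (indicator B \<omega> *\<^sub>R H \<omega>) *v (W t \<omega> - W s \<omega>)))\<^sup>2) =
      expectation (\<lambda>\<omega>. (norm (indicator B \<omega> *\<^sub>R a \<omega>))\<^sup>2) + (t - s) * expectation (\<lambda>\<omega>. (norm (indicator B \<omega> *\<^sub>R H \<omega>))\<^sup>2)"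
    by (rule increment_L2(2)[OF st]) (use a H B i1 in \<open>auto intro!: borel_measurable_scaleR borel_measurable_indicator simp only: n\<close>)
  also have "(\<lambda>\<omega>. (norm (indicator B \<omega> *\<^sub>R a \<omega> + (indicator B \<omega> *\<^sub>R H \<omega>) *v (W t \<omega> - W s \<omega>)))\<^sup>2)
     = (\<lambda>\<omega>. (norm (a \<omega> + H \<omega> *v (W t \<omega> - W s \<omega>)))\<^sup>2 * indicator B \<omega>)"
    by (auto simp: indicator_def)
  finally show ?thesis
    using i1 unfolding n by (simp add: distrib_right mult.assoc)
qed

end

section \<open>A maximal inequality\<close>

text \<open>Doob's first-passage argument for a nonnegative process whose conditional drift is at
  most \<open>\<alpha> n\<close>; it is not assumed to be a submartingale. The hypothesis
  \<open>step\<close> expresses the conditional drift through events of the past.\<close>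

lemma (in prob_space) maximal_inequality:
  fixes X :: "nat \<Rightarrow> 'a \<Rightarrow> real"
  assumes sub: "\<And>n. n \<le> m \<Longrightarrow> subalgebra M (G n)"
    and mono: "\<And>i n. i \<le> n \<Longrightarrow> n \<le> m \<Longrightarrow> sets (G i) \<subseteq> sets (G n)"
    and X: "\<And>n. n \<le> m \<Longrightarrow> X n \<in> borel_measurable (G n)" "\<And>n. n \<le> m \<Longrightarrow> integrable M (X n)"
      "\<And>n \<omega>. n \<le> m \<Longrightarrow> \<omega> \<in> space M \<Longrightarrow> 0 \<le> X n \<omega>"
    and \<alpha>: "\<And>n. n < m \<Longrightarrow> integrable M (\<alpha> n)" "\<And>n \<omega>. n < m \<Longrightarrow> \<omega> \<in> space M \<Longrightarrow> 0 \<le> \<alpha> n \<omega>"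
    and step: "\<And>n B. n < m \<Longrightarrow> B \<in> sets (G n) \<Longrightarrow>
      expectation (\<lambda>\<omega>. X (Suc n) \<omega> * indicator B \<omega>) \<le> expectation (\<lambda>\<omega>. (X n \<omega> + \<alpha> n \<omega>) * indicator B \<omega>)"
  shows "c * prob {\<omega>\<in>space M. \<exists>n\<le>m. X n \<omega> \<ge> c} \<le> expectation (X 0) + (\<Sum>n<m. expectation (\<alpha> n))"
proof -
  define B where "B n = {\<omega>\<in>space M. \<forall>i\<le>n. X i \<omega> < c}" for n
  have XM: "X n \<in> borel_measurable M" if "n \<le> m" for n
    using X(2)[OF that] by simp
  have spG: "space (G n) = space M" if "n \<le> m" for n
    using sub[OF that] by (simp add: subalgebra_def)
  have BG: "B n \<in> sets (G n)" if "n \<le> m" for n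
  proof -
    have "{\<omega>\<in>space M. X i \<omega> < c} \<in> sets (G n)" if "i \<le> n" for i
    proof -
      have "{\<omega>\<in>space (G i). X i \<omega> < c} \<in> sets (G i)"
        using X(1)[of i] \<open>i \<le> n\<close> \<open>n \<le> m\<close> by simp
      then show ?thesis
        using mono[OF \<open>i \<le> n\<close> \<open>n \<le> m\<close>] spG[of i] \<open>i \<le> n\<close> \<open>n \<le> m\<close> by auto
    qed
    moreover have "B n = (\<Inter>i\<in>{..n}. {\<omega>\<in>space M. X i \<omega> < c})"
      by (auto simp: B_def)
    ultimately show ?thesis
      by (auto intro: sets.finite_INT)
  qed
  have BM: "B n \<in> events" if "n \<le> m" for n
    using BG[OF that] sub[OF that] by (auto simp: subalgebra_def)
  \<comment> \<open>Paths that have reached level \<open>c\<close> are booked at the value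
    \<open>c\<close>, the others at their current value. This total grows in expectation by at most
    the drift in each step.\<close>
  have "c * prob (space M - B n) + expectation (\<lambda>\<omega>. X n \<omega> * indicator (B n) \<omega>)
      \<le> expectation (X 0) + (\<Sum>i<n. expectation (\<alpha> i))" if "n \<le> m" for n
    using that
  proof (induction n)
    case 0
    have "c * prob (space M - B 0) = expectation (\<lambda>\<omega>. c * indicator (space M - B 0) \<omega>)"
      using BM[of 0] by simp
    also have "\<dots> + expectation (\<lambda>\<omega>. X 0 \<omega> * indicator (B 0) \<omega>)
       = expectation (\<lambda>\<omega>. c * indicator (space M - B 0) \<omega> + X 0 \<omega> * indicator (B 0) \<omega>)"
      using BM[of 0] X(2)[of 0]
      by (intro Bochner_Integration.integral_add[symmetric]) (auto intro!: integrable_real_mult_indicator simp: emeasure_eq_measure)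
    also have "\<dots> \<le> expectation (X 0)"
      using BM[of 0] X(2)[of 0]
      by (intro integral_mono Bochner_Integration.integrable_add integrable_real_mult_indicator)
        (auto simp: B_def indicator_def)
    finally show ?case by simp
  next
    case (Suc n)
    then have n: "n < m" "n \<le> m" "Suc n \<le> m" by auto
    note [measurable] = BM[OF n(2)] BM[OF n(3)]
    \<comment> \<open>The event that level \<open>c\<close> is reached for the first time at step
      \<open>Suc n\<close>; on it \<open>X (Suc n)\<close> is at least \<open>c\<close>.\<close>
    let ?C = "B n - B (Suc n)"
    have sub: "B (Suc n) \<subseteq> B n" by (auto simp: B_def)
    have "space M - B (Suc n) = (space M - B n) \<union> ?C" using sub BM[OF n(2)] sets.sets_into_space by blast
    then have "prob (space M - B (Suc n)) = prob (space M - B n) + prob ?C"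
      using BM n by (auto intro!: finite_measure_Union)
    then have "c * prob (space M - B (Suc n)) + expectation (\<lambda>\<omega>. X (Suc n) \<omega> * indicator (B (Suc n)) \<omega>)
      = c * prob (space M - B n) + (expectation (\<lambda>\<omega>. c * indicator ?C \<omega>) + expectation (\<lambda>\<omega>. X (Suc n) \<omega> * indicator (B (Suc n)) \<omega>))"
      by (simp add: distrib_left)
    also have "expectation (\<lambda>\<omega>. c * indicator ?C \<omega>) + expectation (\<lambda>\<omega>. X (Suc n) \<omega> * indicator (B (Suc n)) \<omega>)
       = expectation (\<lambda>\<omega>. c * indicator ?C \<omega> + X (Suc n) \<omega> * indicator (B (Suc n)) \<omega>)"
      using X(2)[OF n(3)]
      by (intro Bochner_Integration.integral_add[symmetric]) (auto intro!: integrable_real_mult_indicator simp: emeasure_eq_measure)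
    also have "\<dots> \<le> expectation (\<lambda>\<omega>. X (Suc n) \<omega> * indicator (B n) \<omega>)"
    proof (intro integral_mono)
      fix \<omega> assume \<omega>: "\<omega> \<in> space M"
      show "c * indicator ?C \<omega> + X (Suc n) \<omega> * indicator (B (Suc n)) \<omega> \<le> X (Suc n) \<omega> * indicator (B n) \<omega>"
        using \<omega> by (auto simp: B_def indicator_def not_less le_Suc_eq)
    qed (use X(2)[OF n(3)] in \<open>auto intro!: integrable_real_mult_indicator Bochner_Integration.integrable_add simp: emeasure_eq_measure\<close>)
    also have "\<dots> \<le> expectation (\<lambda>\<omega>. (X n \<omega> + \<alpha> n \<omega>) * indicator (B n) \<omega>)"
      by (rule step[OF n(1) BG[OF n(2)]])
    also have "\<dots> = expectation (\<lambda>\<omega>. X n \<omega> * indicator (B n) \<omega>) + expectation (\<lambda>\<omega>. \<alpha> n \<omega> * indicator (B n) \<omega>)"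
      using X(2)[OF n(2)] \<alpha>(1)[OF n(1)]
      by (simp add: distrib_right integrable_real_mult_indicator)
    also have "expectation (\<lambda>\<omega>. \<alpha> n \<omega> * indicator (B n) \<omega>) \<le> expectation (\<alpha> n)"
      using \<alpha>(1,2)[OF n(1)] by (intro integral_mono integrable_real_mult_indicator) (auto simp: indicator_def)
    finally show ?case
      using Suc.IH n by simp
  qed
  from this[of m] have "c * prob (space M - B m) + expectation (\<lambda>\<omega>. X m \<omega> * indicator (B m) \<omega>)
      \<le> expectation (X 0) + (\<Sum>i<m. expectation (\<alpha> i))" by simp
  moreover have "0 \<le> expectation (\<lambda>\<omega>. X m \<omega> * indicator (B m) \<omega>)"
    using X(3)[of m] by (intro integral_nonneg_AE) (auto simp: indicator_def)
  moreover have "space M - B m = {\<omega>\<in>space M. \<exists>n\<le>m. X n \<omega> \<ge> c}"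
    by (auto simp: B_def not_less)
  ultimately show ?thesis by simp
qed

section \<open>Measurability in the path space\<close>

lemma mspace_C_bdd:
  assumes "\<phi> \<in> mspace (C_metric \<tau>)" "\<psi> \<in> mspace (C_metric \<tau>)"
  shows "bdd_above ((\<lambda>\<theta>. norm (\<phi> \<theta> - \<psi> \<theta>)) ` {-\<tau>..0})"
  using assms unfolding mspace_C_metric
  by (intro bounded_imp_bdd_above compact_imp_bounded compact_continuous_image continuous_intros) auto

lemma mdist_C_leI:
  assumes "\<tau> > 0" "\<phi> \<in> mspace (C_metric \<tau>)" "\<psi> \<in> mspace (C_metric \<tau>)"
    and "\<And>\<theta>. \<theta> \<in> {-\<tau>..0} \<Longrightarrow> norm (\<phi> \<theta> - \<psi> \<theta>) \<le> r"
  shows "mdist (C_metric \<tau>) \<phi> \<psi> \<le> r"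
  unfolding mdist_C_metric[OF assms(1-3)] using assms(1,4) by (intro cSUP_least) auto

lemma mdist_C_geD:
  assumes "\<tau> > 0" "\<phi> \<in> mspace (C_metric \<tau>)" "\<psi> \<in> mspace (C_metric \<tau>)" "\<theta> \<in> {-\<tau>..0}"
  shows "norm (\<phi> \<theta> - \<psi> \<theta>) \<le> mdist (C_metric \<tau>) \<phi> \<psi>"
  unfolding mdist_C_metric[OF assms(1-3)] using assms by (intro cSUP_upper mspace_C_bdd) auto

lemma openin_C_iff:
  "openin (mtopology_of (C_metric \<tau>)) U \<longleftrightarrow>
     U \<subseteq> mspace (C_metric \<tau>) \<and> (\<forall>\<phi>\<in>U. \<exists>r>0. \<forall>\<psi>\<in>mspace (C_metric \<tau>). mdist (C_metric \<tau>) \<phi> \<psi> < r \<longrightarrow> \<psi> \<in> U)"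
proof -
  interpret Metric_space "mspace (C_metric \<tau>)" "mdist (C_metric \<tau>)" ..
  show ?thesis
    unfolding mtopology_of_def openin_mtopology subset_iff in_mball by meson
qed

lemma space_C_borel: "space (C_borel \<tau>) = mspace (C_metric \<tau>)"
  unfolding C_borel_def by (rule space_measure_of) (auto simp: openin_C_iff)

lemma sets_C_borelI: "openin (mtopology_of (C_metric \<tau>)) U \<Longrightarrow> U \<in> sets (C_borel \<tau>)"
  unfolding C_borel_def by (subst sets_measure_of) (auto simp: openin_C_iff)

lemma open_superlevels:
  fixes h :: "'p \<Rightarrow> (real \<Rightarrow> real^'d) \<Rightarrow> real"
  assumes "\<And>p \<phi> \<psi>. p \<in> P \<Longrightarrow> \<phi> \<in> mspace (C_metric \<tau>) \<Longrightarrow> \<psi> \<in> mspace (C_metric \<tau>) \<Longrightarrow>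
     \<bar>h p \<phi> - h p \<psi>\<bar> \<le> L * mdist (C_metric \<tau>) \<phi> \<psi>" "L > 0"
  shows "openin (mtopology_of (C_metric \<tau>)) {\<phi>\<in>mspace (C_metric \<tau>). \<exists>p\<in>P. h p \<phi> > c p}"
  unfolding openin_C_iff
proof (safe, goal_cases)
  case (1 \<phi> p)
  show ?case
  proof (intro exI[of _ "(h p \<phi> - c p) / L"] conjI ballI impI CollectI bexI[of _ p])
    fix \<psi> assume \<psi>: "\<psi> \<in> mspace (C_metric \<tau>)" "mdist (C_metric \<tau>) \<phi> \<psi> < (h p \<phi> - c p) / L"
    then have "\<bar>h p \<phi> - h p \<psi>\<bar> < h p \<phi> - c p"
      using assms(1)[OF 1(2,1) \<psi>(1)] assms(2) by (simp add: field_simps)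
    then show "h p \<psi> > c p" by linarith
  qed (use 1 assms in auto)
qed

text \<open>The index set \<open>P\<close> may be uncountable: the complement is a union of open
  superlevel sets and therefore open. The sup norm and the modulus of continuity of a path are
  treated in this way.\<close>

lemma closed_path_event:
  fixes h :: "'p \<Rightarrow> (real \<Rightarrow> real^'d) \<Rightarrow> real"
  assumes "\<And>p \<phi> \<psi>. p \<in> P \<Longrightarrow> \<phi> \<in> mspace (C_metric \<tau>) \<Longrightarrow> \<psi> \<in> mspace (C_metric \<tau>) \<Longrightarrow>
     \<bar>h p \<phi> - h p \<psi>\<bar> \<le> L * mdist (C_metric \<tau>) \<phi> \<psi>" "L > 0"
  shows "{\<phi>\<in>mspace (C_metric \<tau>). \<forall>p\<in>P. h p \<phi> \<le> c p} \<in> sets (C_borel \<tau>)"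
proof -
  have "space (C_borel \<tau>) - {\<phi>\<in>mspace (C_metric \<tau>). \<exists>p\<in>P. h p \<phi> > c p} \<in> sets (C_borel \<tau>)"
    using open_superlevels[of P \<tau> h L c, OF assms] by (intro sets.compl_sets sets_C_borelI)
  also have "space (C_borel \<tau>) - {\<phi>\<in>mspace (C_metric \<tau>). \<exists>p\<in>P. h p \<phi> > c p}
     = {\<phi>\<in>mspace (C_metric \<tau>). \<forall>p\<in>P. h p \<phi> \<le> c p}"
    by (auto simp: space_C_borel not_less)
  finally show ?thesis .
qed

lemma Lipschitz_path_measurable:
  fixes h :: "(real \<Rightarrow> real^'d) \<Rightarrow> real"
  assumes "\<And>\<phi> \<psi>. \<phi> \<in> mspace (C_metric \<tau>) \<Longrightarrow> \<psi> \<in> mspace (C_metric \<tau>) \<Longrightarrow>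
     \<bar>h \<phi> - h \<psi>\<bar> \<le> L * mdist (C_metric \<tau>) \<phi> \<psi>" "L > 0"
  shows "h \<in> borel_measurable (C_borel \<tau>)"
proof (subst borel_measurable_iff_le, intro allI)
  fix a
  show "{\<phi>\<in>space (C_borel \<tau>). h \<phi> \<le> a} \<in> sets (C_borel \<tau>)"
    using closed_path_event[of "UNIV :: unit set" \<tau> "\<lambda>_. h" L "\<lambda>_. a"] assms by (simp add: space_C_borel)
qed

lemma FM_test_measurable:
  "\<Psi> \<in> FM_test \<tau> \<Longrightarrow> (\<Psi> :: (real \<Rightarrow> real^'d) \<Rightarrow> real) \<in> borel_measurable (C_borel \<tau>)"
  by (rule Lipschitz_path_measurable[of _ _ 1]) (auto simp: FM_test_def)

lemma closure_Rats_interval: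
  fixes a b :: real
  assumes "a < b"
  shows "closure (\<rat> \<inter> {a<..<b}) = {a..b}"
proof -
  have "x \<in> closure \<rat>" for x :: real
  proof (unfold closure_approachable, intro allI impI)
    fix e :: real assume "e > 0"
    then obtain r where "r \<in> \<rat>" "x < r" "r < x + e" using Rats_dense_in_real[of x "x + e"] by auto
    then show "\<exists>y\<in>\<rat>. dist y x < e" by (intro bexI[of _ r]) (auto simp: dist_real_def)
  qed
  then have "closure ({a<..<b} \<inter> \<rat>) = closure {a<..<b}"
    by (intro closure_open_Int_superset) auto
  then show ?thesis using assms by (simp add: Int_commute)
qed

lemma C_ball_rational:
  assumes "\<tau> > 0" "\<phi> \<in> mspace (C_metric \<tau>)" "\<psi> \<in> mspace (C_metric \<tau>)"
    and "\<And>\<theta>. \<theta> \<in> \<rat> \<inter> {-\<tau><..<0} \<Longrightarrow> norm (\<phi> \<theta> - \<psi> \<theta>) \<le> r"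
  shows "mdist (C_metric \<tau>) \<phi> \<psi> \<le> r"
proof (rule mdist_C_leI[OF assms(1-3)])
  fix \<theta> assume \<theta>: "\<theta> \<in> {-\<tau>..0}"
  note cl = closure_Rats_interval[of "-\<tau>" 0]
  have "continuous_on {-\<tau>..0} (\<lambda>\<theta>. norm (\<phi> \<theta> - \<psi> \<theta>))"
    using assms(2,3) unfolding mspace_C_metric by (intro continuous_intros) auto
  then show "norm (\<phi> \<theta> - \<psi> \<theta>) \<le> r"
    using continuous_le_on_closure[of "\<rat> \<inter> {-\<tau><..<0}" "\<lambda>\<theta>. norm (\<phi> \<theta> - \<psi> \<theta>)" \<theta> r] assms(1,4) \<theta>
    by (simp add: cl)
qed

text \<open>Uniform continuity makes the path nearly constant on cells of width
  \<open>1 / k\<close>, and its value at the left end of each cell is rounded to a point of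
  \<open>D\<close>. An approximation is thus coded by a number and a finite list over
  \<open>D\<close>; for countable \<open>D\<close> there are only countably many codes.\<close>

lemma step_approximation:
  fixes \<phi> :: "real \<Rightarrow> real^'d"
  assumes "continuous_on {-\<tau>..0} \<phi>" "\<tau> > 0" "e > 0"
    and D: "\<And>v::real^'d. \<exists>q\<in>D. dist q v < e"
  obtains k :: nat and q where "q \<in> lists D"
    "\<And>\<theta>. \<theta> \<in> {-\<tau><..<0} \<Longrightarrow> norm (\<phi> \<theta> - q ! nat \<lfloor>(\<theta> + \<tau>) * real k\<rfloor>) \<le> 2 * e"
proof -
  have "uniformly_continuous_on {-\<tau>..0} \<phi>"
    using assms by (intro compact_uniformly_continuous) auto
  then obtain d where d: "d > 0" "\<And>s t. s \<in> {-\<tau>..0} \<Longrightarrow> t \<in> {-\<tau>..0} \<Longrightarrow> dist t s < d \<Longrightarrow> dist (\<phi> t) (\<phi> s) < e"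
    unfolding uniformly_continuous_on_def using \<open>e > 0\<close> by blast
  obtain k :: nat where k: "k > 0" "1 / real k < d"
    using d(1) by (metis nat_approx_posE of_nat_Suc zero_less_Suc)
  from D obtain c where c: "\<And>v. c v \<in> D" "\<And>v::real^'d. dist (c v) v < e"
    by metis
  \<comment> \<open>Since \<theta> lies below 0, its cell index is at most the integer part of
    \<open>\<tau> * real k\<close>; one more entry than that covers all cells.\<close>
  define m where "m = nat \<lfloor>\<tau> * real k\<rfloor> + 1"
  define q where "q = map (\<lambda>i. c (\<phi> (real i / real k - \<tau>))) [0..<m]"
  show thesis
  proof (rule that[of q k])
    show "q \<in> lists D" using c(1) by (auto simp: q_def)
    fix \<theta> assume \<theta>: "\<theta> \<in> {-\<tau><..<0}"
    define i where "i = nat \<lfloor>(\<theta> + \<tau>) * real k\<rfloor>"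
    have "(\<theta> + \<tau>) * real k \<le> \<tau> * real k" using \<theta> by (intro mult_right_mono) auto
    then have "i < m" unfolding i_def m_def by (simp add: less_Suc_eq_le nat_mono floor_mono)
    have "0 \<le> (\<theta> + \<tau>) * real k" using \<theta> by auto
    then have "real i \<le> (\<theta> + \<tau>) * real k" "(\<theta> + \<tau>) * real k < real i + 1"
      unfolding i_def by linarith+
    then have i: "real i / real k \<le> \<theta> + \<tau>" "\<theta> + \<tau> < real i / real k + 1 / real k"
      using k(1) by (simp_all add: field_simps)
    then have "dist \<theta> (real i / real k - \<tau>) < d" "real i / real k - \<tau> \<in> {-\<tau>..0}"
      using k(2) \<theta> by (auto simp: dist_real_def)
    then have "dist (\<phi> \<theta>) (\<phi> (real i / real k - \<tau>)) < e"
      using d(2) \<theta> by auto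
    moreover have "dist (c (\<phi> (real i / real k - \<tau>))) (\<phi> (real i / real k - \<tau>)) < e"
      by (rule c(2))
    moreover have "q ! i = c (\<phi> (real i / real k - \<tau>))"
      using \<open>i < m\<close> by (simp add: q_def)
    ultimately show "norm (\<phi> \<theta> - q ! nat \<lfloor>(\<theta> + \<tau>) * real k\<rfloor>) \<le> 2 * e"
      unfolding i_def[symmetric] dist_norm[symmetric]
      using dist_triangle2[of "\<phi> \<theta>" "q ! i" "\<phi> (real i / real k - \<tau>)"] by simp
  qed
qed

text \<open>Every open set is a countable union of sets of paths that stay, at rational times, close to a
  step function with values in a countable dense set.\<close>

lemma measurable_C_borelI:
  fixes Z :: "'w \<Rightarrow> real \<Rightarrow> real^'d"
  assumes "\<tau> > 0" and Z: "\<And>\<omega>. \<omega> \<in> space M \<Longrightarrow> Z \<omega> \<in> mspace (C_metric \<tau>)"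
    and ev: "\<And>\<theta>. \<theta> \<in> {-\<tau>..0} \<Longrightarrow> (\<lambda>\<omega>. Z \<omega> \<theta>) \<in> borel_measurable M"
  shows "Z \<in> measurable M (C_borel \<tau>)"
  unfolding C_borel_def
proof (rule measurable_measure_of)
  show "Z \<in> space M \<rightarrow> mspace (C_metric \<tau>)" using Z by auto
  fix U :: "(real \<Rightarrow> real^'d) set" assume "U \<in> {U. openin (mtopology_of (C_metric \<tau>)) U}"
  then have U: "openin (mtopology_of (C_metric \<tau>)) U" by simp
  obtain D :: "(real^'d) set" where D: "countable D" "\<And>X. open X \<Longrightarrow> X \<noteq> {} \<Longrightarrow> \<exists>d\<in>D. d \<in> X"
    using countable_dense_setE by metis
  have Dd: "\<exists>q\<in>D. dist q v < e" if "e > 0" for e and v :: "real^'d"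
    using D(2)[of "ball v e"] that by (auto simp: dist_commute)
  \<comment> \<open>A tube around a coded step function, tested at rational times only, so that its
    preimage is a countable intersection. \<open>J\<close> keeps the tubes that lie inside
    \<open>U\<close>.\<close>
  define S where "S n k q = {\<phi> :: real \<Rightarrow> real^'d. \<forall>\<theta>\<in>\<rat> \<inter> {-\<tau><..<0}. norm (\<phi> \<theta> - q ! nat \<lfloor>(\<theta> + \<tau>) * real k\<rfloor>) \<le> 2 / real (Suc n)}"
    for n k :: nat and q :: "(real^'d) list"
  define J where "J = {(n, k, q). q \<in> lists D \<and> S n k q \<inter> mspace (C_metric \<tau>) \<subseteq> U}"
  have "J \<subseteq> UNIV \<times> UNIV \<times> lists D" by (auto simp: J_def)
  then have "countable J"
    by (rule countable_subset) (auto intro: countable_lists D)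
  have meas: "{\<omega>\<in>space M. Z \<omega> \<in> S n k q} \<in> sets M" for n k q
  proof -
    have "{\<omega>\<in>space M. Z \<omega> \<in> S n k q} = {\<omega>\<in>space M. \<forall>\<theta>\<in>\<rat> \<inter> {-\<tau><..<0}. norm (Z \<omega> \<theta> - q ! nat \<lfloor>(\<theta> + \<tau>) * real k\<rfloor>) \<le> 2 / real (Suc n)}"
      by (auto simp: S_def)
    also have "\<dots> \<in> sets M"
    proof (rule sets.sets_Collect_countable_All')
      fix \<theta> assume "\<theta> \<in> \<rat> \<inter> {-\<tau><..<0}"
      then have [measurable]: "(\<lambda>\<omega>. Z \<omega> \<theta>) \<in> borel_measurable M" by (intro ev) auto
      show "{\<omega>\<in>space M. norm (Z \<omega> \<theta> - q ! nat \<lfloor>(\<theta> + \<tau>) * real k\<rfloor>) \<le> 2 / real (Suc n)} \<in> sets M"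
        by measurable
    qed (auto intro: countable_Int1 countable_rat)
    finally show ?thesis .
  qed
  have "\<exists>(n,k,q)\<in>J. \<phi> \<in> S n k q" if \<phi>: "\<phi> \<in> U" for \<phi>
  proof -
    have \<phi>C: "\<phi> \<in> mspace (C_metric \<tau>)"
      using U \<phi> by (auto simp: openin_C_iff)
    obtain r where r: "r > 0" "\<And>\<psi>. \<psi> \<in> mspace (C_metric \<tau>) \<Longrightarrow> mdist (C_metric \<tau>) \<phi> \<psi> < r \<Longrightarrow> \<psi> \<in> U"
      using U \<phi> unfolding openin_C_iff by blast
    \<comment> \<open>Two paths in one tube differ by at most twice its radius, that is by
      \<open>4 / real (Suc n)\<close>, which has to be smaller than \<open>r\<close>.\<close>
    obtain n where n: "1 / real (Suc n) < r / 4"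
      using r(1) nat_approx_posE[of "r / 4"] by auto
    obtain k q where kq: "q \<in> lists D"
      "\<And>\<theta>. \<theta> \<in> {-\<tau><..<0} \<Longrightarrow> norm (\<phi> \<theta> - q ! nat \<lfloor>(\<theta> + \<tau>) * real k\<rfloor>) \<le> 2 * (1 / real (Suc n))"
      using step_approximation[of \<tau> \<phi> "1 / real (Suc n)" D] \<phi>C assms(1) Dd
      unfolding mspace_C_metric by (metis (no_types, lifting) mem_Collect_eq of_nat_0_less_iff zero_less_Suc zero_less_divide_1_iff)
    have \<phi>S: "\<phi> \<in> S n k q"
      using kq(2) by (auto simp: S_def)
    have "S n k q \<inter> mspace (C_metric \<tau>) \<subseteq> U"
    proof safe
      fix \<psi> assume \<psi>: "\<psi> \<in> S n k q" "\<psi> \<in> mspace (C_metric \<tau>)"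
      have "mdist (C_metric \<tau>) \<phi> \<psi> \<le> 4 / real (Suc n)"
      proof (rule C_ball_rational[OF assms(1) \<phi>C \<psi>(2)])
        fix \<theta> assume \<theta>: "\<theta> \<in> \<rat> \<inter> {-\<tau><..<0}"
        let ?s = "q ! nat \<lfloor>(\<theta> + \<tau>) * real k\<rfloor>"
        have "norm (\<phi> \<theta> - ?s) \<le> 2 / real (Suc n)" "norm (\<psi> \<theta> - ?s) \<le> 2 / real (Suc n)"
          using \<phi>S \<psi>(1) \<theta> unfolding S_def by blast+
        moreover have "norm (\<phi> \<theta> - \<psi> \<theta>) \<le> norm (\<phi> \<theta> - ?s) + norm (\<psi> \<theta> - ?s)"
          by (metis norm_triangle_ineq4 diff_diff_eq2 diff_add_cancel add_diff_eq)
        ultimately have "norm (\<phi> \<theta> - \<psi> \<theta>) \<le> 2 / real (Suc n) + 2 / real (Suc n)" by linarith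
        then show "norm (\<phi> \<theta> - \<psi> \<theta>) \<le> 4 / real (Suc n)"
          by (simp add: add_divide_distrib[symmetric] del: of_nat_Suc)
      qed
      moreover have "4 / real (Suc n) = 4 * (1 / real (Suc n))" by simp
      ultimately show "\<psi> \<in> U" using n r(2)[OF \<psi>(2)] by linarith
    qed
    then show ?thesis using \<phi>S kq(1) by (auto simp: J_def intro!: bexI[of _ "(n, k, q)"])
  qed
  then have "Z -` U \<inter> space M = (\<Union>(n,k,q)\<in>J. {\<omega>\<in>space M. Z \<omega> \<in> S n k q})"
    using Z by (fastforce simp: J_def)
  also have "\<dots> \<in> sets M"
    using \<open>countable J\<close> meas by (intro sets.countable_UN') auto
  finally show "Z -` U \<inter> space M \<in> sets M" .
qed (auto simp: openin_C_iff)

lemma segment_in_mspace: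
  assumes "continuous_on {t - \<tau>..t} (\<lambda>s. x s \<omega>)"
  shows "segment \<tau> x t \<omega> \<in> mspace (C_metric \<tau>)"
proof -
  have "continuous_on {-\<tau>..0} (\<lambda>\<theta>. x (t + \<theta>) \<omega>)"
    by (rule continuous_on_compose2[OF assms]) (auto intro!: continuous_intros)
  then show ?thesis
    unfolding mspace_C_metric segment_def by (auto cong: continuous_on_cong_simp)
qed

lemma segment_measurable:
  fixes x :: "real \<Rightarrow> 'w \<Rightarrow> real^'d"
  assumes "\<tau> > 0" "\<And>\<omega>. \<omega> \<in> space M \<Longrightarrow> continuous_on {t - \<tau>..t} (\<lambda>s. x s \<omega>)"
    and "\<And>s. s \<in> {t - \<tau>..t} \<Longrightarrow> x s \<in> borel_measurable M"
  shows "segment \<tau> x t \<in> measurable M (C_borel \<tau>)"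
proof (rule measurable_C_borelI[OF assms(1)])
  fix \<theta> assume "\<theta> \<in> {-\<tau>..0}"
  then show "(\<lambda>\<omega>. segment \<tau> x t \<omega> \<theta>) \<in> borel_measurable M"
    using assms(3)[of "t + \<theta>"] by (simp add: segment_def)
qed (intro segment_in_mspace assms)

section \<open>Comparing an invariant measure with a law\<close>

text \<open>The cardinality is the integer part of \<open>y / \<delta>\<close>: the number of steps
  of height \<delta> that fit below \<open>y\<close>, where \<open>m\<close> steps are enough to
  reach \<open>y\<close>. This is the pointwise form of a discrete layer-cake formula.\<close>

lemma staircase:
  fixes y :: real
  assumes "0 < \<delta>" "0 \<le> y" "y \<le> real m * \<delta>"
  shows "\<delta> * real (card {j\<in>{1..m}. real j * \<delta> \<le> y}) \<le> y"
    and "y \<le> \<delta> + \<delta> * real (card {j\<in>{1..m}. real j * \<delta> \<le> y})"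
proof -
  have le: "real j * \<delta> \<le> y \<longleftrightarrow> j \<le> nat \<lfloor>y / \<delta>\<rfloor>" for j
  proof -
    have "real j * \<delta> \<le> y \<longleftrightarrow> real j \<le> y / \<delta>"
      using assms(1) by (simp add: field_simps)
    also have "\<dots> \<longleftrightarrow> int j \<le> \<lfloor>y / \<delta>\<rfloor>" by (metis le_floor_iff of_int_of_nat_eq)
    also have "\<dots> \<longleftrightarrow> j \<le> nat \<lfloor>y / \<delta>\<rfloor>" using assms by (simp add: le_nat_iff)
    finally show ?thesis .
  qed
  have "nat \<lfloor>y / \<delta>\<rfloor> \<le> m"
  proof -
    have "y / \<delta> \<le> real m" using assms by (simp add: field_simps)
    then have "\<lfloor>y / \<delta>\<rfloor> \<le> int m" by linarith
    then show ?thesis by simp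
  qed
  then have "{j\<in>{1..m}. real j * \<delta> \<le> y} = {1..nat \<lfloor>y / \<delta>\<rfloor>}"
    unfolding le by auto
  then have c: "real (card {j\<in>{1..m}. real j * \<delta> \<le> y}) = of_int \<lfloor>y / \<delta>\<rfloor>"
    using assms by simp
  have "of_int \<lfloor>y / \<delta>\<rfloor> \<le> y / \<delta>" "y / \<delta> \<le> of_int \<lfloor>y / \<delta>\<rfloor> + 1" by linarith+
  moreover have "y = \<delta> * (y / \<delta>)" using assms(1) by simp
  ultimately have "\<delta> * of_int \<lfloor>y / \<delta>\<rfloor> \<le> y" "y \<le> \<delta> * (of_int \<lfloor>y / \<delta>\<rfloor> + 1)"
    using assms(1) by (metis less_imp_le mult_left_mono)+
  then show "\<delta> * real (card {j\<in>{1..m}. real j * \<delta> \<le> y}) \<le> y"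
    and "y \<le> \<delta> + \<delta> * real (card {j\<in>{1..m}. real j * \<delta> \<le> y})"
    unfolding c using assms(1) by (simp_all add: distrib_left)
qed

text \<open>A layer-cake argument with finitely many levels, which compares probabilities of
  superlevel sets only. The function shifted by 1 takes values in [0, 2]. Rounding to steps of
  height \<delta> costs \<delta>, the shift of the level by \<delta> moves every step down by one
  and costs another \<delta>, and the defect \<epsilon> is paid once per level with weight
  \<delta>.\<close>

lemma integral_compare:
  fixes f1 :: "'a \<Rightarrow> real" and f2 :: "'b \<Rightarrow> real"
  assumes P1: "prob_space M1" and P2: "prob_space M2"
    and [measurable]: "f1 \<in> borel_measurable M1" "f2 \<in> borel_measurable M2"
    and b: "\<And>x. x \<in> space M1 \<Longrightarrow> \<bar>f1 x\<bar> \<le> 1" "\<And>x. x \<in> space M2 \<Longrightarrow> \<bar>f2 x\<bar> \<le> 1"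
    and \<delta>: "0 < \<delta>" and \<epsilon>: "0 \<le> \<epsilon>"
    and le: "\<And>c. measure M1 {x\<in>space M1. f1 x \<ge> c} \<le> measure M2 {x\<in>space M2. f2 x \<ge> c - \<delta>} + \<epsilon>"
  shows "(\<integral>x. f1 x \<partial>M1) \<le> (\<integral>x. f2 x \<partial>M2) + 2 * \<delta> + (2 + \<delta>) * \<epsilon>"
proof -
  interpret A: prob_space M1 by fact
  interpret B: prob_space M2 by fact
  have i1: "integrable M1 f1" by (rule A.integrable_const_bound[where B = 1]) (use b in auto)
  have i2: "integrable M2 f2" by (rule B.integrable_const_bound[where B = 1]) (use b in auto)
  \<comment> \<open>Enough steps of height \<delta> to cover [0, 2], but with total height at most
    \<open>2 + \<delta>\<close>, which is the factor of \<epsilon> in the bound.\<close>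
  define m where "m = nat \<lceil>2 / \<delta>\<rceil>"
  have m: "2 \<le> real m * \<delta>" "real m * \<delta> \<le> 2 + \<delta>"
  proof -
    have "0 \<le> 2 / \<delta>" using \<delta> by simp
    then have "2 / \<delta> \<le> real m" "real m \<le> 2 / \<delta> + 1" unfolding m_def by linarith+
    then show "2 \<le> real m * \<delta>" "real m * \<delta> \<le> 2 + \<delta>" using \<delta> by (simp_all add: field_simps)
  qed
  have card: "real (card {j\<in>{1..m}. P j}) = (\<Sum>j=1..m. if P j then 1 else 0)" for P
    by (simp add: sum.If_cases Int_def)
  have "(\<integral>x. f1 x \<partial>M1) + 1 = (\<integral>x. f1 x + 1 \<partial>M1)"
    using i1 by (simp add: A.prob_space)
  also have "\<dots> \<le> (\<integral>x. \<delta> + \<delta> * (\<Sum>j=1..m. indicator {x\<in>space M1. f1 x \<ge> real j * \<delta> - 1} x) \<partial>M1)"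
  proof (rule integral_mono)
    fix x assume x: "x \<in> space M1"
    have "f1 x + 1 \<le> \<delta> + \<delta> * real (card {j\<in>{1..m}. real j * \<delta> \<le> f1 x + 1})"
      using b(1)[OF x] m by (intro staircase \<delta>) auto
    also have "real (card {j\<in>{1..m}. real j * \<delta> \<le> f1 x + 1}) = (\<Sum>j=1..m. indicator {x\<in>space M1. f1 x \<ge> real j * \<delta> - 1} x)"
      unfolding card using x by (intro sum.cong) (auto simp: indicator_def)
    finally show "f1 x + 1 \<le> \<delta> + \<delta> * (\<Sum>j=1..m. indicator {x\<in>space M1. f1 x \<ge> real j * \<delta> - 1} x)" .
  qed (use i1 in \<open>auto intro!: Bochner_Integration.integrable_add Bochner_Integration.integrable_sum simp: A.emeasure_eq_measure\<close>)
  also have "\<dots> = \<delta> + \<delta> * (\<Sum>j=1..m. measure M1 {x\<in>space M1. f1 x \<ge> real j * \<delta> - 1})"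
    by (subst Bochner_Integration.integral_add)
      (auto intro!: Bochner_Integration.integrable_sum simp: A.prob_space A.emeasure_eq_measure)
  also have "\<dots> \<le> \<delta> + \<delta> * (\<Sum>j=1..m. measure M2 {x\<in>space M2. f2 x \<ge> real j * \<delta> - 1 - \<delta>} + \<epsilon>)"
    using \<delta> by (intro add_left_mono mult_left_mono sum_mono le) auto
  \<comment> \<open>A level lowered by \<delta> is the previous level, so the sum is re-indexed. The
    new bottom term has probability at most 1 and is the source of the second \<delta>.\<close>
  also have "\<dots> = \<delta> + \<delta> * (\<Sum>j=1..m. measure M2 {x\<in>space M2. f2 x \<ge> real (j - 1) * \<delta> - 1}) + real m * \<delta> * \<epsilon>"
  proof -
    have "real (j - 1) * \<delta> - 1 = real j * \<delta> - 1 - \<delta>" if "j \<in> {1..m}" for j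
      using that by (simp add: of_nat_diff algebra_simps)
    then have "(\<Sum>j=1..m. measure M2 {x\<in>space M2. f2 x \<ge> real (j - 1) * \<delta> - 1}) =
        (\<Sum>j=1..m. measure M2 {x\<in>space M2. f2 x \<ge> real j * \<delta> - 1 - \<delta>})"
      by (intro sum.cong refl) (metis (no_types, lifting))
    then show ?thesis by (simp only: sum.distrib distrib_left sum_constant) simp
  qed
  also have "(\<Sum>j=1..m. measure M2 {x\<in>space M2. f2 x \<ge> real (j - 1) * \<delta> - 1}) = (\<Sum>j<m. measure M2 {x\<in>space M2. f2 x \<ge> real j * \<delta> - 1})"
    by (rule sum.reindex_bij_witness[of _ Suc "\<lambda>j. j - 1"]) auto
  also have "\<dots> \<le> (\<Sum>j\<le>m. measure M2 {x\<in>space M2. f2 x \<ge> real j * \<delta> - 1})"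
    by (intro sum_mono2) auto
  also have "\<dots> = measure M2 {x\<in>space M2. f2 x \<ge> - 1} + (\<Sum>j=1..m. measure M2 {x\<in>space M2. f2 x \<ge> real j * \<delta> - 1})"
    by (simp add: sum.atLeast0_atMost_Suc atMost_atLeast0 sum.atLeast_Suc_atMost)
  also have "measure M2 {x\<in>space M2. f2 x \<ge> - 1} \<le> 1" by simp
  also have "real m * \<delta> * \<epsilon> \<le> (2 + \<delta>) * \<epsilon>" using m \<epsilon> by (intro mult_right_mono)
  also have "\<delta> + \<delta> * (1 + (\<Sum>j=1..m. measure M2 {x\<in>space M2. f2 x \<ge> real j * \<delta> - 1})) + (2 + \<delta>) * \<epsilon> =
     2 * \<delta> + (2 + \<delta>) * \<epsilon> + (\<integral>x. \<delta> * (\<Sum>j=1..m. indicator {x\<in>space M2. f2 x \<ge> real j * \<delta> - 1} x) \<partial>M2)"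
    by (simp add: distrib_left B.emeasure_eq_measure)
  also have "(\<integral>x. \<delta> * (\<Sum>j=1..m. indicator {x\<in>space M2. f2 x \<ge> real j * \<delta> - 1} x) \<partial>M2) \<le> (\<integral>x. f2 x + 1 \<partial>M2)"
  proof (rule integral_mono)
    fix x assume x: "x \<in> space M2"
    have "(\<Sum>j=1..m. indicator {x\<in>space M2. f2 x \<ge> real j * \<delta> - 1} x) = real (card {j\<in>{1..m}. real j * \<delta> \<le> f2 x + 1})"
      unfolding card using x by (intro sum.cong) (auto simp: indicator_def)
    also have "\<delta> * \<dots> \<le> f2 x + 1"
      using b(2)[OF x] m by (intro staircase \<delta>) auto
    finally show "\<delta> * (\<Sum>j=1..m. indicator {x\<in>space M2. f2 x \<ge> real j * \<delta> - 1} x) \<le> f2 x + 1" .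
  qed (use i2 in \<open>auto intro!: Bochner_Integration.integrable_add Bochner_Integration.integrable_sum simp: B.emeasure_eq_measure\<close>)
  also have "(\<integral>x. f2 x + 1 \<partial>M2) = (\<integral>x. f2 x \<partial>M2) + 1"
    using i2 by (simp add: B.prob_space)
  finally show ?thesis using \<delta> by simp
qed

text \<open>The integrand of the invariance equation may be non-measurable in \<open>X\<close>; it is only bounded
  above by a simple function.\<close>

lemma (in prob_space) invariant_le:
  fixes Z :: "(real \<Rightarrow> real^'d) \<Rightarrow> 'a \<Rightarrow> real \<Rightarrow> real^'d"
  assumes \<pi>: "\<pi> \<in> space (prob_algebra (C_borel \<tau>))"
    and inv: "\<And>A. A \<in> sets (C_borel \<tau>) \<Longrightarrow> (\<integral>\<^sup>+ X. emeasure (distr M (C_borel \<tau>) (Z X)) A \<partial>\<pi>) = emeasure \<pi> A"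
    and Z: "\<And>X. X \<in> mspace (C_metric \<tau>) \<Longrightarrow> Z X \<in> measurable M (C_borel \<tau>)"
    and O: "\<xi> \<in> mspace (C_metric \<tau>)"
    and B: "B \<in> sets (C_borel \<tau>)" "measure \<pi> B \<ge> 1 - \<epsilon>\<^sub>1"
    and close: "\<And>X. X \<in> B \<Longrightarrow> prob {\<omega>\<in>space M. mdist (C_metric \<tau>) (Z X \<omega>) (Z \<xi> \<omega>) > \<delta>} \<le> \<epsilon>\<^sub>2"
    and e2: "0 \<le> \<epsilon>\<^sub>2"
    and A: "A \<in> sets (C_borel \<tau>)" "A' \<in> sets (C_borel \<tau>)"
      "\<And>\<phi> \<psi>. \<phi> \<in> A \<Longrightarrow> \<psi> \<in> mspace (C_metric \<tau>) \<Longrightarrow> mdist (C_metric \<tau>) \<phi> \<psi> \<le> \<delta> \<Longrightarrow> \<psi> \<in> A'"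
    and dm: "\<And>X. X \<in> mspace (C_metric \<tau>) \<Longrightarrow> {\<omega>\<in>space M. mdist (C_metric \<tau>) (Z X \<omega>) (Z \<xi> \<omega>) > \<delta>} \<in> events"
  shows "measure \<pi> A \<le> prob {\<omega>\<in>space M. Z \<xi> \<omega> \<in> A'} + \<epsilon>\<^sub>1 + \<epsilon>\<^sub>2"
proof -
  interpret P: prob_space \<pi> using \<pi> by (simp add: space_prob_algebra)
  have sp: "sets \<pi> = sets (C_borel \<tau>)" using \<pi> by (simp add: space_prob_algebra)
  then have sP: "space \<pi> = mspace (C_metric \<tau>)" using space_C_borel sets_eq_imp_space_eq by blast
  have [measurable]: "B \<in> sets \<pi>" using B sp by simp
  let ?p = "prob {\<omega>\<in>space M. Z \<xi> \<omega> \<in> A'}"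
  have mA': "{\<omega>\<in>space M. Z \<xi> \<omega> \<in> A'} \<in> events"
    using measurable_sets[OF Z[OF O] A(2)] by (simp add: vimage_def Int_def conj_commute)
  \<comment> \<open>All \<open>Z X\<close> live on one probability space, so they are coupled by the
    common noise: on \<open>B\<close> the coupling with \<open>Z \<xi>\<close> gives the constant,
    off \<open>B\<close> the trivial bound 1 is used. This majorant is measurable in
    \<open>X\<close> whatever the integrand is.\<close>
  have "emeasure \<pi> A \<le> (\<integral>\<^sup>+ X. ennreal (?p + \<epsilon>\<^sub>2) * indicator B X + indicator (space \<pi> - B) X \<partial>\<pi>)"
    unfolding inv[OF A(1), symmetric]
  proof (rule nn_integral_mono)
    fix X assume X: "X \<in> space \<pi>"
    then have ZX: "Z X \<in> measurable M (C_borel \<tau>)" using Z sP by simp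
    have eq: "emeasure (distr M (C_borel \<tau>) (Z X)) A = prob {\<omega>\<in>space M. Z X \<omega> \<in> A}"
      by (simp add: emeasure_distr[OF ZX A(1)] emeasure_eq_measure vimage_def Int_def conj_commute)
    show "emeasure (distr M (C_borel \<tau>) (Z X)) A \<le> ennreal (?p + \<epsilon>\<^sub>2) * indicator B X + indicator (space \<pi> - B) X"
    proof (cases "X \<in> B")
      case True
      have "prob {\<omega>\<in>space M. Z X \<omega> \<in> A} \<le> prob ({\<omega>\<in>space M. Z \<xi> \<omega> \<in> A'} \<union> {\<omega>\<in>space M. mdist (C_metric \<tau>) (Z X \<omega>) (Z \<xi> \<omega>) > \<delta>})"
      proof (intro finite_measure_mono)
        show "{\<omega>\<in>space M. Z X \<omega> \<in> A} \<subseteq> {\<omega>\<in>space M. Z \<xi> \<omega> \<in> A'} \<union> {\<omega>\<in>space M. mdist (C_metric \<tau>) (Z X \<omega>) (Z \<xi> \<omega>) > \<delta>}"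
          using A(3) measurable_space[OF Z[OF O]] by (auto simp: space_C_borel not_less)
      qed (use mA' dm X sP in auto)
      also have "\<dots> \<le> ?p + prob {\<omega>\<in>space M. mdist (C_metric \<tau>) (Z X \<omega>) (Z \<xi> \<omega>) > \<delta>}"
        using mA' dm X sP by (intro measure_Un_le) auto
      also have "\<dots> \<le> ?p + \<epsilon>\<^sub>2" using close[OF True] by simp
      finally show ?thesis using True X unfolding eq by (simp add: ennreal_leI)
    next
      case False
      then show ?thesis using X unfolding eq by simp
    qed
  qed
  also have "\<dots> = ennreal (?p + \<epsilon>\<^sub>2) * emeasure \<pi> B + emeasure \<pi> (space \<pi> - B)"
    by (subst nn_integral_add) (auto simp: nn_integral_cmult)
  also have "\<dots> \<le> ennreal (?p + \<epsilon>\<^sub>2) + emeasure \<pi> (space \<pi> - B)"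
    using mult_left_mono[OF P.emeasure_le_1[of B], of "ennreal (?p + \<epsilon>\<^sub>2)"] by (intro add_right_mono) simp
  also have "emeasure \<pi> (space \<pi> - B) = ennreal (1 - measure \<pi> B)"
    by (simp add: P.emeasure_eq_measure P.prob_compl)
  also have "\<dots> \<le> ennreal \<epsilon>\<^sub>1" using B(2) by (intro ennreal_leI) simp
  finally have *: "emeasure \<pi> A \<le> ennreal (?p + \<epsilon>\<^sub>2) + ennreal \<epsilon>\<^sub>1" by (simp add: add_left_mono)
  have e1: "0 \<le> \<epsilon>\<^sub>1" using B(2) P.prob_le_1[of B] by linarith
  show ?thesis
    using * e1 e2 by (simp add: P.emeasure_eq_measure ennreal_plus[symmetric] add_ac del: ennreal_plus)
qed

text \<open>A 1-Lipschitz function maps closeness of paths to closeness of values: the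
  \<delta>-neighbourhood of the superlevel set at \<open>c\<close> lies in the one at
  \<open>c - \<delta>\<close>. One inequality suffices, because the class of test functions is
  closed under negation.\<close>

lemma (in prob_space) invariant_FM_test:
  fixes Z :: "(real \<Rightarrow> real^'d) \<Rightarrow> 'a \<Rightarrow> real \<Rightarrow> real^'d"
  assumes \<pi>: "\<pi> \<in> space (prob_algebra (C_borel \<tau>))"
    and inv: "\<And>A. A \<in> sets (C_borel \<tau>) \<Longrightarrow> (\<integral>\<^sup>+ X. emeasure (distr M (C_borel \<tau>) (Z X)) A \<partial>\<pi>) = emeasure \<pi> A"
    and Z: "\<And>X. X \<in> mspace (C_metric \<tau>) \<Longrightarrow> Z X \<in> measurable M (C_borel \<tau>)"
    and O: "\<xi> \<in> mspace (C_metric \<tau>)"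
    and B: "B \<in> sets (C_borel \<tau>)" "measure \<pi> B \<ge> 1 - \<epsilon>\<^sub>1"
    and close: "\<And>X. X \<in> B \<Longrightarrow> prob {\<omega>\<in>space M. mdist (C_metric \<tau>) (Z X \<omega>) (Z \<xi> \<omega>) > \<delta>} \<le> \<epsilon>\<^sub>2"
    and e2: "0 \<le> \<epsilon>\<^sub>2" and \<delta>: "0 < \<delta>"
    and dm: "\<And>X. X \<in> mspace (C_metric \<tau>) \<Longrightarrow> {\<omega>\<in>space M. mdist (C_metric \<tau>) (Z X \<omega>) (Z \<xi> \<omega>) > \<delta>} \<in> events"
    and \<Psi>: "\<Psi> \<in> FM_test \<tau>"
  shows "\<bar>(\<integral>X. \<Psi> X \<partial>\<pi>) - expectation (\<lambda>\<omega>. \<Psi> (Z \<xi> \<omega>))\<bar> \<le> 2 * \<delta> + (2 + \<delta>) * (\<epsilon>\<^sub>1 + \<epsilon>\<^sub>2)"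
proof -
  interpret P: prob_space \<pi> using \<pi> by (simp add: space_prob_algebra)
  have sp: "sets \<pi> = sets (C_borel \<tau>)" using \<pi> by (simp add: space_prob_algebra)
  then have sP: "space \<pi> = mspace (C_metric \<tau>)" using space_C_borel sets_eq_imp_space_eq by blast
  have e1: "0 \<le> \<epsilon>\<^sub>1" using B(2) P.prob_le_1[of B] by linarith
  have *: "(\<integral>X. \<Psi>' X \<partial>\<pi>) \<le> expectation (\<lambda>\<omega>. \<Psi>' (Z \<xi> \<omega>)) + 2 * \<delta> + (2 + \<delta>) * (\<epsilon>\<^sub>1 + \<epsilon>\<^sub>2)"
    if \<Psi>': "\<Psi>' \<in> FM_test \<tau>" for \<Psi>'
  proof (rule integral_compare)
    note mb = FM_test_measurable[OF \<Psi>']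
    have lv: "{X\<in>mspace (C_metric \<tau>). \<Psi>' X \<ge> c} \<in> sets (C_borel \<tau>)" for c
      using borel_measurable_iff_ge[THEN iffD1, OF mb] by (simp add: space_C_borel)
    show "\<Psi>' \<in> borel_measurable \<pi>" using mb sp measurable_cong_sets by blast
    show "(\<lambda>\<omega>. \<Psi>' (Z \<xi> \<omega>)) \<in> borel_measurable M" using mb Z[OF O] by measurable
    show "\<bar>\<Psi>' X\<bar> \<le> 1" if "X \<in> space \<pi>" for X using that \<Psi>' sP by (auto simp: FM_test_def)
    have ZC: "Z \<xi> \<omega> \<in> mspace (C_metric \<tau>)" if "\<omega> \<in> space M" for \<omega>
      using measurable_space[OF Z[OF O] that] by (simp add: space_C_borel)
    then show "\<bar>\<Psi>' (Z \<xi> \<omega>)\<bar> \<le> 1" if "\<omega> \<in> space M" for \<omega> using that \<Psi>' by (auto simp: FM_test_def)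
    fix c
    have "measure \<pi> {X\<in>mspace (C_metric \<tau>). \<Psi>' X \<ge> c} \<le>
      prob {\<omega>\<in>space M. Z \<xi> \<omega> \<in> {X\<in>mspace (C_metric \<tau>). \<Psi>' X \<ge> c - \<delta>}} + \<epsilon>\<^sub>1 + \<epsilon>\<^sub>2"
    proof (rule invariant_le[OF \<pi> inv Z O B close e2 lv lv _ dm])
      fix \<phi> \<psi> assume "\<phi> \<in> {X\<in>mspace (C_metric \<tau>). \<Psi>' X \<ge> c}" "\<psi> \<in> mspace (C_metric \<tau>)" "mdist (C_metric \<tau>) \<phi> \<psi> \<le> \<delta>"
      moreover from this have "\<bar>\<Psi>' \<phi> - \<Psi>' \<psi>\<bar> \<le> mdist (C_metric \<tau>) \<phi> \<psi>"
        using \<Psi>' by (auto simp: FM_test_def)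
      ultimately show "\<psi> \<in> {X\<in>mspace (C_metric \<tau>). \<Psi>' X \<ge> c - \<delta>}" by auto
    qed
    also have "{\<omega>\<in>space M. Z \<xi> \<omega> \<in> {X\<in>mspace (C_metric \<tau>). \<Psi>' X \<ge> c - \<delta>}} = {\<omega>\<in>space M. \<Psi>' (Z \<xi> \<omega>) \<ge> c - \<delta>}"
      using ZC by auto
    finally show "measure \<pi> {X\<in>space \<pi>. \<Psi>' X \<ge> c} \<le> prob {\<omega>\<in>space M. \<Psi>' (Z \<xi> \<omega>) \<ge> c - \<delta>} + (\<epsilon>\<^sub>1 + \<epsilon>\<^sub>2)"
      unfolding sP by simp
  qed (use \<delta> e1 e2 P.prob_space_axioms prob_space_axioms in auto)
  have "(\<lambda>X. - \<Psi> X) \<in> FM_test \<tau>"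
    using \<Psi> by (auto simp: FM_test_def abs_minus_commute)
  from *[OF this] *[OF \<Psi>] show ?thesis by auto
qed

section \<open>A discrete delay inequality\<close>

text \<open>\<open>Q n\<close> is the delayed contribution at step \<open>n\<close>, so \<open>Q (n + N)\<close> is the current one.\<close>

lemma delay_inequality:
  fixes A Q :: "nat \<Rightarrow> real"
  assumes "\<gamma> > 0" "\<Delta> > 0" "c \<ge> 0" and q: "q = 1 + \<gamma> * \<Delta>"
    and A: "\<And>n. A n \<ge> 0" and Q: "\<And>n. Q n \<ge> 0"
    and step: "\<And>n. A (Suc n) \<le> A n + \<Delta> * (c - \<gamma> * A n - q ^ N * Q (n + N) + Q n)"
  shows "A n + \<Delta> * (\<Sum>j<N. Q (n + j)) \<le> (A 0 + q ^ N * \<Delta> * (\<Sum>j<N. Q j)) / q ^ n + q * c / \<gamma>"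
proof -
  have q1: "q \<ge> 1" using assms by simp
  \<comment> \<open>Discrete Lyapunov functional. Besides the weighted value of \<open>A\<close> it
    carries the \<open>N\<close> contributions still waiting to act through the delay; the factor
    \<open>q ^ N\<close> in the hypothesis matches the growth of the weight over one delay, so that
    these contributions cancel from one step to the next.\<close>
  define L where "L n = q ^ n * A n + \<Delta> * (\<Sum>j<N. q ^ (n + j + 1) * Q (n + j))" for n
  have shift: "(\<Sum>j<N. q ^ (Suc n + j + 1) * Q (Suc n + j)) =
     (\<Sum>j<N. q ^ (n + j + 1) * Q (n + j)) + q ^ (n + N + 1) * Q (n + N) - q ^ (n + 1) * Q n" for n
  proof -
    define h where "h j = q ^ (n + j + 1) * Q (n + j)" for j
    have "(\<Sum>j<N. h (Suc j)) + h 0 = (\<Sum>j<N. h j) + h N"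
      using sum.lessThan_Suc_shift[of h N] by simp
    then show ?thesis by (simp add: h_def)
  qed
  have L: "L n \<le> L 0 + q * c / \<gamma> * (q ^ n - 1)" for n
  proof (induction n)
    case (Suc n)
    have "q ^ Suc n * A (Suc n) \<le> q ^ Suc n * (A n + \<Delta> * (c - \<gamma> * A n - q ^ N * Q (n + N) + Q n))"
      using step[of n] q1 by (intro mult_left_mono) auto
    also have "\<dots> = q ^ n * (q * (1 - \<gamma> * \<Delta>)) * A n + \<Delta> * (q ^ Suc n * c - q ^ (n + N + 1) * Q (n + N) + q ^ (n + 1) * Q n)"
      by (simp add: algebra_simps power_add)
    \<comment> \<open>The weight grows no faster than the damping shrinks: the product of the two
      factors is 1 minus a square.\<close>
    also have "q ^ n * (q * (1 - \<gamma> * \<Delta>)) * A n \<le> q ^ n * 1 * A n"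
    proof -
      have "q * (1 - \<gamma> * \<Delta>) = 1 - (\<gamma> * \<Delta>)\<^sup>2" by (simp add: q power2_eq_square algebra_simps)
      then have "q * (1 - \<gamma> * \<Delta>) \<le> 1" by simp
      then show ?thesis using A[of n] q1 by (intro mult_right_mono mult_left_mono) auto
    qed
    finally have "L (Suc n) \<le> L n + \<Delta> * (q ^ Suc n * c)"
      unfolding L_def shift by (simp add: algebra_simps)
    also have "\<dots> \<le> L 0 + q * c / \<gamma> * (q ^ n - 1) + \<Delta> * (q ^ Suc n * c)"
      using Suc.IH by simp
    also have "\<dots> = L 0 + q * c / \<gamma> * (q ^ Suc n - 1)"
      using \<open>\<gamma> > 0\<close> by (simp add: field_simps q)
    finally show ?case .
  qed simp
  have "q ^ n * (A n + \<Delta> * (\<Sum>j<N. Q (n + j))) \<le> L n"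
  proof -
    have "(\<Sum>j<N. q ^ n * Q (n + j)) \<le> (\<Sum>j<N. q ^ (n + j + 1) * Q (n + j))"
      using q1 Q by (intro sum_mono mult_right_mono power_increasing) auto
    then show ?thesis
      unfolding L_def using \<open>\<Delta> > 0\<close> by (simp add: distrib_left sum_distrib_left[symmetric] mult.left_commute[of "q ^ n"] mult_left_mono)
  qed
  also have "\<dots> \<le> L 0 + q * c / \<gamma> * q ^ n"
  proof -
    have "0 \<le> q * c / \<gamma>" using q1 assms by simp
    then show ?thesis using L[of n] by (simp add: right_diff_distrib)
  qed
  also have "L 0 \<le> A 0 + q ^ N * \<Delta> * (\<Sum>j<N. Q j)"
  proof -
    have "(\<Sum>j<N. q ^ (j + 1) * Q j) \<le> (\<Sum>j<N. q ^ N * Q j)"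
      using q1 Q by (intro sum_mono mult_right_mono power_increasing) auto
    then have "\<Delta> * (\<Sum>j<N. q ^ (j + 1) * Q j) \<le> \<Delta> * (\<Sum>j<N. q ^ N * Q j)"
      using \<open>\<Delta> > 0\<close> by (intro mult_left_mono) auto
    moreover have "\<Delta> * (\<Sum>j<N. q ^ N * Q j) = q ^ N * \<Delta> * (\<Sum>j<N. Q j)"
      by (simp add: sum_distrib_left mult_ac)
    ultimately show ?thesis unfolding L_def by simp
  qed
  finally have "(A n + \<Delta> * (\<Sum>j<N. Q (n + j))) * q ^ n \<le>
      (A 0 + q ^ N * \<Delta> * (\<Sum>j<N. Q j)) + q * c / \<gamma> * q ^ n" by (simp add: mult.commute)
  then have "A n + \<Delta> * (\<Sum>j<N. Q (n + j)) \<le> ((A 0 + q ^ N * \<Delta> * (\<Sum>j<N. Q j)) + q * c / \<gamma> * q ^ n) / q ^ n"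
    using q1 by (subst pos_le_divide_eq) auto
  also have "\<dots> = (A 0 + q ^ N * \<Delta> * (\<Sum>j<N. Q j)) / q ^ n + q * c / \<gamma>"
    using q1 by (simp add: add_divide_distrib)
  finally show ?thesis .
qed

text \<open>The delay inequality bounds the mean at step \<open>n\<close> together with the delayed
  terms of the next \<open>N\<close> steps. These are exactly the initial value and the drift that
  the maximal inequality needs on the window from \<open>n\<close> to \<open>n + N\<close>, which is
  one segment long.\<close>

lemma (in prob_space) delay_process:
  fixes X Q :: "nat \<Rightarrow> 'a \<Rightarrow> real"
  assumes "\<gamma> > 0" "\<Delta> > 0" "c \<ge> 0" and q: "q = 1 + \<gamma> * \<Delta>"
    and sub: "\<And>n. subalgebra M (G n)" and mono: "\<And>i n. i \<le> n \<Longrightarrow> sets (G i) \<subseteq> sets (G n)"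
    and X: "\<And>n. X n \<in> borel_measurable (G n)" "\<And>n. integrable M (X n)" "\<And>n \<omega>. X n \<omega> \<ge> 0"
    and Q: "\<And>n. integrable M (Q n)" "\<And>n \<omega>. Q n \<omega> \<ge> 0"
    and step: "\<And>n B. B \<in> sets (G n) \<Longrightarrow> expectation (\<lambda>\<omega>. X (Suc n) \<omega> * indicator B \<omega>) \<le>
       expectation (\<lambda>\<omega>. (X n \<omega> + \<Delta> * (c - \<gamma> * X n \<omega> - q ^ N * Q (n + N) \<omega> + Q n \<omega>)) * indicator B \<omega>)"
    and init: "expectation (X 0) \<le> C\<^sub>0" "\<And>j. j < N \<Longrightarrow> expectation (Q j) \<le> C\<^sub>1"
  shows "\<kappa> * prob {\<omega>\<in>space M. \<exists>j\<le>N. X (n + j) \<omega> \<ge> \<kappa>} \<le>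
     (C\<^sub>0 + q ^ N * (\<Delta> * real N) * C\<^sub>1) / q ^ n + q * c / \<gamma> + c * (\<Delta> * real N)"
proof -
  have q1: "q \<ge> 1" using assms by simp
  have step1: "expectation (X (Suc n)) \<le> expectation (X n) + \<Delta> * (c - \<gamma> * expectation (X n) - q ^ N * expectation (Q (n + N)) + expectation (Q n))" for n
  proof -
    have "space M \<in> sets (G n)"
      using sub[of n] sets.top[of "G n"] by (simp add: subalgebra_def)
    from step[OF this] have "expectation (X (Suc n)) \<le> expectation (\<lambda>\<omega>. X n \<omega> + \<Delta> * (c - \<gamma> * X n \<omega> - q ^ N * Q (n + N) \<omega> + Q n \<omega>))"
      by (simp cong: Bochner_Integration.integral_cong)
    also have "\<dots> = expectation (X n) + \<Delta> * (c - \<gamma> * expectation (X n) - q ^ N * expectation (Q (n + N)) + expectation (Q n))"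
      using X(2) Q(1) by (simp add: prob_space)
    finally show ?thesis .
  qed
  have "expectation (X n) + \<Delta> * (\<Sum>j<N. expectation (Q (n + j))) \<le>
     (expectation (X 0) + q ^ N * \<Delta> * (\<Sum>j<N. expectation (Q j))) / q ^ n + q * c / \<gamma>"
    by (rule delay_inequality[where A = "\<lambda>n. expectation (X n)" and Q = "\<lambda>n. expectation (Q n)", OF assms(1-4)])
      (use step1 X Q in \<open>auto intro!: integral_nonneg_AE\<close>)
  also have "\<dots> \<le> (C\<^sub>0 + q ^ N * \<Delta> * (\<Sum>j<N. C\<^sub>1)) / q ^ n + q * c / \<gamma>"
    using init q1 \<open>\<Delta> > 0\<close> by (intro add_right_mono divide_right_mono add_mono mult_left_mono sum_mono) auto
  finally have *: "expectation (X n) + \<Delta> * (\<Sum>j<N. expectation (Q (n + j))) \<le>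
     (C\<^sub>0 + q ^ N * (\<Delta> * real N) * C\<^sub>1) / q ^ n + q * c / \<gamma>" by (simp add: mult.assoc)
  have "\<kappa> * prob {\<omega>\<in>space M. \<exists>j\<le>N. X (n + j) \<omega> \<ge> \<kappa>} \<le>
     expectation (X (n + 0)) + (\<Sum>j<N. expectation (\<lambda>\<omega>. \<Delta> * (c + Q (n + j) \<omega>)))"
  proof (rule maximal_inequality[where G = "\<lambda>j. G (n + j)"])
    fix j B assume B: "B \<in> sets (G (n + j))"
    have BM: "B \<in> events" using B sub[of "n + j"] by (auto simp: subalgebra_def)
    have "expectation (\<lambda>\<omega>. X (n + Suc j) \<omega> * indicator B \<omega>) \<le>
       expectation (\<lambda>\<omega>. (X (n + j) \<omega> + \<Delta> * (c - \<gamma> * X (n + j) \<omega> - q ^ N * Q (n + j + N) \<omega> + Q (n + j) \<omega>)) * indicator B \<omega>)"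
      using step[OF B] by simp
    \<comment> \<open>The damping terms have already served in the delay inequality and are dropped
      here, because the drift in the maximal inequality has to be nonnegative.\<close>
    also have "\<dots> \<le> expectation (\<lambda>\<omega>. (X (n + j) \<omega> + \<Delta> * (c + Q (n + j) \<omega>)) * indicator B \<omega>)"
    proof (intro integral_mono integrable_real_mult_indicator BM)
      fix \<omega> 
      have "\<Delta> * (c - \<gamma> * X (n + j) \<omega> - q ^ N * Q (n + j + N) \<omega> + Q (n + j) \<omega>) \<le> \<Delta> * (c + Q (n + j) \<omega>)"
      proof -
        have "0 \<le> \<gamma> * X (n + j) \<omega>" "0 \<le> q ^ N * Q (n + j + N) \<omega>"
          using X(3)[of "n + j" \<omega>] Q(2)[of "n + j + N" \<omega>] q1 assms(1) by simp_all
        then show ?thesis using assms(2) by (intro mult_left_mono) linarith+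
      qed
      then show "(X (n + j) \<omega> + \<Delta> * (c - \<gamma> * X (n + j) \<omega> - q ^ N * Q (n + j + N) \<omega> + Q (n + j) \<omega>)) * indicator B \<omega>
         \<le> (X (n + j) \<omega> + \<Delta> * (c + Q (n + j) \<omega>)) * indicator B \<omega>"
        by (intro mult_right_mono) auto
    qed (use X Q in auto)
    finally show "expectation (\<lambda>\<omega>. X (n + Suc j) \<omega> * indicator B \<omega>) \<le>
       expectation (\<lambda>\<omega>. (X (n + j) \<omega> + \<Delta> * (c + Q (n + j) \<omega>)) * indicator B \<omega>)" .
  qed (use sub mono X Q assms(2,3) in auto)
  also have "\<dots> = expectation (X n) + \<Delta> * (\<Sum>j<N. expectation (Q (n + j))) + c * (\<Delta> * real N)"
    using Q(1) by (simp add: prob_space sum.distrib distrib_left sum_distrib_left mult_ac)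
  finally show ?thesis using * by simp
qed

section \<open>Projection onto a ball\<close>

definition ball_proj :: "real \<Rightarrow> 'a::euclidean_space \<Rightarrow> 'a" where
  "ball_proj R x = min (norm x) R *\<^sub>R sgn x"

lemma truncate_eq_ball_proj: "truncate \<Phi> K \<nu> \<Delta> = ball_proj (the_inv_into {1..} \<Phi> (K * \<Delta> powr (-\<nu>)))"
  by (simp add: fun_eq_iff truncate_def ball_proj_def)

lemma norm_ball_proj_le: "0 \<le> R \<Longrightarrow> norm (ball_proj R x) \<le> R"
  by (auto simp: ball_proj_def norm_sgn)

lemma norm_ball_proj_le_norm: "0 \<le> R \<Longrightarrow> norm (ball_proj R x) \<le> norm x"
  by (auto simp: ball_proj_def norm_sgn)

lemma ball_proj_id: "norm x \<le> R \<Longrightarrow> ball_proj R x = x"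
  by (cases "x = 0") (simp_all add: ball_proj_def min_def sgn_div_norm)

text \<open>Radial truncation is the metric projection onto a ball, and metric projections onto
  closed convex sets are nonexpansive. Hence truncation never increases the distance between two
  schemes.\<close>

lemma ball_proj_closest_point:
  assumes "0 \<le> R"
  shows "ball_proj R x = closest_point (cball 0 R) x"
proof (cases "norm x \<le> R")
  case True
  then show ?thesis by (simp add: ball_proj_id closest_point_self)
next
  case False
  then have x: "norm x > R" "x \<noteq> 0" using assms by auto
  have "ball_proj R x = (R / norm x) *\<^sub>R x"
    using x by (simp add: ball_proj_def sgn_div_norm divide_inverse)
  then have "x - ball_proj R x = (1 - R / norm x) *\<^sub>R x" by (simp add: scaleR_diff_left)
  then have "norm (x - ball_proj R x) = (1 - R / norm x) * norm x"
    using x assms by simp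
  then have d: "dist x (ball_proj R x) = norm x - R"
    using x by (simp add: dist_norm left_diff_distrib)
  show ?thesis
  proof (rule closest_point_unique)
    show "\<forall>z\<in>cball 0 R. dist x (ball_proj R x) \<le> dist x z"
      unfolding d
    proof
      fix z :: 'a assume "z \<in> cball 0 R"
      then show "norm x - R \<le> dist x z"
        using norm_triangle_ineq2[of x z] by (simp add: dist_norm)
    qed
  qed (use assms norm_ball_proj_le in auto)
qed

lemma ball_proj_nonexpansive: "0 \<le> R \<Longrightarrow> norm (ball_proj R x - ball_proj R y) \<le> norm (x - y)"
  using closest_point_lipschitz[of "cball 0 R" x y] by (simp add: ball_proj_closest_point dist_norm)

lemma continuous_on_ball_proj: "0 \<le> R \<Longrightarrow> continuous_on S (ball_proj R)"
  by (rule continuous_on_subset[of UNIV])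
    (auto simp: continuous_on_iff dist_norm intro: le_less_trans[OF ball_proj_nonexpansive])

lemma borel_measurable_ball_proj: "0 \<le> R \<Longrightarrow> ball_proj R \<in> borel_measurable borel"
  by (intro borel_measurable_continuous_onI continuous_on_ball_proj)

section \<open>Euler--Maruyama schemes\<close>

lemma borel_measurable_matrix_vector_mult [measurable (raw)]:
  fixes H :: "'a \<Rightarrow> real^'m^'n"
  assumes "H \<in> borel_measurable M" "w \<in> borel_measurable M"
  shows "(\<lambda>\<omega>. H \<omega> *v w \<omega>) \<in> borel_measurable M"
proof (rule borel_measurable_continuous_Pair[OF assms])
  show "continuous_on UNIV (\<lambda>x::(real^'m^'n) \<times> (real^'m). fst x *v snd x)"
    unfolding matrix_vector_mult_def by (intro continuous_intros continuous_on_vec_lambda)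
qed

lemma em_nonpos: "k \<le> 0 \<Longrightarrow> em f g W G \<tau> N \<xi> k \<omega> = G (\<xi> (of_int k * (\<tau> / real N)))"
  by (simp add: em_def em_pre.simps)

lemma em_Suc:
  "em f g W G \<tau> N \<xi> (int (Suc n)) \<omega> =
     (let u = em f g W G \<tau> N \<xi> (int n) \<omega>; v = em f g W G \<tau> N \<xi> (int n - int N) \<omega>
      in G (u + (\<tau> / real N) *\<^sub>R f u v
        + g u v *v (W (real (Suc n) * (\<tau> / real N)) \<omega> - W (real n * (\<tau> / real N)) \<omega>)))"
  unfolding em_def by (subst em_pre.simps) (simp add: Let_def)

context brownian_space
begin

text \<open>Stating adaptedness at time index \<open>n\<close> for every
  \<open>k \<le> int n\<close>, negative ones included, lets a single induction provide the current
  and the delayed value.\<close>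

lemma em_measurable_F:
  fixes f :: "real^'d \<Rightarrow> real^'d \<Rightarrow> real^'d" and g :: "real^'d \<Rightarrow> real^'d \<Rightarrow> real^'m^'d"
  assumes f [measurable]: "(\<lambda>(u, v). f u v) \<in> borel_measurable borel"
    and g [measurable]: "(\<lambda>(u, v). g u v) \<in> borel_measurable borel"
    and G: "G \<in> borel_measurable borel" and "\<tau> \<ge> 0" and "k \<le> int n"
  shows "em f g W G \<tau> N \<xi> k \<in> borel_measurable (F (real n * (\<tau> / real N)))"
  using assms(5)
proof (induction n arbitrary: k)
  case 0
  then have "em f g W G \<tau> N \<xi> k = (\<lambda>\<omega>. G (\<xi> (of_int k * (\<tau> / real N))))"
    by (intro ext em_nonpos) simp
  then show ?case by simp
next
  case (Suc n)
  have mono: "X \<in> borel_measurable (F (real (Suc n) * (\<tau> / real N)))"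
    if "X \<in> borel_measurable (F (real n * (\<tau> / real N)))" for X :: "'w \<Rightarrow> 'z::topological_space"
    by (rule measurable_F_mono[OF that]) (use \<open>\<tau> \<ge> 0\<close> in \<open>auto intro!: mult_right_mono divide_right_mono\<close>)
  show ?case
  proof (cases "k \<le> int n")
    case True
    then show ?thesis by (intro mono Suc.IH)
  next
    case False
    then have k: "k = int (Suc n)" using Suc.prems by simp
    define t where "t = real (Suc n) * (\<tau> / real N)"
    have [measurable]: "em f g W G \<tau> N \<xi> (int n) \<in> borel_measurable (F t)"
      "em f g W G \<tau> N \<xi> (int n - int N) \<in> borel_measurable (F t)"
      unfolding t_def by (intro mono Suc.IH; simp)+
    have [measurable]: "W t \<in> borel_measurable (F t)" "W (real n * (\<tau> / real N)) \<in> borel_measurable (F t)"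
      unfolding t_def by (intro W_F mono; use \<open>\<tau> \<ge> 0\<close> in simp)+
    have fm: "(\<lambda>\<omega>. f (X \<omega>) (Y \<omega>)) \<in> borel_measurable (F t)" and gm: "(\<lambda>\<omega>. g (X \<omega>) (Y \<omega>)) \<in> borel_measurable (F t)"
      if [measurable]: "X \<in> borel_measurable (F t)" "Y \<in> borel_measurable (F t)" for X Y
      using measurable_compose[of "\<lambda>\<omega>. (X \<omega>, Y \<omega>)" "F t" borel, OF _ f]
        measurable_compose[of "\<lambda>\<omega>. (X \<omega>, Y \<omega>)" "F t" borel, OF _ g]
      by (simp_all add: borel_measurable_Pair)
    note [measurable] = fm gm
    have "em f g W G \<tau> N \<xi> k = (\<lambda>\<omega>. G (em f g W G \<tau> N \<xi> (int n) \<omega>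
        + (\<tau> / real N) *\<^sub>R f (em f g W G \<tau> N \<xi> (int n) \<omega>) (em f g W G \<tau> N \<xi> (int n - int N) \<omega>)
        + g (em f g W G \<tau> N \<xi> (int n) \<omega>) (em f g W G \<tau> N \<xi> (int n - int N) \<omega>)
           *v (W t \<omega> - W (real n * (\<tau> / real N)) \<omega>)))"
      unfolding k by (simp only: fun_eq_iff em_Suc Let_def t_def simp_thms)
    also have "\<dots> \<in> borel_measurable (F t)"
      by (rule measurable_compose[OF _ G]) measurable
    finally show ?thesis by (simp add: t_def)
  qed
qed

end

context brownian_space
begin

lemma em_measurable:
  fixes f :: "real^'d \<Rightarrow> real^'d \<Rightarrow> real^'d" and g :: "real^'d \<Rightarrow> real^'d \<Rightarrow> real^'m^'d"
  assumes "(\<lambda>(u, v). f u v) \<in> borel_measurable borel" "(\<lambda>(u, v). g u v) \<in> borel_measurable borel"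
    and "G \<in> borel_measurable borel" and "\<tau> \<ge> 0"
  shows "em f g W G \<tau> N \<xi> k \<in> borel_measurable M"
  by (rule measurable_F_M[OF em_measurable_F[OF assms, of k "nat k"]]) (use \<open>\<tau> \<ge> 0\<close> in auto)

lemma integrable_sq_bounded:
  fixes Z :: "'w \<Rightarrow> 'b::{real_normed_vector, second_countable_topology}"
  assumes "Z \<in> borel_measurable M" "\<And>\<omega>. norm (Z \<omega>) \<le> b"
  shows "integrable M (\<lambda>\<omega>. (norm (Z \<omega>))\<^sup>2)"
proof (rule integrable_const_bound)
  show "AE \<omega> in M. norm ((norm (Z \<omega>))\<^sup>2) \<le> b\<^sup>2"
    using assms(2) by (intro AE_I2) (simp add: power_mono)
qed (use assms(1) in measurable)

lemma norm_em_le: "0 \<le> R \<Longrightarrow> norm (em f g W (ball_proj R) \<tau> N \<xi> k \<omega>) \<le> R"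
  unfolding em_def by (rule norm_ball_proj_le)

lemma borel_measurable_compose2:
  fixes f :: "'x::second_countable_topology \<Rightarrow> 'y::second_countable_topology \<Rightarrow> 'z::topological_space"
  assumes "(\<lambda>(u, v). f u v) \<in> borel_measurable borel" "X \<in> borel_measurable A" "Y \<in> borel_measurable A"
  shows "(\<lambda>\<omega>. f (X \<omega>) (Y \<omega>)) \<in> borel_measurable A"
  using measurable_compose[OF borel_measurable_Pair[OF assms(2,3)] assms(1)] by simp

text \<open>Two schemes with different coefficients are compared; the choice \<open>f' = g' = 0\<close>, \<open>\<xi>' = 0\<close>
  turns the estimate into a moment bound.\<close>

lemma em_pair_estimate:
  fixes f f' :: "real^'d \<Rightarrow> real^'d \<Rightarrow> real^'d" and g g' :: "real^'d \<Rightarrow> real^'d \<Rightarrow> real^'m^'d"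
    and Q :: "real^'d \<Rightarrow> real^'d \<Rightarrow> real"
  assumes "\<tau> > 0" "N > 0" "R \<ge> 0" and \<Delta>: "\<Delta> = \<tau> / real N"
    and f: "(\<lambda>(u, v). f u v) \<in> borel_measurable borel" "(\<lambda>(u, v). f' u v) \<in> borel_measurable borel"
    and g: "(\<lambda>(u, v). g u v) \<in> borel_measurable borel" "(\<lambda>(u, v). g' u v) \<in> borel_measurable borel"
    and bnd: "\<And>u v. norm u \<le> R \<Longrightarrow> norm v \<le> R \<Longrightarrow> norm (f u v) \<le> C \<and> norm (f' u v) \<le> C \<and> norm (g u v) \<le> C \<and> norm (g' u v) \<le> C"
    and Q: "(\<lambda>(u, v). Q u v) \<in> borel_measurable borel"
      "\<And>u v. norm u \<le> R \<Longrightarrow> norm v \<le> R \<Longrightarrow> 0 \<le> Q u v \<and> Q u v \<le> C"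
      "\<And>u v. 0 \<le> Q u v"
    and "\<gamma> > 0" "c \<ge> 0" and q: "q = 1 + \<gamma> * \<Delta>"
    and S: "\<And>k \<omega>. em f' g' W (ball_proj R) \<tau> N \<xi>' k \<omega> \<in> S"
    and drift: "\<And>u u' v v'. norm u \<le> R \<Longrightarrow> norm u' \<le> R \<Longrightarrow> norm v \<le> R \<Longrightarrow> norm v' \<le> R \<Longrightarrow> u' \<in> S \<Longrightarrow> v' \<in> S \<Longrightarrow>
      2 * ((u - u') \<bullet> (f u v - f' u' v')) + (norm (g u v - g' u' v'))\<^sup>2 + \<Delta> * (norm (f u v - f' u' v'))\<^sup>2
        \<le> c - \<gamma> * (norm (u - u'))\<^sup>2 - q ^ N * Q u u' + Q v v'"
    and init: "(norm (ball_proj R (\<xi> 0) - ball_proj R (\<xi>' 0)))\<^sup>2 \<le> C\<^sub>0"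
      "\<And>\<theta>. \<theta> \<in> {-\<tau>..0} \<Longrightarrow> Q (ball_proj R (\<xi> \<theta>)) (ball_proj R (\<xi>' \<theta>)) \<le> C\<^sub>1"
  defines "u \<equiv> em f g W (ball_proj R) \<tau> N \<xi>" and "u' \<equiv> em f' g' W (ball_proj R) \<tau> N \<xi>'"
  shows "\<kappa> * prob {\<omega>\<in>space M. \<exists>j\<le>N. (norm (u (int (n + j)) \<omega> - u' (int (n + j)) \<omega>))\<^sup>2 \<ge> \<kappa>} \<le>
    (C\<^sub>0 + q ^ N * \<tau> * C\<^sub>1) / q ^ n + q * c / \<gamma> + c * \<tau>"
proof -
  have \<Delta>0: "\<Delta> > 0" and \<Delta>N: "\<Delta> * real N = \<tau>" using assms by simp_all
  define X where "X n \<omega> = (norm (u (int n) \<omega> - u' (int n) \<omega>))\<^sup>2" for n \<omega>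
  \<comment> \<open>Evaluated \<open>N\<close> steps back, so that \<open>Y n\<close> is the delayed
    term at step \<open>n\<close> and \<open>Y (n + N)\<close> the current one.\<close>
  define Y where "Y n \<omega> = Q (u (int n - int N) \<omega>) (u' (int n - int N) \<omega>)" for n \<omega>
  have pr: "ball_proj R \<in> borel_measurable (borel :: (real^'d) measure)"
    using \<open>R \<ge> 0\<close> by (rule borel_measurable_ball_proj)
  have uF: "u k \<in> borel_measurable (F (real n * \<Delta>))" "u' k \<in> borel_measurable (F (real n * \<Delta>))" if "k \<le> int n" for k n
    unfolding u_def u'_def \<Delta> using that \<open>\<tau> > 0\<close> by (intro em_measurable_F f g pr; simp)+
  have uM [measurable]: "u k \<in> borel_measurable M" "u' k \<in> borel_measurable M" for k
    unfolding u_def u'_def using \<open>\<tau> > 0\<close> f g pr by (auto intro!: em_measurable)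
  have uR: "norm (u k \<omega>) \<le> R" "norm (u' k \<omega>) \<le> R" for k \<omega>
    unfolding u_def u'_def using \<open>R \<ge> 0\<close> by (auto intro: norm_em_le)
  have XM: "integrable M (X n)" for n
    unfolding X_def
  proof (rule integrable_sq_bounded)
    show "norm (u (int n) \<omega> - u' (int n) \<omega>) \<le> 2 * R" for \<omega>
      using norm_triangle_ineq4[of "u (int n) \<omega>" "u' (int n) \<omega>"] uR[of "int n" \<omega>] by linarith
  qed measurable
  have YM: "integrable M (Y n)" for n
  proof (rule integrable_const_bound[where B = C])
    show "AE \<omega> in M. norm (Y n \<omega>) \<le> C"
      using Q(2) uR by (auto intro!: AE_I2 simp: Y_def)
    show "Y n \<in> borel_measurable M"
      unfolding Y_def by (rule borel_measurable_compose2[OF Q(1) uM])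
  qed
  have "\<kappa> * prob {\<omega>\<in>space M. \<exists>j\<le>N. X (n + j) \<omega> \<ge> \<kappa>} \<le>
    (C\<^sub>0 + q ^ N * (\<Delta> * real N) * C\<^sub>1) / q ^ n + q * c / \<gamma> + c * (\<Delta> * real N)"
  proof (rule delay_process[where G = "\<lambda>n. F (real n * \<Delta>)" and X = X and Q = Y])
    show "X n \<in> borel_measurable (F (real n * \<Delta>))" for n
      unfolding X_def using uF[of "int n" n] by measurable
    show "expectation (X 0) \<le> C\<^sub>0"
    proof -
      have "X 0 = (\<lambda>\<omega>. (norm (ball_proj R (\<xi> 0) - ball_proj R (\<xi>' 0)))\<^sup>2)"
        by (simp add: fun_eq_iff X_def u_def u'_def em_nonpos)
      then show ?thesis using init(1) by (simp add: prob_space)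
    qed
    show "expectation (Y j) \<le> C\<^sub>1" if "j < N" for j
    proof -
      define \<theta> where "\<theta> = of_int (int j - int N) * (\<tau> / real N)"
      have "\<theta> \<in> {-\<tau>..0}"
      proof -
        have "\<theta> = (real j / real N - 1) * \<tau>" using \<open>N > 0\<close> by (simp add: \<theta>_def field_simps)
        moreover have "real j / real N \<le> 1" "0 \<le> real j / real N" using that by simp_all
        moreover have "- 1 * \<tau> \<le> (real j / real N - 1) * \<tau>" "(real j / real N - 1) * \<tau> \<le> 0 * \<tau>"
          using calculation(2,3) \<open>\<tau> > 0\<close> by (intro mult_right_mono; simp)+
        ultimately show ?thesis by simp
      qed
      moreover have "Y j = (\<lambda>\<omega>. Q (ball_proj R (\<xi> \<theta>)) (ball_proj R (\<xi>' \<theta>)))"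
        using that by (simp add: fun_eq_iff Y_def u_def u'_def em_nonpos \<theta>_def)
      ultimately show ?thesis using init(2)[of \<theta>] by (simp add: prob_space)
    qed
    show "sets (F (real i * \<Delta>)) \<subseteq> sets (F (real n * \<Delta>))" if "i \<le> n" for i n
      using that \<Delta>0 by (intro sets_F_mono mult_right_mono) auto
    show "subalgebra M (F (real n * \<Delta>))" for n
      using \<Delta>0 by (intro subalgebra_F) simp
  next
    fix n B assume B: "B \<in> sets (F (real n * \<Delta>))"
    have B': "B \<in> events" using B \<Delta>0 sets_F_events[of "real n * \<Delta>"] by simp
    define e where "e \<omega> = u (int n) \<omega> - u' (int n) \<omega>" for \<omega>
    define df where "df \<omega> = f (u (int n) \<omega>) (u (int n - int N) \<omega>) - f' (u' (int n) \<omega>) (u' (int n - int N) \<omega>)" for \<omega>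
    define dg where "dg \<omega> = g (u (int n) \<omega>) (u (int n - int N) \<omega>) - g' (u' (int n) \<omega>) (u' (int n - int N) \<omega>)" for \<omega>
    define s where "s = real n * \<Delta>"
    define t where "t = real (Suc n) * \<Delta>"
    have st: "0 \<le> s" "s < t" "t - s = \<Delta>" using \<Delta>0 by (simp_all add: s_def t_def algebra_simps)
    have eF: "e \<in> borel_measurable (F s)" "df \<in> borel_measurable (F s)" "dg \<in> borel_measurable (F s)"
      unfolding e_def[abs_def] df_def[abs_def] dg_def[abs_def] s_def
      by (intro borel_measurable_diff borel_measurable_compose2[OF f(1)] borel_measurable_compose2[OF f(2)]
        borel_measurable_compose2[OF g(1)] borel_measurable_compose2[OF g(2)] uF; simp)+
    then have eM [measurable]: "e \<in> borel_measurable M" "df \<in> borel_measurable M" "dg \<in> borel_measurable M"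
      using measurable_F_M st(1) by blast+
    have eb: "norm (e \<omega>) \<le> 2 * R" for \<omega>
      using norm_triangle_ineq4[of "u (int n) \<omega>" "u' (int n) \<omega>"] uR[of "int n" \<omega>] unfolding e_def by linarith
    have dfb: "norm (df \<omega>) \<le> 2 * C" for \<omega>
      using bnd[OF uR(1)[of "int n" \<omega>] uR(1)[of "int n - int N" \<omega>]] bnd[OF uR(2)[of "int n" \<omega>] uR(2)[of "int n - int N" \<omega>]]
        norm_triangle_ineq4[of "f (u (int n) \<omega>) (u (int n - int N) \<omega>)" "f' (u' (int n) \<omega>) (u' (int n - int N) \<omega>)"]
      unfolding df_def by linarith
    have dgb: "norm (dg \<omega>) \<le> 2 * C" for \<omega>
      using bnd[OF uR(1)[of "int n" \<omega>] uR(1)[of "int n - int N" \<omega>]] bnd[OF uR(2)[of "int n" \<omega>] uR(2)[of "int n - int N" \<omega>]]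
        norm_triangle_ineq4[of "g (u (int n) \<omega>) (u (int n - int N) \<omega>)" "g' (u' (int n) \<omega>) (u' (int n - int N) \<omega>)"]
      unfolding dg_def by linarith
    have i1: "integrable M (\<lambda>\<omega>. (norm (e \<omega> + \<Delta> *\<^sub>R df \<omega>))\<^sup>2)"
    proof (rule integrable_sq_bounded)
      show "norm (e \<omega> + \<Delta> *\<^sub>R df \<omega>) \<le> 2 * R + \<Delta> * (2 * C)" for \<omega>
        using eb[of \<omega>] dfb[of \<omega>] \<Delta>0 by (intro norm_triangle_le add_mono) (auto intro: mult_left_mono)
    qed measurable
    have i2: "integrable M (\<lambda>\<omega>. (norm (dg \<omega>))\<^sup>2)"
      by (rule integrable_sq_bounded[OF _ dgb]) measurable
    have a: "(\<lambda>\<omega>. e \<omega> + \<Delta> *\<^sub>R df \<omega>) \<in> borel_measurable (F s)"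
      using eF by simp
    \<comment> \<open>The outer truncation of both schemes is removed by nonexpansiveness. What
      remains is a part known at time \<open>s\<close> plus a matrix applied to the increment, the
      form required by the one-step isometry.\<close>
    have "expectation (\<lambda>\<omega>. X (Suc n) \<omega> * indicator B \<omega>) \<le>
      expectation (\<lambda>\<omega>. (norm ((e \<omega> + \<Delta> *\<^sub>R df \<omega>) + dg \<omega> *v (W t \<omega> - W s \<omega>)))\<^sup>2 * indicator B \<omega>)"
    proof (intro integral_mono integrable_real_mult_indicator B' XM increment_L2(1)[OF st(1,2) a i1 eF(3) i2] mult_right_mono)
      fix \<omega>
      have "u (int (Suc n)) \<omega> = ball_proj R (u (int n) \<omega> + \<Delta> *\<^sub>R f (u (int n) \<omega>) (u (int n - int N) \<omega>)
          + g (u (int n) \<omega>) (u (int n - int N) \<omega>) *v (W t \<omega> - W s \<omega>))"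
        "u' (int (Suc n)) \<omega> = ball_proj R (u' (int n) \<omega> + \<Delta> *\<^sub>R f' (u' (int n) \<omega>) (u' (int n - int N) \<omega>)
          + g' (u' (int n) \<omega>) (u' (int n - int N) \<omega>) *v (W t \<omega> - W s \<omega>))"
        unfolding u_def u'_def em_Suc Let_def s_def t_def \<Delta> by simp_all
      then have "norm (u (int (Suc n)) \<omega> - u' (int (Suc n)) \<omega>) \<le>
        norm ((u (int n) \<omega> + \<Delta> *\<^sub>R f (u (int n) \<omega>) (u (int n - int N) \<omega>)
          + g (u (int n) \<omega>) (u (int n - int N) \<omega>) *v (W t \<omega> - W s \<omega>)) - 
          (u' (int n) \<omega> + \<Delta> *\<^sub>R f' (u' (int n) \<omega>) (u' (int n - int N) \<omega>)
          + g' (u' (int n) \<omega>) (u' (int n - int N) \<omega>) *v (W t \<omega> - W s \<omega>)))"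
        using ball_proj_nonexpansive[OF \<open>R \<ge> 0\<close>] by metis
      also have "\<dots> = norm ((e \<omega> + \<Delta> *\<^sub>R df \<omega>) + dg \<omega> *v (W t \<omega> - W s \<omega>))"
        by (simp add: e_def df_def dg_def matrix_vector_mult_diff_rdistrib scaleR_diff_right algebra_simps)
      finally show "X (Suc n) \<omega> \<le> (norm ((e \<omega> + \<Delta> *\<^sub>R df \<omega>) + dg \<omega> *v (W t \<omega> - W s \<omega>)))\<^sup>2"
        unfolding X_def by (intro power_mono) auto
    qed auto
    also have "\<dots> = expectation (\<lambda>\<omega>. ((norm (e \<omega> + \<Delta> *\<^sub>R df \<omega>))\<^sup>2 + (t - s) * (norm (dg \<omega>))\<^sup>2) * indicator B \<omega>)"
      using B unfolding s_def[symmetric] by (rule increment_L2_set[OF st(1,2) a i1 eF(3) i2])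
    also have "\<dots> \<le> expectation (\<lambda>\<omega>. (X n \<omega> + \<Delta> * (c - \<gamma> * X n \<omega> - q ^ N * Y (n + N) \<omega> + Y n \<omega>)) * indicator B \<omega>)"
    proof (intro integral_mono integrable_real_mult_indicator B' mult_right_mono)
      fix \<omega>
      have "(norm (e \<omega> + \<Delta> *\<^sub>R df \<omega>))\<^sup>2 = (norm (e \<omega>))\<^sup>2 + 2 * \<Delta> * (e \<omega> \<bullet> df \<omega>) + \<Delta>\<^sup>2 * (norm (df \<omega>))\<^sup>2"
        unfolding power2_norm_eq_inner
        by (simp add: inner_add_left inner_add_right inner_commute power2_eq_square algebra_simps)
      then have "(norm (e \<omega> + \<Delta> *\<^sub>R df \<omega>))\<^sup>2 + (t - s) * (norm (dg \<omega>))\<^sup>2 =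
        X n \<omega> + \<Delta> * (2 * (e \<omega> \<bullet> df \<omega>) + (norm (dg \<omega>))\<^sup>2 + \<Delta> * (norm (df \<omega>))\<^sup>2)"
        unfolding st(3) X_def e_def by (simp add: power2_eq_square algebra_simps)
      \<comment> \<open>The drift hypothesis concerns only values of the second scheme in
        \<open>S\<close>, and by assumption that scheme never leaves \<open>S\<close>.\<close>
      also have "2 * (e \<omega> \<bullet> df \<omega>) + (norm (dg \<omega>))\<^sup>2 + \<Delta> * (norm (df \<omega>))\<^sup>2 \<le> c - \<gamma> * X n \<omega> - q ^ N * Y (n + N) \<omega> + Y n \<omega>"
        using drift[of "u (int n) \<omega>" "u' (int n) \<omega>" "u (int n - int N) \<omega>" "u' (int n - int N) \<omega>", OF uR(1) uR(2) uR(1) uR(2)] S[folded u'_def]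
        by (simp add: X_def Y_def e_def df_def dg_def)
      finally show "(norm (e \<omega> + \<Delta> *\<^sub>R df \<omega>))\<^sup>2 + (t - s) * (norm (dg \<omega>))\<^sup>2 \<le>
        X n \<omega> + \<Delta> * (c - \<gamma> * X n \<omega> - q ^ N * Y (n + N) \<omega> + Y n \<omega>)"
        using \<Delta>0 by simp
    qed (use i1 i2 XM YM in auto)
    finally show "expectation (\<lambda>\<omega>. X (Suc n) \<omega> * indicator B \<omega>) \<le>
      expectation (\<lambda>\<omega>. (X n \<omega> + \<Delta> * (c - \<gamma> * X n \<omega> - q ^ N * Y (n + N) \<omega> + Y n \<omega>)) * indicator B \<omega>)" .
  qed (use \<open>\<gamma> > 0\<close> \<open>c \<ge> 0\<close> q \<Delta>0 XM YM Q(3) in \<open>auto simp: X_def Y_def\<close>)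
  then show ?thesis by (simp add: X_def \<Delta>N)
qed

end

section \<open>Interpolated segments\<close>

lemma em_interp_nonpos: "t \<le> 0 \<Longrightarrow> em_interp f g W G \<tau> N \<xi> t \<omega> = G (\<xi> t)"
  by (simp add: em_interp_def)

text \<open>On closed cells the formula also covers grid points, where the integer part selects the
  next cell: both formulas then give the common grid value. At \<open>t = 0\<close> the first branch
  of the interpolation yields the same value. The overlap at the ends is what allows cells to be
  glued.\<close>

lemma em_interp_cell:
  assumes "\<tau> > 0" "N > 0" "real j * (\<tau> / real N) \<le> t" "t \<le> real (Suc j) * (\<tau> / real N)"
  shows "em_interp f g W G \<tau> N \<xi> t \<omega> =
    (1 - (t / (\<tau> / real N) - real j)) *\<^sub>R em f g W G \<tau> N \<xi> (int j) \<omega> +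
    (t / (\<tau> / real N) - real j) *\<^sub>R em f g W G \<tau> N \<xi> (int (Suc j)) \<omega>"
proof -
  define \<Delta> where "\<Delta> = \<tau> / real N"
  have \<Delta>0: "\<Delta> > 0" using assms by (simp add: \<Delta>_def)
  have j: "real j \<le> t / \<Delta>" "t / \<Delta> \<le> real j + 1"
    using assms(3,4) \<Delta>0 unfolding \<Delta>_def[symmetric] by (simp_all add: field_simps)
  show ?thesis
  proof (cases "t \<le> 0")
    case True
    then have "t = 0 \<and> j = 0"
      using assms(3) \<Delta>0 unfolding \<Delta>_def[symmetric] by (metis divide_le_0_iff j(1) le_zero_eq of_nat_0_le_iff of_nat_le_0_iff order.trans antisym mult_nonneg_nonneg less_imp_le)
    then show ?thesis by (simp add: em_interp_nonpos em_nonpos)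
  next
    case False
    define k where "k = \<lfloor>t / \<Delta>\<rfloor>"
    have e: "em_interp f g W G \<tau> N \<xi> t \<omega> =
      (of_int k + 1 - t / \<Delta>) *\<^sub>R em f g W G \<tau> N \<xi> k \<omega> + (t / \<Delta> - of_int k) *\<^sub>R em f g W G \<tau> N \<xi> (k + 1) \<omega>"
      using False \<Delta>0 unfolding em_interp_def Let_def \<Delta>_def[symmetric] k_def[symmetric]
      by (simp add: diff_divide_distrib)
    show ?thesis
    proof (cases "t / \<Delta> = real j + 1")
      case True
      then have "k = int (Suc j)" unfolding k_def by (metis floor_of_nat of_nat_Suc add.commute)
      then show ?thesis using True unfolding e \<Delta>_def[symmetric] by simp
    next
      case False
      then have "k = int j" unfolding k_def using j by (intro floor_unique) auto
      then show ?thesis unfolding e \<Delta>_def[symmetric] by (simp add: add.commute algebra_simps)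
    qed
  qed
qed

text \<open>The right end \<open>real n * (\<tau> / real N)\<close> is assigned to the last cell,
  whence the minimum with \<open>n - 1\<close> and the exception \<open>k = n\<close>.\<close>

lemma grid_cell:
  assumes "\<tau> > 0" "N > 0" "0 \<le> t" "t \<le> real n * (\<tau> / real N)" "n > 0"
  obtains j where "j < n" "real j * (\<tau> / real N) \<le> t" "t \<le> real (Suc j) * (\<tau> / real N)"
    "\<And>k. k \<le> n \<Longrightarrow> real k * (\<tau> / real N) \<le> t \<Longrightarrow> k \<le> j \<or> k = n"
proof -
  define \<Delta> where "\<Delta> = \<tau> / real N"
  have \<Delta>0: "\<Delta> > 0" using assms by (simp add: \<Delta>_def)
  define j where "j = min (nat \<lfloor>t / \<Delta>\<rfloor>) (n - 1)"
  have t: "0 \<le> t / \<Delta>" "t / \<Delta> \<le> real n"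
    using assms(3,4) \<Delta>0 unfolding \<Delta>_def[symmetric] by (simp_all add: field_simps)
  have 1: "j < n" using assms(5) by (simp add: j_def)
  have "real j \<le> t / \<Delta>" unfolding j_def using t(1) by linarith
  then have 2: "real j * \<Delta> \<le> t" using \<Delta>0 by (simp add: field_simps)
  have "t / \<Delta> \<le> real (Suc j)"
  proof (cases "nat \<lfloor>t / \<Delta>\<rfloor> \<le> n - 1")
    case True then show ?thesis using t unfolding j_def by simp linarith
  next
    case False then have "Suc j = n" using assms(5) by (simp add: j_def)
    then show ?thesis using t by simp
  qed
  then have 3: "t \<le> real (Suc j) * \<Delta>" using \<Delta>0 by (simp add: field_simps)
  have 4: "k \<le> j \<or> k = n" if "k \<le> n" "real k * \<Delta> \<le> t" for k
  proof -
    have "real k \<le> t / \<Delta>" using that(2) \<Delta>0 by (simp add: field_simps)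
    then have "int k \<le> \<lfloor>t / \<Delta>\<rfloor>" by linarith
    then show ?thesis using that(1) unfolding j_def by auto
  qed
  show thesis using that 1 2 3 4 unfolding \<Delta>_def by blast
qed

text \<open>The quantifier over the initial path stands inside the existential: indices and weight
  depend on the time only. Two interpolated schemes can therefore be subtracted with the same convex
  weights, and the grid times are close enough to \<open>t\<close> for a comparison by the modulus
  of continuity.\<close>

lemma em_interp_window:
  assumes "\<tau> > 0" "N > 0" "t \<in> {real n * (\<tau> / real N)..real (n + N) * (\<tau> / real N)}"
  shows "\<exists>i j a. i \<le> N \<and> j \<le> N \<and> 0 \<le> a \<and> a \<le> 1 \<and>
    \<bar>t - real (n + i) * (\<tau> / real N)\<bar> \<le> \<tau> / real N \<and> \<bar>t - real (n + j) * (\<tau> / real N)\<bar> \<le> \<tau> / real N \<and>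
    (\<forall>\<xi>. em_interp f g W G \<tau> N \<xi> t \<omega> =
       (1 - a) *\<^sub>R em f g W G \<tau> N \<xi> (int (n + i)) \<omega> + a *\<^sub>R em f g W G \<tau> N \<xi> (int (n + j)) \<omega>)"
proof -
  define \<Delta> where "\<Delta> = \<tau> / real N"
  have \<Delta>0: "\<Delta> > 0" using assms by (simp add: \<Delta>_def)
  have tn: "real n * \<Delta> \<le> t" "t \<le> real (n + N) * \<Delta>" using assms(3) by (auto simp: \<Delta>_def)
  have "0 \<le> t" using tn(1) \<Delta>0 by (metis mult_nonneg_nonneg of_nat_0_le_iff order.trans less_imp_le)
  then obtain l where l: "l < n + N" "real l * \<Delta> \<le> t" "t \<le> real (Suc l) * \<Delta>"
    "\<And>k. k \<le> n + N \<Longrightarrow> real k * \<Delta> \<le> t \<Longrightarrow> k \<le> l \<or> k = n + N"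
    using grid_cell[of \<tau> N t "n + N"] assms tn unfolding \<Delta>_def by auto
  have "n \<le> l" using l(4)[of n] tn assms(2) by auto
  then obtain i where i: "l = n + i" using le_iff_add by blast
  define a where "a = t / \<Delta> - real l"
  have a: "0 \<le> a" "a \<le> 1" using l(2,3) \<Delta>0 by (simp_all add: a_def field_simps)
  have d: "\<bar>t - real (n + i) * \<Delta>\<bar> \<le> \<Delta>" "\<bar>t - real (n + Suc i) * \<Delta>\<bar> \<le> \<Delta>"
    using l(2,3) unfolding i by (auto simp: algebra_simps)
  show ?thesis
    by (intro exI[of _ i] exI[of _ "Suc i"] exI[of _ a] conjI allI)
      (use a d l(1) i em_interp_cell[OF assms(1,2) l(2,3)[unfolded \<Delta>_def]] in \<open>auto simp: a_def \<Delta>_def\<close>)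
qed

lemma norm_convex_comb_le:
  fixes x y :: "'a::real_normed_vector"
  assumes "0 \<le> a" "a \<le> 1" "norm x \<le> r" "norm y \<le> r"
  shows "norm ((1 - a) *\<^sub>R x + a *\<^sub>R y) \<le> r"
proof -
  have "norm ((1 - a) *\<^sub>R x + a *\<^sub>R y) \<le> (1 - a) * norm x + a * norm y"
    using assms by (intro norm_triangle_le add_mono) auto
  also have "\<dots> \<le> (1 - a) * r + a * r"
    using assms by (intro add_mono mult_left_mono) auto
  finally show ?thesis by (simp add: algebra_simps)
qed

lemma em_interp_continuous:
  assumes "\<tau> > 0" "N > 0" "continuous_on {-\<tau>..0} \<xi>" "continuous_on UNIV G"
  shows "continuous_on {-\<tau>..real n * (\<tau> / real N)} (\<lambda>t. em_interp f g W G \<tau> N \<xi> t \<omega>)"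
proof (induction n)
  case 0
  have "continuous_on {-\<tau>..0} (\<lambda>t. G (\<xi> t))"
    using assms(3,4) continuous_on_compose2[of UNIV G] by blast
  then have "continuous_on {-\<tau>..0} (\<lambda>t. em_interp f g W G \<tau> N \<xi> t \<omega>)"
    by (subst continuous_on_cong[OF refl em_interp_nonpos]) auto
  then show ?case by simp
next
  case (Suc n)
  let ?a = "real n * (\<tau> / real N)" and ?b = "real (Suc n) * (\<tau> / real N)"
  have le: "0 \<le> ?a" "?a \<le> ?b" using assms by (auto intro!: divide_right_mono mult_right_mono)
  have "\<tau> \<noteq> 0" using assms(1) by simp
  have "continuous_on {?a..?b} (\<lambda>t. em_interp f g W G \<tau> N \<xi> t \<omega>)"
    by (subst continuous_on_cong[OF refl em_interp_cell[OF assms(1,2), where j = n]])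
      (use \<open>\<tau> \<noteq> 0\<close> assms(2) in \<open>auto intro!: continuous_intros\<close>)
  then have "continuous_on ({-\<tau>..?a} \<union> {?a..?b}) (\<lambda>t. em_interp f g W G \<tau> N \<xi> t \<omega>)"
    by (intro continuous_on_closed_Un Suc.IH) auto
  also have "{-\<tau>..?a} \<union> {?a..?b} = {-\<tau>..?b}"
    using le assms(1) order_trans[of "- \<tau>" 0 ?a] by (intro ivl_disj_un_two_touch) linarith+
  finally show ?case .
qed

lemma (in brownian_space) em_segment_measurable:
  fixes f :: "real^'d \<Rightarrow> real^'d \<Rightarrow> real^'d" and g :: "real^'d \<Rightarrow> real^'d \<Rightarrow> real^'m^'d"
  assumes "\<tau> > 0" "N > 0" "R \<ge> 0" "\<xi> \<in> mspace (C_metric \<tau>)"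
    and fg: "(\<lambda>(u, v). f u v) \<in> borel_measurable borel" "(\<lambda>(u, v). g u v) \<in> borel_measurable borel"
  shows "segment \<tau> (em_interp f g W (ball_proj R) \<tau> N \<xi>) (real k * (\<tau> / real N)) \<in> measurable M (C_borel \<tau>)"
proof (rule segment_measurable[OF assms(1)])
  let ?t = "real k * (\<tau> / real N)"
  have t0: "?t \<ge> 0" using assms by simp
  have "continuous_on {-\<tau>..?t} (\<lambda>s. em_interp f g W (ball_proj R) \<tau> N \<xi> s \<omega>)" for \<omega>
    using assms by (intro em_interp_continuous continuous_on_ball_proj) (auto simp: mspace_C_metric)
  then show "continuous_on {?t - \<tau>..?t} (\<lambda>s. em_interp f g W (ball_proj R) \<tau> N \<xi> s \<omega>)" for \<omega>
    by (rule continuous_on_subset) (use t0 in auto)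
  fix s assume s: "s \<in> {?t - \<tau>..?t}"
  have m: "em f g W (ball_proj R) \<tau> N \<xi> i \<in> borel_measurable M" for i
    using assms by (intro em_measurable borel_measurable_ball_proj fg) auto
  show "em_interp f g W (ball_proj R) \<tau> N \<xi> s \<in> borel_measurable M"
    unfolding em_interp_def[abs_def] Let_def using m by (cases "s \<le> 0") simp_all
qed

section \<open>Estimates for the truncated scheme, uniform in the step size\<close>

text \<open>The strict gap at rate 0 persists for small rates by continuity. It is stated for every
  rate below \<open>\<gamma>\<^sub>0\<close>, so that several gaps can be served by one rate, the
  minimum.\<close>

lemma exists_rate:
  fixes x\<^sub>1 x\<^sub>2 \<tau> :: real
  assumes "x\<^sub>2 < x\<^sub>1" "0 \<le> x\<^sub>2" "\<tau> > 0"
  obtains \<gamma>\<^sub>0 where "\<gamma>\<^sub>0 > 0" "\<And>\<gamma>. 0 < \<gamma> \<Longrightarrow> \<gamma> \<le> \<gamma>\<^sub>0 \<Longrightarrow> \<gamma> + exp (\<gamma> * \<tau>) * x\<^sub>2 \<le> x\<^sub>1"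
proof -
  have "((\<lambda>\<gamma>. \<gamma> + exp (\<gamma> * \<tau>) * x\<^sub>2) \<longlongrightarrow> 0 + exp (0 * \<tau>) * x\<^sub>2) (at_right 0)"
    by (intro tendsto_intros)
  then have "\<forall>\<^sub>F \<gamma> in at_right 0. \<gamma> + exp (\<gamma> * \<tau>) * x\<^sub>2 < x\<^sub>1"
    using assms(1) by (intro order_tendstoD(2)[of _ "x\<^sub>2"]) auto
  then obtain \<gamma>\<^sub>0 where g: "\<gamma>\<^sub>0 > 0" "\<gamma>\<^sub>0 + exp (\<gamma>\<^sub>0 * \<tau>) * x\<^sub>2 < x\<^sub>1"
    unfolding eventually_at_right_field by (metis field_lbound_gt_zero less_add_same_cancel1 dense)
  show thesis
  proof (rule that[OF g(1)])
    fix \<gamma> :: real assume \<gamma>: "0 < \<gamma>" "\<gamma> \<le> \<gamma>\<^sub>0"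
    have "\<gamma> + exp (\<gamma> * \<tau>) * x\<^sub>2 \<le> \<gamma>\<^sub>0 + exp (\<gamma>\<^sub>0 * \<tau>) * x\<^sub>2"
      using \<gamma> assms by (intro add_mono mult_right_mono) auto
    then show "\<gamma> + exp (\<gamma> * \<tau>) * x\<^sub>2 \<le> x\<^sub>1" using g(2) by linarith
  qed
qed

text \<open>The weight gained over one delay stays below a bound that does not depend on the step
  size. This makes the rate \<gamma> common to all schemes.\<close>

lemma one_plus_power_le_exp:
  fixes \<gamma> \<tau> :: real
  assumes "\<gamma> > 0" "\<tau> > 0" "N > 0"
  shows "(1 + \<gamma> * (\<tau> / real N)) ^ N \<le> exp (\<gamma> * \<tau>)"
proof -
  have "(1 + \<gamma> * (\<tau> / real N)) ^ N \<le> exp (\<gamma> * (\<tau> / real N)) ^ N"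
    using assms by (intro power_mono exp_ge_add_one_self) auto
  also have "\<dots> = exp (\<gamma> * \<tau>)"
    using assms by (simp add: exp_of_nat_mult[symmetric])
  finally show ?thesis .
qed

lemma (in prob_space) prob_norm_gt_le:
  fixes Z :: "nat \<Rightarrow> 'a \<Rightarrow> 'b::{real_normed_vector, second_countable_topology}"
  assumes [measurable]: "\<And>j. j \<le> N \<Longrightarrow> Z j \<in> borel_measurable M" and "0 \<le> \<delta>"
  shows "prob {\<omega>\<in>space M. \<exists>j\<le>N. norm (Z j \<omega>) > \<delta>} \<le> prob {\<omega>\<in>space M. \<exists>j\<le>N. (norm (Z j \<omega>))\<^sup>2 \<ge> \<delta>\<^sup>2}"
proof (intro finite_measure_mono subsetI)
  fix \<omega> assume "\<omega> \<in> {\<omega>\<in>space M. \<exists>j\<le>N. norm (Z j \<omega>) > \<delta>}"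
  then obtain j where "\<omega> \<in> space M" "j \<le> N" "\<delta> \<le> norm (Z j \<omega>)" by auto
  then show "\<omega> \<in> {\<omega>\<in>space M. \<exists>j\<le>N. (norm (Z j \<omega>))\<^sup>2 \<ge> \<delta>\<^sup>2}"
    using power_mono[OF _ assms(2)] by blast
qed measurable

section \<open>Standing hypotheses, truncation level, and bounds for the coefficients\<close>

locale delay_system = brownian_space M F W
  for M :: "'w measure" and F and W :: "real \<Rightarrow> 'w \<Rightarrow> real^'m" +
  fixes f :: "real^'d \<Rightarrow> real^'d \<Rightarrow> real^'d"
    and g :: "real^'d \<Rightarrow> real^'d \<Rightarrow> real^'m^'d"
    and V :: "real^'d \<Rightarrow> real^'d \<Rightarrow> real"
    and \<Phi> :: "real \<Rightarrow> real"
    and \<tau> \<alpha> a\<^sub>1 a\<^sub>2 a\<^sub>3 b\<^sub>1 b\<^sub>2 b\<^sub>3 b\<^sub>4 \<nu> K \<Delta>\<^sub>1 \<Delta>\<^sub>2 :: real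
  assumes \<tau>: "\<tau> > 0"
    and f_borel: "(\<lambda>(u, v). f u v) \<in> borel_measurable borel"
    and g_borel: "(\<lambda>(u, v). g u v) \<in> borel_measurable borel"
    and local_Lipschitz:
      "\<forall>R>0. \<exists>l>0. \<forall>u u' v v'.
         max (max (norm u) (norm u')) (max (norm v) (norm v')) \<le> R \<longrightarrow>
         max (norm (f u v - f u' v')) (norm (g u v - g u' v')) \<le> l * (norm (u - u') + norm (v - v'))"
    and \<alpha>: "\<alpha> \<ge> 2" and a: "a\<^sub>1 \<ge> 0" "a\<^sub>3 \<ge> 0"
    and dissipativity:
      "\<And>u v. 2 * (u \<bullet> f u v) + (norm (g u v))\<^sup>2
               \<le> a\<^sub>1 - a\<^sub>2 * norm u powr \<alpha> + a\<^sub>3 * norm v powr \<alpha>"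
    and b: "b\<^sub>2 \<ge> 0" "b\<^sub>4 \<ge> 0" "b\<^sub>3 > b\<^sub>4"
    and V_cont: "continuous_on UNIV (\<lambda>(u, v). V u v)"
    and V_nonneg: "\<And>u v. V u v \<ge> 0"
    and contractivity:
      "\<And>u u' v v'. 2 * ((u - u') \<bullet> (f u v - f u' v')) + (norm (g u v - g u' v'))\<^sup>2
               \<le> - b\<^sub>1 * (norm (u - u'))\<^sup>2 + b\<^sub>2 * (norm (v - v'))\<^sup>2 - b\<^sub>3 * V u u' + b\<^sub>4 * V v v'"
    and \<Phi>: "truncation_function f g \<Phi>" and \<nu>: "0 < \<nu>" "\<nu> \<le> 1 / 3"
    and K: "K = truncation_const f g \<Phi>"
    and \<Delta>\<^sub>1: "0 < \<Delta>\<^sub>1" "\<Delta>\<^sub>1 < 1" "a\<^sub>2 - 6 * K\<^sup>2 * \<Delta>\<^sub>1 powr (1 - 2 * \<nu>) > a\<^sub>3"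
    and \<Delta>\<^sub>2: "0 < \<Delta>\<^sub>2" "\<Delta>\<^sub>2 < 1" "b\<^sub>1 - 4 * K\<^sup>2 * \<Delta>\<^sub>2 powr (1 - 2 * \<nu>) > b\<^sub>2"
begin

definition level :: "real \<Rightarrow> real" where
  "level \<Delta> = the_inv_into {1..} \<Phi> (K * \<Delta> powr (-\<nu>))"

definition valid_steps :: "nat \<Rightarrow> bool" where
  "valid_steps N \<longleftrightarrow> real N > \<tau> \<and> \<tau> / real N \<le> min \<Delta>\<^sub>1 \<Delta>\<^sub>2"

abbreviation trunc_em :: "nat \<Rightarrow> (real \<Rightarrow> real^'d) \<Rightarrow> int \<Rightarrow> 'w \<Rightarrow> real^'d" where
  "trunc_em N \<equiv> em f g W (ball_proj (level (\<tau> / real N))) \<tau> N"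

lemma truncate_level: "truncate \<Phi> K \<nu> \<Delta> = ball_proj (level \<Delta>)"
  by (simp add: truncate_eq_ball_proj level_def)

lemma valid_stepsD:
  assumes "valid_steps N"
  shows "N > 0" "0 < \<tau> / real N" "\<tau> / real N \<le> \<Delta>\<^sub>1" "\<tau> / real N \<le> \<Delta>\<^sub>2" "\<tau> / real N < 1"
proof -
  show N: "N > 0" using assms \<tau> unfolding valid_steps_def by (intro gr0I) auto
  then show "0 < \<tau> / real N" using \<tau> by simp
  show "\<tau> / real N \<le> \<Delta>\<^sub>1" "\<tau> / real N \<le> \<Delta>\<^sub>2" using assms by (simp_all add: valid_steps_def)
  then show "\<tau> / real N < 1" using \<Delta>\<^sub>1 by linarith
qed

lemma K_ge: "K \<ge> 1" "K \<ge> \<Phi> 1" "K \<ge> norm (f 0 0)"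
  unfolding K truncation_const_def by auto

lemma \<Phi>_facts: "strict_mono_on {1..} \<Phi>" "continuous_on {1..} \<Phi>" "filterlim \<Phi> at_top at_top"
  using \<Phi> unfolding truncation_function_def by auto

text \<open>The inverse of \<open>\<Phi>\<close> has a meaning only on its range. The intermediate
  value theorem places \<open>K * \<Delta> powr (-\<nu>)\<close> there: it is at least
  \<open>\<Phi> 1\<close>, as K dominates \<open>\<Phi> 1\<close> and the power is at least 1, and
  \<open>\<Phi>\<close> is unbounded.\<close>

lemma level_props:
  assumes "0 < \<Delta>" "\<Delta> < 1"
  shows "level \<Delta> \<ge> 1" "\<Phi> (level \<Delta>) = K * \<Delta> powr (-\<nu>)"
proof -
  have "\<Delta> powr (-\<nu>) \<ge> 1"
    using assms \<nu> by (simp add: powr_minus powr_le1 one_le_inverse)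
  then have "K * 1 \<le> K * \<Delta> powr (-\<nu>)" using K_ge(1) by (intro mult_left_mono) auto
  then have y: "\<Phi> 1 \<le> K * \<Delta> powr (-\<nu>)" using K_ge(2) by simp
  have "\<forall>\<^sub>F b in at_top. K * \<Delta> powr (-\<nu>) \<le> \<Phi> b"
    using \<Phi>_facts(3) unfolding filterlim_at_top by blast
  then obtain b where b: "b \<ge> 1" "K * \<Delta> powr (-\<nu>) \<le> \<Phi> b"
    unfolding eventually_at_top_linorder by (metis nle_le)
  obtain r where r: "1 \<le> r" "\<Phi> r = K * \<Delta> powr (-\<nu>)"
    using IVT'[of \<Phi> 1 _ b, OF y b(2,1)] continuous_on_subset[OF \<Phi>_facts(2)] by auto
  have "level \<Delta> = r"
    unfolding level_def using r
    by (intro the_inv_into_f_eq strict_mono_on_imp_inj_on \<Phi>_facts) auto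
  with r show "level \<Delta> \<ge> 1" "\<Phi> (level \<Delta>) = K * \<Delta> powr (-\<nu>)" by auto
qed

text \<open>\<open>\<Phi>\<close> at the level tends to infinity as the step shrinks, while
  \<open>\<Phi>\<close> is increasing; so the level leaves every bounded range. In the limit the
  truncation is inactive on each fixed ball.\<close>

lemma level_large:
  obtains N\<^sub>0 where "\<And>N. N \<ge> N\<^sub>0 \<Longrightarrow> valid_steps N \<Longrightarrow> level (\<tau> / real N) \<ge> R"
proof -
  define r where "r = max R 1"
  have r1: "1 \<le> r" "R \<le> r" by (simp_all add: r_def)
  have lim: "filterlim (\<lambda>N. K * (\<tau> / real N) powr (-\<nu>)) at_top sequentially"
    using \<nu> \<tau> K_ge(1) by real_asymp
  then have "\<forall>\<^sub>F N in sequentially. \<Phi> r \<le> K * (\<tau> / real N) powr (-\<nu>)"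
    unfolding filterlim_at_top by blast
  then obtain N\<^sub>0 where N0: "\<And>N. N \<ge> N\<^sub>0 \<Longrightarrow> \<Phi> r \<le> K * (\<tau> / real N) powr (-\<nu>)"
    unfolding eventually_sequentially by blast
  show thesis
  proof (rule that[of N\<^sub>0])
    fix N assume N: "N \<ge> N\<^sub>0" "valid_steps N"
    note l = level_props[OF valid_stepsD(2,5)[OF N(2)]]
    have "\<not> level (\<tau> / real N) < r"
      using strict_mono_onD[OF \<Phi>_facts(1), of "level (\<tau> / real N)" r] l N0[OF N(1)] r1 by auto
    then show "R \<le> level (\<tau> / real N)" using r1 by simp
  qed
qed

text \<open>The nonnegative quotient of \<open>g\<close> is discarded from the condition on
  \<open>\<Phi>\<close>, which leaves a Lipschitz bound for \<open>f\<close> with constant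
  \<open>\<Phi> (level \<Delta>)\<close>. The minimum with 1 matters for the moment bound: compared
  with its value at the origin, \<open>f\<close> does not grow with the delayed argument.\<close>

lemma f_increment:
  assumes "0 < \<Delta>" "\<Delta> < 1"
    and "norm u \<le> level \<Delta>" "norm u' \<le> level \<Delta>" "norm v \<le> level \<Delta>" "norm v' \<le> level \<Delta>"
  shows "norm (f u v - f u' v') \<le> K * \<Delta> powr (-\<nu>) * (norm (u - u') + min 1 (norm (v - v')))"
proof -
  let ?d = "norm (u - u') + min 1 (norm (v - v'))"
  have d0: "?d \<ge> 0" by simp
  show ?thesis
  proof (cases "?d = 0")
    case True
    then have "u = u'" "v = v'" by (auto simp: add_nonneg_eq_0_iff min_def split: if_splits)
    then show ?thesis by simp
  next
    case False
    have "norm (f u v - f u' v') / ?d + (norm (g u v - g u' v'))\<^sup>2 / ?d\<^sup>2 \<le> \<Phi> (level \<Delta>)"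
      using \<Phi> level_props(1)[OF assms(1,2)] False assms(3-) unfolding truncation_function_def by simp
    moreover have "0 \<le> (norm (g u v - g u' v'))\<^sup>2 / ?d\<^sup>2" by simp
    ultimately have "norm (f u v - f u' v') / ?d \<le> K * \<Delta> powr (-\<nu>)"
      unfolding level_props(2)[OF assms(1,2)] by linarith
    then show ?thesis using d0 False by (simp add: pos_divide_le_eq)
  qed
qed

text \<open>One factor \<Delta> against the square of \<Delta>^(-\<nu>) leaves the exponent 1 -
  2\<nu>, positive because \<nu> is at most 1/3. The bound is thus monotone in the step and holds
  with a fixed larger step on the right.\<close>

lemma step_power:
  assumes "0 < \<Delta>" "\<Delta> \<le> \<Delta>'"
  shows "\<Delta> * (K * \<Delta> powr (-\<nu>))\<^sup>2 \<le> K\<^sup>2 * \<Delta>' powr (1 - 2 * \<nu>)"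
proof -
  have "\<Delta> * (K * \<Delta> powr (-\<nu>))\<^sup>2 = K\<^sup>2 * (\<Delta> powr 1 * (\<Delta> powr (-\<nu>) * \<Delta> powr (-\<nu>)))"
    using assms by (simp add: power2_eq_square)
  also have "\<Delta> powr 1 * (\<Delta> powr (-\<nu>) * \<Delta> powr (-\<nu>)) = \<Delta> powr (1 - 2 * \<nu>)"
    unfolding powr_add[symmetric] by simp
  also have "\<dots> \<le> \<Delta>' powr (1 - 2 * \<nu>)"
    using assms \<nu> by (intro powr_mono2) auto
  finally show ?thesis by (simp add: mult_left_mono)
qed

lemma fg_Lipschitz:
  assumes "R > 0"
  obtains l where "l > 0"
    "\<And>u u' v v'. norm u \<le> R \<Longrightarrow> norm u' \<le> R \<Longrightarrow> norm v \<le> R \<Longrightarrow> norm v' \<le> R \<Longrightarrow>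
       norm (f u v - f u' v') \<le> l * (norm (u - u') + norm (v - v'))"
    "\<And>u u' v v'. norm u \<le> R \<Longrightarrow> norm u' \<le> R \<Longrightarrow> norm v \<le> R \<Longrightarrow> norm v' \<le> R \<Longrightarrow>
       norm (g u v - g u' v') \<le> l * (norm (u - u') + norm (v - v'))"
  using local_Lipschitz[rule_format, OF assms] by (metis max.bounded_iff)

lemma fg_bounded:
  assumes "R > 0"
  obtains C where "C \<ge> 0" "\<And>u v. norm u \<le> R \<Longrightarrow> norm v \<le> R \<Longrightarrow> norm (f u v) \<le> C \<and> norm (g u v) \<le> C"
proof -
  obtain l where l: "l > 0"
    "\<And>u u' v v'. norm u \<le> R \<Longrightarrow> norm u' \<le> R \<Longrightarrow> norm v \<le> R \<Longrightarrow> norm v' \<le> R \<Longrightarrow>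
       norm (f u v - f u' v') \<le> l * (norm (u - u') + norm (v - v'))"
    "\<And>u u' v v'. norm u \<le> R \<Longrightarrow> norm u' \<le> R \<Longrightarrow> norm v \<le> R \<Longrightarrow> norm v' \<le> R \<Longrightarrow>
       norm (g u v - g u' v') \<le> l * (norm (u - u') + norm (v - v'))"
    using fg_Lipschitz[OF assms] by blast
  show thesis
  proof (rule that[of "l * (R + R) + norm (f 0 0) + norm (g 0 0)"])
    fix u v :: "real^'d" assume uv: "norm u \<le> R" "norm v \<le> R"
    have "l * (norm u + norm v) \<le> l * (R + R)" using l(1) uv by (intro mult_left_mono add_mono) auto
    moreover have "norm (f u v) \<le> norm (f u v - f 0 0) + norm (f 0 0)" "norm (g u v) \<le> norm (g u v - g 0 0) + norm (g 0 0)"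
      using norm_triangle_sub by (simp_all add: add.commute)
    ultimately show "norm (f u v) \<le> l * (R + R) + norm (f 0 0) + norm (g 0 0) \<and> norm (g u v) \<le> l * (R + R) + norm (f 0 0) + norm (g 0 0)"
      using l(2)[of u 0 v 0] l(3)[of u 0 v 0] uv assms norm_ge_zero[of "f 0 0"] norm_ge_zero[of "g 0 0"]
      by (simp, linarith)
  qed (use l assms in auto)
qed

lemma V_bounded:
  obtains C where "C \<ge> 0" "\<And>u v. norm u \<le> R \<Longrightarrow> norm v \<le> R \<Longrightarrow> V u v \<le> C"
proof -
  have cpt: "compact ((\<lambda>(u, v). V u v) ` (cball 0 R \<times> cball 0 R))"
    by (intro compact_continuous_image continuous_on_subset[OF V_cont] compact_Times) auto
  obtain C where C: "\<And>x. x \<in> (\<lambda>(u, v). V u v) ` (cball 0 R \<times> cball 0 R) \<Longrightarrow> norm x \<le> C"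
    using compact_imp_bounded[OF cpt] by (meson bounded_iff)
  have "norm (V u v) \<le> C" if "norm u \<le> R" "norm v \<le> R" for u v
    by (rule C, rule image_eqI[of _ _ "(u, v)"]) (use that in auto)
  then have *: "V u v \<le> max C 0" if "norm u \<le> R" "norm v \<le> R" for u v
    using that by (metis abs_le_D1 real_norm_def le_max_iff_disj)
  show thesis by (rule that[of "max C 0"]) (use * in auto)
qed

text \<open>The truncation level is chosen so that the quadratic error \<open>\<Delta>|f - f'|\<^sup>2\<close> costs only part of the
  dissipation, uniformly in the step size.\<close>

lemma em_contraction:
  assumes "\<rho> > 0" "\<delta> > 0" "\<epsilon> > 0"
  obtains T where "\<And>N n \<xi> \<xi>'. valid_steps N \<Longrightarrow> \<forall>\<theta>\<in>{-\<tau>..0}. norm (\<xi> \<theta>) \<le> \<rho> \<Longrightarrow>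
    \<forall>\<theta>\<in>{-\<tau>..0}. norm (\<xi>' \<theta>) \<le> \<rho> \<Longrightarrow> real n * (\<tau> / real N) \<ge> T \<Longrightarrow>
    prob {\<omega>\<in>space M. \<exists>j\<le>N. norm (trunc_em N \<xi> (int (n + j)) \<omega>
      - trunc_em N \<xi>' (int (n + j)) \<omega>) > \<delta>} \<le> \<epsilon>"
proof -
  \<comment> \<open>Squaring the increment bound of \<open>f\<close> as (a + b)^2 \<le> 2(a^2 + b^2)
    gives the factor 2. The error appears once with the current and once with the delayed
    difference, so the condition on \<open>\<Delta>\<^sub>2\<close> is exactly the inequality
    \<open>gap\<close>.\<close>
  define \<kappa> where "\<kappa> = 2 * K\<^sup>2 * \<Delta>\<^sub>2 powr (1 - 2 * \<nu>)"
  have \<kappa>0: "\<kappa> \<ge> 0" by (simp add: \<kappa>_def)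
  have gap: "b\<^sub>2 + \<kappa> < b\<^sub>1 - \<kappa>" using \<Delta>\<^sub>2(3) by (simp add: \<kappa>_def)
  obtain \<gamma>1 where \<gamma>1: "\<gamma>1 > 0" "\<And>\<gamma>. 0 < \<gamma> \<Longrightarrow> \<gamma> \<le> \<gamma>1 \<Longrightarrow> \<gamma> + exp (\<gamma> * \<tau>) * (b\<^sub>2 + \<kappa>) \<le> b\<^sub>1 - \<kappa>"
    using exists_rate[OF gap _ \<tau>] b \<kappa>0 by auto
  obtain \<gamma>2 where \<gamma>2: "\<gamma>2 > 0" "\<And>\<gamma>. 0 < \<gamma> \<Longrightarrow> \<gamma> \<le> \<gamma>2 \<Longrightarrow> \<gamma> + exp (\<gamma> * \<tau>) * b\<^sub>4 \<le> b\<^sub>3"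
    using exists_rate[OF b(3,2) \<tau>] by blast
  define \<gamma> where "\<gamma> = min \<gamma>1 \<gamma>2"
  have \<gamma>: "\<gamma> > 0" "\<gamma> + exp (\<gamma> * \<tau>) * (b\<^sub>2 + \<kappa>) \<le> b\<^sub>1 - \<kappa>" "exp (\<gamma> * \<tau>) * b\<^sub>4 \<le> b\<^sub>3"
    using \<gamma>1(1) \<gamma>1(2)[of \<gamma>] \<gamma>2(1) \<gamma>2(2)[of \<gamma>] by (auto simp: \<gamma>_def)
  obtain V1 where V1: "V1 \<ge> 0" "\<And>u v. norm u \<le> \<rho> \<Longrightarrow> norm v \<le> \<rho> \<Longrightarrow> V u v \<le> V1"
    using V_bounded by blast
  \<comment> \<open>The delayed part of the contractivity hypothesis, enlarged by the share \<kappa>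
    of the error of \<open>f\<close> that falls on the delayed difference.\<close>
  define Q where "Q u v = (b\<^sub>2 + \<kappa>) * (norm (u - v))\<^sup>2 + b\<^sub>4 * V u v" for u v
  define C0 where "C0 = (2 * \<rho>)\<^sup>2"
  define C1 where "C1 = (b\<^sub>2 + \<kappa>) * C0 + b\<^sub>4 * V1"
  have C: "C0 \<ge> 0" "C1 \<ge> 0" using b \<kappa>0 V1 by (auto simp: C0_def C1_def)
  \<comment> \<open>Independent of the step size and of the two paths in the ball. By Bernoulli's
    inequality \<open>q ^ n\<close> is at least 1 plus \<gamma> times the elapsed time, so the tail
    is at most \<open>L\<close> divided by that quantity; the threshold for the elapsed time is read
    off from this.\<close>
  define L where "L = C0 + exp (\<gamma> * \<tau>) * \<tau> * C1"
  have L0: "L \<ge> 0" using C \<tau> by (simp add: L_def)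
  have Q0: "Q u v \<ge> 0" for u v using b \<kappa>0 V_nonneg by (simp add: Q_def)
  have diff: "(norm (u - v))\<^sup>2 \<le> (2 * r)\<^sup>2" if "norm u \<le> r" "norm v \<le> r" for u v :: "real^'d" and r
    using norm_triangle_ineq4[of u v] that by (intro power_mono) auto
  show thesis
  proof (rule that[of "(L + 1) / (\<gamma> * (\<delta>\<^sup>2 * \<epsilon>))"])
    fix N n :: nat and \<xi> \<xi>' :: "real \<Rightarrow> real^'d"
    assume N: "valid_steps N" and \<xi>': "\<forall>\<theta>\<in>{-\<tau>..0}. norm (\<xi> \<theta>) \<le> \<rho>" "\<forall>\<theta>\<in>{-\<tau>..0}. norm (\<xi>' \<theta>) \<le> \<rho>"
      and T: "(L + 1) / (\<gamma> * (\<delta>\<^sup>2 * \<epsilon>)) \<le> real n * (\<tau> / real N)"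
    note \<xi> = \<xi>'[rule_format]
    define \<Delta> where "\<Delta> = \<tau> / real N"
    note vs = valid_stepsD[OF N, folded \<Delta>_def]
    define R where "R = level \<Delta>"
    have R1: "R \<ge> 1" unfolding R_def by (rule level_props(1)[OF vs(2,5)])
    define q where "q = 1 + \<gamma> * \<Delta>"
    have q1: "q \<ge> 1" using \<gamma>(1) vs(2) by (simp add: q_def)
    have qN: "q ^ N \<le> exp (\<gamma> * \<tau>)"
      unfolding q_def \<Delta>_def by (rule one_plus_power_le_exp[OF \<gamma>(1) \<tau> vs(1)])
    obtain Cf where Cf: "Cf \<ge> 0" "\<And>u v. norm u \<le> R \<Longrightarrow> norm v \<le> R \<Longrightarrow> norm (f u v) \<le> Cf \<and> norm (g u v) \<le> Cf"
      using fg_bounded[of R] R1 by auto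
    obtain CV where CV: "CV \<ge> 0" "\<And>u v. norm u \<le> R \<Longrightarrow> norm v \<le> R \<Longrightarrow> V u v \<le> CV"
      using V_bounded by blast
    \<comment> \<open>Depends on the level and hence on the step size; this is harmless, since it
      supplies integrability only and does not enter the resulting bound.\<close>
    define D where "D = max Cf ((b\<^sub>2 + \<kappa>) * (2 * R)\<^sup>2 + b\<^sub>4 * CV)"
    have "\<delta>\<^sup>2 * prob {\<omega>\<in>space M. \<exists>j\<le>N. (norm (em f g W (ball_proj R) \<tau> N \<xi> (int (n + j)) \<omega>
      - em f g W (ball_proj R) \<tau> N \<xi>' (int (n + j)) \<omega>))\<^sup>2 \<ge> \<delta>\<^sup>2} \<le> (C0 + q ^ N * \<tau> * C1) / q ^ n + q * 0 / \<gamma> + 0 * \<tau>"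
    proof (rule em_pair_estimate[where S = UNIV and C = D and Q = Q and \<gamma> = \<gamma> and c = 0, OF \<tau> vs(1) _ \<Delta>_def f_borel f_borel g_borel g_borel _ _ _ Q0 \<gamma>(1) _ q_def])
      show "norm (f u v) \<le> D \<and> norm (f u v) \<le> D \<and> norm (g u v) \<le> D \<and> norm (g u v) \<le> D" if "norm u \<le> R" "norm v \<le> R" for u v
        using Cf(2)[OF that] by (auto simp: D_def)
      have "continuous_on UNIV (\<lambda>x. (b\<^sub>2 + \<kappa>) * (norm (fst x - snd x))\<^sup>2 + b\<^sub>4 * V (fst x) (snd x))"
        using V_cont by (intro continuous_intros) (simp add: case_prod_beta)
      then show "(\<lambda>(u, v). Q u v) \<in> borel_measurable borel"
        unfolding Q_def case_prod_beta by (rule borel_measurable_continuous_onI)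
      show "0 \<le> Q u v \<and> Q u v \<le> D" if "norm u \<le> R" "norm v \<le> R" for u v
      proof -
        have "Q u v \<le> (b\<^sub>2 + \<kappa>) * (2 * R)\<^sup>2 + b\<^sub>4 * CV"
          unfolding Q_def using diff[OF that] CV(2)[OF that] b \<kappa>0 by (intro add_mono mult_left_mono) auto
        then show ?thesis using Q0 by (simp add: D_def)
      qed
      show "(norm (ball_proj R (\<xi> 0) - ball_proj R (\<xi>' 0)))\<^sup>2 \<le> C0"
        unfolding C0_def using \<xi>[of 0] \<tau> R1
        by (intro diff order_trans[OF norm_ball_proj_le_norm]) auto
      show "Q (ball_proj R (\<xi> \<theta>)) (ball_proj R (\<xi>' \<theta>)) \<le> C1" if "\<theta> \<in> {-\<tau>..0}" for \<theta>
      proof -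
        have "norm (ball_proj R (\<xi> \<theta>)) \<le> \<rho>" "norm (ball_proj R (\<xi>' \<theta>)) \<le> \<rho>"
          using \<xi>[OF that] R1 by (auto intro: order_trans[OF norm_ball_proj_le_norm])
        then show ?thesis
          unfolding Q_def C1_def C0_def using b \<kappa>0 diff V1(2) by (intro add_mono mult_left_mono) auto
      qed
      fix u u' v v' :: "real^'d"
      assume uv: "norm u \<le> R" "norm u' \<le> R" "norm v \<le> R" "norm v' \<le> R"
      have "norm (f u v - f u' v') \<le> K * \<Delta> powr (-\<nu>) * (norm (u - u') + norm (v - v'))"
        using K_ge(1) by (intro order_trans[OF f_increment[OF vs(2,5) uv[unfolded R_def]]] mult_left_mono) auto
      then have "(norm (f u v - f u' v'))\<^sup>2 \<le> (K * \<Delta> powr (-\<nu>) * (norm (u - u') + norm (v - v')))\<^sup>2"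
        by (intro power_mono) auto
      also have "\<dots> \<le> (K * \<Delta> powr (-\<nu>))\<^sup>2 * (2 * ((norm (u - u'))\<^sup>2 + (norm (v - v'))\<^sup>2))"
        unfolding power_mult_distrib[of "K * \<Delta> powr (-\<nu>)"]
        using sum_squares_bound[of "norm (u - u')" "norm (v - v')"] by (intro mult_left_mono) (auto simp: power2_sum)
      finally have "\<Delta> * (norm (f u v - f u' v'))\<^sup>2 \<le> \<Delta> * ((K * \<Delta> powr (-\<nu>))\<^sup>2 * (2 * ((norm (u - u'))\<^sup>2 + (norm (v - v'))\<^sup>2)))"
        using vs(2) by (intro mult_left_mono) auto
      also have "\<dots> = (\<Delta> * (K * \<Delta> powr (-\<nu>))\<^sup>2) * (2 * ((norm (u - u'))\<^sup>2 + (norm (v - v'))\<^sup>2))"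
        by (simp only: mult.assoc)
      also have "\<dots> \<le> (K\<^sup>2 * \<Delta>\<^sub>2 powr (1 - 2 * \<nu>)) * (2 * ((norm (u - u'))\<^sup>2 + (norm (v - v'))\<^sup>2))"
        using step_power[OF vs(2,4)] by (intro mult_right_mono) auto
      also have "\<dots> = \<kappa> * (norm (u - u'))\<^sup>2 + \<kappa> * (norm (v - v'))\<^sup>2"
        by (simp add: \<kappa>_def algebra_simps)
      finally have 1: "\<Delta> * (norm (f u v - f u' v'))\<^sup>2 \<le> \<kappa> * (norm (u - u'))\<^sup>2 + \<kappa> * (norm (v - v'))\<^sup>2" .
      have "\<gamma> * (norm (u - u'))\<^sup>2 + q ^ N * Q u u' \<le> \<gamma> * (norm (u - u'))\<^sup>2 + exp (\<gamma> * \<tau>) * Q u u'"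
        using qN Q0 by (intro add_left_mono mult_right_mono) auto
      also have "\<dots> = (\<gamma> + exp (\<gamma> * \<tau>) * (b\<^sub>2 + \<kappa>)) * (norm (u - u'))\<^sup>2 + (exp (\<gamma> * \<tau>) * b\<^sub>4) * V u u'"
        by (simp add: Q_def algebra_simps)
      also have "\<dots> \<le> (b\<^sub>1 - \<kappa>) * (norm (u - u'))\<^sup>2 + b\<^sub>3 * V u u'"
        using \<gamma>(2,3) V_nonneg by (intro add_mono mult_right_mono) auto
      finally have 2: "\<gamma> * (norm (u - u'))\<^sup>2 + q ^ N * Q u u' \<le> b\<^sub>1 * (norm (u - u'))\<^sup>2 - \<kappa> * (norm (u - u'))\<^sup>2 + b\<^sub>3 * V u u'"
        by (simp add: left_diff_distrib)
      have 3: "Q v v' = b\<^sub>2 * (norm (v - v'))\<^sup>2 + \<kappa> * (norm (v - v'))\<^sup>2 + b\<^sub>4 * V v v'"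
        by (simp add: Q_def distrib_right)
      show "2 * ((u - u') \<bullet> (f u v - f u' v')) + (norm (g u v - g u' v'))\<^sup>2 + \<Delta> * (norm (f u v - f u' v'))\<^sup>2
        \<le> 0 - \<gamma> * (norm (u - u'))\<^sup>2 - q ^ N * Q u u' + Q v v'"
        using 1 2 contractivity[of u u' v v'] unfolding 3 by linarith
    qed (use R1 in auto)
    also have "\<dots> \<le> L / (1 + real n * (\<gamma> * \<Delta>))"
    proof -
      have "C0 + q ^ N * \<tau> * C1 \<le> L"
        unfolding L_def using qN C \<tau> by (intro add_left_mono mult_right_mono) auto
      moreover have "1 + real n * (\<gamma> * \<Delta>) \<le> q ^ n"
        unfolding q_def using \<gamma>(1) vs(2) by (intro Bernoulli_inequality) (simp add: order_trans[of _ 0])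
      moreover have "0 \<le> real n * (\<gamma> * \<Delta>)" using \<gamma>(1) vs(2) by simp
      ultimately show ?thesis using L0 by (simp add: frac_le)
    qed
    also have "\<dots> \<le> \<delta>\<^sup>2 * \<epsilon>"
    proof -
      have "L + 1 \<le> real n * \<Delta> * (\<gamma> * (\<delta>\<^sup>2 * \<epsilon>))"
        using T assms \<gamma>(1) unfolding \<Delta>_def[symmetric] by (subst (asm) pos_divide_le_eq) auto
      moreover have "0 < \<delta>\<^sup>2 * \<epsilon>" using assms by simp
      ultimately have "L \<le> \<delta>\<^sup>2 * \<epsilon> * (1 + real n * (\<gamma> * \<Delta>))" by (simp add: algebra_simps)
      moreover have "0 < 1 + real n * (\<gamma> * \<Delta>)" using \<gamma>(1) vs(2) by (simp add: add_pos_nonneg)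
      ultimately show ?thesis by (subst pos_divide_le_eq) auto
    qed
    finally have *: "prob {\<omega>\<in>space M. \<exists>j\<le>N. (norm (em f g W (ball_proj R) \<tau> N \<xi> (int (n + j)) \<omega>
      - em f g W (ball_proj R) \<tau> N \<xi>' (int (n + j)) \<omega>))\<^sup>2 \<ge> \<delta>\<^sup>2} \<le> \<epsilon>"
      using assms by simp
    have m: "em f g W (ball_proj R) \<tau> N \<xi> k \<in> borel_measurable M" for \<xi> k
      using \<tau> R1 by (intro em_measurable f_borel g_borel borel_measurable_ball_proj) auto
    from * prob_norm_gt_le[of N "\<lambda>j \<omega>. em f g W (ball_proj R) \<tau> N \<xi> (int (n + j)) \<omega>
      - em f g W (ball_proj R) \<tau> N \<xi>' (int (n + j)) \<omega>" \<delta>, OF borel_measurable_diff[OF m m] less_imp_le[OF assms(2)]]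
    show "prob {\<omega>\<in>space M. \<exists>j\<le>N. norm (trunc_em N \<xi> (int (n + j)) \<omega>
      - trunc_em N \<xi>' (int (n + j)) \<omega>) > \<delta>} \<le> \<epsilon>"
      unfolding R_def \<Delta>_def by (rule order_trans[rotated])
  qed
qed

lemma em_zero: "em (\<lambda>_ _. 0) (\<lambda>_ _. 0) W (ball_proj R) \<tau> N (\<lambda>_. 0) k \<omega> = (0 :: real^'d)"
proof (induction "nat k" arbitrary: k rule: less_induct)
  case less
  have z: "ball_proj R (0 :: real^'d) = 0" by (simp add: ball_proj_def)
  show ?case
  proof (cases "k \<le> 0")
    case True then show ?thesis by (simp add: em_nonpos z)
  next
    case False
    then obtain n where k: "k = int (Suc n)" by (metis Suc_pred' nat_int zero_less_nat_eq int_nat_eq not_le less_imp_le)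
    show ?thesis unfolding k em_Suc Let_def using less[of "int n"] less[of "int n - int N"] z k by simp
  qed
qed

text \<open>A comparison with the scheme that has zero coefficients and starts from 0. Its state
  space is \<open>{0}\<close>, so the drift condition of the pair estimate reduces to dissipativity.
  With zero initial data the decaying term vanishes and the bound is uniform in time as well as in
  the step.\<close>

lemma em_moment:
  assumes "\<epsilon> > 0"
  obtains r where "r > 0" "\<And>N n \<xi>. valid_steps N \<Longrightarrow> \<forall>\<theta>\<in>{-\<tau>..0}. \<xi> \<theta> = 0 \<Longrightarrow>
    prob {\<omega>\<in>space M. \<exists>j\<le>N. norm (trunc_em N \<xi> (int (n + j)) \<omega>) > r} \<le> \<epsilon>"
proof -
  \<comment> \<open>By the increment bound from the origin, |f|^2 is at most (K\<Delta>^(-\<nu>))^2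
    (2|u|^2 + 8); so the quadratic error takes \<open>2 * \<kappa>\<close> from the coefficient of
    |u|^\<alpha>.\<close>
  define \<kappa> where "\<kappa> = K\<^sup>2 * \<Delta>\<^sub>1 powr (1 - 2 * \<nu>)"
  have \<kappa>0: "\<kappa> \<ge> 0" by (simp add: \<kappa>_def)
  have gap: "a\<^sub>3 < a\<^sub>2 - 2 * \<kappa>" using \<Delta>\<^sub>1(3) \<kappa>0 unfolding \<kappa>_def mult.assoc by linarith
  obtain \<gamma> where \<gamma>: "\<gamma> > 0" "\<gamma> + exp (\<gamma> * \<tau>) * a\<^sub>3 \<le> a\<^sub>2 - 2 * \<kappa>"
    using exists_rate[OF gap a(2) \<tau>] by blast
  \<comment> \<open>Replacing |u|^2 by |u|^\<alpha> + 1 turns 2|u|^2 + 8 into 2|u|^\<alpha> + 10,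
    whence \<open>10 * \<kappa>\<close>; the same replacement in the damping term \<gamma>|u|^2
    leaves the summand \<gamma>.\<close>
  define c where "c = a\<^sub>1 + 10 * \<kappa> + \<gamma>"
  have c0: "c \<ge> 0" using a \<kappa>0 \<gamma> by (simp add: c_def)
  define Q where "Q u v = a\<^sub>3 * norm u powr \<alpha>" for u v :: "real^'d"
  have Q0: "Q u v \<ge> 0" for u v using a by (simp add: Q_def)
  define L where "L = (1 + \<gamma>) * c / \<gamma> + c * \<tau>"
  have L0: "L \<ge> 0" using c0 \<gamma> \<tau> by (simp add: L_def)
  \<comment> \<open>Chebyshev: the second-moment tail bound is \<open>L\<close>, so the probability
    of exceeding \<open>r\<close> is at most \<open>L\<close> over r^2.\<close>
  define r where "r = sqrt ((L + 1) / \<epsilon>)"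
  have r0: "r > 0" using L0 assms by (simp add: r_def)
  have r2: "r\<^sup>2 = (L + 1) / \<epsilon>" using L0 assms by (simp add: r_def)
  show thesis
  proof (rule that[OF r0])
    fix N n :: nat and \<xi> :: "real \<Rightarrow> real^'d" assume N: "valid_steps N" and \<xi>: "\<forall>\<theta>\<in>{-\<tau>..0}. \<xi> \<theta> = 0"
    define \<Delta> where "\<Delta> = \<tau> / real N"
    note vs = valid_stepsD[OF N, folded \<Delta>_def]
    define R where "R = level \<Delta>"
    have R1: "R \<ge> 1" unfolding R_def by (rule level_props(1)[OF vs(2,5)])
    define q where "q = 1 + \<gamma> * \<Delta>"
    have q1: "q \<ge> 1" "q \<le> 1 + \<gamma>" using \<gamma>(1) vs(2,5) by (simp_all add: q_def mult_le_cancel_left1)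
    have qN: "q ^ N \<le> exp (\<gamma> * \<tau>)"
      unfolding q_def \<Delta>_def by (rule one_plus_power_le_exp[OF \<gamma>(1) \<tau> vs(1)])
    obtain Cf where Cf: "Cf \<ge> 0" "\<And>u v. norm u \<le> R \<Longrightarrow> norm v \<le> R \<Longrightarrow> norm (f u v) \<le> Cf \<and> norm (g u v) \<le> Cf"
      using fg_bounded[of R] R1 by auto
    define D where "D = max Cf (a\<^sub>3 * R powr \<alpha>)"
    let ?u = "em f g W (ball_proj R) \<tau> N \<xi>"
    let ?z = "em (\<lambda>_ _. 0) (\<lambda>_ _. 0) W (ball_proj R) \<tau> N (\<lambda>_. 0 :: real^'d)"
    have "r\<^sup>2 * prob {\<omega>\<in>space M. \<exists>j\<le>N. (norm (?u (int (n + j)) \<omega> - ?z (int (n + j)) \<omega>))\<^sup>2 \<ge> r\<^sup>2}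
      \<le> (0 + q ^ N * \<tau> * 0) / q ^ n + q * c / \<gamma> + c * \<tau>"
    proof (rule em_pair_estimate[where S = "{0}" and C = D and Q = Q and \<gamma> = \<gamma> and c = c, OF \<tau> vs(1) _ \<Delta>_def f_borel _ g_borel _ _ _ _ Q0 \<gamma>(1) c0 q_def])
      show "norm (f u v) \<le> D \<and> norm (0 :: real^'d) \<le> D \<and> norm (g u v) \<le> D \<and> norm (0 :: real^'m^'d) \<le> D" if "norm u \<le> R" "norm v \<le> R" for u v
        using Cf(1) Cf(2)[OF that] by (auto simp: D_def)
      show "(\<lambda>(u, v). Q u v) \<in> borel_measurable borel"
        unfolding Q_def case_prod_beta borel_prod[symmetric] by measurable
      show "0 \<le> Q u v \<and> Q u v \<le> D" if "norm u \<le> R" "norm v \<le> R" for u v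
      proof -
        have "Q u v \<le> a\<^sub>3 * R powr \<alpha>"
          unfolding Q_def using a \<alpha> that by (intro mult_left_mono powr_mono2) auto
        then show ?thesis using Q0 by (simp add: D_def)
      qed
      show "?z k \<omega> \<in> {0}" for k \<omega> by (simp add: em_zero)
      show "Q (ball_proj R (\<xi> \<theta>)) (ball_proj R 0) \<le> 0" if "\<theta> \<in> {-\<tau>..0}" for \<theta>
        using \<alpha> \<xi>[rule_format, OF that] by (simp add: Q_def ball_proj_def)
      show "(norm (ball_proj R (\<xi> 0) - ball_proj R 0))\<^sup>2 \<le> 0"
        using \<xi>[rule_format, of 0] \<tau> by simp
      fix u u' v v' :: "real^'d"
      assume uv: "norm u \<le> R" "norm u' \<le> R" "norm v \<le> R" "norm v' \<le> R" and z: "u' \<in> {0}" "v' \<in> {0}"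
      have sq: "(norm u)\<^sup>2 \<le> norm u powr \<alpha> + 1"
      proof (cases "norm u \<le> 1")
        case True
        then have "(norm u)\<^sup>2 \<le> 1\<^sup>2" by (intro power_mono) auto
        moreover have "0 \<le> norm u powr \<alpha>" by simp
        ultimately show ?thesis unfolding one_power2 by linarith
      next
        case False
        then have "norm u powr 2 \<le> norm u powr \<alpha>" using \<alpha> by (intro powr_mono) auto
        then show ?thesis using False by simp
      qed
      have Kp: "K * \<Delta> powr (-\<nu>) \<ge> K"
      proof -
        have "\<Delta> powr (-\<nu>) \<ge> 1" using vs(2,5) \<nu> by (simp add: powr_minus powr_le1 one_le_inverse)
        then have "K * 1 \<le> K * \<Delta> powr (-\<nu>)" using K_ge(1) by (intro mult_left_mono) auto
        then show ?thesis by simp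
      qed
      have "norm (f u v - f 0 0) \<le> K * \<Delta> powr (-\<nu>) * (norm (u - 0) + min 1 (norm (v - 0)))"
        using R1 by (intro f_increment vs(2,5) uv(1,3)[unfolded R_def]) (simp_all add: R_def)
      also have "\<dots> \<le> K * \<Delta> powr (-\<nu>) * (norm u + 1)"
        using Kp K_ge(1) by (intro mult_left_mono) auto
      finally have "norm (f u v) \<le> K * \<Delta> powr (-\<nu>) * (norm u + 1) + K"
        using norm_triangle_sub[of "f u v" "f 0 0"] K_ge(3) by linarith
      also have "\<dots> \<le> K * \<Delta> powr (-\<nu>) * (norm u + 1) + K * \<Delta> powr (-\<nu>)"
        using Kp by simp
      also have "\<dots> = K * \<Delta> powr (-\<nu>) * (norm u + 2)"
        by (simp add: algebra_simps)
      finally have "(norm (f u v))\<^sup>2 \<le> (K * \<Delta> powr (-\<nu>) * (norm u + 2))\<^sup>2"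
        by (intro power_mono) auto
      also have "\<dots> \<le> (K * \<Delta> powr (-\<nu>))\<^sup>2 * (2 * (norm u)\<^sup>2 + 8)"
        unfolding power_mult_distrib[of "K * \<Delta> powr (-\<nu>)"]
        using sum_squares_bound[of "norm u" 2] by (intro mult_left_mono) (auto simp: power2_sum)
      also have "\<dots> \<le> (K * \<Delta> powr (-\<nu>))\<^sup>2 * (2 * norm u powr \<alpha> + 10)"
        using sq by (intro mult_left_mono) auto
      finally have "\<Delta> * (norm (f u v))\<^sup>2 \<le> \<Delta> * ((K * \<Delta> powr (-\<nu>))\<^sup>2 * (2 * norm u powr \<alpha> + 10))"
        using vs(2) by (intro mult_left_mono) auto
      also have "\<dots> = (\<Delta> * (K * \<Delta> powr (-\<nu>))\<^sup>2) * (2 * norm u powr \<alpha> + 10)"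
        by (simp only: mult.assoc)
      also have "\<dots> \<le> \<kappa> * (2 * norm u powr \<alpha> + 10)"
        unfolding \<kappa>_def using step_power[OF vs(2,3)] by (intro mult_right_mono) auto
      finally have 1: "\<Delta> * (norm (f u v))\<^sup>2 \<le> 2 * \<kappa> * norm u powr \<alpha> + 10 * \<kappa>"
        by (simp add: algebra_simps)
      have "\<gamma> * (norm u)\<^sup>2 + q ^ N * Q u u' \<le> \<gamma> * (norm u powr \<alpha> + 1) + exp (\<gamma> * \<tau>) * Q u u'"
        using sq \<gamma>(1) qN Q0 by (intro add_mono mult_right_mono mult_left_mono) auto
      also have "\<dots> = (\<gamma> + exp (\<gamma> * \<tau>) * a\<^sub>3) * norm u powr \<alpha> + \<gamma>"
        by (simp add: Q_def algebra_simps)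
      also have "\<dots> \<le> (a\<^sub>2 - 2 * \<kappa>) * norm u powr \<alpha> + \<gamma>"
        using \<gamma>(2) by (intro add_right_mono mult_right_mono) auto
      finally have 2: "\<gamma> * (norm u)\<^sup>2 + q ^ N * Q u u' \<le> a\<^sub>2 * norm u powr \<alpha> - 2 * \<kappa> * norm u powr \<alpha> + \<gamma>"
        by (simp add: left_diff_distrib)
      show "2 * ((u - u') \<bullet> (f u v - 0)) + (norm (g u v - 0))\<^sup>2 + \<Delta> * (norm (f u v - 0))\<^sup>2
        \<le> c - \<gamma> * (norm (u - u'))\<^sup>2 - q ^ N * Q u u' + Q v v'"
        using 1 2 dissipativity[of u v] z unfolding c_def by (simp add: Q_def)
    qed (use R1 in auto)
    also have "\<dots> \<le> L"
    proof -
      have "q * c / \<gamma> \<le> (1 + \<gamma>) * c / \<gamma>"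
        using q1 c0 \<gamma>(1) by (intro divide_right_mono mult_right_mono) auto
      then show ?thesis by (simp add: L_def)
    qed
    finally have "r\<^sup>2 * prob {\<omega>\<in>space M. \<exists>j\<le>N. (norm (?u (int (n + j)) \<omega>))\<^sup>2 \<ge> r\<^sup>2} \<le> L"
      by (simp add: em_zero)
    also have "\<dots> \<le> r\<^sup>2 * \<epsilon>" unfolding r2 using assms by simp
    finally have *: "prob {\<omega>\<in>space M. \<exists>j\<le>N. (norm (?u (int (n + j)) \<omega>))\<^sup>2 \<ge> r\<^sup>2} \<le> \<epsilon>"
      using r0 by simp
    have m: "?u k \<in> borel_measurable M" for k
      using \<tau> R1 by (intro em_measurable f_borel g_borel borel_measurable_ball_proj) auto
    from * prob_norm_gt_le[of N "\<lambda>j \<omega>. ?u (int (n + j)) \<omega>" r, OF m less_imp_le[OF r0]]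
    show "prob {\<omega>\<in>space M. \<exists>j\<le>N. norm (trunc_em N \<xi> (int (n + j)) \<omega>) > r} \<le> \<epsilon>"
      unfolding R_def \<Delta>_def by (rule order_trans[rotated])
  qed
qed

end

section \<open>Events of small outer probability\<close>

context prob_space
begin

text \<open>The set where \<open>P\<close> fails need not be measurable.\<close>

definition whp :: "real \<Rightarrow> ('a \<Rightarrow> bool) \<Rightarrow> bool" where
  "whp \<epsilon> P \<longleftrightarrow> (\<exists>B\<in>events. prob B \<le> \<epsilon> \<and> (\<forall>\<omega>\<in>space M - B. P \<omega>))"

lemma whp_mono:
  assumes "whp \<epsilon> P" "\<epsilon> \<le> \<epsilon>'" "\<And>\<omega>. \<omega> \<in> space M \<Longrightarrow> P \<omega> \<Longrightarrow> Q \<omega>"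
  shows "whp \<epsilon>' Q"
  using assms unfolding whp_def by (metis Diff_iff order_trans)

lemma whp_conj:
  assumes "whp \<epsilon>\<^sub>1 P" "whp \<epsilon>\<^sub>2 Q"
  shows "whp (\<epsilon>\<^sub>1 + \<epsilon>\<^sub>2) (\<lambda>\<omega>. P \<omega> \<and> Q \<omega>)"
proof -
  obtain A B where "A \<in> events" "prob A \<le> \<epsilon>\<^sub>1" "\<forall>\<omega>\<in>space M - A. P \<omega>"
    "B \<in> events" "prob B \<le> \<epsilon>\<^sub>2" "\<forall>\<omega>\<in>space M - B. Q \<omega>"
    using assms unfolding whp_def by blast
  moreover have "prob (A \<union> B) \<le> prob A + prob B" using calculation by (intro measure_Un_le)
  ultimately show ?thesis unfolding whp_def by (intro bexI[of _ "A \<union> B"]) auto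
qed

lemma whp_AE:
  assumes "AE \<omega> in M. P \<omega>"
  shows "whp 0 P"
proof -
  obtain N where "{\<omega>\<in>space M. \<not> P \<omega>} \<subseteq> N" "emeasure M N = 0" "N \<in> events"
    using AE_E[OF assms] by blast
  then show ?thesis unfolding whp_def by (intro bexI[of _ N]) (auto simp: measure_def)
qed

lemma whp_prob:
  assumes "{\<omega>\<in>space M. \<not> P \<omega>} \<in> events" "prob {\<omega>\<in>space M. \<not> P \<omega>} \<le> \<epsilon>"
  shows "whp \<epsilon> P"
  unfolding whp_def using assms by (intro bexI[of _ "{\<omega>\<in>space M. \<not> P \<omega>}"]) auto

lemma prob_whp:
  assumes "whp \<epsilon> P"
  shows "prob {\<omega>\<in>space M. \<not> P \<omega>} \<le> \<epsilon>"
proof -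
  obtain B where B: "B \<in> events" "prob B \<le> \<epsilon>" "\<forall>\<omega>\<in>space M - B. P \<omega>"
    using assms unfolding whp_def by blast
  then have "prob {\<omega>\<in>space M. \<not> P \<omega>} \<le> prob B"
    by (intro finite_measure_mono) auto
  with B(2) show ?thesis by simp
qed

text \<open>The events that some later \<open>P k\<close> fails decrease to the empty set, so their
  probabilities tend to 0. This turns a threshold depending on \<omega> into a deterministic
  one.\<close>

lemma whp_eventually:
  fixes P :: "nat \<Rightarrow> 'a \<Rightarrow> bool"
  assumes ev: "\<And>n. {\<omega>\<in>space M. P n \<omega>} \<in> events"
    and lim: "\<And>\<omega>. \<omega> \<in> space M \<Longrightarrow> \<exists>n\<^sub>0. \<forall>n\<ge>n\<^sub>0. P n \<omega>" and "\<epsilon> > 0"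
  obtains n\<^sub>0 where "\<And>n. n \<ge> n\<^sub>0 \<Longrightarrow> whp \<epsilon> (P n)"
proof -
  define C where "C n = (\<Union>k\<in>{n..}. space M - {\<omega>\<in>space M. P k \<omega>})" for n
  have Cev: "C n \<in> events" for n unfolding C_def using ev by (intro sets.countable_UN'') auto
  have "(\<lambda>n. prob (C n)) \<longlonglongrightarrow> prob (\<Inter>n. C n)"
    by (rule finite_Lim_measure_decseq) (use Cev in \<open>auto simp: decseq_def C_def\<close>)
  moreover have "(\<Inter>n. C n) = {}"
    using lim by (auto simp: C_def) blast
  ultimately have "(\<lambda>n. prob (C n)) \<longlonglongrightarrow> 0" by simp
  then obtain n0 where "\<And>n. n \<ge> n0 \<Longrightarrow> prob (C n) < \<epsilon>"
    using order_tendstoD(2)[of _ 0 sequentially, OF _ \<open>\<epsilon> > 0\<close>] by (auto simp: eventually_sequentially)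
  then have "whp \<epsilon> (P n)" if "n \<ge> n0" for n
    using that Cev unfolding whp_def by (intro bexI[of _ "C n"]) (auto simp: C_def less_imp_le)
  then show thesis by (rule that)
qed

end

section \<open>Sums against Brownian increments\<close>

context brownian_space
begin

text \<open>Freezing the integrand once its energy exceeds \<open>\<delta>\<close> makes the sum a square integrable martingale.\<close>

lemma increment_sum_tail:
  fixes k :: "nat \<Rightarrow> 'w \<Rightarrow> real^'m^'d"
  assumes p: "0 \<le> p 0" "\<And>i. i < m \<Longrightarrow> p i < p (Suc i)"
    and k: "\<And>i. i < m \<Longrightarrow> k i \<in> borel_measurable (F (p i))"
      "\<And>i \<omega>. i < m \<Longrightarrow> \<omega> \<in> space M \<Longrightarrow> norm (k i \<omega>) \<le> b"
    and "\<delta> \<ge> 0" "\<rho> > 0"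
  shows "whp (\<delta> / \<rho>\<^sup>2) (\<lambda>\<omega>. (\<Sum>i<m. (p (Suc i) - p i) * (norm (k i \<omega>))\<^sup>2) \<le> \<delta> \<longrightarrow>
    (\<forall>j\<le>m. norm (\<Sum>i<j. k i \<omega> *v (W (p (Suc i)) \<omega> - W (p i) \<omega>)) < \<rho>))"
proof -
  have p_mono: "p i \<le> p j" if "i \<le> j" "j \<le> m" for i j
    using that
  proof (induction j)
    case (Suc j)
    then show ?case using p(2)[of j] by (cases "i = Suc j") auto
  qed simp
  have p0: "0 \<le> p i" if "i \<le> m" for i using p_mono[of 0 i] p(1) that by simp
  define en where "en j \<omega> = (\<Sum>i<j. (p (Suc i) - p i) * (norm (k i \<omega>))\<^sup>2)" for j \<omega>
  define k' where "k' i \<omega> = (if en (Suc i) \<omega> \<le> \<delta> then k i \<omega> else 0)" for i \<omega>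
  define S where "S j \<omega> = (\<Sum>i<j. k' i \<omega> *v (W (p (Suc i)) \<omega> - W (p i) \<omega>))" for j \<omega>
  have en_mono: "en i \<omega> \<le> en j \<omega>" if "i \<le> j" "j \<le> m" for i j \<omega>
    unfolding en_def by (rule sum_mono2) (use that p(2) in \<open>auto intro!: mult_nonneg_nonneg simp: less_imp_le\<close>)
  have kF: "k i \<in> borel_measurable (F (p j))" if "i < m" "i \<le> j" "j \<le> m" for i j
    using k(1)[OF that(1)] by (rule measurable_F_mono) (use that p0 p_mono in auto)
  have enF: "en j \<in> borel_measurable (F (p l))" if "j \<le> Suc l" "l < m" for j l
    unfolding en_def using kF[of _ l] that by (intro borel_measurable_sum borel_measurable_times borel_measurable_power borel_measurable_norm) auto
  have k'F: "k' i \<in> borel_measurable (F (p i))" if "i < m" for i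
    unfolding k'_def using enF[of "Suc i" i] k(1)[OF that] that by measurable
  have k'b: "norm (k' i \<omega>) \<le> max b 0" if "i < m" "\<omega> \<in> space M" for i \<omega>
    using k(2)[OF that] by (auto simp: k'_def)
  have SF: "S j \<in> borel_measurable (F (p j))" if "j \<le> m" for j
    unfolding S_def
  proof (intro borel_measurable_sum borel_measurable_matrix_vector_mult borel_measurable_diff)
    fix i assume i: "i \<in> {..<j}"
    show "k' i \<in> borel_measurable (F (p j))"
      by (rule measurable_F_mono[OF k'F]) (use i that p0 p_mono in auto)
    show "W (p (Suc i)) \<in> borel_measurable (F (p j))" "W (p i) \<in> borel_measurable (F (p j))"
      by (rule measurable_F_mono[OF W_F]; use i that p0 p_mono in auto)+
  qed
  have k'2: "integrable M (\<lambda>\<omega>. (norm (k' i \<omega>))\<^sup>2)" if "i < m" for i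
  proof (rule integrable_const_bound[where B = "(max b 0)\<^sup>2"])
    show "AE \<omega> in M. norm ((norm (k' i \<omega>))\<^sup>2) \<le> (max b 0)\<^sup>2"
      using k'b[OF that] by (intro AE_I2) (simp add: power_mono)
    show "(\<lambda>\<omega>. (norm (k' i \<omega>))\<^sup>2) \<in> borel_measurable M"
      using measurable_F_M[OF k'F[OF that]] p0[of i] that by simp
  qed
  have S_Suc: "S (Suc j) \<omega> = S j \<omega> + k' j \<omega> *v (W (p (Suc j)) \<omega> - W (p j) \<omega>)" for j \<omega>
    by (simp add: S_def)
  have S2: "integrable M (\<lambda>\<omega>. (norm (S j \<omega>))\<^sup>2)" if "j \<le> m" for j
    using that
  proof (induction j)
    case 0 then show ?case by (simp add: S_def)
  next
    case (Suc j)
    then show ?case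
      unfolding S_Suc by (intro increment_L2(1) p0 p(2) SF k'F k'2) auto
  qed
  have en': "(\<Sum>i<j. (p (Suc i) - p i) * (norm (k' i \<omega>))\<^sup>2) \<le> \<delta>" if "j \<le> m" for j \<omega>
    using that
  proof (induction j)
    case 0 then show ?case using \<open>\<delta> \<ge> 0\<close> by simp
  next
    case (Suc j)
    show ?case
    proof (cases "en (Suc j) \<omega> \<le> \<delta>")
      case True
      have "(\<Sum>i<Suc j. (p (Suc i) - p i) * (norm (k' i \<omega>))\<^sup>2) \<le> en (Suc j) \<omega>"
        unfolding en_def
      proof (rule sum_mono)
        fix i assume "i \<in> {..<Suc j}"
        then have "0 \<le> p (Suc i) - p i" using p(2)[of i] Suc.prems by simp
        then show "(p (Suc i) - p i) * (norm (k' i \<omega>))\<^sup>2 \<le> (p (Suc i) - p i) * (norm (k i \<omega>))\<^sup>2"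
          by (intro mult_left_mono) (auto simp: k'_def)
      qed
      then show ?thesis using True by simp
    next
      case False
      then have "k' j \<omega> = 0" by (simp add: k'_def)
      then show ?thesis using Suc by simp
    qed
  qed
  have "\<rho>\<^sup>2 * prob {\<omega>\<in>space M. \<exists>j\<le>m. (norm (S j \<omega>))\<^sup>2 \<ge> \<rho>\<^sup>2} \<le>
    expectation (\<lambda>\<omega>. (norm (S 0 \<omega>))\<^sup>2) + (\<Sum>j<m. expectation (\<lambda>\<omega>. (p (Suc j) - p j) * (norm (k' j \<omega>))\<^sup>2))"
  proof (rule maximal_inequality[where G = "\<lambda>j. F (p j)"])
    fix j B assume j: "j < m" and B: "B \<in> sets (F (p j))"
    have "expectation (\<lambda>\<omega>. (norm (S (Suc j) \<omega>))\<^sup>2 * indicator B \<omega>) =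
      expectation (\<lambda>\<omega>. ((norm (S j \<omega>))\<^sup>2 + (p (Suc j) - p j) * (norm (k' j \<omega>))\<^sup>2) * indicator B \<omega>)"
      unfolding S_Suc using j B by (intro increment_L2_set p0 p(2) SF k'F k'2 S2) auto
    then show "expectation (\<lambda>\<omega>. (norm (S (Suc j) \<omega>))\<^sup>2 * indicator B \<omega>) \<le>
      expectation (\<lambda>\<omega>. ((norm (S j \<omega>))\<^sup>2 + (p (Suc j) - p j) * (norm (k' j \<omega>))\<^sup>2) * indicator B \<omega>)" by simp
  next
    show "(\<lambda>\<omega>. (norm (S j \<omega>))\<^sup>2) \<in> borel_measurable (F (p j))" if "j \<le> m" for j
      using SF[OF that] by simp
    show "0 \<le> (p (Suc j) - p j) * (norm (k' j \<omega>))\<^sup>2" if "j < m" for j \<omega>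
      using p(2)[OF that] by simp
    show "subalgebra M (F (p j))" if "j \<le> m" for j by (intro subalgebra_F p0 that)
    show "sets (F (p i)) \<subseteq> sets (F (p j))" if "i \<le> j" "j \<le> m" for i j
      using that p_mono p0[of i] by (intro sets_F_mono) auto
  qed (use S2 k'2 in simp_all)
  also have "\<dots> = expectation (\<lambda>\<omega>. \<Sum>j<m. (p (Suc j) - p j) * (norm (k' j \<omega>))\<^sup>2)"
    using k'2 by (simp add: S_def)
  also have "\<dots> \<le> expectation (\<lambda>\<omega>. \<delta>)"
    using k'2 en'[of m] by (intro integral_mono) auto
  finally have "prob {\<omega>\<in>space M. \<exists>j\<le>m. (norm (S j \<omega>))\<^sup>2 \<ge> \<rho>\<^sup>2} \<le> \<delta> / \<rho>\<^sup>2"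
    using \<open>\<rho> > 0\<close> by (simp add: prob_space field_simps)
  moreover have "{\<omega>\<in>space M. \<exists>j\<le>m. (norm (S j \<omega>))\<^sup>2 \<ge> \<rho>\<^sup>2} \<in> events"
  proof -
    have "{\<omega>\<in>space M. (norm (S j \<omega>))\<^sup>2 \<ge> \<rho>\<^sup>2} \<in> events" if "j \<le> m" for j
      using measurable_F_M[OF SF[OF that]] p0[OF that] by simp
    then have "(\<Union>j\<in>{..m}. {\<omega>\<in>space M. (norm (S j \<omega>))\<^sup>2 \<ge> \<rho>\<^sup>2}) \<in> events" by auto
    also have "(\<Union>j\<in>{..m}. {\<omega>\<in>space M. (norm (S j \<omega>))\<^sup>2 \<ge> \<rho>\<^sup>2}) = {\<omega>\<in>space M. \<exists>j\<le>m. (norm (S j \<omega>))\<^sup>2 \<ge> \<rho>\<^sup>2}" by auto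
    finally show ?thesis .
  qed
  ultimately have "whp (\<delta> / \<rho>\<^sup>2) (\<lambda>\<omega>. \<not> (\<exists>j\<le>m. (norm (S j \<omega>))\<^sup>2 \<ge> \<rho>\<^sup>2))"
    by (intro whp_prob) (simp_all only: not_not)
  then show ?thesis
  proof (rule whp_mono)
    fix \<omega> assume \<omega>: "\<omega> \<in> space M" and *: "\<not> (\<exists>j\<le>m. (norm (S j \<omega>))\<^sup>2 \<ge> \<rho>\<^sup>2)"
    show "(\<Sum>i<m. (p (Suc i) - p i) * (norm (k i \<omega>))\<^sup>2) \<le> \<delta> \<longrightarrow>
      (\<forall>j\<le>m. norm (\<Sum>i<j. k i \<omega> *v (W (p (Suc i)) \<omega> - W (p i) \<omega>)) < \<rho>)"
    proof (intro impI allI)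
      fix j assume e: "(\<Sum>i<m. (p (Suc i) - p i) * (norm (k i \<omega>))\<^sup>2) \<le> \<delta>" and j: "j \<le> m"
      have "k' i \<omega> = k i \<omega>" if "i < j" for i
        using en_mono[of "Suc i" m \<omega>] e that j unfolding k'_def en_def by auto
      then have "S j \<omega> = (\<Sum>i<j. k i \<omega> *v (W (p (Suc i)) \<omega> - W (p i) \<omega>))"
        by (simp add: S_def)
      moreover have "(norm (S j \<omega>))\<^sup>2 < \<rho>\<^sup>2" using * j by auto
      then have "norm (S j \<omega>) < \<rho>"
        using \<open>\<rho> > 0\<close> power_less_imp_less_base[of "norm (S j \<omega>)" 2 \<rho>] by simp
      ultimately show "norm (\<Sum>i<j. k i \<omega> *v (W (p (Suc i)) \<omega> - W (p i) \<omega>)) < \<rho>" by simp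
    qed
  qed simp
qed

end

section \<open>Simple integrals on a refined partition\<close>

text \<open>Only the overlap of the window from \<open>a\<close> to \<open>b\<close> with the first
  \<open>j\<close> indices telescopes; the minima mirror those in
  \<open>simple_integral\<close>.\<close>

lemma telescope_window:
  fixes w :: "nat \<Rightarrow> 'b::ab_group_add"
  assumes "a \<le> b"
  shows "(\<Sum>i<j. if a \<le> i \<and> i < b then w (Suc i) - w i else 0) = w (min b j) - w (min a j)"
proof (induction j)
  case (Suc j)
  consider "j < a" | "a \<le> j" "j < b" | "b \<le> j" by linarith
  then show ?case using Suc assms by cases (auto simp: min_def not_le le_Suc_eq)
qed simp

lemma matrix_vector_mult_sum_left: "(\<Sum>i\<in>I. A i) *v v = (\<Sum>i\<in>I. A i *v v)" for A :: "'i \<Rightarrow> real^'m^'n"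
  by (induction I rule: infinite_finite_induct) (auto simp: matrix_vector_mult_add_rdistrib)

lemma matrix_vector_mult_sum_right: "A *v (\<Sum>i\<in>I. v i) = (\<Sum>i\<in>I. A *v v i)" for A :: "real^'m^'n"
  by (induction I rule: infinite_finite_induct) (auto simp: matrix_vector_right_distrib)

text \<open>\<open>p\<close> enumerates a partition refining the times \<open>s j = p (\<sigma> j)\<close> of the simple integrand.\<close>

lemma simple_integral_refined:
  fixes p :: "nat \<Rightarrow> real"
  assumes p: "\<And>i j. i < j \<Longrightarrow> j \<le> L \<Longrightarrow> p i < p j"
    and \<sigma>: "\<And>j. j \<le> n \<Longrightarrow> \<sigma> j \<le> L \<and> s j = p (\<sigma> j)" and s: "\<And>j. j < n \<Longrightarrow> s j < s (Suc j)"
    and "J \<le> L"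
  shows "simple_integral W n s H (p J) \<omega> =
    (\<Sum>i<J. simple_process n s H (p (Suc i)) \<omega> *v (W (p (Suc i)) \<omega> - W (p i) \<omega>))"
proof -
  have less: "p i < p j \<longleftrightarrow> i < j" "p i \<le> p j \<longleftrightarrow> i \<le> j" if "i \<le> L" "j \<le> L" for i j
    using p[of i j] p[of j i] that by (cases i j rule: linorder_cases; auto)+
  have pm: "min (p i) (p j) = p (min i j)" if "i \<le> L" "j \<le> L" for i j
    using less[OF that] by (auto simp: min_def)
  have "(\<Sum>i<J. simple_process n s H (p (Suc i)) \<omega> *v (W (p (Suc i)) \<omega> - W (p i) \<omega>)) =
    (\<Sum>i<J. \<Sum>l<n. (if \<sigma> l \<le> i \<and> i < \<sigma> (Suc l) then H l \<omega> *v (W (p (Suc i)) \<omega> - W (p i) \<omega>) else 0))"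
    unfolding simple_process_def matrix_vector_mult_sum_left
  proof (intro sum.cong refl)
    fix i l assume i: "i \<in> {..<J}" and l: "l \<in> {..<n}"
    \<comment> \<open>Membership of the right end decides for the whole half-open cell, since the
      times of the integrand are among the partition points.\<close>
    have "p (Suc i) \<in> {s l<..s (Suc l)} \<longleftrightarrow> \<sigma> l \<le> i \<and> i < \<sigma> (Suc l)"
      using \<sigma>[of l] \<sigma>[of "Suc l"] less[of "\<sigma> l" "Suc i"] less[of "Suc i" "\<sigma> (Suc l)"] i l \<open>J \<le> L\<close> by auto
    then show "(indicator {s l<..s (Suc l)} (p (Suc i)) *\<^sub>R H l \<omega>) *v (W (p (Suc i)) \<omega> - W (p i) \<omega>) =
      (if \<sigma> l \<le> i \<and> i < \<sigma> (Suc l) then H l \<omega> *v (W (p (Suc i)) \<omega> - W (p i) \<omega>) else 0)"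
      by (simp add: indicator_def)
  qed
  also have "\<dots> = (\<Sum>l<n. H l \<omega> *v (\<Sum>i<J. if \<sigma> l \<le> i \<and> i < \<sigma> (Suc l) then W (p (Suc i)) \<omega> - W (p i) \<omega> else 0))"
    unfolding matrix_vector_mult_sum_right by (subst sum.swap) (intro sum.cong refl; simp)
  also have "\<dots> = (\<Sum>l<n. H l \<omega> *v (W (min (s (Suc l)) (p J)) \<omega> - W (min (s l) (p J)) \<omega>))"
  proof (intro sum.cong refl arg_cong2[where f = "(*v)"])
    fix l assume l: "l \<in> {..<n}"
    have "\<sigma> l < \<sigma> (Suc l)" using \<sigma>[of l] \<sigma>[of "Suc l"] s[of l] less(1)[of "\<sigma> l" "\<sigma> (Suc l)"] l by auto
    then show "(\<Sum>i<J. if \<sigma> l \<le> i \<and> i < \<sigma> (Suc l) then W (p (Suc i)) \<omega> - W (p i) \<omega> else 0) =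
      W (min (s (Suc l)) (p J)) \<omega> - W (min (s l) (p J)) \<omega>"
      using telescope_window[of "\<sigma> l" "\<sigma> (Suc l)" "\<lambda>i. W (p i) \<omega>" J] \<sigma>[of l] \<sigma>[of "Suc l"] l \<open>J \<le> L\<close>
      by (simp add: pm)
  qed
  finally show ?thesis by (simp add: simple_integral_def)
qed

text \<open>No time of the integrand lies strictly inside a cell, and intervals and cells are both
  open on the left; the process is therefore constant on the cell, with the value at its right
  end.\<close>

lemma simple_process_refined:
  fixes p :: "nat \<Rightarrow> real"
  assumes p: "\<And>i j. i < j \<Longrightarrow> j \<le> L \<Longrightarrow> p i < p j"
    and \<sigma>: "\<And>j. j \<le> n \<Longrightarrow> \<sigma> j \<le> L \<and> s j = p (\<sigma> j)"
    and "i < L" "r \<in> {p i<..p (Suc i)}"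
  shows "simple_process n s H r \<omega> = simple_process n s H (p (Suc i)) \<omega>"
  unfolding simple_process_def
proof (intro sum.cong refl arg_cong2[where f = scaleR])
  have le: "p j \<le> p i" if "j \<le> i" for j using p[of j i] that \<open>i < L\<close> by (cases "j = i") auto
  have ge: "p (Suc i) \<le> p j" if "Suc i \<le> j" "j \<le> L" for j using p[of "Suc i" j] that by (cases "j = Suc i") auto
  have lt: "p j < r \<longleftrightarrow> p j < p (Suc i)" if "j \<le> L" for j
    using le[of j] ge[of j] assms(4) that by (cases "j \<le> i") auto
  fix l assume l: "l \<in> {..<n}"
  show "indicator {s l<..s (Suc l)} r = (indicator {s l<..s (Suc l)} (p (Suc i)) :: real)"
    using lt[of "\<sigma> l"] lt[of "\<sigma> (Suc l)"] \<sigma>[of l] \<sigma>[of "Suc l"] l by (auto simp: indicator_def not_le[symmetric])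
qed

lemma common_refinement:
  fixes P :: "real set"
  assumes "finite P" "P \<noteq> {}"
  obtains L :: nat and p :: "nat \<Rightarrow> real" where "strict_mono_on {..L} p" "P = p ` {..L}"
proof -
  define xs where "xs = sorted_list_of_set P"
  define L where "L = length xs - 1"
  have xs: "sorted_wrt (<) xs" "set xs = P" using assms by (simp_all add: xs_def)
  then have ne: "length xs > 0" using assms(2) by auto
  show thesis
  proof (rule that[of L "\<lambda>i. xs ! i"])
    show "strict_mono_on {..L} (\<lambda>i. xs ! i)"
      using xs(1) ne unfolding sorted_wrt_iff_nth_less L_def by (auto intro!: strict_mono_onI)
    have "{..L} = {..<length xs}" using ne unfolding L_def by (simp add: lessThan_Suc_atMost[symmetric] del: length_greater_0_conv)
    then show "P = (\<lambda>i. xs ! i) ` {..L}" using xs(2) by (auto simp: set_conv_nth)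
  qed
qed

section \<open>Approximation of the Ito integral by Riemann sums\<close>

context brownian_space
begin

lemma simple_integral_measurable:
  assumes "simple_integrand M F n s H" "0 \<le> t"
  shows "simple_integral W n s H t \<in> borel_measurable M"
proof -
  have s0: "0 \<le> s j" if "j \<le> n" for j
    using assms(1) that
  proof (induction j)
    case (Suc j)
    then have "s j < s (Suc j)" "0 \<le> s j" by (auto simp: simple_integrand_def)
    then show ?case by simp
  qed (simp add: simple_integrand_def)
  have "H j \<in> borel_measurable M" if "j < n" for j
    using assms(1) that s0[of j] measurable_F_M[of "H j" "s j" borel] by (auto simp: simple_integrand_def)
  then show ?thesis
    unfolding simple_integral_def[abs_def] using s0 assms(2)
    by (intro borel_measurable_sum borel_measurable_matrix_vector_mult borel_measurable_diff W_M) auto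
qed

text \<open>Progressive measurability is joint in time and \<omega> on \<open>{0..T}\<close> with
  respect to \<open>F T\<close>. Exchanging the two coordinates and enlarging \<open>F T\<close> to
  \<open>M\<close> permits integration over time; a section gives the measurability of single
  paths.\<close>

lemma energy_measurable:
  assumes si: "simple_integrand M F n s H" and ito: "ito_integral M F W \<phi> I" and "0 \<le> T"
  shows "(\<lambda>\<omega>. \<integral>\<^sup>+ r\<in>{0..T}. ennreal ((norm (simple_process n s H r \<omega> - \<phi> r \<omega>))\<^sup>2) \<partial>lborel) \<in> borel_measurable M"
    and "\<And>\<omega>. \<omega> \<in> space M \<Longrightarrow> (\<lambda>r. \<phi> r \<omega>) \<in> borel_measurable (restrict_space borel {0..T})"
proof -
  let ?R = "restrict_space borel {0..T}"
  have id: "(\<lambda>\<omega>. \<omega>) \<in> measurable M (F T)"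
    by (rule measurable_F_M[OF measurable_ident_sets[OF refl] \<open>0 \<le> T\<close>])
  have \<phi>: "(\<lambda>(r, \<omega>). \<phi> r \<omega>) \<in> borel_measurable (?R \<Otimes>\<^sub>M F T)"
    using ito \<open>0 \<le> T\<close> by (simp add: ito_integral_def)
  show "(\<lambda>r. \<phi> r \<omega>) \<in> borel_measurable ?R" if "\<omega> \<in> space M" for \<omega>
    using measurable_compose[OF measurable_Pair2' \<phi>, of \<omega>] that space_F[OF \<open>0 \<le> T\<close>] by simp
  have \<phi>M: "(\<lambda>x. \<phi> (snd x) (fst x)) \<in> borel_measurable (M \<Otimes>\<^sub>M ?R)"
  proof -
    have "(\<lambda>x. (snd x, fst x)) \<in> measurable (M \<Otimes>\<^sub>M ?R) (?R \<Otimes>\<^sub>M F T)"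
      by (intro measurable_Pair measurable_snd measurable_compose[OF measurable_fst id])
    from measurable_compose[OF this \<phi>] show ?thesis by simp
  qed
  have s0: "0 \<le> s j" if "j \<le> n" for j
    using si that
  proof (induction j)
    case (Suc j)
    then have "s j < s (Suc j)" "0 \<le> s j" by (auto simp: simple_integrand_def)
    then show ?case by simp
  qed (simp add: simple_integrand_def)
  have H: "(\<lambda>x. H j (fst x)) \<in> borel_measurable (M \<Otimes>\<^sub>M ?R)" if "j < n" for j
    using si that s0[of j] measurable_F_M[of "H j" "s j" borel] by (auto simp: simple_integrand_def)
  have sn: "(\<lambda>x. snd x) \<in> borel_measurable (M \<Otimes>\<^sub>M ?R)"
    by (rule measurable_compose[OF measurable_snd measurable_restrict_space1]) simp
  have "(\<lambda>x. simple_process n s H (snd x) (fst x)) \<in> borel_measurable (M \<Otimes>\<^sub>M ?R)"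
    unfolding simple_process_def
    by (intro borel_measurable_sum borel_measurable_scaleR H measurable_compose[OF sn borel_measurable_indicator]) auto
  then have "(\<lambda>x. ennreal ((norm (simple_process n s H (snd x) (fst x) - \<phi> (snd x) (fst x)))\<^sup>2)) \<in> borel_measurable (M \<Otimes>\<^sub>M ?R)"
    using \<phi>M by measurable
  then have m: "(\<lambda>(\<omega>, r). ennreal ((norm (simple_process n s H r \<omega> - \<phi> r \<omega>))\<^sup>2)) \<in> borel_measurable (M \<Otimes>\<^sub>M restrict_space lborel {0..T})"
    by (subst measurable_cong_sets[where M' = "M \<Otimes>\<^sub>M ?R" and N' = borel])
      (auto simp: case_prod_beta intro!: sets_pair_measure_cong sets_restrict_space_cong)
  interpret R: sigma_finite_measure "restrict_space lborel {0..T}"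
    by (intro sigma_finite_measure_restrict_space lborel.sigma_finite_measure_axioms) simp
  have "(\<lambda>\<omega>. \<integral>\<^sup>+ r. ennreal ((norm (simple_process n s H r \<omega> - \<phi> r \<omega>))\<^sup>2) \<partial>restrict_space lborel {0..T}) \<in> borel_measurable M"
    using R.borel_measurable_nn_integral[OF m] by simp
  then show "(\<lambda>\<omega>. \<integral>\<^sup>+ r\<in>{0..T}. ennreal ((norm (simple_process n s H r \<omega> - \<phi> r \<omega>))\<^sup>2) \<partial>lborel) \<in> borel_measurable M"
    by (simp add: nn_integral_restrict_space)
qed

text \<open>The definition of the Ito integral bounds \<open>measure\<close> of two sets, and
  \<open>measure\<close> is 0 on a set that is not an event. Smallness is therefore informative only
  after both sets are shown to be events.\<close>

lemma ito_approximation: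
  assumes ito: "ito_integral M F W \<phi> I" and "T > 0" "\<epsilon> > 0" "\<delta> > 0"
  obtains n s H where "simple_integrand M F n s H"
    "whp \<epsilon> (\<lambda>\<omega>. (\<integral>\<^sup>+ r\<in>{0..T}. ennreal ((norm (simple_process n s H r \<omega> - \<phi> r \<omega>))\<^sup>2) \<partial>lborel) \<le> ennreal \<delta>)"
    "whp \<epsilon> (\<lambda>\<omega>. \<forall>t\<in>{0..T}. norm (simple_integral W n s H t \<omega> - I t \<omega>) \<le> \<delta>)"
proof -
  obtain n s H where si: "\<And>k. simple_integrand M F (n k) (s k) (H k)"
    and l1: "(\<lambda>k. prob {\<omega>\<in>space M. (\<integral>\<^sup>+ r\<in>{0..T}. ennreal ((norm (simple_process (n k) (s k) (H k) r \<omega> - \<phi> r \<omega>))\<^sup>2) \<partial>lborel)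
             > ennreal \<delta>}) \<longlonglongrightarrow> 0"
    and l2: "(\<lambda>k. prob {\<omega>\<in>space M. \<exists>t\<in>{0..T}. norm (simple_integral W (n k) (s k) (H k) t \<omega> - I t \<omega>) > \<delta>}) \<longlonglongrightarrow> 0"
    using ito \<open>T > 0\<close> \<open>\<delta> > 0\<close> unfolding ito_integral_def by (meson less_imp_le)
  have "\<forall>\<^sub>F k in sequentially. prob {\<omega>\<in>space M. (\<integral>\<^sup>+ r\<in>{0..T}. ennreal ((norm (simple_process (n k) (s k) (H k) r \<omega> - \<phi> r \<omega>))\<^sup>2) \<partial>lborel)
             > ennreal \<delta>} < \<epsilon> \<and>
    prob {\<omega>\<in>space M. \<exists>t\<in>{0..T}. norm (simple_integral W (n k) (s k) (H k) t \<omega> - I t \<omega>) > \<delta>} < \<epsilon>"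
    by (intro eventually_conj order_tendstoD(2)[OF l1] order_tendstoD(2)[OF l2] \<open>\<epsilon> > 0\<close>)
  then obtain k where k: "prob {\<omega>\<in>space M. (\<integral>\<^sup>+ r\<in>{0..T}. ennreal ((norm (simple_process (n k) (s k) (H k) r \<omega> - \<phi> r \<omega>))\<^sup>2) \<partial>lborel)
             > ennreal \<delta>} < \<epsilon>"
    "prob {\<omega>\<in>space M. \<exists>t\<in>{0..T}. norm (simple_integral W (n k) (s k) (H k) t \<omega> - I t \<omega>) > \<delta>} < \<epsilon>"
    by (auto dest: eventually_happens)
  define D where "D t \<omega> = norm (simple_integral W (n k) (s k) (H k) t \<omega> - I t \<omega>)" for t \<omega>
  have IM: "I t \<in> borel_measurable M" if "0 \<le> t" for t
    using ito that measurable_F_M[of "I t" t borel] by (auto simp: ito_integral_def)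
  have DM: "D t \<in> borel_measurable M" if "0 \<le> t" for t
    unfolding D_def using simple_integral_measurable[OF si that] IM[OF that] by measurable
  have s0: "0 \<le> s k j" if "j \<le> n k" for j
    using si[of k] that
  proof (induction j)
    case (Suc j)
    then have "s k j < s k (Suc j)" "0 \<le> s k j" by (auto simp: simple_integrand_def)
    then show ?case by simp
  qed (simp add: simple_integrand_def)
  have Dc: "AE \<omega> in M. continuous_on {0..T} (\<lambda>t. D t \<omega>)"
  proof -
    have "AE \<omega> in M. continuous_on {0..} (\<lambda>t. I t \<omega>)" using ito by (simp add: ito_integral_def)
    with W_continuous show ?thesis
    proof eventually_elim
      case (elim \<omega>)
      have "continuous_on {0..} (\<lambda>t. W (min (s k j) t) \<omega>)" if "j \<le> n k" for j
        by (rule continuous_on_compose2[OF elim(1)]) (use s0[OF that] in \<open>auto intro!: continuous_intros\<close>)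
      then have "continuous_on {0..} (\<lambda>t. D t \<omega>)"
        unfolding D_def simple_integral_def using elim(2)
        by (intro continuous_intros bounded_linear.continuous_on[OF matrix_vector_mul_bounded_linear]) auto
      then show ?case by (rule continuous_on_subset) auto
    qed
  qed
  \<comment> \<open>Almost surely, by continuity, the uncountable supremum is decided at rational
    times; completeness removes the exceptional null set.\<close>
  have ev: "{\<omega>\<in>space M. \<exists>t\<in>{0..T}. D t \<omega> > \<delta>} \<in> events"
  proof (rule events_AE_cong)
    have "{\<omega>\<in>space M. \<forall>t\<in>\<rat> \<inter> {0<..<T}. D t \<omega> \<le> \<delta>} \<in> events"
    proof (rule sets.sets_Collect_countable_All')
      show "{\<omega>\<in>space M. D t \<omega> \<le> \<delta>} \<in> events" if "t \<in> \<rat> \<inter> {0<..<T}" for t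
        using DM[of t] that by simp
    qed (auto intro: countable_Int1 countable_rat)
    then show "space M - {\<omega>\<in>space M. \<forall>t\<in>\<rat> \<inter> {0<..<T}. D t \<omega> \<le> \<delta>} \<in> events" by auto
    show "AE \<omega> in M. \<omega> \<in> space M - {\<omega>\<in>space M. \<forall>t\<in>\<rat> \<inter> {0<..<T}. D t \<omega> \<le> \<delta>} \<longleftrightarrow>
      \<omega> \<in> {\<omega>\<in>space M. \<exists>t\<in>{0..T}. D t \<omega> > \<delta>}"
      using Dc
    proof eventually_elim
      case (elim \<omega>)
      have "(\<forall>t\<in>\<rat> \<inter> {0<..<T}. D t \<omega> \<le> \<delta>) \<longleftrightarrow> (\<forall>t\<in>{0..T}. D t \<omega> \<le> \<delta>)"
        using continuous_le_on_closure[of "\<rat> \<inter> {0<..<T}" "\<lambda>t. D t \<omega>" _ \<delta>] elim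
        by (auto simp: closure_Rats_interval[OF \<open>T > 0\<close>])
      then show ?case by (auto simp: not_le)
    qed
  qed auto
  show thesis
  proof (rule that[OF si[of k]])
    show "whp \<epsilon> (\<lambda>\<omega>. (\<integral>\<^sup>+ r\<in>{0..T}. ennreal ((norm (simple_process (n k) (s k) (H k) r \<omega> - \<phi> r \<omega>))\<^sup>2) \<partial>lborel) \<le> ennreal \<delta>)"
    proof (rule whp_prob)
      show "{\<omega>\<in>space M. \<not> (\<integral>\<^sup>+ r\<in>{0..T}. ennreal ((norm (simple_process (n k) (s k) (H k) r \<omega> - \<phi> r \<omega>))\<^sup>2) \<partial>lborel) \<le> ennreal \<delta>} \<in> events"
        using energy_measurable(1)[OF si[of k] ito less_imp_le[OF \<open>T > 0\<close>]] by measurable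
    qed (use k(1) in \<open>simp add: not_le\<close>)
    show "whp \<epsilon> (\<lambda>\<omega>. \<forall>t\<in>{0..T}. norm (simple_integral W (n k) (s k) (H k) t \<omega> - I t \<omega>) \<le> \<delta>)"
    proof (rule whp_prob)
      have "{\<omega>\<in>space M. \<not> (\<forall>t\<in>{0..T}. norm (simple_integral W (n k) (s k) (H k) t \<omega> - I t \<omega>) \<le> \<delta>)}
        = {\<omega>\<in>space M. \<exists>t\<in>{0..T}. D t \<omega> > \<delta>}" by (auto simp: D_def not_le)
      then show "{\<omega>\<in>space M. \<not> (\<forall>t\<in>{0..T}. norm (simple_integral W (n k) (s k) (H k) t \<omega> - I t \<omega>) \<le> \<delta>)} \<in> events"
        "prob {\<omega>\<in>space M. \<not> (\<forall>t\<in>{0..T}. norm (simple_integral W (n k) (s k) (H k) t \<omega> - I t \<omega>) \<le> \<delta>)} \<le> \<epsilon>"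
        using ev k(2) by (auto simp: D_def)
    qed
  qed
qed

text \<open>An integrand that is active on the cell after \<open>p i\<close> was fixed at a
  partition point before the end of that cell, hence at \<open>p i\<close> or earlier. So the value
  on the cell is known when the cell begins.\<close>

lemma simple_process_refined_measurable:
  fixes p :: "nat \<Rightarrow> real"
  assumes p: "\<And>i j. i < j \<Longrightarrow> j \<le> L \<Longrightarrow> p i < p j" and "0 \<le> p 0"
    and \<sigma>: "\<And>j. j \<le> n \<Longrightarrow> \<sigma> j \<le> L \<and> s j = p (\<sigma> j)"
    and si: "simple_integrand M F n s H" and "i < L"
  shows "(\<lambda>\<omega>. simple_process n s H (p (Suc i)) \<omega>) \<in> borel_measurable (F (p i))"
    and "\<exists>b. \<forall>\<omega>\<in>space M. norm (simple_process n s H (p (Suc i)) \<omega>) \<le> b"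
proof -
  have p_le: "p j \<le> p k" if "j \<le> k" "k \<le> L" for j k using p[of j k] that by (cases "j = k") auto
  show "(\<lambda>\<omega>. simple_process n s H (p (Suc i)) \<omega>) \<in> borel_measurable (F (p i))"
    unfolding simple_process_def
  proof (rule borel_measurable_sum)
    fix l assume l: "l \<in> {..<n}"
    show "(\<lambda>\<omega>. indicator {s l<..s (Suc l)} (p (Suc i)) *\<^sub>R H l \<omega>) \<in> borel_measurable (F (p i))"
    proof (cases "s l < p (Suc i)")
      case True
      then have "\<sigma> l \<le> i" using \<sigma>[of l] p_le[of "Suc i" "\<sigma> l"] l by (cases "\<sigma> l \<le> i") auto
      then have "s l \<le> p i" "0 \<le> s l" using \<sigma>[of l] l p_le[of "\<sigma> l" i] p_le[of 0 "\<sigma> l"] \<open>i < L\<close> \<open>0 \<le> p 0\<close> by auto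
      moreover have "H l \<in> borel_measurable (F (s l))" using si l by (simp add: simple_integrand_def)
      ultimately have "H l \<in> borel_measurable (F (p i))" by (metis measurable_F_mono)
      then show ?thesis by simp
    qed simp
  qed
  have "\<exists>b. \<forall>\<omega>\<in>space M. norm (H l \<omega>) \<le> b" if "l < n" for l
    using si that unfolding simple_integrand_def bounded_iff ball_simps by blast
  then obtain b where b: "\<And>l \<omega>. l < n \<Longrightarrow> \<omega> \<in> space M \<Longrightarrow> norm (H l \<omega>) \<le> b l" by metis
  have "norm (simple_process n s H (p (Suc i)) \<omega>) \<le> (\<Sum>l<n. b l)" if "\<omega> \<in> space M" for \<omega>
    unfolding simple_process_def
  proof (rule sum_norm_le)
    fix l assume "l \<in> {..<n}"
    then show "norm (indicator {s l<..s (Suc l)} (p (Suc i)) *\<^sub>R H l \<omega>) \<le> b l"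
      using b[of l \<omega>] that order_trans[OF norm_ge_zero b[of l \<omega>]] by (auto simp: indicator_def)
  qed
  then show "\<exists>b. \<forall>\<omega>\<in>space M. norm (simple_process n s H (p (Suc i)) \<omega>) \<le> b" by blast
qed

lemma simple_integral_grid:
  assumes t: "\<And>i. i < k \<Longrightarrow> t i < t (Suc i)" and "j \<le> k"
  shows "simple_integral W k t \<psi> (t j) \<omega> = (\<Sum>i<j. \<psi> i \<omega> *v (W (t (Suc i)) \<omega> - W (t i) \<omega>))"
proof -
  have mono: "t i \<le> t l" if "i \<le> l" "l \<le> k" for i l
    using that
  proof (induction l)
    case (Suc l) then show ?case using t[of l] by (cases "i = Suc l") auto
  qed simp
  have "simple_integral W k t \<psi> (t j) \<omega> = (\<Sum>i<k. if i < j then \<psi> i \<omega> *v (W (t (Suc i)) \<omega> - W (t i) \<omega>) else 0)"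
    unfolding simple_integral_def
  proof (intro sum.cong refl)
    fix i assume i: "i \<in> {..<k}"
    show "\<psi> i \<omega> *v (W (min (t (Suc i)) (t j)) \<omega> - W (min (t i) (t j)) \<omega>) = (if i < j then \<psi> i \<omega> *v (W (t (Suc i)) \<omega> - W (t i) \<omega>) else 0)"
      using mono[of "Suc i" j] mono[of i j] mono[of j i] mono[of j "Suc i"] i \<open>j \<le> k\<close>
      by (cases "i < j") (auto simp: min_absorb1 min_absorb2)
  qed
  also have "\<dots> = (\<Sum>i<j. \<psi> i \<omega> *v (W (t (Suc i)) \<omega> - W (t i) \<omega>))"
    using \<open>j \<le> k\<close> by (intro sum.mono_neutral_cong_right) auto
  finally show ?thesis .
qed

text \<open>Both sums live on a common refinement of the two partitions, where their difference is a
  sum against increments with adapted coefficients. Its energy is controlled through \<phi>, which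
  is close to the simple integrand in L^2 and to the grid integrand uniformly.\<close>

lemma simple_integral_vs_riemann_sum:
  assumes si: "simple_integrand M F n s H" and ito: "ito_integral M F W \<phi> I"
    and gi: "simple_integrand M F k t \<psi>" and t: "t 0 = 0" "t k = T" "T > 0"
    and "\<rho> > 0" "\<delta> \<ge> 0" "\<eta> \<ge> 0"
  shows "whp ((2 * \<delta> + 2 * \<eta>\<^sup>2 * T) / \<rho>\<^sup>2) (\<lambda>\<omega>.
    (\<integral>\<^sup>+ r\<in>{0..T}. ennreal ((norm (simple_process n s H r \<omega> - \<phi> r \<omega>))\<^sup>2) \<partial>lborel) \<le> ennreal \<delta> \<and>
    (\<forall>r\<in>{0<..T}. norm (simple_process k t \<psi> r \<omega> - \<phi> r \<omega>) \<le> \<eta>) \<longrightarrow>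
    (\<forall>j\<le>k. norm (simple_integral W n s H (t j) \<omega> - (\<Sum>i<j. \<psi> i \<omega> *v (W (t (Suc i)) \<omega> - W (t i) \<omega>))) < \<rho>))"
proof -
  have smono: "s j < s (Suc j)" if "j < n" for j using si that by (simp add: simple_integrand_def)
  have tmono: "t j < t (Suc j)" if "j < k" for j using gi that by (simp add: simple_integrand_def)
  have tmono': "t i \<le> t l" if "i \<le> l" "l \<le> k" for i l
    using that
  proof (induction l)
    case (Suc l) then show ?case using tmono[of l] by (cases "i = Suc l") auto
  qed simp
  have s0: "0 \<le> s j" if "j \<le> n" for j
    using that
  proof (induction j)
    case (Suc j) then show ?case using smono[of j] by simp
  qed (use si in \<open>simp add: simple_integrand_def\<close>)
  define P where "P = s ` {..n} \<union> t ` {..k}"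
  have P: "finite P" "P \<noteq> {}" by (auto simp: P_def)
  obtain L :: nat and p :: "nat \<Rightarrow> real" where pL: "strict_mono_on {..L} p" and Pp: "P = p ` {..L}"
    by (rule common_refinement[OF P])
  have p: "p i < p j" if "i < j" "j \<le> L" for i j
    using strict_mono_onD[OF pL, of i j] that by simp
  have "\<exists>i. i \<le> L \<and> s j = p i" if "j \<le> n" for j
  proof -
    have "s j \<in> p ` {..L}" unfolding Pp[symmetric] P_def using that by simp
    then show ?thesis by auto
  qed
  then obtain \<sigma> where \<sigma>: "\<And>j. j \<le> n \<Longrightarrow> \<sigma> j \<le> L \<and> s j = p (\<sigma> j)" by metis
  have "\<exists>i. i \<le> L \<and> t j = p i" if "j \<le> k" for j
  proof -
    have "t j \<in> p ` {..L}" unfolding Pp[symmetric] P_def using that by simp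
    then show ?thesis by auto
  qed
  then obtain \<theta> where \<theta>: "\<And>j. j \<le> k \<Longrightarrow> \<theta> j \<le> L \<and> t j = p (\<theta> j)" by metis
  have p_le: "p i \<le> p j \<longleftrightarrow> i \<le> j" if "i \<le> L" "j \<le> L" for i j
    using p[of i j] p[of j i] that by (cases i j rule: linorder_cases) auto
  have p_in: "p i \<ge> 0" if "i \<le> L" for i
  proof -
    have "p i \<in> P" using Pp that by auto
    then show ?thesis using s0 tmono'[of 0] t(1) by (auto simp: P_def)
  qed
  have "p 0 = 0"
    using p_le[of "0" "\<theta> 0"] \<theta>[of 0] t(1) p_in[of 0] by auto
  define J where "J = \<theta> k"
  have J: "J \<le> L" "p J = T" using \<theta>[of k] t(2) by (auto simp: J_def)
  define \<kappa> where "\<kappa> i \<omega> = simple_process n s H (p (Suc i)) \<omega> - simple_process k t \<psi> (p (Suc i)) \<omega>" for i \<omega>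
  note m1 = simple_process_refined_measurable[where L = L and p = p and \<sigma> = \<sigma>, OF p p_in[of 0] \<sigma> si]
  note m2 = simple_process_refined_measurable[where L = L and p = p and \<sigma> = \<theta>, OF p p_in[of 0] \<theta> gi]
  have "\<exists>b. \<forall>i<J. \<forall>\<omega>\<in>space M. norm (\<kappa> i \<omega>) \<le> b"
  proof -
    have "\<exists>b. \<forall>\<omega>\<in>space M. norm (\<kappa> i \<omega>) \<le> b" if "i < J" for i
    proof -
      obtain b1 b2 where "\<forall>\<omega>\<in>space M. norm (simple_process n s H (p (Suc i)) \<omega>) \<le> b1"
        "\<forall>\<omega>\<in>space M. norm (simple_process k t \<psi> (p (Suc i)) \<omega>) \<le> b2"
        using m1(2)[of i] m2(2)[of i] less_le_trans[OF \<open>i < J\<close> J(1)] by blast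
      then show ?thesis unfolding \<kappa>_def
        by (intro exI[of _ "b1 + b2"] ballI order_trans[OF norm_triangle_ineq4] add_mono) auto
    qed
    then obtain b where b: "\<And>i \<omega>. i < J \<Longrightarrow> \<omega> \<in> space M \<Longrightarrow> norm (\<kappa> i \<omega>) \<le> b i" by metis
    show ?thesis
    proof (intro exI allI impI ballI)
      fix i \<omega> assume "i < J" "\<omega> \<in> space M"
      then have "norm (\<kappa> i \<omega>) \<le> \<bar>b i\<bar>" using b by (meson abs_ge_self order_trans)
      also have "\<dots> \<le> (\<Sum>i<J. \<bar>b i\<bar>)" using \<open>i < J\<close> by (intro member_le_sum) auto
      finally show "norm (\<kappa> i \<omega>) \<le> (\<Sum>i<J. \<bar>b i\<bar>)" .
    qed
  qed
  then obtain b where b: "\<And>i \<omega>. i < J \<Longrightarrow> \<omega> \<in> space M \<Longrightarrow> norm (\<kappa> i \<omega>) \<le> b" by blast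
  \<comment> \<open>From (a + b)^2 \<le> 2a^2 + 2b^2: the L^2 error \<delta> of the simple
    integrand, and the uniform error \<eta> of the grid integrand over a time of length
    \<open>T\<close>.\<close>
  let ?D = "2 * \<delta> + 2 * \<eta>\<^sup>2 * T"
  have "whp (?D / \<rho>\<^sup>2) (\<lambda>\<omega>. (\<Sum>i<J. (p (Suc i) - p i) * (norm (\<kappa> i \<omega>))\<^sup>2) \<le> ?D \<longrightarrow>
    (\<forall>j\<le>J. norm (\<Sum>i<j. \<kappa> i \<omega> *v (W (p (Suc i)) \<omega> - W (p i) \<omega>)) < \<rho>))"
  proof (rule increment_sum_tail)
    show "\<kappa> i \<in> borel_measurable (F (p i))" if "i < J" for i
      unfolding \<kappa>_def using m1(1)[of i] m2(1)[of i] that J by auto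
  qed (use p p_in b J assms in auto)
  then show ?thesis
  proof (rule whp_mono, goal_cases)
    case (2 \<omega>)
    then have \<omega>: "\<omega> \<in> space M" by simp
    show ?case
    proof (intro impI allI, elim conjE)
      fix j assume en: "(\<integral>\<^sup>+ r\<in>{0..T}. ennreal ((norm (simple_process n s H r \<omega> - \<phi> r \<omega>))\<^sup>2) \<partial>lborel) \<le> ennreal \<delta>"
        and cl: "\<forall>r\<in>{0<..T}. norm (simple_process k t \<psi> r \<omega> - \<phi> r \<omega>) \<le> \<eta>" and j: "j \<le> k"
      have \<theta>j: "\<theta> j \<le> J" using tmono'[of j k] j \<theta>[of j] \<theta>[of k] p_le[of "\<theta> j" "\<theta> k"] by (auto simp: J_def)
      have \<phi>m: "(\<lambda>r. \<phi> r \<omega>) \<in> borel_measurable (restrict_space borel {0..T})"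
        using energy_measurable(2)[OF si ito _ \<omega>] t(3) by simp
      have Sm: "(\<lambda>r. simple_process n s H r \<omega>) \<in> borel_measurable borel"
        unfolding simple_process_def by measurable
      have Dm: "(\<lambda>r. ennreal ((norm (simple_process n s H r \<omega> - \<phi> r \<omega>))\<^sup>2) * indicator {0..T} r) \<in> borel_measurable lborel"
      proof -
        have "(\<lambda>r. ennreal ((norm (simple_process n s H r \<omega> - \<phi> r \<omega>))\<^sup>2)) \<in> borel_measurable (restrict_space borel {0..T})"
          using \<phi>m measurable_restrict_space1[OF Sm, of "{0..T}"] by measurable
        then show ?thesis by (subst (asm) borel_measurable_restrict_space_iff_ennreal) auto
      qed
      \<comment> \<open>The discrete energy is the Lebesgue integral of a step function, and in this
        form it can be compared with \<phi> pointwise in time.\<close>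
      have "ennreal (\<Sum>i<J. (p (Suc i) - p i) * (norm (\<kappa> i \<omega>))\<^sup>2) =
        (\<Sum>i<J. \<integral>\<^sup>+ r. ennreal ((norm (\<kappa> i \<omega>))\<^sup>2) * indicator {p i<..p (Suc i)} r \<partial>lborel)"
      proof (subst sum_ennreal[symmetric])
        show "(\<Sum>i<J. ennreal ((p (Suc i) - p i) * (norm (\<kappa> i \<omega>))\<^sup>2)) =
          (\<Sum>i<J. \<integral>\<^sup>+ r. ennreal ((norm (\<kappa> i \<omega>))\<^sup>2) * indicator {p i<..p (Suc i)} r \<partial>lborel)"
        proof (rule sum.cong)
          fix i assume "i \<in> {..<J}"
          then have "p i \<le> p (Suc i)" using p[of i "Suc i"] J by auto
          then show "ennreal ((p (Suc i) - p i) * (norm (\<kappa> i \<omega>))\<^sup>2) = (\<integral>\<^sup>+ r. ennreal ((norm (\<kappa> i \<omega>))\<^sup>2) * indicator {p i<..p (Suc i)} r \<partial>lborel)"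
            by (subst nn_integral_cmult_indicator) (auto simp: ennreal_mult[symmetric] mult.commute)
        qed simp
      qed (use p J in \<open>auto intro!: mult_nonneg_nonneg simp: less_imp_le\<close>)
      also have "\<dots> = (\<integral>\<^sup>+ r. (\<Sum>i<J. ennreal ((norm (\<kappa> i \<omega>))\<^sup>2) * indicator {p i<..p (Suc i)} r) \<partial>lborel)"
        by (subst nn_integral_sum) auto
      also have "\<dots> \<le> (\<integral>\<^sup>+ r. 2 * (ennreal ((norm (simple_process n s H r \<omega> - \<phi> r \<omega>))\<^sup>2) * indicator {0..T} r)
          + ennreal (2 * \<eta>\<^sup>2) * indicator {0..T} r \<partial>lborel)"
      proof (rule nn_integral_mono)
        fix r :: real
        let ?B = "2 * (ennreal ((norm (simple_process n s H r \<omega> - \<phi> r \<omega>))\<^sup>2) * indicator {0..T} r) + ennreal (2 * \<eta>\<^sup>2) * indicator {0..T} r"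
        show "(\<Sum>i<J. ennreal ((norm (\<kappa> i \<omega>))\<^sup>2) * indicator {p i<..p (Suc i)} r) \<le> ?B"
        proof (cases "\<exists>i<J. r \<in> {p i<..p (Suc i)}")
          case False
          then have "(\<Sum>i<J. ennreal ((norm (\<kappa> i \<omega>))\<^sup>2) * indicator {p i<..p (Suc i)} r) = 0"
            by (intro sum.neutral) (auto simp: indicator_def)
          then show ?thesis by simp
        next
          case True
          then obtain i where i: "i < J" "r \<in> {p i<..p (Suc i)}" by blast
          have uniq: "l = i" if "l < J" "r \<in> {p l<..p (Suc l)}" for l
          proof (rule ccontr)
            assume "l \<noteq> i"
            then have "Suc l \<le> i \<or> Suc i \<le> l" by auto
            then have "p (Suc l) \<le> p i \<or> p (Suc i) \<le> p l"
              using p_le[of "Suc l" i] p_le[of "Suc i" l] i(1) that(1) J by auto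
            then show False using i(2) that(2) by auto
          qed
          have "(\<Sum>l<J. ennreal ((norm (\<kappa> l \<omega>))\<^sup>2) * indicator {p l<..p (Suc l)} r) = (\<Sum>l\<in>{i}. ennreal ((norm (\<kappa> l \<omega>))\<^sup>2))"
          proof (intro sum.mono_neutral_cong_right ballI)
            fix l assume "l \<in> {..<J} - {i}"
            then have "r \<notin> {p l<..p (Suc l)}" using uniq[of l] by blast
            then show "ennreal ((norm (\<kappa> l \<omega>))\<^sup>2) * indicator {p l<..p (Suc l)} r = 0" by simp
          qed (use i in auto)
          also have "\<dots> = ennreal ((norm (\<kappa> i \<omega>))\<^sup>2)" by simp
          also have "\<dots> \<le> ennreal (2 * (norm (simple_process n s H r \<omega> - \<phi> r \<omega>))\<^sup>2 + 2 * \<eta>\<^sup>2)"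
          proof (rule ennreal_leI)
            have iL: "i < L" using i J by simp
            have rT: "r \<in> {0<..T}"
              using i(2) p_in[of i] p_le[of "Suc i" J] i(1) J by auto
            have eq: "\<kappa> i \<omega> = (simple_process n s H r \<omega> - \<phi> r \<omega>) - (simple_process k t \<psi> r \<omega> - \<phi> r \<omega>)"
              unfolding \<kappa>_def
              using simple_process_refined[where L = L and p = p and \<sigma> = \<sigma> and n = n and H = H and \<omega> = \<omega>, OF p \<sigma> iL i(2)]
                simple_process_refined[where L = L and p = p and \<sigma> = \<theta> and n = k and H = \<psi> and \<omega> = \<omega>, OF p \<theta> iL i(2)] by simp
            have "norm (\<kappa> i \<omega>) \<le> norm (simple_process n s H r \<omega> - \<phi> r \<omega>) + \<eta>"
              unfolding eq using bspec[OF cl rT]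
              by (intro order_trans[OF norm_triangle_ineq4]) linarith
            then have "(norm (\<kappa> i \<omega>))\<^sup>2 \<le> (norm (simple_process n s H r \<omega> - \<phi> r \<omega>) + \<eta>)\<^sup>2"
              by (intro power_mono) auto
            also have "\<dots> \<le> 2 * (norm (simple_process n s H r \<omega> - \<phi> r \<omega>))\<^sup>2 + 2 * \<eta>\<^sup>2"
              using sum_squares_bound[of "norm (simple_process n s H r \<omega> - \<phi> r \<omega>)" \<eta>] by (simp add: power2_sum)
            finally show "(norm (\<kappa> i \<omega>))\<^sup>2 \<le> 2 * (norm (simple_process n s H r \<omega> - \<phi> r \<omega>))\<^sup>2 + 2 * \<eta>\<^sup>2" .
          qed
          also have "\<dots> = ?B"
            using i(2) p_in[of i] p_le[of "Suc i" J] i(1) J \<open>\<eta> \<ge> 0\<close> by (auto simp: ennreal_plus ennreal_mult indicator_def)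
          finally show ?thesis .
        qed
      qed
      also have "\<dots> = 2 * (\<integral>\<^sup>+ r\<in>{0..T}. ennreal ((norm (simple_process n s H r \<omega> - \<phi> r \<omega>))\<^sup>2) \<partial>lborel) + ennreal (2 * \<eta>\<^sup>2) * ennreal T"
        using Dm t(3) by (subst nn_integral_add) (auto simp: nn_integral_cmult nn_integral_cmult_indicator)
      also have "\<dots> \<le> 2 * ennreal \<delta> + ennreal (2 * \<eta>\<^sup>2) * ennreal T"
        using en by (intro add_right_mono mult_left_mono) auto
      also have "\<dots> = ennreal ?D"
        using \<open>\<delta> \<ge> 0\<close> t(3) by (simp add: ennreal_plus ennreal_mult)
      finally have "(\<Sum>i<J. (p (Suc i) - p i) * (norm (\<kappa> i \<omega>))\<^sup>2) \<le> ?D"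
        using \<open>\<delta> \<ge> 0\<close> t(3) by (subst (asm) ennreal_le_iff) auto
      then have "norm (\<Sum>i<\<theta> j. \<kappa> i \<omega> *v (W (p (Suc i)) \<omega> - W (p i) \<omega>)) < \<rho>"
        using 2(2) \<theta>j by blast
      moreover have "(\<Sum>i<\<theta> j. \<kappa> i \<omega> *v (W (p (Suc i)) \<omega> - W (p i) \<omega>)) =
        simple_integral W n s H (t j) \<omega> - (\<Sum>i<j. \<psi> i \<omega> *v (W (t (Suc i)) \<omega> - W (t i) \<omega>))"
      proof -
        have "simple_integral W n s H (p (\<theta> j)) \<omega> = (\<Sum>i<\<theta> j. simple_process n s H (p (Suc i)) \<omega> *v (W (p (Suc i)) \<omega> - W (p i) \<omega>))"
          by (rule simple_integral_refined[where L = L and \<sigma> = \<sigma>]) (use p \<sigma> smono \<theta>j J in auto)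
        moreover have "simple_integral W k t \<psi> (p (\<theta> j)) \<omega> = (\<Sum>i<\<theta> j. simple_process k t \<psi> (p (Suc i)) \<omega> *v (W (p (Suc i)) \<omega> - W (p i) \<omega>))"
          by (rule simple_integral_refined[where L = L and \<sigma> = \<theta>]) (use p \<theta> tmono \<theta>j J in auto)
        ultimately show ?thesis
          using \<theta>[OF j] simple_integral_grid[of k t j \<psi> \<omega>, OF tmono j]
          by (simp add: \<kappa>_def matrix_vector_mult_diff_rdistrib sum_subtractf)
      qed
      ultimately show "norm (simple_integral W n s H (t j) \<omega> - (\<Sum>i<j. \<psi> i \<omega> *v (W (t (Suc i)) \<omega> - W (t i) \<omega>))) < \<rho>" by simp
    qed
  qed simp
qed

end

section \<open>Paths of a continuous process\<close>

text \<open>The whole path on \<open>{a..b}\<close> is regarded as one segment of length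
  \<open>b - a\<close> ending at \<open>b\<close>, so that measurability in path space yields events
  that quantify over uncountably many times.\<close>

lemma (in prob_space) segment_event:
  fixes x :: "real \<Rightarrow> 'a \<Rightarrow> real^'d" and h :: "'p \<Rightarrow> (real \<Rightarrow> real^'d) \<Rightarrow> real"
  assumes "a < b" and c: "\<And>\<omega>. \<omega> \<in> space M \<Longrightarrow> continuous_on {a..b} (\<lambda>t. x t \<omega>)"
    and m: "\<And>t. t \<in> {a..b} \<Longrightarrow> x t \<in> borel_measurable M"
    and h: "\<And>p \<phi> \<psi>. p \<in> P \<Longrightarrow> \<phi> \<in> mspace (C_metric (b - a)) \<Longrightarrow> \<psi> \<in> mspace (C_metric (b - a)) \<Longrightarrow>
     \<bar>h p \<phi> - h p \<psi>\<bar> \<le> L * mdist (C_metric (b - a)) \<phi> \<psi>" "L > 0"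
  shows "{\<omega>\<in>space M. \<forall>p\<in>P. h p (segment (b - a) x b \<omega>) \<le> r} \<in> events"
proof -
  have m: "segment (b - a) x b \<in> measurable M (C_borel (b - a))"
    using assms by (intro segment_measurable) auto
  have "segment (b - a) x b -` {\<phi>\<in>mspace (C_metric (b - a)). \<forall>p\<in>P. h p \<phi> \<le> r} \<inter> space M \<in> events"
    by (rule measurable_sets[OF m closed_path_event[OF h]])
  also have "segment (b - a) x b -` {\<phi>\<in>mspace (C_metric (b - a)). \<forall>p\<in>P. h p \<phi> \<le> r} \<inter> space M =
    {\<omega>\<in>space M. \<forall>p\<in>P. h p (segment (b - a) x b \<omega>) \<le> r}"
    using measurable_space[OF m] by (auto simp: space_C_borel)
  finally show ?thesis .
qed

text \<open>A continuous path is bounded on a compact interval, with a bound depending on \<omega>;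
  along integer radii this becomes one deterministic radius outside a small event.\<close>

lemma (in prob_space) path_bounded_whp:
  fixes x :: "real \<Rightarrow> 'a \<Rightarrow> real^'d"
  assumes "a < b" and c: "\<And>\<omega>. \<omega> \<in> space M \<Longrightarrow> continuous_on {a..b} (\<lambda>t. x t \<omega>)"
    and m: "\<And>t. t \<in> {a..b} \<Longrightarrow> x t \<in> borel_measurable M" and "\<epsilon> > 0"
  obtains R :: real where "R > 0" "whp \<epsilon> (\<lambda>\<omega>. \<forall>t\<in>{a..b}. norm (x t \<omega>) \<le> R)"
proof -
  have eq: "(\<forall>\<theta>\<in>{- (b - a)..0}. norm (segment (b - a) x b \<omega> \<theta>) \<le> r) \<longleftrightarrow> (\<forall>t\<in>{a..b}. norm (x t \<omega>) \<le> r)" for r \<omega>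
  proof safe
    fix t assume *: "\<forall>\<theta>\<in>{- (b - a)..0}. norm (segment (b - a) x b \<omega> \<theta>) \<le> r" and t: "t \<in> {a..b}"
    from *[rule_format, of "t - b"] t show "norm (x t \<omega>) \<le> r" by (simp add: segment_def)
  qed (auto simp: segment_def)
  have "{\<omega>\<in>space M. \<forall>\<theta>\<in>{- (b - a)..0}. norm (segment (b - a) x b \<omega> \<theta>) \<le> real n} \<in> events" for n
  proof (rule segment_event[where h = "\<lambda>\<theta> \<phi>. norm (\<phi> \<theta>)" and L = 1, OF \<open>a < b\<close> c m])
    fix \<theta> and \<phi> \<psi> :: "real \<Rightarrow> real^'d"
    assume "\<theta> \<in> {- (b - a)..0}" "\<phi> \<in> mspace (C_metric (b - a))" "\<psi> \<in> mspace (C_metric (b - a))"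
    then show "\<bar>norm (\<phi> \<theta>) - norm (\<psi> \<theta>)\<bar> \<le> 1 * mdist (C_metric (b - a)) \<phi> \<psi>"
      using mdist_C_geD[of "b - a" \<phi> \<psi> \<theta>] \<open>a < b\<close> norm_triangle_ineq3[of "\<phi> \<theta>" "\<psi> \<theta>"] by simp
  qed auto
  then have ev: "{\<omega>\<in>space M. \<forall>t\<in>{a..b}. norm (x t \<omega>) \<le> real n} \<in> events" for n
    unfolding eq .
  have "\<exists>n0. \<forall>n\<ge>n0. \<forall>t\<in>{a..b}. norm (x t \<omega>) \<le> real n" if "\<omega> \<in> space M" for \<omega>
  proof -
    have "bounded ((\<lambda>t. x t \<omega>) ` {a..b})"
      by (intro compact_imp_bounded compact_continuous_image c that) simp
    then obtain r where r: "\<And>t. t \<in> {a..b} \<Longrightarrow> norm (x t \<omega>) \<le> r"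
      unfolding bounded_iff by (metis image_eqI)
    show ?thesis
    proof (intro exI[of _ "nat \<lceil>r\<rceil>"] allI impI ballI)
      fix n t assume n: "nat \<lceil>r\<rceil> \<le> n" and t: "t \<in> {a..b}"
      have "norm (x t \<omega>) \<le> r" by (rule r[OF t])
      also have "r \<le> real n" using n by linarith
      finally show "norm (x t \<omega>) \<le> real n" .
    qed
  qed
  then obtain n0 where n0: "\<And>n. n \<ge> n0 \<Longrightarrow> whp \<epsilon> (\<lambda>\<omega>. \<forall>t\<in>{a..b}. norm (x t \<omega>) \<le> real n)"
    using whp_eventually[of "\<lambda>n \<omega>. \<forall>t\<in>{a..b}. norm (x t \<omega>) \<le> real n" \<epsilon>, OF ev _ \<open>\<epsilon> > 0\<close>] by blast
  show thesis by (rule that[of "real (Suc n0)"]) (use n0[of "Suc n0"] in auto)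
qed

text \<open>Uniform continuity of each path supplies a step threshold depending on \<omega>. The
  pairs of nearby times form the index set of a family of functionals with Lipschitz constant 2, so
  the condition is an event.\<close>

lemma (in prob_space) path_modulus_whp:
  fixes x :: "real \<Rightarrow> 'a \<Rightarrow> real^'d"
  assumes "a < b" and c: "\<And>\<omega>. \<omega> \<in> space M \<Longrightarrow> continuous_on {a..b} (\<lambda>t. x t \<omega>)"
    and m: "\<And>t. t \<in> {a..b} \<Longrightarrow> x t \<in> borel_measurable M" and "\<epsilon> > 0" "\<eta> > 0"
  obtains N\<^sub>0 :: nat where "\<And>N. N \<ge> N\<^sub>0 \<Longrightarrow>
    whp \<epsilon> (\<lambda>\<omega>. \<forall>s\<in>{a..b}. \<forall>t\<in>{a..b}. \<bar>s - t\<bar> \<le> \<tau> / real N \<longrightarrow> norm (x s \<omega> - x t \<omega>) \<le> \<eta>)"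
proof -
  let ?I = "{- (b - a)..0}"
  define P where "P N = {p. fst p \<in> ?I \<and> snd p \<in> ?I \<and> \<bar>fst p - snd p\<bar> \<le> \<tau> / real N}" for N :: nat
  define U where "U N \<omega> \<longleftrightarrow> (\<forall>s\<in>{a..b}. \<forall>t\<in>{a..b}. \<bar>s - t\<bar> \<le> \<tau> / real N \<longrightarrow> norm (x s \<omega> - x t \<omega>) \<le> \<eta>)" for N \<omega>
  have eq: "(\<forall>p\<in>P N. norm (segment (b - a) x b \<omega> (fst p) - segment (b - a) x b \<omega> (snd p)) \<le> \<eta>) \<longleftrightarrow> U N \<omega>" for N \<omega>
    unfolding U_def
  proof safe
    fix s t assume *: "\<forall>p\<in>P N. norm (segment (b - a) x b \<omega> (fst p) - segment (b - a) x b \<omega> (snd p)) \<le> \<eta>"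
      and st: "s \<in> {a..b}" "t \<in> {a..b}" "\<bar>s - t\<bar> \<le> \<tau> / real N"
    from *[rule_format, of "(s - b, t - b)"] st show "norm (x s \<omega> - x t \<omega>) \<le> \<eta>" by (simp add: segment_def P_def)
  qed (auto simp: segment_def P_def)
  have "{\<omega>\<in>space M. \<forall>p\<in>P N. norm (segment (b - a) x b \<omega> (fst p) - segment (b - a) x b \<omega> (snd p)) \<le> \<eta>} \<in> events" for N
  proof (rule segment_event[where h = "\<lambda>p \<phi>. norm (\<phi> (fst p) - \<phi> (snd p))" and L = 2, OF \<open>a < b\<close> c m])
    fix p and \<phi> \<psi> :: "real \<Rightarrow> real^'d"
    assume p: "p \<in> P N" and \<phi>: "\<phi> \<in> mspace (C_metric (b - a))" "\<psi> \<in> mspace (C_metric (b - a))"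
    have "norm (\<phi> (fst p) - \<psi> (fst p)) \<le> mdist (C_metric (b - a)) \<phi> \<psi>" "norm (\<phi> (snd p) - \<psi> (snd p)) \<le> mdist (C_metric (b - a)) \<phi> \<psi>"
      using p \<phi> \<open>a < b\<close> by (auto intro!: mdist_C_geD simp: P_def)
    moreover have "\<bar>norm (\<phi> (fst p) - \<phi> (snd p)) - norm (\<psi> (fst p) - \<psi> (snd p))\<bar> \<le>
      norm ((\<phi> (fst p) - \<psi> (fst p)) - (\<phi> (snd p) - \<psi> (snd p)))"
      using norm_triangle_ineq3[of "\<phi> (fst p) - \<phi> (snd p)" "\<psi> (fst p) - \<psi> (snd p)"] by (simp add: algebra_simps)
    moreover have "\<dots> \<le> norm (\<phi> (fst p) - \<psi> (fst p)) + norm (\<phi> (snd p) - \<psi> (snd p))"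
      by (rule norm_triangle_ineq4)
    ultimately show "\<bar>norm (\<phi> (fst p) - \<phi> (snd p)) - norm (\<psi> (fst p) - \<psi> (snd p))\<bar> \<le> 2 * mdist (C_metric (b - a)) \<phi> \<psi>"
      by linarith
  qed auto
  then have ev: "{\<omega>\<in>space M. U N \<omega>} \<in> events" for N
    unfolding eq .
  have "\<exists>n0. \<forall>n\<ge>n0. U n \<omega>" if "\<omega> \<in> space M" for \<omega>
  proof -
    have "uniformly_continuous_on {a..b} (\<lambda>t. x t \<omega>)"
      by (intro compact_uniformly_continuous c that) simp
    then obtain d where d: "d > 0" "\<And>s t. s \<in> {a..b} \<Longrightarrow> t \<in> {a..b} \<Longrightarrow> dist t s < d \<Longrightarrow> dist (x t \<omega>) (x s \<omega>) < \<eta>"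
      unfolding uniformly_continuous_on_def using \<open>\<eta> > 0\<close> by blast
    have "((\<lambda>n. \<tau> / real n) \<longlonglongrightarrow> 0)" by (rule lim_const_over_n)
    then obtain n0 where n0: "\<And>n. n \<ge> n0 \<Longrightarrow> \<tau> / real n < d"
      using order_tendstoD(2)[of _ 0 sequentially d, OF _ d(1)] by (auto simp: eventually_sequentially)
    show ?thesis
    proof (intro exI[of _ n0] allI impI)
      fix n assume "n0 \<le> n"
      then have "\<tau> / real n < d" by (rule n0)
      then show "U n \<omega>" unfolding U_def using d(2) by (force simp: dist_norm dist_real_def intro: less_imp_le)
    qed
  qed
  then obtain n0 where "\<And>n. n \<ge> n0 \<Longrightarrow> whp \<epsilon> (U n)"
    using whp_eventually[of U \<epsilon>, OF ev _ \<open>\<epsilon> > 0\<close>] by blast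
  then show thesis using that unfolding U_def by blast
qed

section \<open>Stability of the Euler scheme\<close>

lemma em_id_sum:
  "em f g W (\<lambda>v. v) \<tau> N \<xi> (int j) \<omega> = \<xi> 0 + (\<Sum>i<j.
     (\<tau> / real N) *\<^sub>R f (em f g W (\<lambda>v. v) \<tau> N \<xi> (int i) \<omega>) (em f g W (\<lambda>v. v) \<tau> N \<xi> (int i - int N) \<omega>)
     + g (em f g W (\<lambda>v. v) \<tau> N \<xi> (int i) \<omega>) (em f g W (\<lambda>v. v) \<tau> N \<xi> (int i - int N) \<omega>)
       *v (W (real (Suc i) * (\<tau> / real N)) \<omega> - W (real i * (\<tau> / real N)) \<omega>))"
proof (induction j)
  case 0 then show ?case by (simp add: em_nonpos)
next
  case (Suc j)
  show ?case by (simp only: em_Suc Let_def sum.lessThan_Suc add.assoc[symmetric] Suc.IH[symmetric])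
qed

text \<open>The induction claim is increasing in the index, so the delayed term obeys the bound of
  the current one and the rate doubles to \<open>2 * c\<close>. The bound vanishes at index 0 and is
  proportional to the perturbation \<open>r\<close>.\<close>

lemma delay_gronwall:
  fixes a :: "nat \<Rightarrow> real"
  assumes "a 0 \<le> 0" "c \<ge> 0" "r \<ge> 0"
    and step: "\<And>j. j < k \<Longrightarrow> a (Suc j) \<le> a j + c * (a j + (if j < N then 0 else a (j - N)) + r)"
  shows "j \<le> k \<Longrightarrow> a j \<le> r * ((1 + 2 * c) ^ j - 1)"
proof (induction j rule: less_induct)
  case (less j)
  let ?q = "1 + 2 * c"
  have q1: "?q \<ge> 1" using assms by simp
  show ?case
  proof (cases j)
    case 0 then show ?thesis using assms(1) by simp
  next
    case (Suc i)
    have ai: "a i \<le> r * (?q ^ i - 1)" using less Suc by simp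
    have ad: "(if i < N then 0 else a (i - N)) \<le> r * (?q ^ i - 1)"
    proof (cases "i < N")
      case True then show ?thesis using q1 assms(3) by simp
    next
      case False
      then have "a (i - N) \<le> r * (?q ^ (i - N) - 1)" using less Suc by simp
      also have "\<dots> \<le> r * (?q ^ i - 1)" using q1 assms(3) by (intro mult_left_mono diff_right_mono power_increasing) auto
      finally show ?thesis using False by simp
    qed
    have "a j \<le> a i + c * (a i + (if i < N then 0 else a (i - N)) + r)" using step[of i] less.prems Suc by simp
    also have "\<dots> \<le> r * (?q ^ i - 1) + c * (r * (?q ^ i - 1) + r * (?q ^ i - 1) + r)"
      using ai ad assms(2) by (intro add_mono mult_left_mono) auto
    also have "\<dots> = r * (?q ^ j - 1) - c * r" unfolding Suc by (simp add: algebra_simps)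
    also have "\<dots> \<le> r * (?q ^ j - 1)" using assms by simp
    finally show ?thesis .
  qed
qed

context brownian_space
begin

text \<open>The process \<open>y\<close> satisfies the Euler recursion up to an error \<open>\<rho>\<close>; the comparison is stopped as
  soon as the error exceeds \<open>\<rho>\<close>.\<close>

lemma euler_stability:
  fixes f :: "real^'d \<Rightarrow> real^'d \<Rightarrow> real^'d" and g :: "real^'d \<Rightarrow> real^'d \<Rightarrow> real^'m^'d"
    and y z :: "nat \<Rightarrow> 'w \<Rightarrow> real^'d"
  assumes "\<tau> > 0" "N > 0" and \<Delta>: "\<Delta> = \<tau> / real N" "\<Delta> \<le> 1"
    and f: "(\<lambda>(u, v). f u v) \<in> borel_measurable borel" and g: "(\<lambda>(u, v). g u v) \<in> borel_measurable borel"
    and L: "L \<ge> 0" "\<And>u v u' v'. norm (f u v - f u' v') \<le> L * (norm (u - u') + norm (v - v'))"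
      "\<And>u v u' v'. norm (g u v - g u' v') \<le> L * (norm (u - u') + norm (v - v'))"
    and C: "\<And>u v. norm (f u v) \<le> C" "\<And>u v. norm (g u v) \<le> C"
    and y: "\<And>j. y j \<in> borel_measurable (F (real j * \<Delta>))" and z: "\<And>j. z j \<in> borel_measurable (F (real j * \<Delta>))"
    and z_eq: "\<And>j \<omega>. j < N \<Longrightarrow> \<omega> \<in> space M \<Longrightarrow> z j \<omega> = \<xi> (of_int (int j - int N) * \<Delta>)"
      "\<And>j \<omega>. N \<le> j \<Longrightarrow> \<omega> \<in> space M \<Longrightarrow> z j \<omega> = y (j - N) \<omega>"
    and "\<rho> > 0" "\<beta> > 0" and c: "c = 1 + 36 * L\<^sup>2"
  defines "X \<equiv> \<lambda>j \<omega>. \<xi> 0 + (\<Sum>i<j. \<Delta> *\<^sub>R f (y i \<omega>) (z i \<omega>) + g (y i \<omega>) (z i \<omega>) *v (W (real (Suc i) * \<Delta>) \<omega> - W (real i * \<Delta>) \<omega>))"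
    and "w \<equiv> \<lambda>j. em f g W (\<lambda>v. v) \<tau> N \<xi> (int j)"
  shows "whp (2 * c * (real k * \<Delta>) * exp (2 * c * (real k * \<Delta>)) * \<rho>\<^sup>2 / \<beta>\<^sup>2)
    (\<lambda>\<omega>. (\<forall>j\<le>k. norm (y j \<omega> - X j \<omega>) \<le> \<rho>) \<longrightarrow> (\<forall>j\<le>k. norm (X j \<omega> - w j \<omega>) < \<beta>))"
proof -
  have \<Delta>0: "\<Delta> > 0" using assms by simp
  have c1: "c \<ge> 1" by (simp add: c)
  have C0: "C \<ge> 0" using C(1)[of 0 0] norm_ge_zero order_trans by blast
  have t0: "0 \<le> real j * \<Delta>" for j using \<Delta>0 by simp
  have tl: "real j * \<Delta> < real (Suc j) * \<Delta>" for j using \<Delta>0 by simp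
  have tm: "real i * \<Delta> \<le> real j * \<Delta>" if "i \<le> j" for i j using that \<Delta>0 by simp
  have td: "real (Suc j) * \<Delta> - real j * \<Delta> = \<Delta>" for j by (simp add: algebra_simps)
  define v where "v j = em f g W (\<lambda>v. v) \<tau> N \<xi> (int j - int N)" for j
  define dW where "dW j \<omega> = W (real (Suc j) * \<Delta>) \<omega> - W (real j * \<Delta>) \<omega>" for j \<omega>
  have wF: "w j \<in> borel_measurable (F (real j * \<Delta>))" "v j \<in> borel_measurable (F (real j * \<Delta>))" for j
    unfolding w_def v_def \<Delta>(1) by (intro em_measurable_F f g; use \<open>\<tau> > 0\<close> in simp)+
  have up: "h \<in> borel_measurable (F (real j * \<Delta>))" if "h \<in> borel_measurable (F (real i * \<Delta>))" "i \<le> j"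
    for h :: "'w \<Rightarrow> 'b::topological_space" and i j
    by (rule measurable_F_mono[OF that(1) t0 tm[OF that(2)]])
  have WF: "W (real j * \<Delta>) \<in> borel_measurable (F (real j * \<Delta>))" for j by (rule W_F[OF t0])
  have XF: "X j \<in> borel_measurable (F (real j * \<Delta>))" for j
    unfolding X_def
  proof (intro borel_measurable_add borel_measurable_const borel_measurable_sum borel_measurable_scaleR
      borel_measurable_matrix_vector_mult borel_measurable_diff borel_measurable_compose2[OF f] borel_measurable_compose2[OF g])
    fix i assume "i \<in> {..<j}"
    then have ij: "i \<le> j" "Suc i \<le> j" by auto
    show "y i \<in> borel_measurable (F (real j * \<Delta>))" "z i \<in> borel_measurable (F (real j * \<Delta>))"
      "y i \<in> borel_measurable (F (real j * \<Delta>))" "z i \<in> borel_measurable (F (real j * \<Delta>))"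
      "W (real (Suc i) * \<Delta>) \<in> borel_measurable (F (real j * \<Delta>))" "W (real i * \<Delta>) \<in> borel_measurable (F (real j * \<Delta>))"
      by (rule up[OF y ij(1)] up[OF z ij(1)] up[OF WF ij(1)] up[OF WF ij(2)])+
  qed
  \<comment> \<open>Membership is known at time \<open>j\<close>, so the indicator
    \<open>\<zeta> j\<close> may multiply the coefficients of step \<open>j\<close> without
    destroying adaptedness.\<close>
  define ok where "ok j \<omega> \<longleftrightarrow> (\<forall>l\<le>j. norm (y l \<omega> - X l \<omega>) \<le> \<rho>)" for j \<omega>
  define \<zeta> where "\<zeta> j \<omega> = (if ok j \<omega> then 1 else 0 :: real)" for j \<omega>
  have okF: "{\<omega>\<in>space (F (real j * \<Delta>)). ok j \<omega>} \<in> sets (F (real j * \<Delta>))" for j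
  proof -
    have le: "{\<omega>\<in>space (F (real j * \<Delta>)). norm (y l \<omega> - X l \<omega>) \<le> \<rho>} \<in> sets (F (real j * \<Delta>))" if "l \<le> j" for l
      by (rule borel_measurable_le[OF measurable_compose[OF borel_measurable_diff[OF up[OF y that] up[OF XF that]] borel_measurable_norm] borel_measurable_const])
    have "{\<omega>\<in>space (F (real j * \<Delta>)). \<forall>l\<in>{..j}. norm (y l \<omega> - X l \<omega>) \<le> \<rho>} \<in> sets (F (real j * \<Delta>))"
    proof (rule sets.sets_Collect_countable_All')
      show "countable {..j}" by simp
    qed (use le in simp)
    then show ?thesis unfolding ok_def Ball_def atMost_iff .
  qed
  have \<zeta>F: "\<zeta> j \<in> borel_measurable (F (real j * \<Delta>))" for j
    unfolding \<zeta>_def[abs_def] by (rule measurable_If) (use okF in auto)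
  define df where "df j \<omega> = \<zeta> j \<omega> *\<^sub>R (f (y j \<omega>) (z j \<omega>) - f (w j \<omega>) (v j \<omega>))" for j \<omega>
  define dg where "dg j \<omega> = \<zeta> j \<omega> *\<^sub>R (g (y j \<omega>) (z j \<omega>) - g (w j \<omega>) (v j \<omega>))" for j \<omega>
  \<comment> \<open>The difference of \<open>X\<close> and the scheme \<open>w\<close>, frozen from
    the first step at which the defect of \<open>y\<close> exceeds \<rho>. Unlike
    \<open>X - w\<close> it has second moments controlled by \<rho> alone.\<close>
  define Z where "Z j \<omega> = (\<Sum>i<j. \<Delta> *\<^sub>R df i \<omega> + dg i \<omega> *v dW i \<omega>)" for j \<omega>
  define Zd where "Zd j \<omega> = (if j < N then 0 else Z (j - N) \<omega>)" for j \<omega>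
  have dfF: "df j \<in> borel_measurable (F (real j * \<Delta>))" "dg j \<in> borel_measurable (F (real j * \<Delta>))" for j
    unfolding df_def[abs_def] dg_def[abs_def]
    by (intro borel_measurable_scaleR \<zeta>F borel_measurable_diff borel_measurable_compose2[OF f] borel_measurable_compose2[OF g] y z wF)+
  have ZF: "Z j \<in> borel_measurable (F (real j * \<Delta>))" for j
    unfolding Z_def[abs_def] dW_def
    by (intro borel_measurable_sum borel_measurable_add borel_measurable_scaleR borel_measurable_const
      borel_measurable_matrix_vector_mult borel_measurable_diff up[OF dfF(1)] up[OF dfF(2)] up[OF WF]) auto
  have dfM: "df j \<in> borel_measurable M" "dg j \<in> borel_measurable M" and ZM [measurable]: "Z j \<in> borel_measurable M" for j
    using measurable_F_M[OF _ t0] dfF ZF by blast+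
  have dfb: "norm (df j \<omega>) \<le> 2 * C" "norm (dg j \<omega>) \<le> 2 * C" for j \<omega>
    using norm_triangle_ineq4[of "f (y j \<omega>) (z j \<omega>)" "f (w j \<omega>) (v j \<omega>)"] C(1)[of "y j \<omega>" "z j \<omega>"] C(1)[of "w j \<omega>" "v j \<omega>"]
      norm_triangle_ineq4[of "g (y j \<omega>) (z j \<omega>)" "g (w j \<omega>) (v j \<omega>)"] C(2)[of "y j \<omega>" "z j \<omega>"] C(2)[of "w j \<omega>" "v j \<omega>"] C0
    by (auto simp: df_def dg_def \<zeta>_def)
  have Z_Suc: "Z (Suc j) \<omega> = (Z j \<omega> + \<Delta> *\<^sub>R df j \<omega>) + dg j \<omega> *v (W (real (Suc j) * \<Delta>) \<omega> - W (real j * \<Delta>) \<omega>)" for j \<omega>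
    by (simp add: Z_def dW_def)
  have dg2: "integrable M (\<lambda>\<omega>. (norm (dg j \<omega>))\<^sup>2)" for j
    by (rule integrable_sq_bounded[OF dfM(2) dfb(2)])
  have ZD2: "integrable M (\<lambda>\<omega>. (norm (Z j \<omega> + \<Delta> *\<^sub>R df j \<omega>))\<^sup>2)" if "integrable M (\<lambda>\<omega>. (norm (Z j \<omega>))\<^sup>2)" for j
  proof (rule Bochner_Integration.integrable_bound)
    show "integrable M (\<lambda>\<omega>. 2 * (norm (Z j \<omega>))\<^sup>2 + 2 * (\<Delta> * (2 * C))\<^sup>2)" using that by simp
    show "AE \<omega> in M. norm ((norm (Z j \<omega> + \<Delta> *\<^sub>R df j \<omega>))\<^sup>2) \<le> norm (2 * (norm (Z j \<omega>))\<^sup>2 + 2 * (\<Delta> * (2 * C))\<^sup>2)"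
    proof (intro AE_I2)
      fix \<omega>
      have "norm (Z j \<omega> + \<Delta> *\<^sub>R df j \<omega>) \<le> norm (Z j \<omega>) + \<Delta> * (2 * C)"
        using dfb(1)[of j \<omega>] \<Delta>0 by (intro norm_triangle_le add_left_mono) (auto intro: mult_left_mono)
      then have "(norm (Z j \<omega> + \<Delta> *\<^sub>R df j \<omega>))\<^sup>2 \<le> (norm (Z j \<omega>) + \<Delta> * (2 * C))\<^sup>2" by (intro power_mono) auto
      also have "\<dots> \<le> 2 * (norm (Z j \<omega>))\<^sup>2 + 2 * (\<Delta> * (2 * C))\<^sup>2"
        using sum_squares_bound[of "norm (Z j \<omega>)" "\<Delta> * (2 * C)"] unfolding power2_sum by linarith
      finally show "norm ((norm (Z j \<omega> + \<Delta> *\<^sub>R df j \<omega>))\<^sup>2) \<le> norm (2 * (norm (Z j \<omega>))\<^sup>2 + 2 * (\<Delta> * (2 * C))\<^sup>2)"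
        by simp
    qed
    show "(\<lambda>\<omega>. (norm (Z j \<omega> + \<Delta> *\<^sub>R df j \<omega>))\<^sup>2) \<in> borel_measurable M" using ZM dfM by measurable
  qed
  have ZDF: "(\<lambda>\<omega>. Z j \<omega> + \<Delta> *\<^sub>R df j \<omega>) \<in> borel_measurable (F (real j * \<Delta>))" for j
    using ZF dfF by measurable
  have Z2: "integrable M (\<lambda>\<omega>. (norm (Z j \<omega>))\<^sup>2)" for j
  proof (induction j)
    case 0 then show ?case by (simp add: Z_def)
  next
    case (Suc j)
    show ?case unfolding Z_Suc by (rule increment_L2(1)[OF t0 tl ZDF ZD2[OF Suc] dfF(2) dg2])
  qed
  have Zd2: "integrable M (\<lambda>\<omega>. (norm (Zd j \<omega>))\<^sup>2)" for j
    using Z2[of "j - N"] by (cases "j < N") (simp_all add: Zd_def)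
  \<comment> \<open>As long as \<open>ok\<close> has held, every factor \<zeta> in the sum is 1. The
    next index is still covered, because its last increment is switched on by the current
    state.\<close>
  have Z_eq: "Z l \<omega> = X l \<omega> - w l \<omega>" if "ok j \<omega>" "l \<le> Suc j" for l j \<omega>
  proof -
    have "\<zeta> i \<omega> = 1" if "i < l" for i
      using \<open>ok j \<omega>\<close> that \<open>l \<le> Suc j\<close> by (auto simp: \<zeta>_def ok_def)
    then have "Z l \<omega> = (\<Sum>i<l. (\<Delta> *\<^sub>R f (y i \<omega>) (z i \<omega>) + g (y i \<omega>) (z i \<omega>) *v dW i \<omega>)
       - (\<Delta> *\<^sub>R f (w i \<omega>) (v i \<omega>) + g (w i \<omega>) (v i \<omega>) *v dW i \<omega>))"
      unfolding Z_def by (intro sum.cong refl) (simp add: df_def dg_def scaleR_diff_right matrix_vector_mult_diff_rdistrib)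
    also have "\<dots> = X l \<omega> - w l \<omega>"
      unfolding sum_subtractf X_def w_def v_def dW_def \<Delta>(1) by (subst em_id_sum[of f g W \<tau> N \<xi> l \<omega>]) simp
    finally show ?thesis .
  qed
  define \<alpha> where "\<alpha> j \<omega> = \<Delta> * c * ((norm (Z j \<omega>))\<^sup>2 + (norm (Zd j \<omega>))\<^sup>2 + \<rho>\<^sup>2)" for j \<omega>
  have \<alpha>i: "integrable M (\<alpha> j)" for j
    unfolding \<alpha>_def[abs_def] using Z2 Zd2 by simp
  have drift: "(norm (Z j \<omega> + \<Delta> *\<^sub>R df j \<omega>))\<^sup>2 + \<Delta> * (norm (dg j \<omega>))\<^sup>2 \<le> (norm (Z j \<omega>))\<^sup>2 + \<alpha> j \<omega>"
    if \<omega>: "\<omega> \<in> space M" for j \<omega>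
  proof (cases "ok j \<omega>")
    case False
    then have "df j \<omega> = 0" "dg j \<omega> = 0" by (simp_all add: df_def dg_def \<zeta>_def)
    then show ?thesis using \<Delta>0 c1 by (simp add: \<alpha>_def)
  next
    case True
    have yw: "norm (y j \<omega> - w j \<omega>) \<le> \<rho> + norm (Z j \<omega>)"
    proof -
      have "norm (y j \<omega> - w j \<omega>) \<le> norm (y j \<omega> - X j \<omega>) + norm (X j \<omega> - w j \<omega>)"
        using norm_triangle_ineq[of "y j \<omega> - X j \<omega>" "X j \<omega> - w j \<omega>"] by simp
      then show ?thesis using True Z_eq[OF True, of j] by (auto simp: ok_def)
    qed
    have zv: "norm (z j \<omega> - v j \<omega>) \<le> \<rho> + norm (Zd j \<omega>)"
    proof (cases "j < N")
      case True
      then have "z j \<omega> = v j \<omega>" using z_eq(1)[OF True \<omega>] by (simp add: v_def em_nonpos \<Delta>(1))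
      then show ?thesis using \<open>\<rho> > 0\<close> by simp
    next
      case False
      then have e: "z j \<omega> = y (j - N) \<omega>" "v j \<omega> = w (j - N) \<omega>" "Zd j \<omega> = Z (j - N) \<omega>"
        using z_eq(2)[OF _ \<omega>, of j] by (simp_all add: v_def w_def Zd_def of_nat_diff)
      have "norm (y (j - N) \<omega> - w (j - N) \<omega>) \<le> norm (y (j - N) \<omega> - X (j - N) \<omega>) + norm (X (j - N) \<omega> - w (j - N) \<omega>)"
        using norm_triangle_ineq[of "y (j - N) \<omega> - X (j - N) \<omega>" "X (j - N) \<omega> - w (j - N) \<omega>"] by simp
      moreover have "norm (y (j - N) \<omega> - X (j - N) \<omega>) \<le> \<rho>" using \<open>ok j \<omega>\<close> by (simp add: ok_def)
      moreover have "Z (j - N) \<omega> = X (j - N) \<omega> - w (j - N) \<omega>" by (rule Z_eq[OF \<open>ok j \<omega>\<close>]) simp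
      ultimately show ?thesis unfolding e by simp
    qed
    \<comment> \<open>The distance of \<open>y\<close> from the scheme is at most \<rho> plus |Z|,
      at the current and at the delayed time alike, hence \<rho> twice.\<close>
    let ?s = "2 * \<rho> + norm (Z j \<omega>) + norm (Zd j \<omega>)"
    have s2: "?s\<^sup>2 \<le> 3 * (4 * \<rho>\<^sup>2 + (norm (Z j \<omega>))\<^sup>2 + (norm (Zd j \<omega>))\<^sup>2)"
    proof -
      have "?s\<^sup>2 + (2 * \<rho> - norm (Z j \<omega>))\<^sup>2 + (2 * \<rho> - norm (Zd j \<omega>))\<^sup>2 + (norm (Z j \<omega>) - norm (Zd j \<omega>))\<^sup>2
        = 3 * (4 * \<rho>\<^sup>2 + (norm (Z j \<omega>))\<^sup>2 + (norm (Zd j \<omega>))\<^sup>2)"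
        by (simp add: power2_eq_square algebra_simps)
      then show ?thesis
        using zero_le_power2[of "2 * \<rho> - norm (Z j \<omega>)"] zero_le_power2[of "2 * \<rho> - norm (Zd j \<omega>)"] zero_le_power2[of "norm (Z j \<omega>) - norm (Zd j \<omega>)"]
        by linarith
    qed
    have Ls: "L * (norm (y j \<omega> - w j \<omega>) + norm (z j \<omega> - v j \<omega>)) \<le> L * ?s"
      using yw zv L(1) by (intro mult_left_mono) auto
    have sq: "(norm d)\<^sup>2 \<le> 3 * L\<^sup>2 * (4 * \<rho>\<^sup>2 + (norm (Z j \<omega>))\<^sup>2 + (norm (Zd j \<omega>))\<^sup>2)"
      if "norm d \<le> L * ?s" for d :: "'b::real_normed_vector"
    proof -
      have "(norm d)\<^sup>2 \<le> (L * ?s)\<^sup>2" using that by (intro power_mono) auto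
      also have "\<dots> \<le> L\<^sup>2 * (3 * (4 * \<rho>\<^sup>2 + (norm (Z j \<omega>))\<^sup>2 + (norm (Zd j \<omega>))\<^sup>2))"
        unfolding power_mult_distrib[of L] using s2 by (intro mult_left_mono) auto
      finally show ?thesis by (simp only: mult_ac)
    qed
    have df2: "(norm (df j \<omega>))\<^sup>2 \<le> 3 * L\<^sup>2 * (4 * \<rho>\<^sup>2 + (norm (Z j \<omega>))\<^sup>2 + (norm (Zd j \<omega>))\<^sup>2)"
      using order_trans[OF L(2)[of "y j \<omega>" "z j \<omega>" "w j \<omega>" "v j \<omega>"] Ls] True
      by (intro sq) (simp add: df_def \<zeta>_def)
    have dg2: "(norm (dg j \<omega>))\<^sup>2 \<le> 3 * L\<^sup>2 * (4 * \<rho>\<^sup>2 + (norm (Z j \<omega>))\<^sup>2 + (norm (Zd j \<omega>))\<^sup>2)"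
      using order_trans[OF L(3)[of "y j \<omega>" "z j \<omega>" "w j \<omega>" "v j \<omega>"] Ls] True
      by (intro sq) (simp add: dg_def \<zeta>_def)
    have "(norm (Z j \<omega> + \<Delta> *\<^sub>R df j \<omega>))\<^sup>2 = (norm (Z j \<omega>))\<^sup>2 + \<Delta> * (2 * (Z j \<omega> \<bullet> df j \<omega>) + \<Delta> * (norm (df j \<omega>))\<^sup>2)"
      unfolding power2_norm_eq_inner
      by (simp add: inner_add_left inner_add_right inner_commute power2_eq_square algebra_simps)
    also have "2 * (Z j \<omega> \<bullet> df j \<omega>) \<le> (norm (Z j \<omega>))\<^sup>2 + (norm (df j \<omega>))\<^sup>2"
    proof -
      have "Z j \<omega> \<bullet> df j \<omega> \<le> norm (Z j \<omega>) * norm (df j \<omega>)" by (rule norm_cauchy_schwarz)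
      then show ?thesis using sum_squares_bound[of "norm (Z j \<omega>)" "norm (df j \<omega>)"] by linarith
    qed
    also have "\<Delta> * (norm (df j \<omega>))\<^sup>2 \<le> 1 * (norm (df j \<omega>))\<^sup>2"
      using \<Delta>(2) by (intro mult_right_mono) auto
    finally have "(norm (Z j \<omega> + \<Delta> *\<^sub>R df j \<omega>))\<^sup>2 + \<Delta> * (norm (dg j \<omega>))\<^sup>2
      \<le> (norm (Z j \<omega>))\<^sup>2 + \<Delta> * ((norm (Z j \<omega>))\<^sup>2 + (norm (df j \<omega>))\<^sup>2 + 1 * (norm (df j \<omega>))\<^sup>2) + \<Delta> * (norm (dg j \<omega>))\<^sup>2"
      using \<Delta>0 by simp
    also have "\<dots> = (norm (Z j \<omega>))\<^sup>2 + \<Delta> * ((norm (Z j \<omega>))\<^sup>2 + 2 * (norm (df j \<omega>))\<^sup>2 + (norm (dg j \<omega>))\<^sup>2)"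
      by (simp add: algebra_simps)
    also have "\<dots> \<le> (norm (Z j \<omega>))\<^sup>2 + \<Delta> * (c * ((norm (Z j \<omega>))\<^sup>2 + (norm (Zd j \<omega>))\<^sup>2 + \<rho>\<^sup>2))"
    proof (intro add_left_mono mult_left_mono)
      \<comment> \<open>Each squared difference of coefficients carries the factor 3 L^2. The drift
        enters twice and the diffusion once, which makes 9 L^2; its product with the 4 in front of
        \<rho>^2 is the 36 in \<open>c\<close>.\<close>
      have "(norm (Z j \<omega>))\<^sup>2 + 2 * (norm (df j \<omega>))\<^sup>2 + (norm (dg j \<omega>))\<^sup>2 \<le>
        (norm (Z j \<omega>))\<^sup>2 + 9 * L\<^sup>2 * (4 * \<rho>\<^sup>2 + (norm (Z j \<omega>))\<^sup>2 + (norm (Zd j \<omega>))\<^sup>2)"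
        using df2 dg2 by linarith
      also have "\<dots> \<le> c * ((norm (Z j \<omega>))\<^sup>2 + (norm (Zd j \<omega>))\<^sup>2 + \<rho>\<^sup>2)"
      proof -
        have "c * ((norm (Z j \<omega>))\<^sup>2 + (norm (Zd j \<omega>))\<^sup>2 + \<rho>\<^sup>2) - ((norm (Z j \<omega>))\<^sup>2 + 9 * L\<^sup>2 * (4 * \<rho>\<^sup>2 + (norm (Z j \<omega>))\<^sup>2 + (norm (Zd j \<omega>))\<^sup>2))
          = (norm (Zd j \<omega>))\<^sup>2 + \<rho>\<^sup>2 + 27 * L\<^sup>2 * ((norm (Z j \<omega>))\<^sup>2 + (norm (Zd j \<omega>))\<^sup>2)"
          unfolding c by (simp add: algebra_simps)
        moreover have "0 \<le> (norm (Zd j \<omega>))\<^sup>2 + \<rho>\<^sup>2 + 27 * L\<^sup>2 * ((norm (Z j \<omega>))\<^sup>2 + (norm (Zd j \<omega>))\<^sup>2)" by simp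
        ultimately show ?thesis by linarith
      qed
      finally show "(norm (Z j \<omega>))\<^sup>2 + 2 * (norm (df j \<omega>))\<^sup>2 + (norm (dg j \<omega>))\<^sup>2 \<le> c * ((norm (Z j \<omega>))\<^sup>2 + (norm (Zd j \<omega>))\<^sup>2 + \<rho>\<^sup>2)" .
    qed (use \<Delta>0 in simp)
    finally show ?thesis by (simp add: \<alpha>_def mult.assoc)
  qed
  have step: "expectation (\<lambda>\<omega>. (norm (Z (Suc j) \<omega>))\<^sup>2 * indicator B \<omega>) \<le> expectation (\<lambda>\<omega>. ((norm (Z j \<omega>))\<^sup>2 + \<alpha> j \<omega>) * indicator B \<omega>)"
    if B: "B \<in> sets (F (real j * \<Delta>))" for j B
  proof -
    have BM: "B \<in> events" using B sets_F_events[OF t0] by blast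
    have "expectation (\<lambda>\<omega>. (norm (Z (Suc j) \<omega>))\<^sup>2 * indicator B \<omega>) =
      expectation (\<lambda>\<omega>. ((norm (Z j \<omega> + \<Delta> *\<^sub>R df j \<omega>))\<^sup>2 + (real (Suc j) * \<Delta> - real j * \<Delta>) * (norm (dg j \<omega>))\<^sup>2) * indicator B \<omega>)"
      unfolding Z_Suc by (rule increment_L2_set[OF t0 tl ZDF ZD2[OF Z2] dfF(2) dg2 B])
    also have "\<dots> \<le> expectation (\<lambda>\<omega>. ((norm (Z j \<omega>))\<^sup>2 + \<alpha> j \<omega>) * indicator B \<omega>)"
      unfolding td
      by (intro integral_mono integrable_real_mult_indicator BM mult_right_mono drift Bochner_Integration.integrable_add
          ZD2 Z2 \<alpha>i integrable_mult_right dg2) auto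
    finally show ?thesis .
  qed
  have E\<alpha>: "expectation (\<alpha> j) = \<Delta> * c * (expectation (\<lambda>\<omega>. (norm (Z j \<omega>))\<^sup>2) + (if j < N then 0 else expectation (\<lambda>\<omega>. (norm (Z (j - N) \<omega>))\<^sup>2)) + \<rho>\<^sup>2)" for j
    unfolding \<alpha>_def[abs_def] using Z2 by (cases "j < N") (simp_all add: Zd_def prob_space)
  define q where "q = 1 + 2 * (\<Delta> * c)"
  have q1: "q \<ge> 1" using \<Delta>0 c1 by (simp add: q_def)
  \<comment> \<open>\<open>Z\<close> starts from 0, so its second moment is driven by the defect
    only and the bound is proportional to \<rho>^2.\<close>
  have a: "expectation (\<lambda>\<omega>. (norm (Z j \<omega>))\<^sup>2) \<le> \<rho>\<^sup>2 * (q ^ j - 1)" for j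
    unfolding q_def
  proof (rule delay_gronwall[where k = j and N = N])
    fix i
    have "space M \<in> sets (F (real i * \<Delta>))" using sets.top[of "F (real i * \<Delta>)"] space_F[OF t0] by simp
    from step[OF this] have "expectation (\<lambda>\<omega>. (norm (Z (Suc i) \<omega>))\<^sup>2) \<le> expectation (\<lambda>\<omega>. (norm (Z i \<omega>))\<^sup>2 + \<alpha> i \<omega>)"
      by (simp cong: Bochner_Integration.integral_cong)
    also have "\<dots> = expectation (\<lambda>\<omega>. (norm (Z i \<omega>))\<^sup>2) + expectation (\<alpha> i)" using Z2 \<alpha>i by simp
    finally show "expectation (\<lambda>\<omega>. (norm (Z (Suc i) \<omega>))\<^sup>2) \<le> expectation (\<lambda>\<omega>. (norm (Z i \<omega>))\<^sup>2) +
      \<Delta> * c * (expectation (\<lambda>\<omega>. (norm (Z i \<omega>))\<^sup>2) + (if i < N then 0 else expectation (\<lambda>\<omega>. (norm (Z (i - N) \<omega>))\<^sup>2)) + \<rho>\<^sup>2)"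
      unfolding E\<alpha> .
  qed (use \<Delta>0 c1 in \<open>auto simp: Z_def\<close>)
  have "\<beta>\<^sup>2 * prob {\<omega>\<in>space M. \<exists>j\<le>k. (norm (Z j \<omega>))\<^sup>2 \<ge> \<beta>\<^sup>2} \<le> expectation (\<lambda>\<omega>. (norm (Z 0 \<omega>))\<^sup>2) + (\<Sum>j<k. expectation (\<alpha> j))"
  proof (rule maximal_inequality[where G = "\<lambda>j. F (real j * \<Delta>)"])
    show "sets (F (real i * \<Delta>)) \<subseteq> sets (F (real n * \<Delta>))" if "i \<le> n" for i n by (intro sets_F_mono t0 tm that)
    show "subalgebra M (F (real n * \<Delta>))" for n by (intro subalgebra_F t0)
    show "(\<lambda>\<omega>. (norm (Z n \<omega>))\<^sup>2) \<in> borel_measurable (F (real n * \<Delta>))" for n using ZF by measurable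
    show "0 \<le> \<alpha> n \<omega>" for n \<omega> using \<Delta>0 c1 by (simp add: \<alpha>_def)
  qed (use Z2 \<alpha>i step in auto)
  also have "\<dots> \<le> 0 + (\<Sum>j<k. \<Delta> * c * (2 * q ^ k * \<rho>\<^sup>2))"
  proof (intro add_mono sum_mono)
    fix j assume "j \<in> {..<k}"
    then have j: "j \<le> k" by simp
    have b: "expectation (\<lambda>\<omega>. (norm (Z i \<omega>))\<^sup>2) \<le> \<rho>\<^sup>2 * (q ^ k - 1)" if "i \<le> k" for i
      using a[of i] mult_left_mono[OF diff_right_mono[OF power_increasing[OF that q1]], of "\<rho>\<^sup>2" 1] by simp
    have b0: "0 \<le> \<rho>\<^sup>2 * (q ^ k - 1)" using q1 by simp
    have "expectation (\<lambda>\<omega>. (norm (Z j \<omega>))\<^sup>2) + (if j < N then 0 else expectation (\<lambda>\<omega>. (norm (Z (j - N) \<omega>))\<^sup>2)) + \<rho>\<^sup>2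
      \<le> \<rho>\<^sup>2 * (q ^ k - 1) + \<rho>\<^sup>2 * (q ^ k - 1) + \<rho>\<^sup>2"
      using b[of j] b[of "j - N"] b0 j by (intro add_mono) auto
    also have "\<dots> \<le> 2 * q ^ k * \<rho>\<^sup>2" by (simp add: algebra_simps)
    finally show "expectation (\<alpha> j) \<le> \<Delta> * c * (2 * q ^ k * \<rho>\<^sup>2)"
      unfolding E\<alpha> using \<Delta>0 c1 by (intro mult_left_mono) auto
  qed (simp add: Z_def)
  also have "\<dots> = 2 * c * (real k * \<Delta>) * q ^ k * \<rho>\<^sup>2" by simp
  also have "\<dots> \<le> 2 * c * (real k * \<Delta>) * exp (2 * c * (real k * \<Delta>)) * \<rho>\<^sup>2"
  proof -
    have "q ^ k \<le> exp (2 * (\<Delta> * c)) ^ k"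
      unfolding q_def using \<Delta>0 c1 by (intro power_mono exp_ge_add_one_self) auto
    also have "\<dots> = exp (2 * c * (real k * \<Delta>))" by (simp add: exp_of_nat_mult[symmetric] mult_ac)
    finally show ?thesis using \<Delta>0 c1 by (intro mult_right_mono mult_left_mono) auto
  qed
  finally have *: "\<beta>\<^sup>2 * prob {\<omega>\<in>space M. \<exists>j\<le>k. (norm (Z j \<omega>))\<^sup>2 \<ge> \<beta>\<^sup>2} \<le> 2 * c * (real k * \<Delta>) * exp (2 * c * (real k * \<Delta>)) * \<rho>\<^sup>2" .
  have ev: "{\<omega>\<in>space M. \<exists>j\<le>k. (norm (Z j \<omega>))\<^sup>2 \<ge> \<beta>\<^sup>2} \<in> events"
    by measurable
  have "whp (2 * c * (real k * \<Delta>) * exp (2 * c * (real k * \<Delta>)) * \<rho>\<^sup>2 / \<beta>\<^sup>2) (\<lambda>\<omega>. \<not> (\<exists>j\<le>k. (norm (Z j \<omega>))\<^sup>2 \<ge> \<beta>\<^sup>2))"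
  proof (rule whp_prob, unfold not_not)
    show "prob {\<omega>\<in>space M. \<exists>j\<le>k. (norm (Z j \<omega>))\<^sup>2 \<ge> \<beta>\<^sup>2} \<le> 2 * c * (real k * \<Delta>) * exp (2 * c * (real k * \<Delta>)) * \<rho>\<^sup>2 / \<beta>\<^sup>2"
      using * \<open>\<beta> > 0\<close> by (subst pos_le_divide_eq) (simp_all add: mult.commute)
  qed (rule ev)
  then show ?thesis
  proof (rule whp_mono, simp)
    fix \<omega> assume n: "\<not> (\<exists>j\<le>k. (norm (Z j \<omega>))\<^sup>2 \<ge> \<beta>\<^sup>2)"
    show "(\<forall>j\<le>k. norm (y j \<omega> - X j \<omega>) \<le> \<rho>) \<longrightarrow> (\<forall>j\<le>k. norm (X j \<omega> - w j \<omega>) < \<beta>)"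
    proof (intro impI allI)
      fix j assume o: "\<forall>j\<le>k. norm (y j \<omega> - X j \<omega>) \<le> \<rho>" and j: "j \<le> k"
      then have "Z j \<omega> = X j \<omega> - w j \<omega>" by (intro Z_eq[of k]) (auto simp: ok_def)
      moreover have "(norm (Z j \<omega>))\<^sup>2 < \<beta>\<^sup>2" using n j by auto
      ultimately show "norm (X j \<omega> - w j \<omega>) < \<beta>" using \<open>\<beta> > 0\<close> power_less_imp_less_base[of _ 2 \<beta>] by simp
    qed
  qed
qed

end

section \<open>Convergence of the scheme to the solution\<close>

lemma simple_process_grid:
  assumes t: "\<And>i. i < k \<Longrightarrow> t i < t (Suc i)" and "i < k" and r: "r \<in> {t i<..t (Suc i)}"
  shows "simple_process k t \<psi> r \<omega> = \<psi> i \<omega>"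
proof -
  have mono: "t i \<le> t l" if "i \<le> l" "l \<le> k" for i l
    using that
  proof (induction l)
    case (Suc l) then show ?case using t[of l] by (cases "i = Suc l") auto
  qed simp
  have "simple_process k t \<psi> r \<omega> = (\<Sum>l<k. if l = i then \<psi> l \<omega> else 0)"
    unfolding simple_process_def
  proof (intro sum.cong refl)
    fix l assume l: "l \<in> {..<k}"
    have "r \<in> {t l<..t (Suc l)} \<longleftrightarrow> l = i"
      using mono[of "Suc l" i] mono[of "Suc i" l] l \<open>i < k\<close> r by (cases l i rule: linorder_cases) auto
    then show "indicator {t l<..t (Suc l)} r *\<^sub>R \<psi> l \<omega> = (if l = i then \<psi> l \<omega> else 0)"
      by (simp add: indicator_def)
  qed
  then show ?thesis using \<open>i < k\<close> by simp
qed

lemma grid_half_open: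
  assumes "\<Delta> > 0" "0 < r" "r \<le> real k * \<Delta>"
  obtains i where "i < k" "r \<in> {real i * \<Delta><..real (Suc i) * \<Delta>}"
proof -
  define i where "i = nat (\<lceil>r / \<Delta>\<rceil> - 1)"
  have p: "0 < r / \<Delta>" "r / \<Delta> \<le> real k" using assms by (simp_all add: field_simps)
  have "1 \<le> \<lceil>r / \<Delta>\<rceil>" "\<lceil>r / \<Delta>\<rceil> \<le> int k" using p by linarith+
  then have "i < k" "real i < r / \<Delta>" "r / \<Delta> \<le> real (Suc i)" unfolding i_def by linarith+
  then show thesis using that[of i] assms(1) by (simp add: field_simps)
qed

text \<open>Each cell contributes at most \<Delta> times the oscillation \<open>e\<close>. The
  integral is read as a Henstock--Kurzweil integral, which can be split at grid points and bounded
  on closed cells.\<close>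

lemma drift_riemann_sum:
  fixes h :: "real \<Rightarrow> 'b::euclidean_space"
  assumes "\<Delta> > 0" "e \<ge> 0" and h: "\<And>t. t \<ge> 0 \<Longrightarrow> set_integrable lborel {0..t} h"
    and close: "\<And>i s. i < k \<Longrightarrow> s \<in> {real i * \<Delta>..real (Suc i) * \<Delta>} \<Longrightarrow> norm (h s - v i) \<le> e"
  shows "j \<le> k \<Longrightarrow> norm ((LINT s:{0..real j * \<Delta>}|lborel. h s) - (\<Sum>i<j. \<Delta> *\<^sub>R v i)) \<le> real j * \<Delta> * e"
proof (induction j)
  case 0
  have "(LINT s:{0..0}|lborel. h s) = integral {0..0} h"
    using h[of 0] by (intro set_borel_integral_eq_integral(2)) simp
  then show ?case by simp
next
  case (Suc j)
  let ?a = "real j * \<Delta>" and ?b = "real (Suc j) * \<Delta>"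
  have ab: "0 \<le> ?a" "?a \<le> ?b" "?b - ?a = \<Delta>" using assms(1) by (simp_all add: algebra_simps)
  note int = set_borel_integral_eq_integral[OF h]
  have hb: "h integrable_on {0..?b}" using int(1)[of ?b] ab by simp
  have eq: "(LINT s:{0..?b}|lborel. h s) = (LINT s:{0..?a}|lborel. h s) + integral {?a..?b} h"
    using int(2)[of ?b] int(2)[of ?a] ab Henstock_Kurzweil_Integration.integral_combine[OF ab(1,2) hb] by simp
  have "h integrable_on {?a..?b}"
    by (rule integrable_on_subinterval[OF hb]) (use ab in auto)
  then have "((\<lambda>s. h s - v j) has_integral (integral {?a..?b} h - \<Delta> *\<^sub>R v j)) {?a..?b}"
    using has_integral_const_real[of "v j" ?a ?b] ab by (intro has_integral_diff integrable_integral) (auto simp: algebra_simps)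
  then have "norm (integral {?a..?b} h - \<Delta> *\<^sub>R v j) \<le> e * measure lborel {?a..?b}"
    by (rule has_integral_bound_real[OF assms(2) finite.emptyI]) (use close[of j] Suc.prems in auto)
  also have "e * measure lborel {?a..?b} = \<Delta> * e" using ab by simp
  finally have "norm (integral {?a..?b} h - \<Delta> *\<^sub>R v j) \<le> \<Delta> * e" .
  moreover have "norm ((LINT s:{0..?a}|lborel. h s) - (\<Sum>i<j. \<Delta> *\<^sub>R v i)) \<le> ?a * e"
    using Suc by simp
  moreover have "(LINT s:{0..?b}|lborel. h s) - (\<Sum>i<Suc j. \<Delta> *\<^sub>R v i) =
    ((LINT s:{0..?a}|lborel. h s) - (\<Sum>i<j. \<Delta> *\<^sub>R v i)) + (integral {?a..?b} h - \<Delta> *\<^sub>R v j)"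
    unfolding eq by simp
  ultimately have "norm ((LINT s:{0..?b}|lborel. h s) - (\<Sum>i<Suc j. \<Delta> *\<^sub>R v i)) \<le> ?a * e + \<Delta> * e"
    by (metis (no_types, lifting) norm_triangle_le add_mono)
  then show ?case by (simp add: algebra_simps)
qed

section \<open>Localisation to a ball, and Riemann sums for the solution\<close>

context delay_system
begin

text \<open>Composition with a nonexpansive projection onto a ball turns a local Lipschitz constant
  into a global one and makes the coefficients bounded. On paths that stay in the ball nothing is
  changed.\<close>

lemma truncated_coefficients:
  assumes "R > 0"
  obtains L C where "L > 0" "C \<ge> 0"
    "\<And>u v u' v'. norm (f (ball_proj R u) (ball_proj R v) - f (ball_proj R u') (ball_proj R v')) \<le> L * (norm (u - u') + norm (v - v'))"
    "\<And>u v u' v'. norm (g (ball_proj R u) (ball_proj R v) - g (ball_proj R u') (ball_proj R v')) \<le> L * (norm (u - u') + norm (v - v'))"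
    "\<And>u v. norm (f (ball_proj R u) (ball_proj R v)) \<le> C" "\<And>u v. norm (g (ball_proj R u) (ball_proj R v)) \<le> C"
proof -
  obtain L where L: "L > 0"
    "\<And>u u' v v'. norm u \<le> R \<Longrightarrow> norm u' \<le> R \<Longrightarrow> norm v \<le> R \<Longrightarrow> norm v' \<le> R \<Longrightarrow>
       norm (f u v - f u' v') \<le> L * (norm (u - u') + norm (v - v'))"
    "\<And>u u' v v'. norm u \<le> R \<Longrightarrow> norm u' \<le> R \<Longrightarrow> norm v \<le> R \<Longrightarrow> norm v' \<le> R \<Longrightarrow>
       norm (g u v - g u' v') \<le> L * (norm (u - u') + norm (v - v'))"
    using fg_Lipschitz[OF assms] by blast
  obtain C where C: "C \<ge> 0" "\<And>u v. norm u \<le> R \<Longrightarrow> norm v \<le> R \<Longrightarrow> norm (f u v) \<le> C \<and> norm (g u v) \<le> C"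
    using fg_bounded[OF assms] by blast
  have R: "0 \<le> R" using assms by simp
  have b: "norm (ball_proj R v) \<le> R" for v :: "real^'d" by (rule norm_ball_proj_le[OF R])
  have d: "L * (norm (ball_proj R u - ball_proj R u') + norm (ball_proj R v - ball_proj R v')) \<le> L * (norm (u - u') + norm (v - v'))"
    for u u' v v' :: "real^'d"
    using L(1) by (intro mult_left_mono add_mono ball_proj_nonexpansive R) auto
  show thesis
    by (rule that[OF L(1) C(1) order_trans[OF L(2) d] order_trans[OF L(3) d]]) (use C(2) b in auto)
qed

text \<open>The coefficients need the solution one delay back to be measurable at nonnegative times;
  before time 0 the path is the deterministic initial datum.\<close>

lemma solution_facts:
  assumes "sdde_solution M F W f g \<tau> \<xi> x"
  shows "\<And>\<omega>. \<omega> \<in> space M \<Longrightarrow> continuous_on {-\<tau>..} (\<lambda>t. x t \<omega>)"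
    and "\<And>t \<omega>. t \<in> {-\<tau>..0} \<Longrightarrow> \<omega> \<in> space M \<Longrightarrow> x t \<omega> = \<xi> t"
    and "\<And>s t. -\<tau> \<le> s \<Longrightarrow> s \<le> t \<Longrightarrow> 0 \<le> t \<Longrightarrow> x s \<in> borel_measurable (F t)"
    and "\<And>t. -\<tau> \<le> t \<Longrightarrow> x t \<in> borel_measurable M"
proof -
  show "\<And>\<omega>. \<omega> \<in> space M \<Longrightarrow> continuous_on {-\<tau>..} (\<lambda>t. x t \<omega>)"
    and i: "\<And>t \<omega>. t \<in> {-\<tau>..0} \<Longrightarrow> \<omega> \<in> space M \<Longrightarrow> x t \<omega> = \<xi> t"
    using assms by (auto simp: sdde_solution_def)
  show F: "x s \<in> borel_measurable (F t)" if "-\<tau> \<le> s" "s \<le> t" "0 \<le> t" for s t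
  proof (cases "0 \<le> s")
    case True
    then have "x s \<in> borel_measurable (F s)" using assms by (simp add: sdde_solution_def)
    then show ?thesis by (rule measurable_F_mono) (use True that in auto)
  next
    case False
    then have "x s \<in> borel_measurable (F t) \<longleftrightarrow> (\<lambda>_. \<xi> s) \<in> borel_measurable (F t)"
      using i[of s] that space_F[OF that(3)] by (intro measurable_cong) auto
    then show ?thesis by simp
  qed
  show "x t \<in> borel_measurable M" if "-\<tau> \<le> t" for t
    by (rule measurable_F_M[OF F[of t "max 0 t"]]) (use that in auto)
qed

text \<open>While the path stays in the ball, the projected coefficients agree with the true ones
  along it. The Riemann sums then differ from the two integrals of the equation by the modulus of
  continuity and by the error of a simple approximation of the Ito integral.\<close>

lemma solution_riemann_sum:
  assumes sol: "sdde_solution M F W f g \<tau> \<xi> x" and "m > 0" "R > 0" "\<rho> > 0" "\<epsilon> > 0"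
  defines "fR \<equiv> \<lambda>u v. f (ball_proj R u) (ball_proj R v)" and "gR \<equiv> \<lambda>u v. g (ball_proj R u) (ball_proj R v)"
  obtains N\<^sub>0 :: nat where "\<And>N. N \<ge> N\<^sub>0 \<Longrightarrow> N > 0 \<Longrightarrow> whp \<epsilon> (\<lambda>\<omega>.
    (\<forall>t\<in>{-\<tau>..real m * \<tau>}. norm (x t \<omega>) \<le> R) \<longrightarrow> (\<forall>j\<le>m * N. norm (x (real j * (\<tau> / real N)) \<omega> -
      (\<xi> 0 + (\<Sum>i<j. (\<tau> / real N) *\<^sub>R fR (x (real i * (\<tau> / real N)) \<omega>) (x (real i * (\<tau> / real N) - \<tau>) \<omega>)
        + gR (x (real i * (\<tau> / real N)) \<omega>) (x (real i * (\<tau> / real N) - \<tau>) \<omega>)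
          *v (W (real (Suc i) * (\<tau> / real N)) \<omega> - W (real i * (\<tau> / real N)) \<omega>)))) \<le> \<rho>))"
proof -
  define T where "T = real m * \<tau>"
  have T: "T > 0" using \<open>m > 0\<close> \<tau> by (simp add: T_def)
  note xc = solution_facts(1)[OF sol] and xi = solution_facts(2)[OF sol] and xF = solution_facts(3)[OF sol] and xM = solution_facts(4)[OF sol]
  define \<phi> where "\<phi> s \<omega> = g (x s \<omega>) (x (s - \<tau>) \<omega>)" for s \<omega>
  obtain I where ito: "ito_integral M F W \<phi> I"
    and eq: "AE \<omega> in M. \<forall>t\<ge>0. set_integrable lborel {0..t} (\<lambda>s. f (x s \<omega>) (x (s - \<tau>) \<omega>)) \<and>
       x t \<omega> = \<xi> 0 + (LINT s:{0..t}|lborel. f (x s \<omega>) (x (s - \<tau>) \<omega>)) + I t \<omega>"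
    using sol unfolding sdde_solution_def \<phi>_def by blast
  obtain L C where L: "L > 0" and C: "C \<ge> 0"
    and Lf: "\<And>u v u' v'. norm (fR u v - fR u' v') \<le> L * (norm (u - u') + norm (v - v'))"
    and Lg: "\<And>u v u' v'. norm (gR u v - gR u' v') \<le> L * (norm (u - u') + norm (v - v'))"
    and Cg: "\<And>u v. norm (gR u v) \<le> C"
    using truncated_coefficients[OF \<open>R > 0\<close>] unfolding fR_def gR_def by metis
  have gR_borel: "(\<lambda>(u, v). gR u v) \<in> borel_measurable borel"
  proof -
    have pr: "ball_proj R \<in> borel_measurable (borel :: (real^'d) measure)"
      using \<open>R > 0\<close> by (intro borel_measurable_ball_proj) simp
    have "(\<lambda>x. g (ball_proj R (fst x)) (ball_proj R (snd x))) \<in> borel_measurable (borel :: ((real^'d) \<times> (real^'d)) measure)"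
      by (intro borel_measurable_compose2[OF g_borel] measurable_compose[OF _ pr] borel_measurable_continuous_onI continuous_intros)
    then show ?thesis by (simp add: gR_def case_prod_beta)
  qed
  \<comment> \<open>Budget for \<rho>: one half for the drift, one quarter for the Riemann sum
    against the simple integral, one quarter for the simple integral against \<open>I\<close>. The
    second term in \<open>e\<close> and the one in \<open>\<delta>\<close> keep the tail of the
    middle comparison below \<open>\<epsilon> / 4\<close>.\<close>
  define \<rho>' where "\<rho>' = \<rho> / 4"
  define e where "e = min (\<rho> / (2 * T)) (sqrt (\<epsilon> * \<rho>'\<^sup>2 / (16 * T)))"
  have \<rho>': "\<rho>' > 0" using assms by (simp add: \<rho>'_def)
  have e: "e > 0" using \<rho>' assms T by (simp add: e_def)
  have eT: "T * e \<le> \<rho> / 2"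
  proof -
    have "T * e \<le> T * (\<rho> / (2 * T))" using T by (intro mult_left_mono) (auto simp: e_def)
    then show ?thesis using T by simp
  qed
  have e2: "2 * e\<^sup>2 * T \<le> \<epsilon> * \<rho>'\<^sup>2 / 8"
  proof -
    have "e\<^sup>2 \<le> (sqrt (\<epsilon> * \<rho>'\<^sup>2 / (16 * T)))\<^sup>2" using e by (intro power_mono) (auto simp: e_def)
    also have "\<dots> = \<epsilon> * \<rho>'\<^sup>2 / (16 * T)" using assms T by (intro real_sqrt_pow2) simp
    finally have "2 * e\<^sup>2 * T \<le> 2 * (\<epsilon> * \<rho>'\<^sup>2 / (16 * T)) * T" using T by (intro mult_right_mono mult_left_mono) auto
    then show ?thesis using T by simp
  qed
  \<comment> \<open>Within a cell the current and the delayed argument each move by at most \<eta>,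
    so the coefficients move by at most \<open>L * (\<eta> + \<eta>)\<close>, which is
    \<open>e\<close>.\<close>
  define \<eta> where "\<eta> = e / (2 * L)"
  have \<eta>: "\<eta> > 0" "L * (\<eta> + \<eta>) = e" using e L by (simp_all add: \<eta>_def)
  define \<delta> where "\<delta> = min \<rho>' (\<epsilon> * \<rho>'\<^sup>2 / 16)"
  have \<delta>: "\<delta> > 0" "\<delta> \<le> \<rho>'" "2 * \<delta> \<le> \<epsilon> * \<rho>'\<^sup>2 / 8" using \<rho>' assms by (auto simp: \<delta>_def)
  have tail: "(2 * \<delta> + 2 * e\<^sup>2 * T) / \<rho>'\<^sup>2 \<le> \<epsilon> / 4"
  proof -
    have "2 * \<delta> + 2 * e\<^sup>2 * T \<le> \<epsilon> / 4 * \<rho>'\<^sup>2" using \<delta>(3) e2 by simp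
    then show ?thesis using \<rho>' by (subst pos_divide_le_eq) auto
  qed
  \<comment> \<open>The approximating simple integrand is fixed before \<open>N\<close>; afterwards
    only the modulus of continuity determines how large \<open>N\<close> has to be.\<close>
  obtain n s H where si: "simple_integrand M F n s H"
    and w1: "whp (\<epsilon> / 4) (\<lambda>\<omega>. (\<integral>\<^sup>+ r\<in>{0..T}. ennreal ((norm (simple_process n s H r \<omega> - \<phi> r \<omega>))\<^sup>2) \<partial>lborel) \<le> ennreal \<delta>)"
    and w2: "whp (\<epsilon> / 4) (\<lambda>\<omega>. \<forall>t\<in>{0..T}. norm (simple_integral W n s H t \<omega> - I t \<omega>) \<le> \<delta>)"
    by (rule ito_approximation[OF ito T _ \<delta>(1), of "\<epsilon> / 4"]) (use \<open>\<epsilon> > 0\<close> in auto)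
  have cT: "continuous_on {-\<tau>..T} (\<lambda>t. x t \<omega>)" if "\<omega> \<in> space M" for \<omega>
    by (rule continuous_on_subset[OF xc[OF that]]) auto
  obtain N0 :: nat where w3: "\<And>N. N \<ge> N0 \<Longrightarrow>
    whp (\<epsilon> / 4) (\<lambda>\<omega>. \<forall>s\<in>{-\<tau>..T}. \<forall>t\<in>{-\<tau>..T}. \<bar>s - t\<bar> \<le> \<tau> / real N \<longrightarrow> norm (x s \<omega> - x t \<omega>) \<le> \<eta>)"
    using path_modulus_whp[of "-\<tau>" T x "\<epsilon> / 4" \<eta> \<tau>, OF _ cT xM] \<tau> T \<eta>(1) \<open>\<epsilon> > 0\<close> by auto
  show thesis
  proof (rule that[of N0])
    fix N :: nat assume N: "N \<ge> N0" "N > 0"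
    define \<Delta> where "\<Delta> = \<tau> / real N"
    have \<Delta>: "\<Delta> > 0" "real N * \<Delta> = \<tau>" using N \<tau> by (simp_all add: \<Delta>_def)
    have kT: "real (m * N) * \<Delta> = T" using \<Delta>(2) by (simp add: T_def mult.assoc)
    define t where "t i = real i * \<Delta>" for i
    have tl: "t i < t (Suc i)" "t (Suc i) - t i = \<Delta>" "0 \<le> t i" for i using \<Delta>(1) by (simp_all add: t_def algebra_simps)
    have tT: "t i \<le> T" if "i \<le> m * N" for i
      unfolding kT[symmetric] t_def using that \<Delta>(1) by (intro mult_right_mono) (auto simp flip: of_nat_mult)
    define \<psi> where "\<psi> i \<omega> = gR (x (t i) \<omega>) (x (t i - \<tau>) \<omega>)" for i \<omega>
    have gi: "simple_integrand M F (m * N) t \<psi>"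
      unfolding simple_integrand_def
    proof (intro conjI allI impI)
      fix j
      show "\<psi> j \<in> borel_measurable (F (t j))"
        unfolding \<psi>_def using tl(3)[of j] \<tau> by (intro borel_measurable_compose2[OF gR_borel] xF) auto
      show "bounded (\<psi> j ` space M)" unfolding bounded_iff \<psi>_def using Cg by auto
    qed (use tl in auto)
    let ?E = "\<lambda>\<omega>. (\<integral>\<^sup>+ r\<in>{0..T}. ennreal ((norm (simple_process n s H r \<omega> - \<phi> r \<omega>))\<^sup>2) \<partial>lborel) \<le> ennreal \<delta>"
    let ?S = "\<lambda>\<omega>. \<forall>t\<in>{0..T}. norm (simple_integral W n s H t \<omega> - I t \<omega>) \<le> \<delta>"
    let ?U = "\<lambda>\<omega>. \<forall>s\<in>{-\<tau>..T}. \<forall>t\<in>{-\<tau>..T}. \<bar>s - t\<bar> \<le> \<tau> / real N \<longrightarrow> norm (x s \<omega> - x t \<omega>) \<le> \<eta>"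
    let ?C = "\<lambda>\<omega>. \<forall>r\<in>{0<..T}. norm (simple_process (m * N) t \<psi> r \<omega> - \<phi> r \<omega>) \<le> e"
    let ?D = "\<lambda>\<omega>. \<forall>j\<le>m * N. norm (simple_integral W n s H (t j) \<omega> - (\<Sum>i<j. \<psi> i \<omega> *v (W (t (Suc i)) \<omega> - W (t i) \<omega>))) < \<rho>'"
    let ?A = "\<lambda>\<omega>. \<forall>t\<ge>0. set_integrable lborel {0..t} (\<lambda>s. f (x s \<omega>) (x (s - \<tau>) \<omega>)) \<and>
       x t \<omega> = \<xi> 0 + (LINT s:{0..t}|lborel. f (x s \<omega>) (x (s - \<tau>) \<omega>)) + I t \<omega>"
    have w4: "whp (\<epsilon> / 4) (\<lambda>\<omega>. ?E \<omega> \<and> ?C \<omega> \<longrightarrow> ?D \<omega>)"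
      by (rule whp_mono[OF simple_integral_vs_riemann_sum[OF si ito gi _ _ T \<rho>' less_imp_le[OF \<delta>(1)] less_imp_le[OF e]] tail])
        (simp_all only: t_def kT of_nat_0 mult_zero_left)
    have "whp (\<epsilon> / 4 + (\<epsilon> / 4 + (\<epsilon> / 4 + (\<epsilon> / 4 + 0)))) (\<lambda>\<omega>.
      ?E \<omega> \<and> ?S \<omega> \<and> ?U \<omega> \<and> (?E \<omega> \<and> ?C \<omega> \<longrightarrow> ?D \<omega>) \<and> ?A \<omega>)"
      by (intro whp_conj w1 w2 w3[OF N(1)] w4 whp_AE eq)
    then have "whp \<epsilon> (\<lambda>\<omega>. (\<forall>t\<in>{-\<tau>..T}. norm (x t \<omega>) \<le> R) \<longrightarrow> (\<forall>j\<le>m * N. norm (x (t j) \<omega> -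
      (\<xi> 0 + (\<Sum>i<j. \<Delta> *\<^sub>R fR (x (t i) \<omega>) (x (t i - \<tau>) \<omega>)
        + \<psi> i \<omega> *v (W (t (Suc i)) \<omega> - W (t i) \<omega>)))) \<le> \<rho>))"
    proof (rule whp_mono)
      fix \<omega> assume \<omega>: "\<omega> \<in> space M" and *: "?E \<omega> \<and> ?S \<omega> \<and> ?U \<omega> \<and> (?E \<omega> \<and> ?C \<omega> \<longrightarrow> ?D \<omega>) \<and> ?A \<omega>"
      show "(\<forall>t\<in>{-\<tau>..T}. norm (x t \<omega>) \<le> R) \<longrightarrow> (\<forall>j\<le>m * N. norm (x (t j) \<omega> -
        (\<xi> 0 + (\<Sum>i<j. \<Delta> *\<^sub>R fR (x (t i) \<omega>) (x (t i - \<tau>) \<omega>)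
        + \<psi> i \<omega> *v (W (t (Suc i)) \<omega> - W (t i) \<omega>)))) \<le> \<rho>)"
      proof (intro impI allI)
        fix j assume R: "\<forall>t\<in>{-\<tau>..T}. norm (x t \<omega>) \<le> R" and j: "j \<le> m * N"
        have md: "norm (x s \<omega> - x t \<omega>) \<le> \<eta>" if "s \<in> {-\<tau>..T}" "t \<in> {-\<tau>..T}" "\<bar>s - t\<bar> \<le> \<Delta>" for s t
          using * that unfolding \<Delta>_def by blast
        have cell: "norm (x r \<omega> - x (t i) \<omega>) + norm (x (r - \<tau>) \<omega> - x (t i - \<tau>) \<omega>) \<le> \<eta> + \<eta>" "r \<in> {0..T}"
          if "i < m * N" "r \<in> {t i..t (Suc i)}" for i r
        proof -
          show "r \<in> {0..T}" using that tl(3)[of i] tT[of "Suc i"] by auto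
          moreover have "t i \<in> {0..T}" using that tl(3)[of i] tT[of i] by auto
          moreover have "\<bar>r - t i\<bar> \<le> \<Delta>" using that(2) tl(2)[of i] by auto
          ultimately show "norm (x r \<omega> - x (t i) \<omega>) + norm (x (r - \<tau>) \<omega> - x (t i - \<tau>) \<omega>) \<le> \<eta> + \<eta>"
            using \<tau> by (intro add_mono md) auto
        qed
        have pid: "ball_proj R (x r \<omega>) = x r \<omega>" "ball_proj R (x (r - \<tau>) \<omega>) = x (r - \<tau>) \<omega>" if "r \<in> {0..T}" for r
          using that R \<tau> by (auto intro!: ball_proj_id)
        have "norm (simple_process (m * N) t \<psi> r \<omega> - \<phi> r \<omega>) \<le> e" if r: "r \<in> {0<..T}" for r
        proof -
          obtain i where i: "i < m * N" "r \<in> {t i<..t (Suc i)}"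
            using grid_half_open[of \<Delta> r "m * N"] r \<Delta>(1) kT unfolding t_def by auto
          have "simple_process (m * N) t \<psi> r \<omega> = \<psi> i \<omega>"
            by (rule simple_process_grid[OF tl(1) i])
          moreover have "\<phi> r \<omega> = gR (x r \<omega>) (x (r - \<tau>) \<omega>)"
            using pid[of r] r by (simp add: \<phi>_def gR_def)
          moreover have "norm (gR (x r \<omega>) (x (r - \<tau>) \<omega>) - \<psi> i \<omega>) \<le> L * (\<eta> + \<eta>)"
            unfolding \<psi>_def using cell(1)[of i r] i L by (intro order_trans[OF Lg] mult_left_mono) auto
          ultimately show ?thesis using \<eta>(2) by (simp add: norm_minus_commute)
        qed
        then have 1: "norm (simple_integral W n s H (t j) \<omega> - (\<Sum>i<j. \<psi> i \<omega> *v (W (t (Suc i)) \<omega> - W (t i) \<omega>))) < \<rho>'"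
          using * j by blast
        have 2: "norm (simple_integral W n s H (t j) \<omega> - I (t j) \<omega>) \<le> \<delta>"
          using * tl(3)[of j] tT[OF j] by auto
        have 3: "norm ((LINT s:{0..t j}|lborel. f (x s \<omega>) (x (s - \<tau>) \<omega>)) - (\<Sum>i<j. \<Delta> *\<^sub>R fR (x (t i) \<omega>) (x (t i - \<tau>) \<omega>))) \<le> real j * \<Delta> * e"
          unfolding t_def[of j]
        proof (rule drift_riemann_sum[where k = "m * N", OF \<Delta>(1) less_imp_le[OF e] _ _ j])
          show "set_integrable lborel {0..t} (\<lambda>s. f (x s \<omega>) (x (s - \<tau>) \<omega>))" if "t \<ge> 0" for t
            using * that by blast
          fix i s assume i: "i < m * N" "s \<in> {real i * \<Delta>..real (Suc i) * \<Delta>}"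
          have "f (x s \<omega>) (x (s - \<tau>) \<omega>) = fR (x s \<omega>) (x (s - \<tau>) \<omega>)"
            using pid[of s] cell(2)[of i s] i by (simp add: fR_def t_def)
          moreover have "norm (fR (x s \<omega>) (x (s - \<tau>) \<omega>) - fR (x (t i) \<omega>) (x (t i - \<tau>) \<omega>)) \<le> L * (\<eta> + \<eta>)"
            using cell(1)[of i s] i L by (intro order_trans[OF Lf] mult_left_mono) (auto simp: t_def)
          ultimately show "norm (f (x s \<omega>) (x (s - \<tau>) \<omega>) - fR (x (t i) \<omega>) (x (t i - \<tau>) \<omega>)) \<le> e"
            using \<eta>(2) by simp
        qed
        also have "real j * \<Delta> * e \<le> T * e" using tT[OF j] e by (intro mult_right_mono) (auto simp: t_def)
        finally have 3: "norm ((LINT s:{0..t j}|lborel. f (x s \<omega>) (x (s - \<tau>) \<omega>)) - (\<Sum>i<j. \<Delta> *\<^sub>R fR (x (t i) \<omega>) (x (t i - \<tau>) \<omega>))) \<le> \<rho> / 2"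
          using eT by simp
        have xe: "x (t j) \<omega> = \<xi> 0 + (LINT s:{0..t j}|lborel. f (x s \<omega>) (x (s - \<tau>) \<omega>)) + I (t j) \<omega>"
          using * tl(3)[of j] by blast
        have "x (t j) \<omega> - (\<xi> 0 + (\<Sum>i<j. \<Delta> *\<^sub>R fR (x (t i) \<omega>) (x (t i - \<tau>) \<omega>) + \<psi> i \<omega> *v (W (t (Suc i)) \<omega> - W (t i) \<omega>)))
          = ((LINT s:{0..t j}|lborel. f (x s \<omega>) (x (s - \<tau>) \<omega>)) - (\<Sum>i<j. \<Delta> *\<^sub>R fR (x (t i) \<omega>) (x (t i - \<tau>) \<omega>)))
           + ((simple_integral W n s H (t j) \<omega> - (\<Sum>i<j. \<psi> i \<omega> *v (W (t (Suc i)) \<omega> - W (t i) \<omega>))) - (simple_integral W n s H (t j) \<omega> - I (t j) \<omega>))"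
          unfolding xe by (simp add: sum.distrib)
        also have "norm \<dots> \<le> \<rho> / 2 + (\<rho>' + \<delta>)"
        proof -
          have tri: "norm (a + (b - c)) \<le> norm a + (norm b + norm c)" for a b c :: "real^'d"
            by (intro order_trans[OF norm_triangle_ineq] add_left_mono norm_triangle_ineq4)
          show ?thesis by (rule order_trans[OF tri]) (intro add_mono less_imp_le[OF 1] 2 3)
        qed
        also have "\<dots> \<le> \<rho>" using \<delta>(2) by (simp add: \<rho>'_def)
        finally show "norm (x (t j) \<omega> - (\<xi> 0 + (\<Sum>i<j. \<Delta> *\<^sub>R fR (x (t i) \<omega>) (x (t i - \<tau>) \<omega>) + \<psi> i \<omega> *v (W (t (Suc i)) \<omega> - W (t i) \<omega>)))) \<le> \<rho>" .
      qed
    qed simp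
    then show "whp \<epsilon> (\<lambda>\<omega>.
    (\<forall>t\<in>{-\<tau>..real m * \<tau>}. norm (x t \<omega>) \<le> R) \<longrightarrow> (\<forall>j\<le>m * N. norm (x (real j * (\<tau> / real N)) \<omega> -
      (\<xi> 0 + (\<Sum>i<j. (\<tau> / real N) *\<^sub>R fR (x (real i * (\<tau> / real N)) \<omega>) (x (real i * (\<tau> / real N) - \<tau>) \<omega>)
        + gR (x (real i * (\<tau> / real N)) \<omega>) (x (real i * (\<tau> / real N) - \<tau>) \<omega>)
          *v (W (real (Suc i) * (\<tau> / real N)) \<omega> - W (real i * (\<tau> / real N)) \<omega>)))) \<le> \<rho>))"
      unfolding T_def t_def \<psi>_def \<Delta>_def .
  qed
qed

end

section \<open>From Riemann sums to the truncated scheme and to whole segments\<close>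

context delay_system
begin

text \<open>While the scheme \<open>w\<close> stays within radius \<open>R\<close>, the projection
  inside its coefficients and the outer truncation at the larger radius \<open>R'\<close> both act
  as the identity, so the recursions coincide. The claim covers negative indices because the delayed
  values enter.\<close>

lemma em_untruncated:
  assumes "N > 0" "0 \<le> R" "R \<le> R'" and \<xi>: "\<And>\<theta>. \<theta> \<in> {-\<tau>..0} \<Longrightarrow> norm (\<xi> \<theta>) \<le> R"
  defines "w \<equiv> em (\<lambda>u v. f (ball_proj R u) (ball_proj R v)) (\<lambda>u v. g (ball_proj R u) (ball_proj R v)) W (\<lambda>v. v) \<tau> N \<xi>"
  assumes w: "\<And>i. i \<le> j \<Longrightarrow> norm (w (int i) \<omega>) \<le> R"
  shows "- int N \<le> i \<Longrightarrow> i \<le> int j \<Longrightarrow> em f g W (ball_proj R') \<tau> N \<xi> i \<omega> = w i \<omega> \<and> norm (w i \<omega>) \<le> R"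
proof (induction "nat i" arbitrary: i rule: less_induct)
  case less
  show ?case
  proof (cases "i \<le> 0")
    case True
    have "of_int i * (\<tau> / real N) \<in> {-\<tau>..0}"
    proof -
      have "- real N * (\<tau> / real N) \<le> of_int i * (\<tau> / real N)"
        using less.prems(1) \<tau> by (intro mult_right_mono) (linarith, simp)
      moreover have "of_int i * (\<tau> / real N) \<le> 0"
        using True \<tau> by (intro mult_nonpos_nonneg) auto
      ultimately show ?thesis using \<open>N > 0\<close> by simp
    qed
    from \<xi>[OF this] show ?thesis
      using True assms(3) by (simp add: w_def em_nonpos ball_proj_id)
  next
    case False
    then obtain n where i: "i = int (Suc n)" by (metis Suc_pred' nat_int zero_less_nat_eq int_nat_eq not_le less_imp_le)
    have a: "em f g W (ball_proj R') \<tau> N \<xi> (int n) \<omega> = w (int n) \<omega> \<and> norm (w (int n) \<omega>) \<le> R"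
      using less.prems i by (intro less.hyps) auto
    have b: "em f g W (ball_proj R') \<tau> N \<xi> (int n - int N) \<omega> = w (int n - int N) \<omega> \<and> norm (w (int n - int N) \<omega>) \<le> R"
      using less.prems i \<open>N > 0\<close> by (intro less.hyps) auto
    have nw: "norm (w i \<omega>) \<le> R" using w[of "Suc n"] less.prems i by simp
    have "em f g W (ball_proj R') \<tau> N \<xi> i \<omega> = ball_proj R' (w i \<omega>)"
      unfolding i em_Suc Let_def w_def using a b by (simp only: w_def ball_proj_id)
    then show ?thesis using nw assms(3) by (simp add: ball_proj_id)
  qed
qed

text \<open>Two intermediate objects link solution and scheme: the Riemann sums along the solution,
  and the Euler scheme with projected coefficients but without outer truncation. The latter is close
  to the solution, hence stays in the ball, and there it coincides with the truncated
  scheme.\<close>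

lemma grid_convergence:
  assumes sol: "sdde_solution M F W f g \<tau> \<xi> x" and "\<xi> \<in> mspace (C_metric \<tau>)" and "m > 0" "\<delta> > 0" "\<epsilon> > 0"
  obtains N\<^sub>0 :: nat where "\<And>N. N \<ge> N\<^sub>0 \<Longrightarrow> valid_steps N \<Longrightarrow> whp \<epsilon> (\<lambda>\<omega>. \<forall>j\<le>m * N.
    norm (x (real j * (\<tau> / real N)) \<omega> - trunc_em N \<xi> (int j) \<omega>) \<le> \<delta>)"
proof -
  define T where "T = real m * \<tau>"
  have T: "T > 0" using \<open>m > 0\<close> \<tau> by (simp add: T_def)
  note xc = solution_facts(1)[OF sol] and xi = solution_facts(2)[OF sol] and xF = solution_facts(3)[OF sol] and xM = solution_facts(4)[OF sol]
  have cT: "continuous_on {-\<tau>..T} (\<lambda>t. x t \<omega>)" if "\<omega> \<in> space M" for \<omega>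
    by (rule continuous_on_subset[OF xc[OF that]]) auto
  obtain R0 where R0: "R0 > 0" "whp (\<epsilon> / 3) (\<lambda>\<omega>. \<forall>t\<in>{-\<tau>..T}. norm (x t \<omega>) \<le> R0)"
    using path_bounded_whp[of "-\<tau>" T x "\<epsilon> / 3", OF _ cT xM] \<tau> T \<open>\<epsilon> > 0\<close> by auto
  have "bounded (\<xi> ` {-\<tau>..0})"
    using assms(2) by (intro compact_imp_bounded compact_continuous_image) (auto simp: mspace_C_metric)
  then obtain R1 where R1: "\<And>\<theta>. \<theta> \<in> {-\<tau>..0} \<Longrightarrow> norm (\<xi> \<theta>) \<le> R1"
    unfolding bounded_iff by (metis image_eqI)
  \<comment> \<open>The margin 1 above the bound of the path leaves room for the scheme, whose
    distance from the solution will be at most \<open>2 * \<beta>\<close>, hence at most 1.\<close>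
  define R where "R = max R0 R1 + 1"
  have R: "R > 0" "R0 + 1 \<le> R" "\<And>\<theta>. \<theta> \<in> {-\<tau>..0} \<Longrightarrow> norm (\<xi> \<theta>) \<le> R"
    using R0 R1 by (force simp: R_def)+
  define fR where "fR u v = f (ball_proj R u) (ball_proj R v)" for u v
  define gR where "gR u v = g (ball_proj R u) (ball_proj R v)" for u v
  obtain L C where L: "L > 0" and C: "C \<ge> 0"
    and Lf: "\<And>u v u' v'. norm (fR u v - fR u' v') \<le> L * (norm (u - u') + norm (v - v'))"
    and Lg: "\<And>u v u' v'. norm (gR u v - gR u' v') \<le> L * (norm (u - u') + norm (v - v'))"
    and Cf: "\<And>u v. norm (fR u v) \<le> C" and Cg: "\<And>u v. norm (gR u v) \<le> C"
    using truncated_coefficients[OF \<open>R > 0\<close>] unfolding fR_def gR_def by metis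
  have pr: "ball_proj R \<in> borel_measurable (borel :: (real^'d) measure)"
    using \<open>R > 0\<close> by (intro borel_measurable_ball_proj) simp
  have fR_borel: "(\<lambda>(u, v). fR u v) \<in> borel_measurable borel"
    unfolding fR_def case_prod_beta
    by (intro borel_measurable_compose2[OF f_borel] measurable_compose[OF _ pr] borel_measurable_continuous_onI continuous_intros)
  have gR_borel: "(\<lambda>(u, v). gR u v) \<in> borel_measurable borel"
    unfolding gR_def case_prod_beta
    by (intro borel_measurable_compose2[OF g_borel] measurable_compose[OF _ pr] borel_measurable_continuous_onI continuous_intros)
  define c where "c = 1 + 36 * L\<^sup>2"
  have c1: "c \<ge> 1" by (simp add: c_def)
  define \<beta> where "\<beta> = min \<delta> 1 / 2"
  have \<beta>: "\<beta> > 0" "2 * \<beta> \<le> \<delta>" "2 * \<beta> \<le> 1" using \<open>\<delta> > 0\<close> by (auto simp: \<beta>_def)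
  \<comment> \<open>The factor in the stability estimate. It contains the step size only through the
    total time \<open>T\<close>, so \<rho> can be chosen from it before \<open>N\<close>.\<close>
  define A where "A = 2 * c * T * exp (2 * c * T)"
  have A: "A > 0" using c1 T by (simp add: A_def)
  define \<rho> where "\<rho> = min \<beta> (sqrt (\<epsilon> * \<beta>\<^sup>2 / (3 * A)))"
  have \<rho>: "\<rho> > 0" "\<rho> \<le> \<beta>" using \<beta> A \<open>\<epsilon> > 0\<close> by (auto simp: \<rho>_def)
  have "\<rho>\<^sup>2 \<le> (sqrt (\<epsilon> * \<beta>\<^sup>2 / (3 * A)))\<^sup>2" using \<rho> by (intro power_mono) (auto simp: \<rho>_def)
  also have "\<dots> = \<epsilon> * \<beta>\<^sup>2 / (3 * A)" using A \<open>\<epsilon> > 0\<close> by (intro real_sqrt_pow2) simp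
  finally have "A * \<rho>\<^sup>2 \<le> A * (\<epsilon> * \<beta>\<^sup>2 / (3 * A))" using A by (intro mult_left_mono) auto
  then have tail: "A * \<rho>\<^sup>2 / \<beta>\<^sup>2 \<le> \<epsilon> / 3" using A \<beta>(1) by (simp add: field_simps)
  obtain N1 :: nat where N1: "\<And>N. N \<ge> N1 \<Longrightarrow> N > 0 \<Longrightarrow> whp (\<epsilon> / 3) (\<lambda>\<omega>.
    (\<forall>t\<in>{-\<tau>..real m * \<tau>}. norm (x t \<omega>) \<le> R) \<longrightarrow> (\<forall>j\<le>m * N. norm (x (real j * (\<tau> / real N)) \<omega> -
      (\<xi> 0 + (\<Sum>i<j. (\<tau> / real N) *\<^sub>R fR (x (real i * (\<tau> / real N)) \<omega>) (x (real i * (\<tau> / real N) - \<tau>) \<omega>)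
        + gR (x (real i * (\<tau> / real N)) \<omega>) (x (real i * (\<tau> / real N) - \<tau>) \<omega>)
          *v (W (real (Suc i) * (\<tau> / real N)) \<omega> - W (real i * (\<tau> / real N)) \<omega>)))) \<le> \<rho>))"
    unfolding fR_def gR_def
    using solution_riemann_sum[OF sol \<open>m > 0\<close> \<open>R > 0\<close> \<rho>(1), of "\<epsilon> / 3"] \<open>\<epsilon> > 0\<close> by auto
  obtain N2 where N2: "\<And>N. N \<ge> N2 \<Longrightarrow> valid_steps N \<Longrightarrow> level (\<tau> / real N) \<ge> R"
    using level_large[of R] by auto
  show thesis
  proof (rule that[of "max N1 N2"])
    fix N :: nat assume N: "N \<ge> max N1 N2" "valid_steps N"
    note vs = valid_stepsD[OF N(2)]
    define \<Delta> where "\<Delta> = \<tau> / real N"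
    have \<Delta>: "\<Delta> > 0" "\<Delta> \<le> 1" "real N * \<Delta> = \<tau>" using vs \<tau> by (simp_all add: \<Delta>_def)
    have kT: "real (m * N) * \<Delta> = T" using \<Delta>(3) by (simp add: T_def mult.assoc)
    define X where "X j \<omega> = \<xi> 0 + (\<Sum>i<j. \<Delta> *\<^sub>R fR (x (real i * \<Delta>) \<omega>) (x (real i * \<Delta> - \<tau>) \<omega>)
        + gR (x (real i * \<Delta>) \<omega>) (x (real i * \<Delta> - \<tau>) \<omega>) *v (W (real (Suc i) * \<Delta>) \<omega> - W (real i * \<Delta>) \<omega>))" for j \<omega>
    define w where "w = em fR gR W (\<lambda>v. v) \<tau> N \<xi>"
    let ?B = "\<lambda>r \<omega>. \<forall>t\<in>{-\<tau>..T}. norm (x t \<omega>) \<le> r"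
    let ?X = "\<lambda>\<omega>. \<forall>j\<le>m * N. norm (x (real j * \<Delta>) \<omega> - X j \<omega>) \<le> \<rho>"
    let ?Y = "\<lambda>\<omega>. \<forall>j\<le>m * N. norm (X j \<omega> - w (int j) \<omega>) < \<beta>"
    have w1: "whp (\<epsilon> / 3) (\<lambda>\<omega>. ?B R \<omega> \<longrightarrow> ?X \<omega>)"
      using N1[of N] N(1) vs(1) unfolding \<Delta>_def T_def X_def by simp
    have "whp (2 * c * (real (m * N) * \<Delta>) * exp (2 * c * (real (m * N) * \<Delta>)) * \<rho>\<^sup>2 / \<beta>\<^sup>2)
      (\<lambda>\<omega>. ?X \<omega> \<longrightarrow> ?Y \<omega>)"
      unfolding X_def w_def
    proof (rule euler_stability[OF \<tau> vs(1) \<Delta>_def \<Delta>(2) fR_borel gR_borel less_imp_le[OF L] Lf Lg Cf Cg _ _ _ _ \<rho>(1) \<beta>(1) c_def])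
      show "x (real j * \<Delta>) \<in> borel_measurable (F (real j * \<Delta>))" "x (real j * \<Delta> - \<tau>) \<in> borel_measurable (F (real j * \<Delta>))" for j
      proof -
        have "0 \<le> real j * \<Delta>" using \<Delta>(1) by simp
        then show "x (real j * \<Delta>) \<in> borel_measurable (F (real j * \<Delta>))" "x (real j * \<Delta> - \<tau>) \<in> borel_measurable (F (real j * \<Delta>))"
          using \<tau> by (intro xF; linarith)+
      qed
      show "x (real j * \<Delta> - \<tau>) \<omega> = \<xi> (of_int (int j - int N) * \<Delta>)" if "j < N" "\<omega> \<in> space M" for j \<omega>
      proof -
        have e: "of_int (int j - int N) * \<Delta> = real j * \<Delta> - \<tau>" using \<Delta>(3) by (simp add: left_diff_distrib)
        have "real j * \<Delta> \<le> real N * \<Delta>" "0 \<le> real j * \<Delta>" using that(1) \<Delta>(1) by simp_all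
        then show ?thesis unfolding e using \<Delta>(3) that(2) by (intro xi) auto
      qed
      show "x (real j * \<Delta> - \<tau>) \<omega> = x (real (j - N) * \<Delta>) \<omega>" if "N \<le> j" for j \<omega>
        using that \<Delta>(3) by (simp add: of_nat_diff left_diff_distrib)
    qed
    then have w2: "whp (\<epsilon> / 3) (\<lambda>\<omega>. ?X \<omega> \<longrightarrow> ?Y \<omega>)"
      unfolding kT A_def[symmetric] by (rule whp_mono[OF _ tail])
    have "whp (\<epsilon> / 3 + (\<epsilon> / 3 + \<epsilon> / 3)) (\<lambda>\<omega>. ?B R0 \<omega> \<and> (?B R \<omega> \<longrightarrow> ?X \<omega>) \<and> (?X \<omega> \<longrightarrow> ?Y \<omega>))"
      by (intro whp_conj R0(2) w1 w2)
    then have "whp \<epsilon> (\<lambda>\<omega>. \<forall>j\<le>m * N. norm (x (real j * \<Delta>) \<omega> - em f g W (ball_proj (level \<Delta>)) \<tau> N \<xi> (int j) \<omega>) \<le> \<delta>)"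
    proof (rule whp_mono)
      fix \<omega> assume \<omega>: "\<omega> \<in> space M" and *: "?B R0 \<omega> \<and> (?B R \<omega> \<longrightarrow> ?X \<omega>) \<and> (?X \<omega> \<longrightarrow> ?Y \<omega>)"
      have "\<forall>t\<in>{-\<tau>..T}. norm (x t \<omega>) \<le> R" using * R(2) by force
      then have 1: "norm (x (real j * \<Delta>) \<omega> - X j \<omega>) \<le> \<rho>" "norm (X j \<omega> - w (int j) \<omega>) < \<beta>" if "j \<le> m * N" for j
        using * that by blast+
      have xw: "norm (x (real j * \<Delta>) \<omega> - w (int j) \<omega>) \<le> 2 * \<beta>" if "j \<le> m * N" for j
        using 1[OF that] \<rho>(2) norm_triangle_ineq[of "x (real j * \<Delta>) \<omega> - X j \<omega>" "X j \<omega> - w (int j) \<omega>"] by simp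
      have wR: "norm (w (int j) \<omega>) \<le> R" if "j \<le> m * N" for j
      proof -
        have "real j * \<Delta> \<le> real (m * N) * \<Delta>" using that \<Delta>(1) by (intro mult_right_mono of_nat_mono) auto
        then have "real j * \<Delta> \<in> {-\<tau>..T}" using kT \<Delta>(1) \<tau> by (auto intro: order_trans[of _ 0])
        then have "norm (x (real j * \<Delta>) \<omega>) \<le> R0" using * by blast
        moreover have "norm (w (int j) \<omega>) \<le> norm (x (real j * \<Delta>) \<omega>) + norm (x (real j * \<Delta>) \<omega> - w (int j) \<omega>)"
          by (metis norm_minus_commute norm_triangle_sub)
        ultimately show ?thesis using xw[OF that] \<beta>(3) R(2) by linarith
      qed
      have lv: "R \<le> level \<Delta>" using N2[of N] N unfolding \<Delta>_def by simp
      show "\<forall>j\<le>m * N. norm (x (real j * \<Delta>) \<omega> - em f g W (ball_proj (level \<Delta>)) \<tau> N \<xi> (int j) \<omega>) \<le> \<delta>"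
      proof (intro allI impI)
        fix j assume j: "j \<le> m * N"
        have "em f g W (ball_proj (level \<Delta>)) \<tau> N \<xi> (int j) \<omega> = w (int j) \<omega>"
          using em_untruncated[where \<xi> = \<xi> and j = "m * N" and i = "int j" and \<omega> = \<omega>, OF vs(1) less_imp_le[OF R(1)] lv R(3)] wR j
          unfolding w_def fR_def gR_def by (simp del: of_nat_mult)
        then show "norm (x (real j * \<Delta>) \<omega> - em f g W (ball_proj (level \<Delta>)) \<tau> N \<xi> (int j) \<omega>) \<le> \<delta>"
          using xw[OF j] \<beta>(2) by simp
      qed
    qed simp
    then show "whp \<epsilon> (\<lambda>\<omega>. \<forall>j\<le>m * N. norm (x (real j * (\<tau> / real N)) \<omega> - trunc_em N \<xi> (int j) \<omega>) \<le> \<delta>)"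
      unfolding \<Delta>_def .
  qed
qed

abbreviation em_seg :: "nat \<Rightarrow> nat \<Rightarrow> (real \<Rightarrow> real^'d) \<Rightarrow> 'w \<Rightarrow> real \<Rightarrow> real^'d" where
  "em_seg N k \<xi> \<equiv> segment \<tau> (em_interp f g W (ball_proj (level (\<tau> / real N))) \<tau> N \<xi>) (real k * (\<tau> / real N))"

lemma em_seg_measurable:
  assumes "valid_steps N" "\<xi> \<in> mspace (C_metric \<tau>)"
  shows "em_seg N k \<xi> \<in> measurable M (C_borel \<tau>)"
  using level_props(1)[OF valid_stepsD(2,5)[OF assms(1)]] assms valid_stepsD(1)
  by (intro em_segment_measurable \<tau> f_borel g_borel) auto

lemma solution_segment_measurable:
  assumes "sdde_solution M F W f g \<tau> \<xi> x" "0 \<le> t"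
  shows "segment \<tau> x t \<in> measurable M (C_borel \<tau>)"
proof (rule segment_measurable[OF \<tau>])
  show "continuous_on {t - \<tau>..t} (\<lambda>s. x s \<omega>)" if "\<omega> \<in> space M" for \<omega>
    by (rule continuous_on_subset[OF solution_facts(1)[OF assms(1) that]]) (use assms(2) in auto)
  show "x s \<in> borel_measurable M" if "s \<in> {t - \<tau>..t}" for s
    using that assms(2) by (intro solution_facts(4)[OF assms(1)]) auto
qed

lemma window_time:
  assumes "N > 0" "N \<le> k" "\<theta> \<in> {-\<tau>..0}"
  shows "real k * (\<tau> / real N) + \<theta> \<in> {real (k - N) * (\<tau> / real N)..real (k - N + N) * (\<tau> / real N)}"
proof -
  have "real (k - N) * (\<tau> / real N) = real k * (\<tau> / real N) - \<tau>"
    using assms(1,2) by (simp add: of_nat_diff left_diff_distrib diff_divide_distrib)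
  then show ?thesis using assms(2,3) by simp
qed

text \<open>At every time of the segment the two interpolated paths are convex combinations with the
  same indices and weights, so the sup distance is governed by the grid values in the
  window.\<close>

lemma em_seg_mdist_le:
  assumes N: "valid_steps N" "N \<le> k" and \<xi>: "\<xi> \<in> mspace (C_metric \<tau>)" "\<xi>' \<in> mspace (C_metric \<tau>)" and \<omega>: "\<omega> \<in> space M"
    and le: "\<And>j. j \<le> N \<Longrightarrow> norm (trunc_em N \<xi> (int (k - N + j)) \<omega>
      - trunc_em N \<xi>' (int (k - N + j)) \<omega>) \<le> \<delta>"
  shows "mdist (C_metric \<tau>) (em_seg N k \<xi> \<omega>) (em_seg N k \<xi>' \<omega>) \<le> \<delta>"
proof (rule mdist_C_leI[OF \<tau>])
  show "em_seg N k \<xi> \<omega> \<in> mspace (C_metric \<tau>)" "em_seg N k \<xi>' \<omega> \<in> mspace (C_metric \<tau>)"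
    using measurable_space[OF em_seg_measurable[OF N(1)] \<omega>] \<xi> by (auto simp: space_C_borel)
  fix \<theta> assume \<theta>: "\<theta> \<in> {-\<tau>..0}"
  let ?u = "trunc_em N"
  obtain i j a where ij: "i \<le> N" "j \<le> N" "0 \<le> a" "a \<le> 1"
    "\<forall>\<xi>. em_interp f g W (ball_proj (level (\<tau> / real N))) \<tau> N \<xi> (real k * (\<tau> / real N) + \<theta>) \<omega> =
       (1 - a) *\<^sub>R ?u \<xi> (int (k - N + i)) \<omega> + a *\<^sub>R ?u \<xi> (int (k - N + j)) \<omega>"
    using em_interp_window[OF \<tau> valid_stepsD(1)[OF N(1)] window_time[OF valid_stepsD(1)[OF N(1)] N(2) \<theta>]] by meson
  have "em_seg N k \<xi> \<omega> \<theta> - em_seg N k \<xi>' \<omega> \<theta> =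
    (1 - a) *\<^sub>R (?u \<xi> (int (k - N + i)) \<omega> - ?u \<xi>' (int (k - N + i)) \<omega>) + a *\<^sub>R (?u \<xi> (int (k - N + j)) \<omega> - ?u \<xi>' (int (k - N + j)) \<omega>)"
    using \<theta> unfolding segment_def restrict_apply'[OF \<theta>] ij(5)[rule_format] by (simp add: scaleR_diff_right)
  then show "norm (em_seg N k \<xi> \<omega> \<theta> - em_seg N k \<xi>' \<omega> \<theta>) \<le> \<delta>"
    using norm_convex_comb_le[OF ij(3,4) le[OF ij(1)] le[OF ij(2)]] by simp
qed

text \<open>At any time the interpolated scheme is a convex combination of two grid values at
  distance at most one step. Half of \<delta> moves the solution to such a grid point, the other
  half is the error there.\<close>

lemma segment_convergence:
  assumes sol: "sdde_solution M F W f g \<tau> \<xi> x" and \<xi>: "\<xi> \<in> mspace (C_metric \<tau>)" and "m > 0" "\<delta> > 0" "\<epsilon> > 0"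
  obtains N\<^sub>0 :: nat where "\<And>N. N \<ge> N\<^sub>0 \<Longrightarrow> valid_steps N \<Longrightarrow>
    whp \<epsilon> (\<lambda>\<omega>. mdist (C_metric \<tau>) (segment \<tau> x (real m * \<tau>) \<omega>) (em_seg N (m * N) \<xi> \<omega>) \<le> \<delta>)"
proof -
  define T where "T = real m * \<tau>"
  have T: "T > 0" "\<tau> \<le> T" using \<open>m > 0\<close> \<tau> by (simp_all add: T_def)
  note xc = solution_facts(1)[OF sol] and xM = solution_facts(4)[OF sol]
  have cT: "continuous_on {-\<tau>..T} (\<lambda>t. x t \<omega>)" if "\<omega> \<in> space M" for \<omega>
    by (rule continuous_on_subset[OF xc[OF that]]) auto
  obtain N1 :: nat where N1: "\<And>N. N \<ge> N1 \<Longrightarrow>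
    whp (\<epsilon> / 2) (\<lambda>\<omega>. \<forall>s\<in>{-\<tau>..T}. \<forall>t\<in>{-\<tau>..T}. \<bar>s - t\<bar> \<le> \<tau> / real N \<longrightarrow> norm (x s \<omega> - x t \<omega>) \<le> \<delta> / 2)"
    using path_modulus_whp[of "-\<tau>" T x "\<epsilon> / 2" "\<delta> / 2" \<tau>, OF _ cT xM] \<tau> T \<open>\<delta> > 0\<close> \<open>\<epsilon> > 0\<close> by auto
  obtain N2 :: nat where N2: "\<And>N. N \<ge> N2 \<Longrightarrow> valid_steps N \<Longrightarrow> whp (\<epsilon> / 2) (\<lambda>\<omega>. \<forall>j\<le>m * N.
    norm (x (real j * (\<tau> / real N)) \<omega> - trunc_em N \<xi> (int j) \<omega>) \<le> \<delta> / 2)"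
    using grid_convergence[OF sol \<xi> \<open>m > 0\<close>, of "\<delta> / 2" "\<epsilon> / 2"] \<open>\<delta> > 0\<close> \<open>\<epsilon> > 0\<close> by auto
  show thesis
  proof (rule that[of "max N1 N2"])
    fix N :: nat assume N: "N \<ge> max N1 N2" "valid_steps N"
    note vs = valid_stepsD[OF N(2)]
    define \<Delta> where "\<Delta> = \<tau> / real N"
    have \<Delta>: "\<Delta> > 0" "real N * \<Delta> = \<tau>" using vs \<tau> by (simp_all add: \<Delta>_def)
    have kT: "real (m * N) * \<Delta> = T" using \<Delta>(2) by (simp add: T_def mult.assoc)
    let ?u = "em f g W (ball_proj (level \<Delta>)) \<tau> N \<xi>"
    let ?U = "\<lambda>\<omega>. \<forall>s\<in>{-\<tau>..T}. \<forall>t\<in>{-\<tau>..T}. \<bar>s - t\<bar> \<le> \<tau> / real N \<longrightarrow> norm (x s \<omega> - x t \<omega>) \<le> \<delta> / 2"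
    let ?X = "\<lambda>\<omega>. \<forall>j\<le>m * N. norm (x (real j * (\<tau> / real N)) \<omega> - trunc_em N \<xi> (int j) \<omega>) \<le> \<delta> / 2"
    have "whp (\<epsilon> / 2 + \<epsilon> / 2) (\<lambda>\<omega>.
      ?U \<omega> \<and> ?X \<omega>)"
      using N by (intro whp_conj N1 N2) auto
    then show "whp \<epsilon> (\<lambda>\<omega>. mdist (C_metric \<tau>) (segment \<tau> x (real m * \<tau>) \<omega>) (em_seg N (m * N) \<xi> \<omega>) \<le> \<delta>)"
    proof (rule whp_mono)
      fix \<omega> assume \<omega>: "\<omega> \<in> space M" and *: "?U \<omega> \<and> ?X \<omega>"
      show "mdist (C_metric \<tau>) (segment \<tau> x (real m * \<tau>) \<omega>) (em_seg N (m * N) \<xi> \<omega>) \<le> \<delta>"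
      proof (rule mdist_C_leI[OF \<tau>])
        show "segment \<tau> x (real m * \<tau>) \<omega> \<in> mspace (C_metric \<tau>)"
          using measurable_space[OF solution_segment_measurable[OF sol] \<omega>] T by (auto simp: space_C_borel T_def)
        show "em_seg N (m * N) \<xi> \<omega> \<in> mspace (C_metric \<tau>)"
          using measurable_space[OF em_seg_measurable[OF N(2) \<xi>, of "m * N"] \<omega>] by (simp only: space_C_borel)
        fix \<theta> assume \<theta>: "\<theta> \<in> {-\<tau>..0}"
        have "N \<le> m * N" using \<open>m > 0\<close> by simp
        from em_interp_window[OF \<tau> vs(1) window_time[OF vs(1) this \<theta>], of f g W "ball_proj (level \<Delta>)" \<omega>]
        obtain i j a where ij: "i \<le> N" "j \<le> N" "0 \<le> a" "a \<le> 1"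
          "\<bar>real (m * N) * (\<tau> / real N) + \<theta> - real (m * N - N + i) * (\<tau> / real N)\<bar> \<le> \<tau> / real N"
          "\<bar>real (m * N) * (\<tau> / real N) + \<theta> - real (m * N - N + j) * (\<tau> / real N)\<bar> \<le> \<tau> / real N"
          "\<forall>\<xi>. em_interp f g W (ball_proj (level \<Delta>)) \<tau> N \<xi> (real (m * N) * (\<tau> / real N) + \<theta>) \<omega> =
             (1 - a) *\<^sub>R em f g W (ball_proj (level \<Delta>)) \<tau> N \<xi> (int (m * N - N + i)) \<omega>
             + a *\<^sub>R em f g W (ball_proj (level \<Delta>)) \<tau> N \<xi> (int (m * N - N + j)) \<omega>"
          by meson
        let ?t = "T + \<theta>"
        have t: "?t \<in> {-\<tau>..T}" using \<theta> T by auto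
        have g: "norm (x ?t \<omega> - ?u (int (m * N - N + l)) \<omega>) \<le> \<delta>"
          if l: "l \<le> N" "\<bar>?t - real (m * N - N + l) * \<Delta>\<bar> \<le> \<Delta>" for l
        proof -
          have lm: "m * N - N + l \<le> m * N" using l(1) \<open>N \<le> m * N\<close> by linarith
          have "real (m * N - N + l) * \<Delta> \<le> real (m * N) * \<Delta>" using lm \<Delta>(1) by (intro mult_right_mono of_nat_mono) auto
          then have "real (m * N - N + l) * \<Delta> \<in> {-\<tau>..T}" using kT \<Delta>(1) \<tau> by (auto intro: order_trans[of _ 0])
          then have "norm (x ?t \<omega> - x (real (m * N - N + l) * \<Delta>) \<omega>) \<le> \<delta> / 2"
            using * t l(2) unfolding \<Delta>_def by blast
          moreover have "norm (x (real (m * N - N + l) * \<Delta>) \<omega> - ?u (int (m * N - N + l)) \<omega>) \<le> \<delta> / 2"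
            using * lm unfolding \<Delta>_def by blast
          ultimately show ?thesis
            using norm_triangle_ineq[of "x ?t \<omega> - x (real (m * N - N + l) * \<Delta>) \<omega>" "x (real (m * N - N + l) * \<Delta>) \<omega> - ?u (int (m * N - N + l)) \<omega>"] by simp
        qed
        have "norm (x ?t \<omega> - ?u (int (m * N - N + i)) \<omega>) \<le> \<delta>" "norm (x ?t \<omega> - ?u (int (m * N - N + j)) \<omega>) \<le> \<delta>"
          using ij(1,2,5,6) unfolding \<Delta>_def[symmetric] kT by (intro g; simp)+
        from norm_convex_comb_le[OF ij(3,4) this]
        have "norm (x ?t \<omega> - ((1 - a) *\<^sub>R ?u (int (m * N - N + i)) \<omega> + a *\<^sub>R ?u (int (m * N - N + j)) \<omega>)) \<le> \<delta>"
          by (simp add: algebra_simps)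
        then show "norm (segment \<tau> x (real m * \<tau>) \<omega> \<theta> - em_seg N (m * N) \<xi> \<omega> \<theta>) \<le> \<delta>"
          unfolding segment_def restrict_apply'[OF \<theta>] \<Delta>_def[symmetric]
          by (simp only: ij(7)[rule_format, unfolded \<Delta>_def[symmetric] kT] kT T_def[symmetric])
      qed
    qed simp
  qed
qed

end

section \<open>Convergence of the invariant measures\<close>

definition path_ball :: "real \<Rightarrow> real \<Rightarrow> (real \<Rightarrow> real^'d) set" where
  "path_ball \<tau> \<rho> = {\<phi>\<in>mspace (C_metric \<tau>). \<forall>\<theta>\<in>{-\<tau>..0}. norm (\<phi> \<theta>) \<le> \<rho>}"

lemma path_ball_mono: "\<rho> \<le> \<rho>' \<Longrightarrow> path_ball \<tau> \<rho> \<subseteq> path_ball \<tau> \<rho>'"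
  by (force simp: path_ball_def)

lemma path_ball_sets: "\<tau> > 0 \<Longrightarrow> path_ball \<tau> \<rho> \<in> sets (C_borel \<tau>)"
  unfolding path_ball_def
proof (rule closed_path_event[where L = 1])
  fix \<theta> and \<phi> \<psi> :: "real \<Rightarrow> real^'d"
  assume "\<tau> > 0" "\<theta> \<in> {-\<tau>..0}" "\<phi> \<in> mspace (C_metric \<tau>)" "\<psi> \<in> mspace (C_metric \<tau>)"
  then show "\<bar>norm (\<phi> \<theta>) - norm (\<psi> \<theta>)\<bar> \<le> 1 * mdist (C_metric \<tau>) \<phi> \<psi>"
    using mdist_C_geD[of \<tau> \<phi> \<psi> \<theta>] norm_triangle_ineq3[of "\<phi> \<theta>" "\<psi> \<theta>"] by simp
qed simp

text \<open>Every path is bounded, so the balls of integer radius exhaust the space. The radius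
  obtained depends on the measure.\<close>

lemma path_ball_tight:
  fixes \<pi> :: "(real \<Rightarrow> real^'d) measure"
  assumes "\<tau> > 0" "\<pi> \<in> space (prob_algebra (C_borel \<tau>))" "\<epsilon> > 0"
  obtains \<rho> where "\<rho> > 0" "measure \<pi> (path_ball \<tau> \<rho>) \<ge> 1 - \<epsilon>"
proof -
  interpret P: prob_space \<pi> using assms by (simp add: space_prob_algebra)
  have sp: "sets \<pi> = sets (C_borel \<tau>)" using assms by (simp add: space_prob_algebra)
  then have sP: "space \<pi> = mspace (C_metric \<tau>)" using space_C_borel sets_eq_imp_space_eq by blast
  have "\<phi> \<in> (\<Union>n. path_ball \<tau> (real n))" if "\<phi> \<in> space \<pi>" for \<phi>
  proof -
    have "bounded (\<phi> ` {-\<tau>..0})"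
      using that sP by (intro compact_imp_bounded compact_continuous_image) (auto simp: mspace_C_metric)
    then obtain r where r: "\<And>\<theta>. \<theta> \<in> {-\<tau>..0} \<Longrightarrow> norm (\<phi> \<theta>) \<le> r"
      unfolding bounded_iff by (metis image_eqI)
    obtain n :: nat where "r \<le> real n" using real_arch_simple by blast
    then have "\<phi> \<in> path_ball \<tau> (real n)"
      using that sP by (auto simp: path_ball_def intro: order_trans[OF r])
    then show ?thesis by blast
  qed
  then have "(\<Union>n. path_ball \<tau> (real n)) = space \<pi>"
    unfolding sP by (auto simp: path_ball_def)
  moreover have "(\<lambda>n. measure \<pi> (path_ball \<tau> (real n))) \<longlonglongrightarrow> measure \<pi> (\<Union>n. path_ball \<tau> (real n))"
  proof (rule P.finite_Lim_measure_incseq)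
    show "range (\<lambda>n. path_ball \<tau> (real n)) \<subseteq> sets \<pi>"
      using path_ball_sets[OF assms(1)] sp by auto
    show "incseq (\<lambda>n. path_ball \<tau> (real n) :: (real \<Rightarrow> real^'d) set)"
      by (auto simp: incseq_def intro!: path_ball_mono)
  qed
  ultimately have "(\<lambda>n. measure \<pi> (path_ball \<tau> (real n))) \<longlonglongrightarrow> 1"
    by (simp add: P.prob_space)
  then have "\<forall>\<^sub>F n in sequentially. 1 - \<epsilon> < measure \<pi> (path_ball \<tau> (real n))"
    using \<open>\<epsilon> > 0\<close> by (intro order_tendstoD(1)) auto
  then obtain n where n: "\<And>k. k \<ge> n \<Longrightarrow> 1 - \<epsilon> < measure \<pi> (path_ball \<tau> (real k))"
    unfolding eventually_sequentially by blast
  show thesis by (rule that[of "real (Suc n)"]) (use n[of "Suc n"] in auto)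
qed

text \<open>The distance of two continuous paths is decided at rational times, so evaluations
  suffice and no product sigma-algebra on pairs of paths is involved.\<close>

lemma (in prob_space) mdist_event:
  fixes Z1 Z2 :: "'a \<Rightarrow> real \<Rightarrow> real^'d"
  assumes "\<tau> > 0" and Z: "Z1 \<in> measurable M (C_borel \<tau>)" "Z2 \<in> measurable M (C_borel \<tau>)"
  shows "{\<omega>\<in>space M. mdist (C_metric \<tau>) (Z1 \<omega>) (Z2 \<omega>) > \<delta>} \<in> events"
proof -
  have ev: "(\<lambda>\<omega>. Y \<omega> \<theta>) \<in> borel_measurable M" if Y: "Y \<in> measurable M (C_borel \<tau>)" and \<theta>: "\<theta> \<in> {-\<tau>..0}"
    for Y :: "'a \<Rightarrow> real \<Rightarrow> real^'d" and \<theta>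
  proof -
    have "(\<lambda>\<omega>. Y \<omega> \<theta> \<bullet> i) \<in> borel_measurable M" if "i \<in> Basis" for i
    proof (rule measurable_compose[OF Y Lipschitz_path_measurable[where L = 1]])
      fix \<phi> \<psi> :: "real \<Rightarrow> real^'d" assume "\<phi> \<in> mspace (C_metric \<tau>)" "\<psi> \<in> mspace (C_metric \<tau>)"
      then show "\<bar>\<phi> \<theta> \<bullet> i - \<psi> \<theta> \<bullet> i\<bar> \<le> 1 * mdist (C_metric \<tau>) \<phi> \<psi>"
        using mdist_C_geD[of \<tau> \<phi> \<psi> \<theta>] assms(1) \<theta> Basis_le_norm[OF that, of "\<phi> \<theta> - \<psi> \<theta>"] by (simp add: inner_diff_left)
    qed simp
    then show ?thesis by (subst borel_measurable_euclidean_space) auto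
  qed
  have "{\<omega>\<in>space M. \<forall>\<theta>\<in>\<rat> \<inter> {-\<tau><..<0}. norm (Z1 \<omega> \<theta> - Z2 \<omega> \<theta>) \<le> \<delta>} \<in> events"
  proof (rule sets.sets_Collect_countable_All')
    show "countable (\<rat> \<inter> {-\<tau><..<0} :: real set)" by (intro countable_Int1 countable_rat)
    fix \<theta> assume "\<theta> \<in> \<rat> \<inter> {-\<tau><..<0}"
    then have "(\<lambda>\<omega>. Z1 \<omega> \<theta>) \<in> borel_measurable M" "(\<lambda>\<omega>. Z2 \<omega> \<theta>) \<in> borel_measurable M"
      by (auto intro!: ev Z)
    then show "{\<omega>\<in>space M. norm (Z1 \<omega> \<theta> - Z2 \<omega> \<theta>) \<le> \<delta>} \<in> events" by measurable
  qed
  then have "space M - {\<omega>\<in>space M. \<forall>\<theta>\<in>\<rat> \<inter> {-\<tau><..<0}. norm (Z1 \<omega> \<theta> - Z2 \<omega> \<theta>) \<le> \<delta>} \<in> events"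
    by (rule sets.compl_sets)
  also have "space M - {\<omega>\<in>space M. \<forall>\<theta>\<in>\<rat> \<inter> {-\<tau><..<0}. norm (Z1 \<omega> \<theta> - Z2 \<omega> \<theta>) \<le> \<delta>} =
    {\<omega>\<in>space M. mdist (C_metric \<tau>) (Z1 \<omega>) (Z2 \<omega>) > \<delta>}"
  proof -
    have "(\<forall>\<theta>\<in>\<rat> \<inter> {-\<tau><..<0}. norm (Z1 \<omega> \<theta> - Z2 \<omega> \<theta>) \<le> \<delta>) \<longleftrightarrow> mdist (C_metric \<tau>) (Z1 \<omega>) (Z2 \<omega>) \<le> \<delta>"
      if "\<omega> \<in> space M" for \<omega>
    proof -
      have C: "Z1 \<omega> \<in> mspace (C_metric \<tau>)" "Z2 \<omega> \<in> mspace (C_metric \<tau>)"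
        using measurable_space[OF Z(1) that] measurable_space[OF Z(2) that] by (simp_all add: space_C_borel)
      show ?thesis
      proof
        assume "mdist (C_metric \<tau>) (Z1 \<omega>) (Z2 \<omega>) \<le> \<delta>"
        then show "\<forall>\<theta>\<in>\<rat> \<inter> {-\<tau><..<0}. norm (Z1 \<omega> \<theta> - Z2 \<omega> \<theta>) \<le> \<delta>"
          by (auto intro: order_trans[OF mdist_C_geD[OF assms(1) C]])
      qed (use C_ball_rational[OF assms(1) C] in blast)
    qed
    then show ?thesis by (auto simp: not_le[symmetric])
  qed
  finally show ?thesis .
qed

text \<open>Outside the exceptional event the Lipschitz property gives \<delta>; on it two values in
  [-1, 1] differ by at most 2.\<close>

lemma (in prob_space) expectation_diff_le:
  fixes Z1 Z2 :: "'a \<Rightarrow> real \<Rightarrow> real^'d"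
  assumes "\<tau> > 0" and Z: "Z1 \<in> measurable M (C_borel \<tau>)" "Z2 \<in> measurable M (C_borel \<tau>)"
    and w: "whp \<epsilon> (\<lambda>\<omega>. mdist (C_metric \<tau>) (Z1 \<omega>) (Z2 \<omega>) \<le> \<delta>)" and \<Psi>: "\<Psi> \<in> FM_test \<tau>" and "\<delta> \<ge> 0"
  shows "\<bar>expectation (\<lambda>\<omega>. \<Psi> (Z1 \<omega>)) - expectation (\<lambda>\<omega>. \<Psi> (Z2 \<omega>))\<bar> \<le> \<delta> + 2 * \<epsilon>"
proof -
  obtain B where B: "B \<in> events" "prob B \<le> \<epsilon>" "\<forall>\<omega>\<in>space M - B. mdist (C_metric \<tau>) (Z1 \<omega>) (Z2 \<omega>) \<le> \<delta>"
    using w unfolding whp_def by blast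
  have C: "Z1 \<omega> \<in> mspace (C_metric \<tau>)" "Z2 \<omega> \<in> mspace (C_metric \<tau>)" if "\<omega> \<in> space M" for \<omega>
    using measurable_space[OF Z(1) that] measurable_space[OF Z(2) that] by (simp_all add: space_C_borel)
  have b: "\<bar>\<Psi> (Z1 \<omega>)\<bar> \<le> 1" "\<bar>\<Psi> (Z2 \<omega>)\<bar> \<le> 1" if "\<omega> \<in> space M" for \<omega>
    using \<Psi> C[OF that] by (auto simp: FM_test_def)
  have m: "(\<lambda>\<omega>. \<Psi> (Z1 \<omega>)) \<in> borel_measurable M" "(\<lambda>\<omega>. \<Psi> (Z2 \<omega>)) \<in> borel_measurable M"
    using measurable_compose[OF Z(1) FM_test_measurable[OF \<Psi>]] measurable_compose[OF Z(2) FM_test_measurable[OF \<Psi>]] by auto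
  have i: "integrable M (\<lambda>\<omega>. \<Psi> (Z1 \<omega>))" "integrable M (\<lambda>\<omega>. \<Psi> (Z2 \<omega>))"
    by (rule integrable_const_bound[where B = 1]; use b m in auto)+
  have "\<bar>expectation (\<lambda>\<omega>. \<Psi> (Z1 \<omega>)) - expectation (\<lambda>\<omega>. \<Psi> (Z2 \<omega>))\<bar> = \<bar>expectation (\<lambda>\<omega>. \<Psi> (Z1 \<omega>) - \<Psi> (Z2 \<omega>))\<bar>"
    using i by simp
  also have "\<dots> \<le> expectation (\<lambda>\<omega>. \<bar>\<Psi> (Z1 \<omega>) - \<Psi> (Z2 \<omega>)\<bar>)"
    by (rule integral_abs_bound)
  also have "\<dots> \<le> expectation (\<lambda>\<omega>. \<delta> + 2 * indicator B \<omega>)"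
  proof (rule integral_mono)
    fix \<omega> assume \<omega>: "\<omega> \<in> space M"
    show "\<bar>\<Psi> (Z1 \<omega>) - \<Psi> (Z2 \<omega>)\<bar> \<le> \<delta> + 2 * indicator B \<omega>"
    proof (cases "\<omega> \<in> B")
      case True then show ?thesis using b[OF \<omega>] \<open>\<delta> \<ge> 0\<close> by simp
    next
      case False
      have "\<bar>\<Psi> (Z1 \<omega>) - \<Psi> (Z2 \<omega>)\<bar> \<le> mdist (C_metric \<tau>) (Z1 \<omega>) (Z2 \<omega>)"
        using \<Psi> C[OF \<omega>] by (auto simp: FM_test_def)
      also have "\<dots> \<le> \<delta>" using B(3) False \<omega> by blast
      finally show ?thesis using False by simp
    qed
  qed (use i B(1) in \<open>auto simp: emeasure_eq_measure\<close>)
  also have "\<dots> = \<delta> + 2 * prob B" using B(1) by (simp add: prob_space emeasure_eq_measure)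
  finally show ?thesis using B(2) by simp
qed

lemma (in prob_space) whp_mdist_trans:
  fixes Z1 Z2 Z3 :: "'a \<Rightarrow> real \<Rightarrow> real^'d"
  assumes Z: "Z1 \<in> measurable M (C_borel \<tau>)" "Z2 \<in> measurable M (C_borel \<tau>)" "Z3 \<in> measurable M (C_borel \<tau>)"
    and w: "whp \<epsilon>\<^sub>1 (\<lambda>\<omega>. mdist (C_metric \<tau>) (Z1 \<omega>) (Z2 \<omega>) \<le> \<delta>\<^sub>1)" "whp \<epsilon>\<^sub>2 (\<lambda>\<omega>. mdist (C_metric \<tau>) (Z2 \<omega>) (Z3 \<omega>) \<le> \<delta>\<^sub>2)"
  shows "whp (\<epsilon>\<^sub>1 + \<epsilon>\<^sub>2) (\<lambda>\<omega>. mdist (C_metric \<tau>) (Z1 \<omega>) (Z3 \<omega>) \<le> \<delta>\<^sub>1 + \<delta>\<^sub>2)"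
proof (rule whp_mono[OF whp_conj[OF w] order_refl])
  fix \<omega> assume \<omega>: "\<omega> \<in> space M"
    and *: "mdist (C_metric \<tau>) (Z1 \<omega>) (Z2 \<omega>) \<le> \<delta>\<^sub>1 \<and> mdist (C_metric \<tau>) (Z2 \<omega>) (Z3 \<omega>) \<le> \<delta>\<^sub>2"
  have C: "Z1 \<omega> \<in> mspace (C_metric \<tau>)" "Z2 \<omega> \<in> mspace (C_metric \<tau>)" "Z3 \<omega> \<in> mspace (C_metric \<tau>)"
    using measurable_space[OF Z(1) \<omega>] measurable_space[OF Z(2) \<omega>] measurable_space[OF Z(3) \<omega>] by (simp_all add: space_C_borel)
  show "mdist (C_metric \<tau>) (Z1 \<omega>) (Z3 \<omega>) \<le> \<delta>\<^sub>1 + \<delta>\<^sub>2"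
    using mdist_triangle[OF C] * by linarith
qed

section \<open>Contraction of the solution, uniform tightness, and the limit\<close>

context delay_system
begin

text \<open>The contraction is available at the grid points of a window that starts at index
  \<open>k - N\<close>; interpolation carries it over to the segment ending at index
  \<open>k\<close>.\<close>

lemma em_seg_contraction:
  assumes "\<rho> > 0" "\<delta> > 0" "\<epsilon> > 0"
  obtains T where "\<And>N k \<xi> \<xi>'. valid_steps N \<Longrightarrow> \<xi> \<in> path_ball \<tau> \<rho> \<Longrightarrow> \<xi>' \<in> path_ball \<tau> \<rho> \<Longrightarrow> N \<le> k \<Longrightarrow>
    real (k - N) * (\<tau> / real N) \<ge> T \<Longrightarrow> whp \<epsilon> (\<lambda>\<omega>. mdist (C_metric \<tau>) (em_seg N k \<xi> \<omega>) (em_seg N k \<xi>' \<omega>) \<le> \<delta>)"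
proof -
  obtain T where T: "\<And>N n \<xi> \<xi>'. valid_steps N \<Longrightarrow> \<forall>\<theta>\<in>{-\<tau>..0}. norm (\<xi> \<theta>) \<le> \<rho> \<Longrightarrow>
    \<forall>\<theta>\<in>{-\<tau>..0}. norm (\<xi>' \<theta>) \<le> \<rho> \<Longrightarrow> real n * (\<tau> / real N) \<ge> T \<Longrightarrow>
    prob {\<omega>\<in>space M. \<exists>j\<le>N. norm (trunc_em N \<xi> (int (n + j)) \<omega>
      - trunc_em N \<xi>' (int (n + j)) \<omega>) > \<delta>} \<le> \<epsilon>"
    using em_contraction[OF assms] by blast
  show thesis
  proof (rule that[of T])
    fix N k :: nat and \<xi> \<xi>' :: "real \<Rightarrow> real^'d"
    assume N: "valid_steps N" and \<xi>: "\<xi> \<in> path_ball \<tau> \<rho>" "\<xi>' \<in> path_ball \<tau> \<rho>" and k: "N \<le> k" "real (k - N) * (\<tau> / real N) \<ge> T"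
    have R1: "level (\<tau> / real N) \<ge> 1" by (rule level_props(1)[OF valid_stepsD(2,5)[OF N]])
    have m [measurable]: "trunc_em N \<xi> k \<in> borel_measurable M" for \<xi> k
      using \<tau> R1 by (intro em_measurable f_borel g_borel borel_measurable_ball_proj) auto
    define D where "D j \<omega> = norm (trunc_em N \<xi> (int (k - N + j)) \<omega>
      - trunc_em N \<xi>' (int (k - N + j)) \<omega>)" for j \<omega>
    have [measurable]: "D j \<in> borel_measurable M" for j unfolding D_def by measurable
    have "whp \<epsilon> (\<lambda>\<omega>. \<not> (\<exists>j\<le>N. D j \<omega> > \<delta>))"
    proof (rule whp_prob, unfold not_not)
      show "{\<omega>\<in>space M. \<exists>j\<le>N. D j \<omega> > \<delta>} \<in> events" by measurable
      show "prob {\<omega>\<in>space M. \<exists>j\<le>N. D j \<omega> > \<delta>} \<le> \<epsilon>"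
        unfolding D_def using N \<xi> k by (intro T) (auto simp: path_ball_def)
    qed
    then show "whp \<epsilon> (\<lambda>\<omega>. mdist (C_metric \<tau>) (em_seg N k \<xi> \<omega>) (em_seg N k \<xi>' \<omega>) \<le> \<delta>)"
    proof (rule whp_mono, simp)
      fix \<omega> assume "\<omega> \<in> space M" "\<not> (\<exists>j\<le>N. D j \<omega> > \<delta>)"
      then show "mdist (C_metric \<tau>) (em_seg N k \<xi> \<omega>) (em_seg N k \<xi>' \<omega>) \<le> \<delta>"
        using \<xi> by (intro em_seg_mdist_le N k(1)) (auto simp: path_ball_def D_def not_less)
    qed
  qed
qed

lemma valid_steps_large:
  obtains N where "N \<ge> N\<^sub>0" "valid_steps N"
proof -
  have "((\<lambda>n. \<tau> / real n) \<longlonglongrightarrow> 0)" by (rule lim_const_over_n)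
  then have "\<forall>\<^sub>F n in sequentially. \<tau> / real n < min \<Delta>\<^sub>1 \<Delta>\<^sub>2"
    using \<Delta>\<^sub>1 \<Delta>\<^sub>2 by (intro order_tendstoD(2)) auto
  moreover have "\<forall>\<^sub>F n in sequentially. real n > \<tau>"
    using filterlim_real_sequentially by (simp add: filterlim_at_top_dense)
  moreover have "\<forall>\<^sub>F n in sequentially. n \<ge> N\<^sub>0" by (rule eventually_ge_at_top)
  ultimately have "\<forall>\<^sub>F n in sequentially. n \<ge> N\<^sub>0 \<and> valid_steps n"
    by eventually_elim (simp add: valid_steps_def)
  then show thesis using that by (auto dest: eventually_happens)
qed

text \<open>The time \<open>T\<close> of the scheme does not depend on the step size. For given
  initial paths and a given \<open>m\<close> it is enough to pick one sufficiently fine scheme and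
  to pass from solution to scheme, to the other scheme, to the other solution. The fineness may
  depend on everything, as it leaves no trace in the conclusion.\<close>

lemma solution_contraction:
  assumes sol: "\<And>\<xi>. \<xi> \<in> mspace (C_metric \<tau>) \<Longrightarrow> sdde_solution M F W f g \<tau> \<xi> (x \<xi>)"
    and "\<rho> > 0" "\<delta> > 0" "\<epsilon> > 0"
  obtains T where "\<And>m \<xi> \<xi>'. \<xi> \<in> path_ball \<tau> \<rho> \<Longrightarrow> \<xi>' \<in> path_ball \<tau> \<rho> \<Longrightarrow> m > 0 \<Longrightarrow>
    real (m - 1) * \<tau> \<ge> T \<Longrightarrow> whp \<epsilon> (\<lambda>\<omega>. mdist (C_metric \<tau>) (segment \<tau> (x \<xi>) (real m * \<tau>) \<omega>) (segment \<tau> (x \<xi>') (real m * \<tau>) \<omega>) \<le> \<delta>)"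
proof -
  have d: "\<delta> / 3 > 0" "\<epsilon> / 3 > 0" using assms by auto
  obtain T where T: "\<And>N k \<xi> \<xi>'. valid_steps N \<Longrightarrow> \<xi> \<in> path_ball \<tau> \<rho> \<Longrightarrow> \<xi>' \<in> path_ball \<tau> \<rho> \<Longrightarrow> N \<le> k \<Longrightarrow>
    real (k - N) * (\<tau> / real N) \<ge> T \<Longrightarrow> whp (\<epsilon> / 3) (\<lambda>\<omega>. mdist (C_metric \<tau>) (em_seg N k \<xi> \<omega>) (em_seg N k \<xi>' \<omega>) \<le> \<delta> / 3)"
    using em_seg_contraction[OF \<open>\<rho> > 0\<close> d] by blast
  show thesis
  proof (rule that[of T])
    fix m :: nat and \<xi> \<xi>' :: "real \<Rightarrow> real^'d" assume \<xi>: "\<xi> \<in> path_ball \<tau> \<rho>" "\<xi>' \<in> path_ball \<tau> \<rho>" and m: "m > 0" "real (m - 1) * \<tau> \<ge> T"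
    have \<xi>C: "\<xi> \<in> mspace (C_metric \<tau>)" "\<xi>' \<in> mspace (C_metric \<tau>)" using \<xi> by (auto simp: path_ball_def)
    obtain N1 :: nat where N1: "\<And>N. N \<ge> N1 \<Longrightarrow> valid_steps N \<Longrightarrow>
      whp (\<epsilon> / 3) (\<lambda>\<omega>. mdist (C_metric \<tau>) (segment \<tau> (x \<xi>) (real m * \<tau>) \<omega>) (em_seg N (m * N) \<xi> \<omega>) \<le> \<delta> / 3)"
      using segment_convergence[OF sol[OF \<xi>C(1)] \<xi>C(1) m(1) d] by blast
    obtain N2 :: nat where N2: "\<And>N. N \<ge> N2 \<Longrightarrow> valid_steps N \<Longrightarrow>
      whp (\<epsilon> / 3) (\<lambda>\<omega>. mdist (C_metric \<tau>) (segment \<tau> (x \<xi>') (real m * \<tau>) \<omega>) (em_seg N (m * N) \<xi>' \<omega>) \<le> \<delta> / 3)"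
      using segment_convergence[OF sol[OF \<xi>C(2)] \<xi>C(2) m(1) d] by blast
    obtain N where N: "N \<ge> max N1 N2" "valid_steps N" by (rule valid_steps_large)
    note Npos = valid_stepsD(1)[OF N(2)]
    have "real (m * N - N) * (\<tau> / real N) = real (m - 1) * \<tau>"
    proof -
      have "m * N - N = (m - 1) * N" by (simp add: diff_mult_distrib)
      then show ?thesis using Npos by simp
    qed
    then have w2: "whp (\<epsilon> / 3) (\<lambda>\<omega>. mdist (C_metric \<tau>) (em_seg N (m * N) \<xi> \<omega>) (em_seg N (m * N) \<xi>' \<omega>) \<le> \<delta> / 3)"
      using m by (intro T N \<xi>) auto
    have w3: "whp (\<epsilon> / 3) (\<lambda>\<omega>. mdist (C_metric \<tau>) (em_seg N (m * N) \<xi>' \<omega>) (segment \<tau> (x \<xi>') (real m * \<tau>) \<omega>) \<le> \<delta> / 3)"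
      using N2[of N] N by (simp add: mdist_commute)
    have mt: "0 \<le> real m * \<tau>" using \<tau> by simp
    note sm = solution_segment_measurable[OF sol[OF \<xi>C(1)] mt] solution_segment_measurable[OF sol[OF \<xi>C(2)] mt]
      em_seg_measurable[OF N(2) \<xi>C(1), of "m * N"] em_seg_measurable[OF N(2) \<xi>C(2), of "m * N"]
    have "whp (\<epsilon> / 3 + \<epsilon> / 3 + \<epsilon> / 3) (\<lambda>\<omega>. mdist (C_metric \<tau>) (segment \<tau> (x \<xi>) (real m * \<tau>) \<omega>) (segment \<tau> (x \<xi>') (real m * \<tau>) \<omega>) \<le> \<delta> / 3 + \<delta> / 3 + \<delta> / 3)"
      using N by (intro whp_mdist_trans[OF sm(1,4,2) whp_mdist_trans[OF sm(1,3,4) N1 w2] w3]) auto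
    then show "whp \<epsilon> (\<lambda>\<omega>. mdist (C_metric \<tau>) (segment \<tau> (x \<xi>) (real m * \<tau>) \<omega>) (segment \<tau> (x \<xi>') (real m * \<tau>) \<omega>) \<le> \<delta>)"
      by simp
  qed
qed

lemma em_seg_norm_le:
  assumes N: "valid_steps N" "N \<le> k" and \<theta>: "\<theta> \<in> {-\<tau>..0}"
    and le: "\<And>j. j \<le> N \<Longrightarrow> norm (trunc_em N \<xi> (int (k - N + j)) \<omega>) \<le> r"
  shows "norm (em_seg N k \<xi> \<omega> \<theta>) \<le> r"
proof -
  let ?u = "trunc_em N"
  obtain i j a where ij: "i \<le> N" "j \<le> N" "0 \<le> a" "a \<le> 1"
    "\<forall>\<xi>. em_interp f g W (ball_proj (level (\<tau> / real N))) \<tau> N \<xi> (real k * (\<tau> / real N) + \<theta>) \<omega> =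
       (1 - a) *\<^sub>R ?u \<xi> (int (k - N + i)) \<omega> + a *\<^sub>R ?u \<xi> (int (k - N + j)) \<omega>"
    using em_interp_window[OF \<tau> valid_stepsD(1)[OF N(1)] window_time[OF valid_stepsD(1)[OF N(1)] N(2) \<theta>]] by meson
  show ?thesis
    unfolding segment_def restrict_apply'[OF \<theta>] ij(5)[rule_format]
    by (rule norm_convex_comb_le[OF ij(3,4) le[OF ij(1)] le[OF ij(2)]])
qed

text \<open>Restricted to the interval because points of the path space are extensional
  functions.\<close>

definition zero_path :: "real \<Rightarrow> real^'d" where
  "zero_path = (\<lambda>\<theta>\<in>{-\<tau>..0}. 0)"

lemma zero_path: "0 \<le> \<rho> \<Longrightarrow> zero_path \<in> path_ball \<tau> \<rho>" "zero_path \<in> mspace (C_metric \<tau>)"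
proof -
  have "continuous_on {-\<tau>..0} zero_path"
    by (rule continuous_on_eq[of _ "\<lambda>_. 0"]) (auto simp: zero_path_def)
  then show "zero_path \<in> mspace (C_metric \<tau>)"
    unfolding mspace_C_metric by (auto simp: zero_path_def)
  then show "0 \<le> \<rho> \<Longrightarrow> zero_path \<in> path_ball \<tau> \<rho>"
    by (auto simp: path_ball_def zero_path_def)
qed

text \<open>The radius has to serve all schemes at once, since the contraction time depends on it.
  The moment bound from the zero path gives such a radius \<open>r\<close>. By invariance the
  measure is compared with the law from the zero path at a late time, where segments are within
  distance 1 of each other, whence \<open>r + 1\<close>.\<close>

lemma em_invariant_tight:
  assumes "\<epsilon> > 0"
  obtains \<rho> where "\<rho> > 0" "\<And>N \<pi>. valid_steps N \<Longrightarrow>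
    invariant_prob (C_borel \<tau>) UNIV (em_segment_law M f g W (truncate \<Phi> K \<nu> (\<tau> / real N)) \<tau> N) \<pi> \<Longrightarrow>
    measure \<pi> (path_ball \<tau> \<rho>) \<ge> 1 - \<epsilon>"
proof -
  have e3: "\<epsilon> / 3 > 0" using assms by simp
  obtain r where r: "r > 0" "\<And>N n \<xi>. valid_steps N \<Longrightarrow> \<forall>\<theta>\<in>{-\<tau>..0}. \<xi> \<theta> = 0 \<Longrightarrow>
    prob {\<omega>\<in>space M. \<exists>j\<le>N. norm (trunc_em N \<xi> (int (n + j)) \<omega>) > r} \<le> \<epsilon> / 3"
    using em_moment[OF e3] by blast
  show thesis
  proof (rule that[of "r + 1"])
    fix N and \<pi> :: "(real \<Rightarrow> real^'d) measure"
    assume N: "valid_steps N"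
      and "invariant_prob (C_borel \<tau>) UNIV (em_segment_law M f g W (truncate \<Phi> K \<nu> (\<tau> / real N)) \<tau> N) \<pi>"
    then have \<pi>: "\<pi> \<in> space (prob_algebra (C_borel \<tau>))"
      and inv: "\<And>k A. A \<in> sets (C_borel \<tau>) \<Longrightarrow> (\<integral>\<^sup>+ X. emeasure (distr M (C_borel \<tau>) (em_seg N k X)) A \<partial>\<pi>) = emeasure \<pi> A"
      by (auto simp: invariant_prob_def em_segment_law_def segment_law_def truncate_level)
    interpret P: prob_space \<pi> using \<pi> by (simp add: space_prob_algebra)
    have sp: "sets \<pi> = sets (C_borel \<tau>)" using \<pi> by (simp add: space_prob_algebra)
    then have sP: "space \<pi> = mspace (C_metric \<tau>)" using space_C_borel sets_eq_imp_space_eq by blast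
    \<comment> \<open>This radius depends on the single measure and the single step size. It only
      determines how late the comparison time \<open>k\<close> must be and does not affect the final
      radius.\<close>
    obtain \<rho> where \<rho>: "\<rho> > 0" "measure \<pi> (path_ball \<tau> \<rho>) \<ge> 1 - \<epsilon> / 3"
      by (rule path_ball_tight[OF \<tau> \<pi> e3])
    obtain T where T: "\<And>N k \<xi> \<xi>'. valid_steps N \<Longrightarrow> \<xi> \<in> path_ball \<tau> \<rho> \<Longrightarrow> \<xi>' \<in> path_ball \<tau> \<rho> \<Longrightarrow> N \<le> k \<Longrightarrow>
      real (k - N) * (\<tau> / real N) \<ge> T \<Longrightarrow> whp (\<epsilon> / 3) (\<lambda>\<omega>. mdist (C_metric \<tau>) (em_seg N k \<xi> \<omega>) (em_seg N k \<xi>' \<omega>) \<le> 1)"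
      using em_seg_contraction[OF \<rho>(1) zero_less_one e3] by blast
    obtain n :: nat where n: "T / (\<tau> / real N) \<le> real n" using real_arch_simple by blast
    define k where "k = n + N"
    have k: "N \<le> k" "T \<le> real (k - N) * (\<tau> / real N)"
      using n valid_stepsD(2)[OF N] unfolding k_def by (simp_all only: pos_divide_le_eq add_diff_cancel_right' le_add2)
    have cs: "mspace (C_metric \<tau>) - path_ball \<tau> s \<in> sets (C_borel \<tau>)" for s
      using sets.compl_sets[OF path_ball_sets[OF \<tau>, of s]] by (simp add: space_C_borel)
    have "measure \<pi> (mspace (C_metric \<tau>) - path_ball \<tau> (r + 1)) \<le>
      prob {\<omega>\<in>space M. em_seg N k zero_path \<omega> \<in> mspace (C_metric \<tau>) - path_ball \<tau> r} + \<epsilon> / 3 + \<epsilon> / 3"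
    proof (rule invariant_le[where Z = "em_seg N k" and \<delta> = 1, OF \<pi> inv em_seg_measurable[OF N] zero_path(2) path_ball_sets[OF \<tau>] \<rho>(2) _ _ cs cs])
      show "prob {\<omega>\<in>space M. 1 < mdist (C_metric \<tau>) (em_seg N k X \<omega>) (em_seg N k zero_path \<omega>)} \<le> \<epsilon> / 3" if "X \<in> path_ball \<tau> \<rho>" for X
        using prob_whp[OF T[OF N that zero_path(1) k]] \<rho>(1) by (simp add: not_le)
      show "{\<omega>\<in>space M. 1 < mdist (C_metric \<tau>) (em_seg N k X \<omega>) (em_seg N k zero_path \<omega>)} \<in> events" if "X \<in> mspace (C_metric \<tau>)" for X
        by (rule mdist_event[OF \<tau> em_seg_measurable[OF N that] em_seg_measurable[OF N zero_path(2)]])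
      fix \<phi> \<psi> :: "real \<Rightarrow> real^'d"
      assume \<phi>: "\<phi> \<in> mspace (C_metric \<tau>) - path_ball \<tau> (r + 1)" and \<psi>: "\<psi> \<in> mspace (C_metric \<tau>)" and d: "mdist (C_metric \<tau>) \<phi> \<psi> \<le> 1"
      show "\<psi> \<in> mspace (C_metric \<tau>) - path_ball \<tau> r"
      proof (rule ccontr)
        assume "\<psi> \<notin> mspace (C_metric \<tau>) - path_ball \<tau> r"
        then have "\<psi> \<in> path_ball \<tau> r" using \<psi> by auto
        have "norm (\<phi> \<theta>) \<le> r + 1" if \<theta>: "\<theta> \<in> {-\<tau>..0}" for \<theta>
        proof -
          have "norm (\<phi> \<theta> - \<psi> \<theta>) \<le> 1" using mdist_C_geD[OF \<tau> _ \<psi> \<theta>, of \<phi>] \<phi> d by simp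
          moreover have "norm (\<psi> \<theta>) \<le> r" using \<open>\<psi> \<in> path_ball \<tau> r\<close> \<theta> by (auto simp: path_ball_def)
          ultimately show ?thesis using norm_triangle_sub[of "\<phi> \<theta>" "\<psi> \<theta>"] by linarith
        qed
        then show False using \<phi> by (auto simp: path_ball_def)
      qed
    qed (use assms in auto)
    also have "prob {\<omega>\<in>space M. em_seg N k zero_path \<omega> \<in> mspace (C_metric \<tau>) - path_ball \<tau> r} \<le> \<epsilon> / 3"
    proof -
      have R1: "level (\<tau> / real N) \<ge> 1" by (rule level_props(1)[OF valid_stepsD(2,5)[OF N]])
      have [measurable]: "trunc_em N \<xi> k \<in> borel_measurable M" for \<xi> k
        using \<tau> R1 by (intro em_measurable f_borel g_borel borel_measurable_ball_proj) auto
      have "prob {\<omega>\<in>space M. em_seg N k zero_path \<omega> \<in> mspace (C_metric \<tau>) - path_ball \<tau> r} \<le>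
        prob {\<omega>\<in>space M. \<exists>j\<le>N. norm (trunc_em N zero_path (int (k - N + j)) \<omega>) > r}"
      proof (rule finite_measure_mono)
        show "{\<omega>\<in>space M. em_seg N k zero_path \<omega> \<in> mspace (C_metric \<tau>) - path_ball \<tau> r} \<subseteq>
          {\<omega>\<in>space M. \<exists>j\<le>N. norm (trunc_em N zero_path (int (k - N + j)) \<omega>) > r}"
        proof (rule subsetI, rule ccontr)
          fix \<omega> assume 1: "\<omega> \<in> {\<omega>\<in>space M. em_seg N k zero_path \<omega> \<in> mspace (C_metric \<tau>) - path_ball \<tau> r}"
            and 2: "\<omega> \<notin> {\<omega>\<in>space M. \<exists>j\<le>N. norm (trunc_em N zero_path (int (k - N + j)) \<omega>) > r}"
          then have "norm (em_seg N k zero_path \<omega> \<theta>) \<le> r" if "\<theta> \<in> {-\<tau>..0}" for \<theta>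
            by (intro em_seg_norm_le N k(1) that) (auto simp: not_less)
          with 1 show False by (auto simp: path_ball_def)
        qed
      qed measurable
      also have "\<dots> \<le> \<epsilon> / 3" by (rule r(2)[OF N]) (auto simp: zero_path_def)
      finally show ?thesis .
    qed
    finally have "measure \<pi> (mspace (C_metric \<tau>) - path_ball \<tau> (r + 1)) \<le> \<epsilon>" by simp
    moreover have "measure \<pi> (space \<pi> - path_ball \<tau> (r + 1)) = 1 - measure \<pi> (path_ball \<tau> (r + 1))"
      using path_ball_sets[OF \<tau>, of "r + 1"] sp by (intro P.prob_compl) simp
    ultimately show "1 - \<epsilon> \<le> measure \<pi> (path_ball \<tau> (r + 1))" unfolding sP by simp
  qed (use r in simp)
qed

text \<open>The threshold is chosen before the test function, so the estimate is uniform over the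
  class and survives the supremum in \<open>FM_dist\<close>. The bridge consists of the laws at time
  \<open>real m * \<tau>\<close> of solution and scheme, both started from the zero path.\<close>

lemma invariant_measures_close:
  assumes sol: "\<And>\<xi>. \<xi> \<in> mspace (C_metric \<tau>) \<Longrightarrow> sdde_solution M F W f g \<tau> \<xi> (x \<xi>)"
    and "invariant_prob (C_borel \<tau>) {0..} (\<lambda>t X. segment_law M \<tau> (x X) t) \<pi>" and "\<eta> > 0"
  obtains N\<^sub>0 :: nat where "\<And>N \<pi>' \<Psi>. N \<ge> N\<^sub>0 \<Longrightarrow> valid_steps N \<Longrightarrow>
    invariant_prob (C_borel \<tau>) UNIV (em_segment_law M f g W (truncate \<Phi> K \<nu> (\<tau> / real N)) \<tau> N) \<pi>' \<Longrightarrow>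
    \<Psi> \<in> FM_test \<tau> \<Longrightarrow> \<bar>(\<integral>X. \<Psi> X \<partial>\<pi>) - (\<integral>X. \<Psi> X \<partial>\<pi>')\<bar> \<le> \<eta>"
proof -
  have \<pi>: "\<pi> \<in> space (prob_algebra (C_borel \<tau>))"
    and inv: "\<And>t A. t \<ge> 0 \<Longrightarrow> A \<in> sets (C_borel \<tau>) \<Longrightarrow> (\<integral>\<^sup>+ X. emeasure (distr M (C_borel \<tau>) (segment \<tau> (x X) t)) A \<partial>\<pi>) = emeasure \<pi> A"
    using assms(2) by (auto simp: invariant_prob_def segment_law_def)
  \<comment> \<open>Each of the two invariant measures is within \<open>8 * \<epsilon>\<close> of
    the law from the zero path, and the two laws are within \<open>3 * \<epsilon>\<close> of each
    other: 19 in total.\<close>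
  define \<epsilon> where "\<epsilon> = min 1 (\<eta> / 20)"
  have \<epsilon>: "0 < \<epsilon>" "\<epsilon> \<le> 1" "20 * \<epsilon> \<le> \<eta>" using \<open>\<eta> > 0\<close> by (auto simp: \<epsilon>_def)
  have small: "2 * \<epsilon> + (2 + \<epsilon>) * (\<epsilon> + \<epsilon>) \<le> 8 * \<epsilon>"
  proof -
    have "(2 + \<epsilon>) * (\<epsilon> + \<epsilon>) \<le> 3 * (\<epsilon> + \<epsilon>)" using \<epsilon> by (intro mult_right_mono) auto
    then show ?thesis by simp
  qed
  obtain \<rho>1 where \<rho>1: "\<rho>1 > 0" "measure \<pi> (path_ball \<tau> \<rho>1) \<ge> 1 - \<epsilon>"
    by (rule path_ball_tight[OF \<tau> \<pi> \<epsilon>(1)])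
  obtain \<rho>2 where \<rho>2: "\<rho>2 > 0" "\<And>N \<pi>. valid_steps N \<Longrightarrow>
    invariant_prob (C_borel \<tau>) UNIV (em_segment_law M f g W (truncate \<Phi> K \<nu> (\<tau> / real N)) \<tau> N) \<pi> \<Longrightarrow>
    measure \<pi> (path_ball \<tau> \<rho>2) \<ge> 1 - \<epsilon>"
    using em_invariant_tight[OF \<epsilon>(1)] by blast
  obtain T1 where T1: "\<And>m \<xi> \<xi>'. \<xi> \<in> path_ball \<tau> \<rho>1 \<Longrightarrow> \<xi>' \<in> path_ball \<tau> \<rho>1 \<Longrightarrow> m > 0 \<Longrightarrow>
    real (m - 1) * \<tau> \<ge> T1 \<Longrightarrow> whp \<epsilon> (\<lambda>\<omega>. mdist (C_metric \<tau>) (segment \<tau> (x \<xi>) (real m * \<tau>) \<omega>) (segment \<tau> (x \<xi>') (real m * \<tau>) \<omega>) \<le> \<epsilon>)"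
    using solution_contraction[OF sol \<rho>1(1) \<epsilon>(1) \<epsilon>(1)] by blast
  obtain T2 where T2: "\<And>N k \<xi> \<xi>'. valid_steps N \<Longrightarrow> \<xi> \<in> path_ball \<tau> \<rho>2 \<Longrightarrow> \<xi>' \<in> path_ball \<tau> \<rho>2 \<Longrightarrow> N \<le> k \<Longrightarrow>
    real (k - N) * (\<tau> / real N) \<ge> T2 \<Longrightarrow> whp \<epsilon> (\<lambda>\<omega>. mdist (C_metric \<tau>) (em_seg N k \<xi> \<omega>) (em_seg N k \<xi>' \<omega>) \<le> \<epsilon>)"
    using em_seg_contraction[OF \<rho>2(1) \<epsilon>(1) \<epsilon>(1)] by blast
  \<comment> \<open>Both contraction times are known here, and \<open>T2\<close> serves every
    admissible step size. Hence the comparison time is fixed before \<open>N\<close>, and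
    convergence of the scheme at a single time suffices.\<close>
  obtain n :: nat where n: "max T1 T2 / \<tau> \<le> real n" using real_arch_simple by blast
  define m where "m = Suc n"
  have m: "m > 0" "real (m - 1) * \<tau> \<ge> T1" "real (m - 1) * \<tau> \<ge> T2"
    using n \<tau> by (simp_all add: m_def pos_divide_le_eq)
  have mt: "0 \<le> real m * \<tau>" using \<tau> by simp
  obtain N0 :: nat where N0: "\<And>N. N \<ge> N0 \<Longrightarrow> valid_steps N \<Longrightarrow>
    whp \<epsilon> (\<lambda>\<omega>. mdist (C_metric \<tau>) (segment \<tau> (x zero_path) (real m * \<tau>) \<omega>) (em_seg N (m * N) zero_path \<omega>) \<le> \<epsilon>)"
    using segment_convergence[OF sol[OF zero_path(2)] zero_path(2) m(1) \<epsilon>(1) \<epsilon>(1)] by blast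
  show thesis
  proof (rule that[of N0])
    fix N :: nat and \<pi>' :: "(real \<Rightarrow> real^'d) measure" and \<Psi> :: "(real \<Rightarrow> real^'d) \<Rightarrow> real"
    assume N: "N \<ge> N0" "valid_steps N"
      and i: "invariant_prob (C_borel \<tau>) UNIV (em_segment_law M f g W (truncate \<Phi> K \<nu> (\<tau> / real N)) \<tau> N) \<pi>'"
      and \<Psi>: "\<Psi> \<in> FM_test \<tau>"
    note Npos = valid_stepsD(1)[OF N(2)]
    have \<pi>': "\<pi>' \<in> space (prob_algebra (C_borel \<tau>))"
      and inv': "\<And>k A. A \<in> sets (C_borel \<tau>) \<Longrightarrow> (\<integral>\<^sup>+ X. emeasure (distr M (C_borel \<tau>) (em_seg N k X)) A \<partial>\<pi>') = emeasure \<pi>' A"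
      using i by (auto simp: invariant_prob_def em_segment_law_def segment_law_def truncate_level)
    note sm = solution_segment_measurable[OF sol mt] and em = em_seg_measurable[OF N(2), where k = "m * N"]
    have k: "N \<le> m * N" "real (m * N - N) * (\<tau> / real N) \<ge> T2"
    proof -
      have "m * N - N = (m - 1) * N" by (simp add: diff_mult_distrib)
      then show "real (m * N - N) * (\<tau> / real N) \<ge> T2" using Npos m(3) by simp
    qed (use m in simp)
    have 1: "\<bar>(\<integral>X. \<Psi> X \<partial>\<pi>) - expectation (\<lambda>\<omega>. \<Psi> (segment \<tau> (x zero_path) (real m * \<tau>) \<omega>))\<bar> \<le> 2 * \<epsilon> + (2 + \<epsilon>) * (\<epsilon> + \<epsilon>)"
    proof (rule invariant_FM_test[where Z = "\<lambda>X. segment \<tau> (x X) (real m * \<tau>)", OF \<pi> inv[OF mt] sm zero_path(2) path_ball_sets[OF \<tau>] \<rho>1(2) _ _ \<epsilon>(1) _ \<Psi>])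
      show "prob {\<omega>\<in>space M. \<epsilon> < mdist (C_metric \<tau>) (segment \<tau> (x X) (real m * \<tau>) \<omega>) (segment \<tau> (x zero_path) (real m * \<tau>) \<omega>)} \<le> \<epsilon>"
        if "X \<in> path_ball \<tau> \<rho>1" for X
        using prob_whp[OF T1[OF that zero_path(1) m(1,2)]] \<rho>1(1) by (simp add: not_le)
      show "{\<omega>\<in>space M. \<epsilon> < mdist (C_metric \<tau>) (segment \<tau> (x X) (real m * \<tau>) \<omega>) (segment \<tau> (x zero_path) (real m * \<tau>) \<omega>)} \<in> events"
        if "X \<in> mspace (C_metric \<tau>)" for X
        by (rule mdist_event[OF \<tau> sm[OF that] sm[OF zero_path(2)]])
    qed (use \<epsilon> in auto)
    have 2: "\<bar>expectation (\<lambda>\<omega>. \<Psi> (segment \<tau> (x zero_path) (real m * \<tau>) \<omega>)) - expectation (\<lambda>\<omega>. \<Psi> (em_seg N (m * N) zero_path \<omega>))\<bar> \<le> \<epsilon> + 2 * \<epsilon>"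
      by (rule expectation_diff_le[OF \<tau> sm[OF zero_path(2)] em[OF zero_path(2)] N0[OF N] \<Psi> less_imp_le[OF \<epsilon>(1)]])
    have 3: "\<bar>(\<integral>X. \<Psi> X \<partial>\<pi>') - expectation (\<lambda>\<omega>. \<Psi> (em_seg N (m * N) zero_path \<omega>))\<bar> \<le> 2 * \<epsilon> + (2 + \<epsilon>) * (\<epsilon> + \<epsilon>)"
    proof (rule invariant_FM_test[where Z = "em_seg N (m * N)", OF \<pi>' inv' em zero_path(2) path_ball_sets[OF \<tau>] \<rho>2(2)[OF N(2) i] _ _ \<epsilon>(1) _ \<Psi>])
      show "prob {\<omega>\<in>space M. \<epsilon> < mdist (C_metric \<tau>) (em_seg N (m * N) X \<omega>) (em_seg N (m * N) zero_path \<omega>)} \<le> \<epsilon>"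
        if "X \<in> path_ball \<tau> \<rho>2" for X
        using prob_whp[OF T2[OF N(2) that zero_path(1) k]] \<rho>2(1) by (simp add: not_le)
      show "{\<omega>\<in>space M. \<epsilon> < mdist (C_metric \<tau>) (em_seg N (m * N) X \<omega>) (em_seg N (m * N) zero_path \<omega>)} \<in> events"
        if "X \<in> mspace (C_metric \<tau>)" for X
        by (rule mdist_event[OF \<tau> em[OF that] em[OF zero_path(2)]])
    qed (use \<epsilon> in auto)
    show "\<bar>(\<integral>X. \<Psi> X \<partial>\<pi>) - (\<integral>X. \<Psi> X \<partial>\<pi>')\<bar> \<le> \<eta>"
      using 1 2 3 small \<epsilon> by linarith
  qed
qed

end

theorem theorem2:
  fixes M :: "'w measure"
    and F :: "real \<Rightarrow> 'w measure"
    and W :: "real \<Rightarrow> 'w \<Rightarrow> real^'m"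
    and f :: "real^'d \<Rightarrow> real^'d \<Rightarrow> real^'d"
    and g :: "real^'d \<Rightarrow> real^'d \<Rightarrow> real^'m^'d"
    and V :: "real^'d \<Rightarrow> real^'d \<Rightarrow> real"
    and x :: "(real \<Rightarrow> real^'d) \<Rightarrow> real \<Rightarrow> 'w \<Rightarrow> real^'d"
    and \<Phi> :: "real \<Rightarrow> real"
    and \<tau> \<alpha> a\<^sub>1 a\<^sub>2 a\<^sub>3 b\<^sub>1 b\<^sub>2 b\<^sub>3 b\<^sub>4 \<nu> K \<Delta>\<^sub>1 \<Delta>\<^sub>2 :: real
    and \<pi> :: "(real \<Rightarrow> real^'d) measure"
    and \<pi>\<^sub>\<Delta> :: "real \<Rightarrow> (real \<Rightarrow> real^'d) measure"
  assumes "prob_space M" and "usual_filtration M F" and "brownian_motion M F W"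
    and "\<tau> > 0"
    and f_borel: "(\<lambda>(u, v). f u v) \<in> borel_measurable borel"
    and g_borel: "(\<lambda>(u, v). g u v) \<in> borel_measurable borel"
    and local_Lipschitz:
      "\<forall>R>0. \<exists>l>0. \<forall>u u' v v'.
         max (max (norm u) (norm u')) (max (norm v) (norm v')) \<le> R \<longrightarrow>
         max (norm (f u v - f u' v')) (norm (g u v - g u' v')) \<le> l * (norm (u - u') + norm (v - v'))"
    and "\<alpha> \<ge> 2" and "a\<^sub>1 \<ge> 0" and "a\<^sub>2 \<ge> 0" and "a\<^sub>3 \<ge> 0" and "a\<^sub>2 > a\<^sub>3"
    and dissipativity:
      "\<forall>u v. 2 * (u \<bullet> f u v) + (norm (g u v))\<^sup>2
               \<le> a\<^sub>1 - a\<^sub>2 * norm u powr \<alpha> + a\<^sub>3 * norm v powr \<alpha>"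
    and "b\<^sub>1 \<ge> 0" and "b\<^sub>2 \<ge> 0" and "b\<^sub>3 \<ge> 0" and "b\<^sub>4 \<ge> 0" and "b\<^sub>1 > b\<^sub>2" and "b\<^sub>3 > b\<^sub>4"
    and V_cont: "continuous_on UNIV (\<lambda>(u, v). V u v)"
    and V_nonneg: "\<forall>u v. V u v \<ge> 0" and V_diag: "\<forall>u. V u u = 0"
    and contractivity:
      "\<forall>u u' v v'. 2 * ((u - u') \<bullet> (f u v - f u' v')) + (norm (g u v - g u' v'))\<^sup>2
               \<le> - b\<^sub>1 * (norm (u - u'))\<^sup>2 + b\<^sub>2 * (norm (v - v'))\<^sup>2 - b\<^sub>3 * V u u' + b\<^sub>4 * V v v'"
    and x_solution: "\<forall>\<xi>\<in>mspace (C_metric \<tau>). sdde_solution M F W f g \<tau> \<xi> (x \<xi>)"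
    and \<pi>_invariant:
      "invariant_prob (C_borel \<tau>) {0..} (\<lambda>t X. segment_law M \<tau> (x X) t) \<pi>"
    and "truncation_function f g \<Phi>" and "0 < \<nu>" and "\<nu> \<le> 1 / 3"
    and K: "K = truncation_const f g \<Phi>"
    and "0 < \<Delta>\<^sub>1" and "\<Delta>\<^sub>1 < 1" and "a\<^sub>2 - 6 * K\<^sup>2 * \<Delta>\<^sub>1 powr (1 - 2 * \<nu>) > a\<^sub>3"
    and "0 < \<Delta>\<^sub>2" and "\<Delta>\<^sub>2 < 1" and "b\<^sub>1 - 4 * K\<^sup>2 * \<Delta>\<^sub>2 powr (1 - 2 * \<nu>) > b\<^sub>2"
    and \<pi>\<^sub>\<Delta>_invariant:
      "\<forall>N. real N > \<tau> \<and> \<tau> / real N \<le> min \<Delta>\<^sub>1 \<Delta>\<^sub>2 \<longrightarrow>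
         invariant_prob (C_borel \<tau>) UNIV
           (em_segment_law M f g W (truncate \<Phi> K \<nu> (\<tau> / real N)) \<tau> N) (\<pi>\<^sub>\<Delta> (\<tau> / real N))"
  shows "((\<lambda>\<Delta>. FM_dist \<tau> \<pi> (\<pi>\<^sub>\<Delta> \<Delta>)) \<longlongrightarrow> 0)
           (at 0 within {\<tau> / real N | N. real N > \<tau> \<and> \<tau> / real N \<le> min \<Delta>\<^sub>1 \<Delta>\<^sub>2})"
proof -
  interpret delay_system M F W f g V \<Phi> \<tau> \<alpha> a\<^sub>1 a\<^sub>2 a\<^sub>3 b\<^sub>1 b\<^sub>2 b\<^sub>3 b\<^sub>4 \<nu> K \<Delta>\<^sub>1 \<Delta>\<^sub>2
    by (intro delay_system.intro brownian_space.intro brownian_space_axioms.intro delay_system_axioms.intro)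
      (use assms in blast)+
  let ?S = "{\<tau> / real N | N. real N > \<tau> \<and> \<tau> / real N \<le> min \<Delta>\<^sub>1 \<Delta>\<^sub>2}"
  show ?thesis
  proof (rule tendstoI)
    fix e :: real assume "e > 0"
    then have e2: "e / 2 > 0" by simp
    have sol: "\<And>\<xi>. \<xi> \<in> mspace (C_metric \<tau>) \<Longrightarrow> sdde_solution M F W f g \<tau> \<xi> (x \<xi>)"
      using x_solution by blast
    obtain N\<^sub>0 :: nat where N0: "\<And>N \<pi>' \<Psi>. N \<ge> N\<^sub>0 \<Longrightarrow> valid_steps N \<Longrightarrow>
      invariant_prob (C_borel \<tau>) UNIV (em_segment_law M f g W (truncate \<Phi> K \<nu> (\<tau> / real N)) \<tau> N) \<pi>' \<Longrightarrow>
      \<Psi> \<in> FM_test \<tau> \<Longrightarrow> \<bar>(\<integral>X. \<Psi> X \<partial>\<pi>) - (\<integral>X. \<Psi> X \<partial>\<pi>')\<bar> \<le> e / 2"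
      using invariant_measures_close[OF sol \<pi>_invariant e2] by blast
    have close: "dist (FM_dist \<tau> \<pi> (\<pi>\<^sub>\<Delta> (\<tau> / real N))) 0 < e" if N: "valid_steps N" "N\<^sub>0 \<le> N" for N
    proof -
      let ?h = "\<lambda>\<Psi>. \<bar>(\<integral>X. \<Psi> X \<partial>\<pi>) - (\<integral>X. \<Psi> X \<partial>(\<pi>\<^sub>\<Delta> (\<tau> / real N)))\<bar>"
      have inv: "invariant_prob (C_borel \<tau>) UNIV (em_segment_law M f g W (truncate \<Phi> K \<nu> (\<tau> / real N)) \<tau> N) (\<pi>\<^sub>\<Delta> (\<tau> / real N))"
        using \<pi>\<^sub>\<Delta>_invariant N(1) by (simp add: valid_steps_def)
      have b: "?h \<Psi> \<le> e / 2" if "\<Psi> \<in> FM_test \<tau>" for \<Psi>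
        by (rule N0[OF N(2,1) inv that])
      \<comment> \<open>The zero function serves twice: the class is nonempty, so the supremum is
        bounded by the common bound, and its own value 0 shows that the distance is
        nonnegative.\<close>
      have z: "(\<lambda>_. 0) \<in> FM_test \<tau>" by (auto simp: FM_test_def)
      have "FM_dist \<tau> \<pi> (\<pi>\<^sub>\<Delta> (\<tau> / real N)) \<le> e / 2"
        unfolding FM_dist_def by (rule cSUP_least) (use z b in blast)+
      moreover have "?h (\<lambda>_. 0) \<le> FM_dist \<tau> \<pi> (\<pi>\<^sub>\<Delta> (\<tau> / real N))"
        unfolding FM_dist_def using b by (intro cSUP_upper[OF z] bdd_aboveI2)
      ultimately show ?thesis using \<open>e > 0\<close> by (simp add: dist_real_def)
    qed
    show "\<forall>\<^sub>F \<Delta> in at 0 within ?S. dist (FM_dist \<tau> \<pi> (\<pi>\<^sub>\<Delta> \<Delta>)) 0 < e"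
      unfolding eventually_at
    proof (intro exI[of _ "\<tau> / real (Suc N\<^sub>0)"] conjI ballI impI)
      show "0 < \<tau> / real (Suc N\<^sub>0)" using \<tau> by simp
      fix \<Delta> assume "\<Delta> \<in> ?S" and d: "\<Delta> \<noteq> 0 \<and> dist \<Delta> 0 < \<tau> / real (Suc N\<^sub>0)"
      then obtain N where \<Delta>: "\<Delta> = \<tau> / real N" and N: "valid_steps N" by (auto simp: valid_steps_def)
      \<comment> \<open>A small admissible step forces a large number of steps per delay, so the
        limit in \<Delta> is a limit in \<open>N\<close>.\<close>
      have "real N > real (Suc N\<^sub>0)"
      proof (rule ccontr)
        assume "\<not> real N > real (Suc N\<^sub>0)"
        then have "\<tau> / real (Suc N\<^sub>0) \<le> \<tau> / real N"
          using \<tau> valid_stepsD(1)[OF N] by (intro divide_left_mono) auto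
        then show False using d \<tau> unfolding \<Delta> by (simp add: dist_real_def)
      qed
      then have "N\<^sub>0 \<le> N" by simp
      then show "dist (FM_dist \<tau> \<pi> (\<pi>\<^sub>\<Delta> \<Delta>)) 0 < e" unfolding \<Delta> by (intro close N)
    qed
  qed
qed


end
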